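(* Let $k\ge 0$ be an integer. Let $F\in\mathfrak{N}_{\le k}-\mathfrak{N}_{\le k}$ be such that $F(\cdot+ic)\in\mathcal{AP}(\mathbb{C}^+)$ for some $c>0$, and assume that the function $\lambda\in\mathbb{R}\mapsto\mathbb{E}F(\lambda)$ is locally summable. Then there exists $c_1>0$ such that the limit $$\mathbb{E}F(\lambda)=\lim_{T\to\infty}\frac{1}{2T}\int_{-T+iy}^{T+iy}F(z)e^{-2\pi i\lambda z}\,dz$$ exists for all $\lambda\in\mathbb{R}$ and $y>c_1$ and does not depend on $y$, and the function $\lambda\mapsto\mathbb{E}F(\lambda)$ vanishes for $\lambda<0$. Moreover, define $$a(\lambda):=\begin{cases}\mathbb{E}F(\lambda)&\text{if }\lambda>0,\\ 2\operatorname{Re}\mathbb{E}F(0)&\text{if }\lambda=0,\\ \overline{\mathbb{E}F(-\lambda)}&\text{if }\lambda<0,\end{cases}$$ and let $\mu$ be the unique real-valued measure coming from the Nevanlinna factorization of $F$ (see context). Then $(\mu,a)$ is a real-antipodal FS-pair with $\deg(\mu)\le 2(k+1)$ (where $a$ is locally summable, but not necessarily of finite exponential growth).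
   Context: Notation: $\mathbb{C}^+=\{z\in\mathbb{C}:\operatorname{Im} z>0\}$. The Fourier transform is $\widehat{f}(\xi)=\int_{\mathbb{R}}f(x)e^{-2\pi i x\xi}\,dx$. A test function is a $C^\infty$ compactly supported function $\varphi:\mathbb{R}\to\mathbb{C}$. A real polynomial is a polynomial with real coefficients. Measures on $\mathbb{R}$ are (locally finite, not necessarily of finite total variation) complex-valued Borel measures; "real" or "signed" measure means real-valued. Degree: $\deg(\mu):=\inf\{n\in\mathbb{Z}:\int_{\mathbb{R}}(1+t^2)^{-n/2}\,d|\mu|(t)<\infty\}$. The measure $\mu$ is strongly tempered if $\deg(\mu)<\infty$ (i.e. some such $n$ exists). Locally summable: $a:\mathbb{R}\to\mathbb{C}$ is locally summable if $\operatorname{supp}(a):=\{\lambda\in\mathbb{R}:a(\lambda)\ne0\}$ is countable and $\sum_{\lambda\in\operatorname{supp}(a)\cap[-T,T]}|a(\lambda)|<\infty$ for every $T>0$. It has finite exponential growth if $\sum_{\lambda\in\operatorname{supp}(a)}|a(\lambda)|e^{-c|\lambda|}<\infty$ for some $c>0$. Sums over $\lambda\in\mathbb{R}$ are over the countable support. FS-pair (Fourier summation pair): a pair $(\mu,a)$ with $\mu$ a strongly tempered measure on $\mathbb{R}$ and $a:\mathbb{R}\to\mathbb{C}$ locally summable, such that $\int_{\mathbb{R}}\widehat{\varphi}(t)\,d\mu(t)=\sum_{\lambda\in\mathbb{R}}a(\lambda)\varphi(\lambda)$ for every test function $\varphi$. It is real-antipodal if $\mu$ is real-valued (which implies that $a$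 is antipodal, i.e. $a(-\lambda)=\overline{a(\lambda)}$ for all $\lambda$). Almost periodic class: a holomorphic $F$ on $\mathbb{C}^+$ belongs to $\mathcal{AP}(\mathbb{C}^+)$ if for any $0<\alpha<\beta<\infty$ and $\varepsilon>0$ there is a relatively dense set $\tau\subset\mathbb{R}$ (there is $l>0$ with $\tau\cap(x,x+l)\neq\emptyset$ for all $x\in\mathbb{R}$) with $\sup_{\alpha<\operatorname{Im} z<\beta}|F(z+t)-F(z)|\le\varepsilon$ for all $t\in\tau$. If $F(\cdot+ic)\in\mathcal{AP}(\mathbb{C}^+)$ then for every $\lambda\in\mathbb{R}$ the limit $\mathbb{E}F(\lambda):=\lim_{T\to\infty}\frac{1}{2T}\int_{-T+iy}^{T+iy}F(z)e^{-2\pi i\lambda z}\,dz$ (along the horizontal segment) exists and is independent of $y>c$, and $\{\lambda:\mathbb{E}F(\lambda)\ne0\}$ is countable. Nevanlinna class: $\mathfrak{N}_{\le k}$ is the set of holomorphic maps $F:\mathbb{C}^+\to\mathbb{C}$ such that for any $N$ and any $z_1,\dots,z_N\in\mathbb{C}^+$ the Hermitian matrix $\left[i\frac{F(z_n)+\overline{F(z_m)}}{z_n-\overline{z_m}}\right]_{1\le n,m\le N}$ has at most $k$ negative eigenvalues (counting multiplicities). $\mathfrak{N}_{\le k}-\mathfrak{N}_{\le k}:=\{F-G:F,G\in\mathfrak{N}_{\le k}\}$. Nevanlinna factorization (known fact): $F\in\mathfrak{N}_{\le k}-\mathfrak{N}_{\le k}$ if and only if, for some $m\le k$, $$F(z)=\frac{(z^2+1)^m}{2\pi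 i}\int_{\mathbb{R}}\frac{tz+1}{t-z}\cdot\frac{d\mu(t)}{(1+t^2)^{m+1}}+iQ(z),\qquad z\in\mathbb{C}^+,$$ with $\mu$ a signed measure with $\deg(\mu)\le 2(m+1)$ and $Q$ a real polynomial of degree at most $2m+1$; the measure $\mu$ is uniquely determined by $F$.
   Formalization: For some F in the class as defined (e.g. with a double pole on the real line) no Nevanlinna factorization exists, so μ would be undefined; the claims about (μ,a) and deg(μ) are stated for every real measure μ that does arise from such a factorization of F, without asserting that one exists. *)

theory Defs
  imports
    "HOL-Complex_Analysis.Complex_Analysis"
    "Jordan_Normal_Form.Spectral_Radius"
begin

section \<open>Locally finite complex measures on the real line\<close>

text \<open>
  A locally finite complex measure need not have finite total variation, so it is a set function
  on the bounded Borel sets only; its values on all other sets are irrelevant.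
\<close>

definition bounded_borel :: "real set set" where
  "bounded_borel = {A \<in> sets borel. bounded A}"

definition complex_measure :: "(real set \<Rightarrow> complex) \<Rightarrow> bool" where
  "complex_measure \<mu> \<longleftrightarrow>
     (\<forall>A :: nat \<Rightarrow> real set. range A \<subseteq> bounded_borel \<longrightarrow> disjoint_family A \<longrightarrow> bounded (\<Union>n. A n) \<longrightarrow>
        (\<lambda>n. \<mu> (A n)) sums \<mu> (\<Union>n. A n))"

definition real_measure :: "(real set \<Rightarrow> complex) \<Rightarrow> bool" where
  "real_measure \<mu> \<longleftrightarrow> complex_measure \<mu> \<and> (\<forall>A\<in>bounded_borel. \<mu> A \<in> \<real>)"

text \<open>
  The total variation, and the positive variation of a real set function. For a complex measure
  (respectively its real or imaginary part, up to sign) the suprema below are countably additive on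
  the Borel sets, so that they are the values of the measures produced by \<^const>\<open>measure_of\<close>.
\<close>

definition total_variation :: "(real set \<Rightarrow> complex) \<Rightarrow> real measure" where
  "total_variation \<mu> = measure_of UNIV (sets borel)
     (\<lambda>B. SUP P \<in> {P. finite P \<and> disjoint P \<and> P \<subseteq> bounded_borel \<and> \<Union>P \<subseteq> B}.
            \<Sum>A\<in>P. ennreal (cmod (\<mu> A)))"

definition pos_variation :: "(real set \<Rightarrow> real) \<Rightarrow> real measure" where
  "pos_variation \<rho> = measure_of UNIV (sets borel)
     (\<lambda>B. SUP A \<in> {A \<in> bounded_borel. A \<subseteq> B}. ennreal (\<rho> A))"

text \<open>Integration by means of the Jordan decompositions of the real and imaginary parts.\<close>

definition cm_integral :: "(real set \<Rightarrow> complex) \<Rightarrow> (real \<Rightarrow> complex) \<Rightarrow> complex" where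
  "cm_integral \<mu> f =
     (integral\<^sup>L (pos_variation (\<lambda>A. Re (\<mu> A))) f - integral\<^sup>L (pos_variation (\<lambda>A. - Re (\<mu> A))) f)
     + \<i> * (integral\<^sup>L (pos_variation (\<lambda>A. Im (\<mu> A))) f - integral\<^sup>L (pos_variation (\<lambda>A. - Im (\<mu> A))) f)"

text \<open>
  The degree can be \<open>- \<infinity>\<close> (for instance for compactly supported measures), and it is
  \<open>\<infinity>\<close>, the infimum of the empty set, if the measure is not strongly tempered.
\<close>

definition measure_deg :: "(real set \<Rightarrow> complex) \<Rightarrow> ereal" where
  "measure_deg \<mu> = (INF n \<in> {n :: int.
       (\<integral>\<^sup>+ t. ennreal ((1 + t\<^sup>2) powr (- real_of_int n / 2)) \<partial>total_variation \<mu>) < \<infinity>}.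
     ereal (real_of_int n))"

definition strongly_tempered :: "(real set \<Rightarrow> complex) \<Rightarrow> bool" where
  "strongly_tempered \<mu> \<longleftrightarrow> complex_measure \<mu> \<and> measure_deg \<mu> < \<infinity>"


section \<open>Fourier summation pairs\<close>

definition supp :: "(real \<Rightarrow> complex) \<Rightarrow> real set" where
  "supp a = {\<nu>. a \<nu> \<noteq> 0}"

definition locally_summable :: "(real \<Rightarrow> complex) \<Rightarrow> bool" where
  "locally_summable a \<longleftrightarrow> countable (supp a) \<and>
     (\<forall>T>0. (\<lambda>\<nu>. norm (a \<nu>)) summable_on (supp a \<inter> {-T..T}))"

definition test_function :: "(real \<Rightarrow> complex) \<Rightarrow> bool" where
  "test_function \<phi> \<longleftrightarrow>
     (\<exists>D :: nat \<Rightarrow> real \<Rightarrow> complex. D 0 = \<phi> \<and>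
        (\<forall>n x. (D n has_vector_derivative D (Suc n) x) (at x))) \<and>
     compact (closure {x. \<phi> x \<noteq> 0})"

definition fourier :: "(real \<Rightarrow> complex) \<Rightarrow> real \<Rightarrow> complex" where
  "fourier f \<xi> = (LINT x|lborel. f x * exp (- 2 * of_real pi * \<i> * of_real x * of_real \<xi>))"

definition FS_pair :: "(real set \<Rightarrow> complex) \<Rightarrow> (real \<Rightarrow> complex) \<Rightarrow> bool" where
  "FS_pair \<mu> a \<longleftrightarrow> strongly_tempered \<mu> \<and> locally_summable a \<and>
     (\<forall>\<phi>. test_function \<phi> \<longrightarrow> ((\<lambda>\<nu>. a \<nu> * \<phi> \<nu>) has_sum cm_integral \<mu> (fourier \<phi>)) (supp a))"

definition real_antipodal_FS_pair :: "(real set \<Rightarrow> complex) \<Rightarrow> (real \<Rightarrow> complex) \<Rightarrow> bool" where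
  "real_antipodal_FS_pair \<mu> a \<longleftrightarrow> FS_pair \<mu> a \<and> real_measure \<mu>"


section \<open>Almost periodic functions on the upper half-plane\<close>

definition upper_halfplane :: "complex set" where
  "upper_halfplane = {z. Im z > 0}"

definition relatively_dense :: "real set \<Rightarrow> bool" where
  "relatively_dense S \<longleftrightarrow> (\<exists>l>0. \<forall>x. S \<inter> {x<..<x + l} \<noteq> {})"

definition AP :: "(complex \<Rightarrow> complex) set" where
  "AP = {F. F holomorphic_on upper_halfplane \<and>
     (\<forall>\<alpha> \<beta> \<epsilon> :: real. 0 < \<alpha> \<longrightarrow> \<alpha> < \<beta> \<longrightarrow> 0 < \<epsilon> \<longrightarrow>
        (\<exists>S. relatively_dense S \<and>
           (\<forall>t\<in>S. \<forall>z. \<alpha> < Im z \<and> Im z < \<beta> \<longrightarrow> norm (F (z + of_real t) - F z) \<le> \<epsilon>)))}"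

definition bohr_mean :: "(complex \<Rightarrow> complex) \<Rightarrow> real \<Rightarrow> real \<Rightarrow> real \<Rightarrow> complex" where
  "bohr_mean F \<nu> y T =
     1 / (2 * of_real T) * contour_integral (linepath (Complex (- T) y) (Complex T y))
        (\<lambda>z. F z * exp (- 2 * of_real pi * \<i> * of_real \<nu> * z))"

text \<open>The common limit of the means on all sufficiently high horizontal lines, if it exists.\<close>

definition bohr_coeff :: "(complex \<Rightarrow> complex) \<Rightarrow> real \<Rightarrow> complex" where
  "bohr_coeff F \<nu> = (THE L. \<exists>c0. \<forall>y>c0. (bohr_mean F \<nu> y \<longlongrightarrow> L) at_top)"


section \<open>Generalized Nevanlinna classes\<close>

text \<open>Negative eigenvalues are counted with their multiplicity as roots of the characteristic
  polynomial; for Hermitian matrices this is also the dimension of the eigenspace.\<close>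

definition num_neg_eigenvalues :: "complex mat \<Rightarrow> nat" where
  "num_neg_eigenvalues A =
     (\<Sum>x \<in> {x \<in> spectrum A. x \<in> \<real> \<and> Re x < 0}. Polynomial.order x (char_poly A))"

definition nevanlinna_class :: "nat \<Rightarrow> (complex \<Rightarrow> complex) set" where
  "nevanlinna_class k = {F. F holomorphic_on upper_halfplane \<and>
     (\<forall>N. \<forall>z :: nat \<Rightarrow> complex. (\<forall>n<N. z n \<in> upper_halfplane) \<longrightarrow>
        num_neg_eigenvalues
          (mat N N (\<lambda>(n, m). \<i> * (F (z n) + cnj (F (z m))) / (z n - cnj (z m)))) \<le> k)}"

definition nevanlinna_diff :: "nat \<Rightarrow> (complex \<Rightarrow> complex) set" where
  "nevanlinna_diff k = {F. \<exists>G\<in>nevanlinna_class k. \<exists>H\<in>nevanlinna_class k.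
     \<forall>z\<in>upper_halfplane. F z = G z - H z}"

text \<open>\<open>\<mu>\<close> is the measure of a Nevanlinna factorization of \<open>F\<close>.\<close>

definition nevanlinna_measure :: "nat \<Rightarrow> (complex \<Rightarrow> complex) \<Rightarrow> (real set \<Rightarrow> complex) \<Rightarrow> bool" where
  "nevanlinna_measure k F \<mu> \<longleftrightarrow> real_measure \<mu> \<and>
     (\<exists>m\<le>k. \<exists>Q :: real poly. measure_deg \<mu> \<le> ereal (2 * (real m + 1)) \<and>
        Polynomial.degree Q \<le> 2 * m + 1 \<and>
        (\<forall>z\<in>upper_halfplane.
           F z = (z\<^sup>2 + 1) ^ m / (2 * of_real pi * \<i>) *
                   cm_integral \<mu> (\<lambda>t. (of_real t * z + 1) / (of_real t - z) * (1 / of_real ((1 + t\<^sup>2) ^ (m + 1))))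
                 + \<i> * poly (map_poly of_real Q) z))"

end

theory Submission imports Defs "HOL-Probability.Probability" begin

text \<open>
  A function in \<open>nevanlinna_class k\<close> is bounded by a constant times a power of \<open>\<bar>z + \<i>\<bar>\<^sup>2 / Im z\<close>. In the disc, this
  concerns the power series \<open>g\<close> of a Toeplitz form with at most \<open>k\<close> negative squares: following Krein, the zeros of its
  orthogonal polynomials yield polynomials \<open>p\<close> of degree at most \<open>k\<close> such that the form is nonnegative on
  multiples of \<open>p\<close> (up to any given degree). The Toeplitz sequence twisted by \<open>p\<close> is then positive definite, hence
  bounded, which bounds \<open>g\<close> times a product of \<open>2 k\<close> linear factors; the maximum principle removes
  these factors.

  So \<open>F\<close> has polynomial growth above any horizontal line. It is bounded on horizontal lines above height \<open>c\<close>
  by almost periodicity, hence bounded above \<open>c + 1\<close> by Phragmen and Lindeloef, and the mean at frequency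
  \<open>\<nu>\<close>, computed at height \<open>y\<close>, is \<open>O(exp (2 \<pi> \<nu> y))\<close>. This is \<open>0\<close> if \<open>\<nu> < 0\<close>.

  Let \<open>\<psi>\<close> be the (entire) Fourier transform of a test function \<open>\<phi>\<close>. For \<open>y > c\<close> the integral of
  \<open>\<psi>(x + \<i> y) F(x + \<i> y)\<close> over \<open>x\<close> is the sum of \<open>bohr_coeff F \<nu> * \<phi> \<nu>\<close>: both are the values at \<open>0\<close> of
  almost periodic functions (replace \<open>F\<close> by its translates) with the same Fourier coefficients. By
  symmetry the integral of \<open>\<psi>(x - \<i> y) cnj (F(x + \<i> y))\<close> is the sum of
  \<open>cnj (bohr_coeff F \<nu>) * \<phi> (- \<nu>)\<close>. The two sums add up to the sum of \<open>a \<nu> * \<phi> \<nu>\<close>. Inserting the factorization of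
  \<open>F\<close>, Fubini's theorem and Cauchy's formula in the strip \<open>\<bar>Im z\<bar> < y\<close> turn the two integrals into the integral
  of \<open>\<psi>\<close> with respect to \<open>\<mu>\<close>.
\<close>

section \<open>Hermitian matrices with few negative eigenvalues\<close>

text \<open>The factorization of F would give polynomial growth at once, but in the theorem it is a
  premise of the last part only; the vanishing at negative frequencies has to follow from the kernel
  matrices, which is why Krein's argument is needed. Its obstacle is that the factor
  \<open>p\<close> changes with the degree up to which the form is nonnegative. No limit factor is
  taken: degree and coefficients are bounded uniformly, and each radius in the disc uses a factor of
  its own. The formula rests on a reflection. For a real measure the right-hand side of the
  factorization also makes sense below the axis, where its value at \<open>cnj z\<close> is
  \<open>- cnj (F z)\<close>. The two line integrals are thus a difference of integrals of one
  function above and below the axis; the polynomial term cancels and the kernel contributes its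
  residues. Only local summability is assumed, so F need not be the sum of its Fourier series.
  Pairing with a test function first restricts the frequencies to a bounded set; then the series
  converges absolutely, and the uniqueness theorem identifies it with the integral.\<close>

lemma underdetermined_system:
  fixes A :: "'i \<Rightarrow> 'j \<Rightarrow> 'a::field"
  assumes "finite I" "finite J" "card I < card J"
  shows "\<exists>x. (\<exists>j\<in>J. x j \<noteq> 0) \<and> (\<forall>i\<in>I. (\<Sum>j\<in>J. A i j * x j) = 0)"
  using assms
proof (induction I arbitrary: J A rule: finite_induct)
  case empty
  then have "J \<noteq> {}" by auto
  then show ?case by (intro exI[of _ "\<lambda>_. 1"]) auto
next
  case (insert i0 I)
  show ?case
  proof (cases "\<forall>j\<in>J. A i0 j = 0")
    case True
    obtain x where "\<exists>j\<in>J. x j \<noteq> 0" "\<forall>i\<in>I. (\<Sum>j\<in>J. A i j * x j) = 0"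
      using insert.IH[of J A] insert.prems insert.hyps by (metis Suc_lessD card_insert_disjoint)
    with True show ?thesis by (intro exI[of _ x]) auto
  next
    case False
    then obtain j0 where j0: "j0 \<in> J" "A i0 j0 \<noteq> 0" by auto
    define J' where "J' = J - {j0}"
    have J': "finite J'" "card I < card J'" "J = insert j0 J'" "j0 \<notin> J'"
      using insert j0 by (auto simp: J'_def)
    \<comment> \<open>Gaussian elimination: row \<open>i0\<close>, with pivot
      \<open>A i0 j0\<close>, clears column \<open>j0\<close> in the other rows; \<open>s\<close>
      below is the back substitution.\<close>
    obtain x where x: "\<exists>j\<in>J'. x j \<noteq> 0"
      "\<forall>i\<in>I. (\<Sum>j\<in>J'. (A i j - A i j0 * A i0 j / A i0 j0) * x j) = 0"
      using insert.IH[OF J'(1,2), of "\<lambda>i j. A i j - A i j0 * A i0 j / A i0 j0"] by auto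
    define s where "s = - (\<Sum>j\<in>J'. A i0 j * x j) / A i0 j0"
    have sumx: "(\<Sum>j\<in>J'. A i j * (x(j0 := s)) j) = (\<Sum>j\<in>J'. A i j * x j)" for i
      using J'(4) by (intro sum.cong) auto
    have "(\<Sum>j\<in>J. A i j * (x(j0 := s)) j) = 0" if "i \<in> insert i0 I" for i
    proof (cases "i = i0")
      case True
      then show ?thesis unfolding J'(3) using J'(1,4) j0(2) by (simp add: sumx del: fun_upd_apply) (simp add: s_def)
    next
      case False
      with that have "i \<in> I" by auto
      then have "0 = (\<Sum>j\<in>J'. (A i j - A i j0 * A i0 j / A i0 j0) * x j)" using x(2) by auto
      also have "\<dots> = (\<Sum>j\<in>J'. A i j * x j) - (\<Sum>j\<in>J'. A i j0 / A i0 j0 * (A i0 j * x j))"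
        by (simp add: sum_subtractf [symmetric] algebra_simps)
      also have "\<dots> = (\<Sum>j\<in>J'. A i j * x j) + A i j0 * s"
        unfolding s_def sum_distrib_left[symmetric] by simp
      finally show ?thesis unfolding J'(3) using J'(1,4) by (simp add: sumx add.commute del: fun_upd_apply) (simp add: add.commute)
    qed
    moreover have "\<exists>j\<in>J. (x(j0 := s)) j \<noteq> 0" using x(1) J' by auto
    ultimately show ?thesis by blast
  qed
qed

definition cip :: "nat \<Rightarrow> (nat \<Rightarrow> complex) \<Rightarrow> (nat \<Rightarrow> complex) \<Rightarrow> complex" where
  "cip N x y = (\<Sum>i<N. x i * cnj (y i))"

lemma cnj_cip: "cnj (cip N x y) = cip N y x"
  by (simp add: cip_def mult.commute)

lemma cip_self: "cip N x x = of_real (\<Sum>i<N. (cmod (x i))\<^sup>2)"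
  unfolding cip_def of_real_sum complex_norm_square ..

lemma cip_self_eq_0: "cip N x x = 0 \<longleftrightarrow> (\<forall>i<N. x i = 0)"
  unfolding cip_self of_real_eq_0_iff by (subst sum_nonneg_eq_0_iff) auto

lemma cip_scale: "cip N (\<lambda>i. a * x i) y = a * cip N x y" "cip N x (\<lambda>i. a * y i) = cnj a * cip N x y"
  by (simp_all add: cip_def sum_distrib_left mult_ac)

lemma cip_sum: "cip N (\<lambda>i. \<Sum>j\<in>J. x j i) y = (\<Sum>j\<in>J. cip N (x j) y)"
  unfolding cip_def by (subst sum.swap) (simp add: sum_distrib_right)

text \<open>Krylov argument inside the orthogonal complement \<open>W\<close> of the eigenvectors
  already found, which is invariant by self-adjointness. If \<open>p\<close> is an annihilating
  polynomial of least degree of a nonzero \<open>x0\<close> in \<open>W\<close> and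
  \<open>p = [:-l, 1:] * q\<close>, then \<open>q\<close> applied to \<open>x0\<close> is an
  eigenvector.\<close>

lemma hermitian_eigenvector_complement:
  fixes a :: "nat \<Rightarrow> nat \<Rightarrow> complex"
  assumes herm: "\<And>i j. i < N \<Longrightarrow> j < N \<Longrightarrow> a j i = cnj (a i j)"
    and r: "r < N"
    and ev: "\<And>l i. l < r \<Longrightarrow> i < N \<Longrightarrow> (\<Sum>j<N. a i j * e l j) = of_real (d l) * e l i"
  shows "\<exists>y (\<mu>::real). cip N y y = 1 \<and> (\<forall>l<r. cip N y (e l) = 0) \<and>
      (\<forall>i<N. (\<Sum>j<N. a i j * y j) = of_real \<mu> * y i)"
proof -
  define op where "op x = (\<lambda>i. \<Sum>j<N. a i j * x j)" for x
  have adj: "cip N (op x) y = cip N x (op y)" for x y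
  proof -
    have "cip N (op x) y = (\<Sum>i<N. \<Sum>j<N. a i j * x j * cnj (y i))"
      by (simp add: cip_def op_def sum_distrib_right)
    also have "\<dots> = (\<Sum>j<N. \<Sum>i<N. a i j * x j * cnj (y i))" by (rule sum.swap)
    also have "\<dots> = cip N x (op y)"
      unfolding cip_def op_def cnj_sum sum_distrib_left
      by (intro sum.cong refl) (subst herm, auto simp: mult_ac)
    finally show ?thesis .
  qed
  define W where "W = {x. \<forall>l<r. cip N x (e l) = 0}"
  have opW: "op x \<in> W" if "x \<in> W" for x
    unfolding W_def mem_Collect_eq
  proof (intro allI impI)
    fix l assume l: "l < r"
    have "cip N (op x) (e l) = cip N x (\<lambda>i. of_real (d l) * e l i)"
      unfolding adj unfolding cip_def by (intro sum.cong refl) (use ev[OF l] in \<open>auto simp: op_def\<close>)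
    then show "cip N (op x) (e l) = 0" using that l by (simp add: cip_scale W_def)
  qed
  obtain x0 where x0: "\<exists>j\<in>{..<N}. x0 j \<noteq> 0" "\<forall>l\<in>{..<r}. (\<Sum>j\<in>{..<N}. cnj (e l j) * x0 j) = 0"
    using underdetermined_system[of "{..<r}" "{..<N}" "\<lambda>l j. cnj (e l j)"] r by auto
  have x0W: "x0 \<in> W" using x0(2) by (simp add: W_def cip_def mult.commute)
  define x where "x n = (op ^^ n) x0" for n
  have xW: "x n \<in> W" for n unfolding x_def by (induction n) (auto simp: x0W opW)
  have xSuc: "x (Suc n) = op (x n)" for n by (simp add: x_def)
  define act where "act p = (\<lambda>i. \<Sum>n\<le>N. coeff p n * x n i)" for p
  \<comment> \<open>\<open>N + 1\<close> iterates in dimension \<open>N\<close> are linearly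
    dependent, which gives an annihilating polynomial.\<close>
  obtain c where c: "\<exists>n\<in>{..N}. c n \<noteq> 0" "\<forall>i\<in>{..<N}. (\<Sum>n\<in>{..N}. x n i * c n) = 0"
    using underdetermined_system[of "{..<N}" "{..N}" "\<lambda>i n. x n i"] by auto
  define S where "S = {p::complex poly. p \<noteq> 0 \<and> Polynomial.degree p \<le> N \<and> (\<forall>i<N. act p i = 0)}"
  define p0 where "p0 = (\<Sum>n\<le>N. monom (c n) n)"
  have cp0: "coeff p0 n = (if n \<le> N then c n else 0)" for n
    by (simp add: p0_def coeff_sum coeff_monom)
  have "p0 \<in> S"
    unfolding S_def mem_Collect_eq
  proof (intro conjI allI impI)
    show "p0 \<noteq> 0" using c(1) cp0 by (metis atMost_iff coeff_0)
    show "Polynomial.degree p0 \<le> N" by (intro degree_le) (auto simp: cp0)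
    show "act p0 i = 0" if "i < N" for i using c(2) that by (simp add: act_def cp0 mult.commute)
  qed
  then obtain p where p: "p \<in> S" and pmin: "\<And>q. q \<in> S \<Longrightarrow> Polynomial.degree p \<le> Polynomial.degree q"
    using ex_has_least_nat[of "\<lambda>p. p \<in> S" p0 Polynomial.degree] by auto
  have pS: "p \<noteq> 0" "Polynomial.degree p \<le> N" "\<And>i. i < N \<Longrightarrow> act p i = 0" using p by (auto simp: S_def)
  have "Polynomial.degree p \<noteq> 0"
  proof
    assume "Polynomial.degree p = 0"
    then obtain c where pc: "p = [:c:]" by (meson degree_eq_zeroE)
    have "act p i = c * x0 i" for i
      unfolding act_def pc by (subst sum.remove[of _ 0]) (auto simp: x_def coeff_pCons intro!: sum.neutral split: nat.splits)
    with pS pc x0(1) show False by auto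
  qed
  then obtain l where "poly p l = 0"
    using fundamental_theorem_of_algebra_alt[of p] by (metis degree_pCons_0)
  then obtain q where q: "p = [:-l, 1:] * q" by (metis poly_eq_0_iff_dvd dvdE)
  have q0: "q \<noteq> 0" using q pS(1) by auto
  have dq: "Polynomial.degree p = Suc (Polynomial.degree q)"
    unfolding q by (subst degree_mult_eq) (use q0 in auto)
  have actW: "act q \<in> W"
    unfolding W_def act_def using xW by (auto simp: cip_sum cip_scale W_def)
  have actp: "act p i = op (act q) i - l * act q i" if "i < N" for i
  proof -
    have 1: "coeff p n = (case n of 0 \<Rightarrow> 0 | Suc m \<Rightarrow> coeff q m) - l * coeff q n" for n
      unfolding q by (auto simp: coeff_pCons split: nat.splits)
    have N0: "N = Suc (N - 1)" using r by auto
    have cqN: "coeff q N = 0" using dq pS(2) by (intro coeff_eq_0) auto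
    have "(\<Sum>n\<le>N. (case n of 0 \<Rightarrow> 0 | Suc m \<Rightarrow> coeff q m) * x n i) =
        (\<Sum>n\<le>N-1. coeff q n * x (Suc n) i)"
      by (subst N0, subst sum.atMost_Suc_shift) simp
    also have "\<dots> = (\<Sum>n\<le>N. coeff q n * x (Suc n) i)"
      by (subst (2) N0, subst sum.atMost_Suc) (use N0 cqN in simp)
    also have "\<dots> = op (act q) i"
      unfolding xSuc op_def act_def sum_distrib_left
      by (subst sum.swap) (simp add: mult_ac)
    finally show ?thesis unfolding act_def 1
      by (simp add: algebra_simps sum_subtractf sum_distrib_left act_def)
  qed
  have eig: "op (act q) i = l * act q i" if "i < N" for i using actp[OF that] pS(3)[OF that] by simp
  define s where "s = (\<Sum>i<N. (cmod (act q i))\<^sup>2)"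
  have s: "cip N (act q) (act q) = of_real s" by (simp add: cip_self s_def)
  have s0: "s > 0"
  proof -
    have "s \<ge> 0" by (simp add: s_def sum_nonneg)
    \<comment> \<open>By minimality of \<open>p\<close>, the polynomial \<open>q\<close> of smaller
      degree does not annihilate \<open>x0\<close>.\<close>
    moreover have "s \<noteq> 0"
    proof
      assume "s = 0"
      then have "\<forall>i<N. act q i = 0" using s cip_self_eq_0[of N "act q"] by simp
      then have "q \<in> S" using q0 dq pS(2) by (auto simp: S_def)
      from pmin[OF this] dq show False by simp
    qed
    ultimately show ?thesis by simp
  qed
  have "l * of_real s = cip N (op (act q)) (act q)"
    unfolding s[symmetric] cip_scale(1)[symmetric] by (simp add: cip_def eig)
  also have "\<dots> = cip N (act q) (op (act q))" by (rule adj)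
  also have "\<dots> = cnj l * of_real s"
    unfolding s[symmetric] cip_scale(2)[symmetric] by (simp add: cip_def eig)
  finally have "l = cnj l" using s0 by auto
  then have lr: "l = of_real (Re l)" by (metis Reals_cnj_iff of_real_Re)
  define y where "y = (\<lambda>i. of_real (1 / sqrt s) * act q i)"
  have "cip N y y = 1"
    unfolding y_def cip_scale s using s0 by (simp flip: of_real_mult)
  moreover have "\<forall>l<r. cip N y (e l) = 0" using actW unfolding y_def cip_scale by (auto simp: W_def)
  moreover have "(\<Sum>j<N. a i j * y j) = of_real (Re l) * y i" if "i < N" for i
  proof -
    have "(\<Sum>j<N. a i j * y j) = of_real (1 / sqrt s) * op (act q) i"
      by (simp add: y_def op_def sum_distrib_left mult_ac)
    then show ?thesis using eig[OF that] lr by (simp add: y_def)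
  qed
  ultimately show ?thesis by blast
qed

lemma hermitian_diagonalization:
  fixes a :: "nat \<Rightarrow> nat \<Rightarrow> complex"
  assumes herm: "\<And>i j. i < N \<Longrightarrow> j < N \<Longrightarrow> a j i = cnj (a i j)"
  shows "\<exists>e (d :: nat \<Rightarrow> real). (\<forall>l<N. \<forall>i<N. (\<Sum>j<N. a i j * e l j) = of_real (d l) * e l i) \<and>
     (\<forall>l<N. \<forall>l'<N. cip N (e l) (e l') = (if l = l' then 1 else 0))"
proof -
  have "\<exists>e (d :: nat \<Rightarrow> real). (\<forall>l<r. \<forall>i<N. (\<Sum>j<N. a i j * e l j) = of_real (d l) * e l i) \<and>
     (\<forall>l<r. \<forall>l'<r. cip N (e l) (e l') = (if l = l' then 1 else 0))" if "r \<le> N" for r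
    using that
  proof (induction r)
    case (Suc r)
    then obtain e d where IH: "\<forall>l<r. \<forall>i<N. (\<Sum>j<N. a i j * e l j) = complex_of_real (d l) * e l i"
      "\<forall>l<r. \<forall>l'<r. cip N (e l) (e l') = (if l = l' then 1 else 0)" by auto
    obtain y \<mu> where y: "cip N y y = 1" "\<forall>l<r. cip N y (e l) = 0"
      "\<forall>i<N. (\<Sum>j<N. a i j * y j) = complex_of_real \<mu> * y i"
      using hermitian_eigenvector_complement[where N=N and a=a and r=r and e=e and d=d, OF herm] IH Suc.prems by (auto simp: Suc_le_eq)
    have "\<forall>l<r. cip N (e l) y = 0" using y(2) cnj_cip by (metis complex_cnj_zero)
    with IH y show ?case
      by (intro exI[of _ "e(r := y)"] exI[of _ "d(r := \<mu>)"]) (auto simp: less_Suc_eq)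
  qed simp
  then show ?thesis by blast
qed

lemma order_prod_linear:
  "Polynomial.order x (\<Prod>l\<in>S. [:- d l, 1:]) = card {l\<in>S. d l = (x::complex)}" if "finite S"
  using that
proof (induction S rule: finite_induct)
  case (insert l S)
  have "(\<Prod>l\<in>S. [:- d l, 1:]) \<noteq> 0" using insert(1) by (simp add: prod_zero_iff)
  then have ne: "[:- d l, 1:] * (\<Prod>l\<in>S. [:- d l, 1:]) \<noteq> 0" by (metis mult_eq_0_iff one_neq_zero pCons_eq_0_iff)
  have o: "Polynomial.order x [:- d l, 1:] = (if d l = x then 1 else 0)"
    using order_power_n_n[of x 1] by (auto intro!: order_0I)
  have eq: "{j \<in> insert l S. d j = x} = (if d l = x then insert l {j\<in>S. d j = x} else {j\<in>S. d j = x})"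
    by auto
  have c: "card {j \<in> insert l S. d j = x} = (if d l = x then Suc (card {j\<in>S. d j = x}) else card {j\<in>S. d j = x})"
    unfolding eq using insert by simp
  show ?case unfolding c prod.insert[OF insert(1,2)] order_mult[OF ne] o using insert by simp
qed (simp add: order_0I)

text \<open>The eigenvectors as columns form a matrix \<open>P\<close> whose adjoint
  \<open>Q\<close> is a left inverse; for square matrices it is also a right inverse, which is the
  second claim. Hence \<open>A\<close> is similar to the diagonal matrix \<open>D\<close>, and
  multiplicities in the characteristic polynomial count indices.\<close>

lemma num_neg_eigenvalues_hermitian:
  assumes A: "A \<in> carrier_mat N N"
    and ev: "\<And>l i. l < N \<Longrightarrow> i < N \<Longrightarrow> (\<Sum>j<N. A $$ (i,j) * e l j) = of_real (d l) * e l i"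
    and on: "\<And>l l'. l < N \<Longrightarrow> l' < N \<Longrightarrow> cip N (e l) (e l') = (if l = l' then 1 else 0)"
  shows "num_neg_eigenvalues A = card {l\<in>{..<N}. d l < 0}"
    and "\<And>i j. i < N \<Longrightarrow> j < N \<Longrightarrow> (\<Sum>l<N. e l i * cnj (e l j)) = (if i = j then 1 else 0)"
proof -
  define P where "P = mat N N (\<lambda>(i,l). e l i)"
  define Q where "Q = mat N N (\<lambda>(l,i). cnj (e l i))"
  define D where "D = mat N N (\<lambda>(i,l). if i = l then complex_of_real (d l) else 0)"
  have cP: "P \<in> carrier_mat N N" "Q \<in> carrier_mat N N" "D \<in> carrier_mat N N" by (auto simp: P_def Q_def D_def)
  have QP: "Q * P = 1\<^sub>m N"
  proof (rule eq_matI)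
    fix i j assume "i < dim_row (1\<^sub>m N)" "j < dim_col (1\<^sub>m N :: complex mat)"
    then have ij: "i < N" "j < N" by auto
    have "(Q * P) $$ (i,j) = cip N (e j) (e i)"
      using ij by (simp add: P_def Q_def scalar_prod_def cip_def mult.commute atLeast0LessThan)
    then show "(Q * P) $$ (i,j) = 1\<^sub>m N $$ (i,j)" using on ij by auto
  qed (use cP in auto)
  have PQ: "P * Q = 1\<^sub>m N" using mat_mult_left_right_inverse[OF cP(2,1) QP] .
  show "(\<Sum>l<N. e l i * cnj (e l j)) = (if i = j then 1 else 0)" if "i < N" "j < N" for i j
  proof -
    have "(P * Q) $$ (i,j) = (\<Sum>l<N. e l i * cnj (e l j))"
      using that by (simp add: P_def Q_def scalar_prod_def atLeast0LessThan)
    then show ?thesis using PQ that by auto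
  qed
  have AP: "A * P = P * D"
  proof (rule eq_matI)
    fix i l assume "i < dim_row (P * D)" "l < dim_col (P * D)"
    then have il: "i < N" "l < N" using cP by auto
    have "(A * P) $$ (i,l) = (\<Sum>j<N. A $$ (i,j) * e l j)"
      using il A by (simp add: P_def scalar_prod_def atLeast0LessThan)
    also have "\<dots> = (\<Sum>j<N. e j i * (if j = l then of_real (d l) else 0))"
      using ev il by (simp add: if_distrib mult.commute cong: if_cong)
    also have "\<dots> = (P * D) $$ (i,l)"
      using il by (simp add: P_def D_def scalar_prod_def atLeast0LessThan)
    finally show "(A * P) $$ (i,l) = (P * D) $$ (i,l)" .
  qed (use cP A in auto)
  have "A = A * (P * Q)" using PQ A by simp
  also have "\<dots> = A * P * Q" using A cP by (simp add: assoc_mult_mat[of A N N P N Q N])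
  also have "\<dots> = P * D * Q" by (simp add: AP)
  finally have "similar_mat_wit A D P Q"
    using A cP PQ QP by (intro similar_mat_witI[of P Q N A D]) auto
  then have "char_poly A = char_poly D" by (intro char_poly_similar) (auto simp: similar_mat_def)
  also have "\<dots> = (\<Prod>x\<leftarrow>diag_mat D. [:- x, 1:])"
    by (rule char_poly_upper_triangular[OF cP(3)]) (auto simp: D_def)
  also have "\<dots> = (\<Prod>l<N. [:- of_real (d l), 1:])"
  proof -
    have "diag_mat D = map (\<lambda>l. complex_of_real (d l)) [0..<N]"
      by (auto simp: diag_mat_def D_def)
    then show ?thesis
      using prod.distinct_set_conv_list[of "[0..<N]" "\<lambda>l. [:- complex_of_real (d l), 1:]"]
      by (simp add: o_def atLeast0LessThan del: mult_pCons_left)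
  qed
  finally have cp: "char_poly A = (\<Prod>l<N. [:- complex_of_real (d l), 1:])" .
  have ord: "Polynomial.order x (char_poly A) = card {l\<in>{..<N}. complex_of_real (d l) = x}" for x
    unfolding cp by (rule order_prod_linear) auto
  have sp: "spectrum A = (\<lambda>l. complex_of_real (d l)) ` {..<N}"
    using eigenvalue_root_char_poly[OF A] by (auto simp: spectrum_def cp poly_prod prod_zero_iff)
  have "num_neg_eigenvalues A = (\<Sum>x\<in>{x \<in> spectrum A. x \<in> \<real> \<and> Re x < 0}. card {l\<in>{..<N}. complex_of_real (d l) = x})"
    unfolding num_neg_eigenvalues_def ord ..
  also have "\<dots> = card (\<Union>x\<in>{x \<in> spectrum A. x \<in> \<real> \<and> Re x < 0}. {l\<in>{..<N}. complex_of_real (d l) = x})"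
    by (rule card_UN_disjoint[symmetric]) (auto simp: sp)
  also have "(\<Union>x\<in>{x \<in> spectrum A. x \<in> \<real> \<and> Re x < 0}. {l\<in>{..<N}. complex_of_real (d l) = x}) = {l\<in>{..<N}. d l < 0}"
    by (auto simp: sp)
  finally show "num_neg_eigenvalues A = card {l\<in>{..<N}. d l < 0}" .
qed

text \<open>Orthogonality to the at most \<open>k\<close> eigenvectors with negative eigenvalue
  imposes at most \<open>k\<close> linear conditions on \<open>k + 1\<close> coefficients. Since the
  \<open>v j\<close> may be dependent, only the coefficient vector is claimed to be nonzero; after
  normalization this survives the limit taken later.\<close>

lemma num_neg_eigenvalues_nonneg_direction:
  assumes A: "A \<in> carrier_mat N N"
    and herm: "\<And>i j. i < N \<Longrightarrow> j < N \<Longrightarrow> A $$ (j,i) = cnj (A $$ (i,j))"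
    and k: "num_neg_eigenvalues A \<le> k"
  shows "\<exists>\<alpha>. (\<exists>j\<le>k. \<alpha> j \<noteq> 0) \<and>
    0 \<le> Re (\<Sum>i<N. \<Sum>m<N. A $$ (i,m) * (\<Sum>j\<le>k. \<alpha> j * v j m) * cnj (\<Sum>j\<le>k. \<alpha> j * v j i))"
proof -
  obtain e d where ed: "(\<forall>l<N. \<forall>i<N. (\<Sum>j<N. A $$ (i,j) * e l j) = complex_of_real (d l) * e l i) \<and>
     (\<forall>l<N. \<forall>l'<N. cip N (e l) (e l') = (if l = l' then 1 else 0))"
    using hermitian_diagonalization[of N "\<lambda>i j. A $$ (i,j)", OF herm] by blast
  have ev: "\<And>l i. l < N \<Longrightarrow> i < N \<Longrightarrow> (\<Sum>j<N. A $$ (i,j) * e l j) = complex_of_real (d l) * e l i"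
    and on: "\<And>l l'. l < N \<Longrightarrow> l' < N \<Longrightarrow> cip N (e l) (e l') = (if l = l' then 1 else 0)"
    using ed by blast+
  note nn = num_neg_eigenvalues_hermitian[OF A ev on]
  have "card {l\<in>{..<N}. d l < 0} < card {..k}" using nn(1) k by auto
  then obtain \<alpha> where \<alpha>: "\<exists>j\<in>{..k}. \<alpha> j \<noteq> 0"
    "\<forall>l\<in>{l\<in>{..<N}. d l < 0}. (\<Sum>j\<in>{..k}. cip N (v j) (e l) * \<alpha> j) = 0"
    using underdetermined_system[of "{l\<in>{..<N}. d l < 0}" "{..k}" "\<lambda>l j. cip N (v j) (e l)"] by auto
  define y where "y = (\<lambda>i. \<Sum>j\<le>k. \<alpha> j * v j i)"
  define b where "b l = cip N y (e l)" for l
  have b0: "b l = 0" if "l < N" "d l < 0" for l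
    using \<alpha>(2) that by (simp add: b_def y_def cip_sum cip_scale mult.commute)
  have yexp: "y m = (\<Sum>l<N. b l * e l m)" if "m < N" for m
  proof -
    have "(\<Sum>l<N. b l * e l m) = (\<Sum>l<N. \<Sum>i<N. y i * (e l m * cnj (e l i)))"
      by (simp add: b_def cip_def sum_distrib_left mult_ac)
    also have "\<dots> = (\<Sum>i<N. y i * (\<Sum>l<N. e l m * cnj (e l i)))"
      by (subst sum.swap) (simp add: sum_distrib_left)
    also have "\<dots> = (\<Sum>i<N. y i * (if m = i then 1 else 0))" using nn(2) that by simp
    also have "\<dots> = y m" using that by (simp add: if_distrib cong: if_cong)
    finally show ?thesis ..
  qed
  have Ay: "(\<Sum>m<N. A $$ (i,m) * y m) = (\<Sum>l<N. b l * of_real (d l) * e l i)" if "i < N" for i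
  proof -
    have "(\<Sum>m<N. A $$ (i,m) * y m) = (\<Sum>m<N. \<Sum>l<N. b l * (A $$ (i,m) * e l m))"
      by (simp add: yexp sum_distrib_left mult_ac)
    also have "\<dots> = (\<Sum>l<N. b l * (\<Sum>m<N. A $$ (i,m) * e l m))"
      by (subst sum.swap) (simp add: sum_distrib_left)
    finally show ?thesis using ev that by (simp add: mult_ac)
  qed
  have "(\<Sum>i<N. \<Sum>m<N. A $$ (i,m) * y m * cnj (y i)) = (\<Sum>i<N. (\<Sum>l<N. b l * of_real (d l) * e l i) * cnj (y i))"
    by (simp add: Ay sum_distrib_right[symmetric])
  also have "\<dots> = (\<Sum>l<N. b l * of_real (d l) * cip N (e l) y)"
    unfolding sum_distrib_right by (subst sum.swap) (simp add: cip_def sum_distrib_left mult_ac)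
  also have "\<dots> = (\<Sum>l<N. of_real (d l * (cmod (b l))\<^sup>2))"
  proof (intro sum.cong refl)
    fix l
    have "cip N (e l) y = cnj (b l)" unfolding b_def cnj_cip ..
    then have "b l * of_real (d l) * cip N (e l) y = of_real (d l) * (b l * cnj (b l))" by simp
    also have "\<dots> = of_real (d l * (cmod (b l))\<^sup>2)" unfolding of_real_mult complex_norm_square ..
    finally show "b l * of_real (d l) * cip N (e l) y = of_real (d l * (cmod (b l))\<^sup>2)" .
  qed
  finally have eq: "(\<Sum>i<N. \<Sum>m<N. A $$ (i,m) * y m * cnj (y i)) = of_real (\<Sum>l<N. d l * (cmod (b l))\<^sup>2)" by simp
  have "(\<Sum>l<N. d l * (cmod (b l))\<^sup>2) \<ge> 0"
  proof (intro sum_nonneg)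
    fix l assume "l \<in> {..<N}"
    then show "0 \<le> d l * (cmod (b l))\<^sup>2" using b0[of l] by (cases "d l < 0") auto
  qed
  then have "0 \<le> Re (\<Sum>i<N. \<Sum>m<N. A $$ (i,m) * y m * cnj (y i))" unfolding eq by simp
  then show ?thesis using \<alpha>(1) unfolding y_def by blast
qed

section \<open>Toeplitz forms with few negative squares\<close>

text \<open>The Toeplitz form of \<open>c\<close>, sesquilinear in the coefficients. Written on
  polynomials, its Toeplitz structure is invariance under multiplication of both arguments with the
  variable (\<open>tform_shift\<close>), and zeros and factorizations become available.\<close>

definition tform :: "(int \<Rightarrow> complex) \<Rightarrow> complex poly \<Rightarrow> complex poly \<Rightarrow> complex" where
  "tform c p q = (\<Sum>i\<le>Polynomial.degree p. \<Sum>j\<le>Polynomial.degree q. c (int i - int j) * coeff p i * cnj (coeff q j))"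

lemma tform_eq:
  assumes "Polynomial.degree p \<le> N" "Polynomial.degree q \<le> M"
  shows "tform c p q = (\<Sum>i\<le>N. \<Sum>j\<le>M. c (int i - int j) * coeff p i * cnj (coeff q j))"
proof -
  have "(\<Sum>i\<le>N. \<Sum>j\<le>M. c (int i - int j) * coeff p i * cnj (coeff q j)) =
     (\<Sum>i\<le>N. \<Sum>j\<le>Polynomial.degree q. c (int i - int j) * coeff p i * cnj (coeff q j))"
    by (intro sum.cong refl sum.mono_neutral_right) (use assms in \<open>auto simp: coeff_eq_0\<close>)
  also have "\<dots> = tform c p q"
    unfolding tform_def by (intro sum.mono_neutral_right) (use assms in \<open>auto simp: coeff_eq_0\<close>)
  finally show ?thesis ..
qed

lemma tform_add_left: "tform c (p + q) r = tform c p r + tform c q r"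
proof -
  define N where "N = max (Polynomial.degree p) (Polynomial.degree q)"
  have "Polynomial.degree p \<le> N" "Polynomial.degree q \<le> N" "Polynomial.degree (p + q) \<le> N" by (auto simp: N_def intro: degree_add_le)
  from this[THEN tform_eq, OF order_refl, of c r] show ?thesis
    by (simp only: coeff_add distrib_left distrib_right sum.distrib)
qed

lemma tform_smult_left: "tform c (Polynomial.smult a p) r = a * tform c p r"
  by (simp add: tform_eq[of "Polynomial.smult a p" "Polynomial.degree p" r "Polynomial.degree r"] tform_eq[of p "Polynomial.degree p" r "Polynomial.degree r"]
     sum_distrib_left mult_ac)

lemma tform_shift: "tform c (pCons 0 p) (pCons 0 q) = tform c p q"
proof -
  have "tform c (pCons 0 p) (pCons 0 q) = (\<Sum>i\<le>Suc (Polynomial.degree p). \<Sum>j\<le>Suc (Polynomial.degree q). c (int i - int j) * coeff (pCons 0 p) i * cnj (coeff (pCons 0 q) j))"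
    by (rule tform_eq) (auto intro: degree_pCons_le)
  then show ?thesis unfolding sum.atMost_Suc_shift by (simp add: tform_def)
qed

locale hermitian_sequence =
  fixes c :: "int \<Rightarrow> complex"
  assumes herm: "c (- n) = cnj (c n)"
begin

abbreviation "B \<equiv> tform c"

lemma B_cnj: "cnj (B p q) = B q p"
proof -
  have "cnj (c (int i - int j)) = c (int j - int i)" for i j using herm[of "int i - int j"] by simp
  then show ?thesis unfolding tform_def by (subst sum.swap) (simp add: mult_ac)
qed

lemma B_real: "B p p = of_real (Re (B p p))"
  using B_cnj[of p p] by (metis Reals_cnj_iff of_real_Re)

lemma B_add_right: "B p (q + r) = B p q + B p r"
  by (metis B_cnj complex_cnj_add tform_add_left)

lemma B_smult_right: "B p (Polynomial.smult a q) = cnj a * B p q"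
  by (metis B_cnj complex_cnj_mult tform_smult_left)

lemma B_zero: "B 0 p = 0" "B p 0 = 0"
  using tform_smult_left[of c 0 p p] B_smult_right[of p 0 p] by simp_all

lemma B_diff_left: "B (p - q) r = B p r - B q r"
  using tform_add_left[of c "p - q" q r] by (simp add: algebra_simps)

lemma B_diff_right: "B r (p - q) = B r p - B r q"
  by (metis B_cnj complex_cnj_diff B_diff_left)

lemma B_sum_left: "B (\<Sum>i\<in>A. f i) q = (\<Sum>i\<in>A. B (f i) q)"
  by (induction A rule: infinite_finite_induct) (auto simp: B_zero tform_add_left)

lemma B_sum_right: "B q (\<Sum>i\<in>A. f i) = (\<Sum>i\<in>A. B q (f i))"
  by (induction A rule: infinite_finite_induct) (auto simp: B_zero B_add_right)

end

text \<open>
  The condition says that no \<open>k + 1\<close> polynomials span a space of dimension \<open>k + 1\<close> on which the form is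
  negative definite; the polynomials \<open>x i\<close> may be linearly dependent.
\<close>
definition neg_squares_le :: "(int \<Rightarrow> complex) \<Rightarrow> nat \<Rightarrow> bool" where
  "neg_squares_le c k \<longleftrightarrow> (\<forall>x :: nat \<Rightarrow> complex poly. \<exists>\<alpha>. (\<exists>i\<le>k. \<alpha> i \<noteq> 0) \<and>
      0 \<le> Re (tform c (\<Sum>i\<le>k. Polynomial.smult (\<alpha> i) (x i)) (\<Sum>i\<le>k. Polynomial.smult (\<alpha> i) (x i))))"

section \<open>Coefficientwise convergence of polynomials to zero\<close>

definition pnull :: "(nat \<Rightarrow> complex poly) \<Rightarrow> bool" where
  "pnull q \<longleftrightarrow> (\<forall>i. (\<lambda>n. coeff (q n) i) \<longlonglongrightarrow> 0)"

lemma pnull_add: "pnull p \<Longrightarrow> pnull q \<Longrightarrow> pnull (\<lambda>n. p n + q n)"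
  unfolding pnull_def by (auto intro: tendsto_add_zero)

lemma pnull_const_poly: "b \<longlonglongrightarrow> 0 \<Longrightarrow> pnull (\<lambda>n. [:b n:])"
  unfolding pnull_def by (rule allI, rename_tac i, case_tac i) simp_all

lemma pnull_mult: "pnull q \<Longrightarrow> pnull (\<lambda>n. P * q n)"
  unfolding pnull_def coeff_mult by (auto intro!: tendsto_null_sum tendsto_mult_right_zero)

lemma pnull_poly:
  assumes "pnull q" and d: "\<And>n i. i \<ge> d \<Longrightarrow> coeff (q n) i = 0"
  shows "(\<lambda>n. poly (q n) z) \<longlonglongrightarrow> 0"
proof -
  have "poly (q n) z = (\<Sum>i\<le>d. coeff (q n) i * z ^ i)" for n
  proof -
    have "Polynomial.degree (q n) \<le> d" using d[of _ n] by (intro degree_le) auto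
    then show ?thesis unfolding poly_altdef by (intro sum.mono_neutral_left) (auto simp: coeff_eq_0)
  qed
  then show ?thesis
    using assms(1) unfolding pnull_def by (auto intro!: tendsto_null_sum tendsto_mult_left_zero)
qed

lemma coeff_synthetic_div:
  fixes p :: "complex poly"
  shows "coeff (synthetic_div p z) i = coeff p (Suc i) + z * coeff (synthetic_div p z) (Suc i)"
proof -
  have "p = [:- z, 1:] * synthetic_div p z + [:poly p z:]" by (rule synthetic_div_correct'[symmetric])
  then have "coeff p (Suc i) = coeff ([:- z, 1:] * synthetic_div p z + [:poly p z:]) (Suc i)" by simp
  then show ?thesis by simp
qed

lemma coeff_synthetic_div_eq_0:
  fixes p :: "complex poly"
  assumes "\<And>i. i \<ge> Suc d \<Longrightarrow> coeff p i = 0" "i \<ge> d"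
  shows "coeff (synthetic_div p z) i = 0"
proof -
  have "Polynomial.degree p \<le> d" using assms(1) by (intro degree_le) auto
  show ?thesis
  proof (cases "Polynomial.degree p = 0")
    case True
    then show ?thesis by (simp add: synthetic_div_eq_0_iff[THEN iffD2])
  next
    case False
    then show ?thesis using \<open>Polynomial.degree p \<le> d\<close> assms(2) by (intro coeff_eq_0) (simp add: degree_synthetic_div)
  qed
qed

text \<open>Horner's scheme yields the coefficients of the quotient from the top downward; hence the
  induction on the distance from the degree bound \<open>d\<close>, which makes the recursion
  finite, uniformly in \<open>n\<close>.\<close>

lemma pnull_synthetic_div:
  assumes "pnull q" and d: "\<And>n i. i \<ge> Suc d \<Longrightarrow> coeff (q n) i = 0"
  shows "pnull (\<lambda>n. synthetic_div (q n) z)"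
proof -
  have "(\<lambda>n. coeff (synthetic_div (q n) z) (d - m)) \<longlonglongrightarrow> 0" for m
  proof (induction m)
    case 0
    then show ?case using coeff_synthetic_div_eq_0[OF d] by simp
  next
    case (Suc m)
    show ?case
    proof (cases "Suc m \<le> d")
      case True
      then have "Suc (d - Suc m) = d - m" by simp
      then have "coeff (synthetic_div (q n) z) (d - Suc m) = coeff (q n) (d - m) + z * coeff (synthetic_div (q n) z) (d - m)" for n
        using coeff_synthetic_div[of "q n" z "d - Suc m"] by simp
      then show ?thesis using Suc assms(1) unfolding pnull_def
        by (auto intro!: tendsto_add_zero tendsto_mult_right_zero)
    next
      case False then show ?thesis using Suc by simp
    qed
  qed
  then have "(\<lambda>n. coeff (synthetic_div (q n) z) i) \<longlonglongrightarrow> 0" if "i \<le> d" for i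
    using that by (metis diff_diff_cancel)
  moreover have "(\<lambda>n. coeff (synthetic_div (q n) z) i) \<longlonglongrightarrow> 0" if "i \<ge> d" for i
    using coeff_synthetic_div_eq_0[OF d that] by simp
  ultimately show ?thesis unfolding pnull_def by (meson nle_le)
qed

lemma contraction_recurrence_null:
  fixes b v :: "nat \<Rightarrow> complex"
  assumes rec: "\<And>n. b (Suc n) = z * b n + v n" and z: "cmod z < 1" and v: "v \<longlonglongrightarrow> 0"
  shows "b \<longlonglongrightarrow> 0"
proof (rule LIMSEQ_I)
  fix e :: real assume e: "e > 0"
  define \<rho> where "\<rho> = cmod z"
  have \<rho>: "0 \<le> \<rho>" "\<rho> < 1" using z by (auto simp: \<rho>_def)
  \<comment> \<open>With this constant the geometric series of all later perturbations sums to
    \<open>e / 2\<close>.\<close>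
  obtain N where N: "\<And>n. n \<ge> N \<Longrightarrow> cmod (v n) < e / 2 * (1 - \<rho>)"
    using LIMSEQ_D[OF v, of "e / 2 * (1 - \<rho>)"] e \<rho> by auto
  have bound: "cmod (b (N + m)) \<le> \<rho> ^ m * cmod (b N) + e / 2" for m
  proof (induction m)
    case (Suc m)
    have "cmod (b (N + Suc m)) \<le> \<rho> * cmod (b (N + m)) + cmod (v (N + m))"
      using norm_triangle_ineq[of "z * b (N + m)" "v (N + m)"] by (simp add: rec norm_mult \<rho>_def)
    also have "\<dots> \<le> \<rho> * (\<rho> ^ m * cmod (b N) + e / 2) + e / 2 * (1 - \<rho>)"
      using Suc N[of "N + m"] \<rho> by (intro add_mono mult_left_mono) auto
    also have "\<dots> = \<rho> ^ Suc m * cmod (b N) + e / 2" by (simp add: field_simps)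
    finally show ?case .
  qed (use e in simp)
  have "(\<lambda>m. \<rho> ^ m * cmod (b N)) \<longlonglongrightarrow> 0" using \<rho> by (intro tendsto_mult_left_zero LIMSEQ_realpow_zero) auto
  from order_tendstoD(2)[OF this, of "e/2"] e obtain m0 where m0: "\<And>m. m \<ge> m0 \<Longrightarrow> \<rho> ^ m * cmod (b N) < e / 2"
    by (auto simp: eventually_sequentially)
  show "\<exists>no. \<forall>n\<ge>no. norm (b n - 0) < e"
  proof (intro exI[of _ "N + m0"] allI impI)
    fix n assume "n \<ge> N + m0"
    then have "m0 \<le> n - N" "N + (n - N) = n" by auto
    then show "norm (b n - 0) < e" using bound[of "n - N"] m0[of "n - N"] by simp
  qed
qed

abbreviation root_poly :: "complex list \<Rightarrow> complex poly" where
  "root_poly zs \<equiv> (\<Prod>z\<leftarrow>zs. [:- z, 1:])"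

lemma degree_linear_factors: "Polynomial.degree (root_poly zs) = length zs"
  and lead_coeff_linear_factors: "lead_coeff (root_poly zs) = 1"
proof -
  have "Polynomial.degree (root_poly zs) = length zs \<and> root_poly zs \<noteq> 0 \<and> lead_coeff (root_poly zs) = 1"
  proof (induction zs)
    case (Cons z zs)
    then show ?case
      unfolding list.map prod_list.Cons lead_coeff_mult
      by (simp add: degree_mult_eq del: mult_pCons_left) metis
  qed simp
  then show "Polynomial.degree (root_poly zs) = length zs" "lead_coeff (root_poly zs) = 1" by auto
qed

text \<open>
  Up to \<open>v\<close>, the sequence \<open>q\<close> arises by repeated multiplication with the variable modulo \<open>root_poly zs\<close>
  (\<open>fwd\<close>), or by repeated division. The induction on \<open>zs\<close> removes one zero at a time; this creates the
  inhomogeneity \<open>v\<close>.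
\<close>
lemma polynomial_recurrence_null:
  fixes zs :: "complex list"
  assumes "\<And>n i. i \<ge> length zs \<Longrightarrow> coeff (q n) i = 0"
    and "\<And>n. pCons 0 (q (if fwd then n else Suc n)) + v n =
        q (if fwd then Suc n else n) + Polynomial.smult (l n) (root_poly zs)"
    and "\<And>z. z \<in> set zs \<Longrightarrow> if fwd then cmod z < 1 else cmod z > 1"
    and "pnull v"
  shows "pnull q"
  using assms
proof (induction zs arbitrary: q v)
  case Nil
  then have "q n = 0" for n by (simp add: poly_eq_iff)
  then show ?case by (simp add: pnull_def)
next
  case (Cons z zs)
  define R where "R = root_poly zs"
  have lcR: "Polynomial.degree R = length zs" unfolding R_def by (rule degree_linear_factors)
  define a where "a n = q (if fwd then n else Suc n)" for n
  define b where "b n = q (if fwd then Suc n else n)" for n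
  have eq: "pCons 0 (a n) + v n = b n + Polynomial.smult (l n) ([:- z, 1:] * R)" for n
    using Cons.prems(2)[of n] by (simp add: a_def b_def R_def)
  have vd: "coeff (v n) i = 0" if "i \<ge> Suc (Suc (length zs))" for n i
  proof -
    have "v n = b n + Polynomial.smult (l n) ([:- z, 1:] * R) - pCons 0 (a n)" using eq[of n] by (simp add: algebra_simps)
    moreover have "coeff ([:- z, 1:] * R) i = 0"
      using that lcR by (intro coeff_eq_0 le_less_trans[OF degree_mult_le]) auto
    moreover have "coeff (pCons 0 (a n)) i = 0" "coeff (b n) i = 0"
      using that Cons.prems(1)[of "i - 1" "if fwd then n else Suc n"] Cons.prems(1)[of i "if fwd then Suc n else n"]
      by (auto simp: a_def b_def coeff_pCons split: nat.splits)
    ultimately show ?thesis by simp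
  qed
  define \<beta> where "\<beta> n = poly (q n) z" for n
  define r where "r n = synthetic_div (q n) z" for n
  define w where "w n = synthetic_div (v n) z" for n
  have q: "q n = [:- z, 1:] * r n + [:\<beta> n:]" for n unfolding r_def \<beta>_def by (rule synthetic_div_correct'[symmetric])
  have v: "v n = [:- z, 1:] * w n + [:poly (v n) z:]" for n unfolding w_def by (rule synthetic_div_correct'[symmetric])
  have vz: "(\<lambda>n. poly (v n) z) \<longlonglongrightarrow> 0" by (rule pnull_poly[OF Cons.prems(4) vd])
  \<comment> \<open>At the zero \<open>z\<close> the multiple of \<open>root_poly\<close> drops out
    and a scalar recurrence for the remainders \<beta> is left: contracting with factor
    \<open>z\<close> forwards, and with factor \<open>1 / z\<close> backwards.\<close>
  have evz: "z * poly (a n) z + poly (v n) z = poly (b n) z" for n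
    using arg_cong[OF eq[of n], of "\<lambda>p. poly p z"] by simp
  have \<beta>: "\<beta> \<longlonglongrightarrow> 0"
  proof (cases fwd)
    case True
    then show ?thesis using evz Cons.prems(3)[of z] by (intro contraction_recurrence_null[OF _ _ vz]) (auto simp: a_def b_def \<beta>_def)
  next
    case False
    then have z: "cmod z > 1" using Cons.prems(3)[of z] by auto
    then have z0: "z \<noteq> 0" by auto
    have "(\<lambda>n. - poly (v n) z / z) \<longlonglongrightarrow> 0" using tendsto_divide[OF tendsto_minus[OF vz] tendsto_const[of z]] z0 by simp
    moreover have "\<beta> (Suc n) = 1 / z * \<beta> n + - poly (v n) z / z" for n
      using evz[of n] False z0 by (simp add: a_def b_def \<beta>_def field_simps)
    moreover have "cmod (1 / z) < 1" using z z0 by (simp add: norm_divide divide_less_eq)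
    ultimately show ?thesis by (intro contraction_recurrence_null[of \<beta> "1 / z"]) auto
  qed
  define ia where "ia n = (if fwd then n else Suc n)" for n
  define ib where "ib n = (if fwd then Suc n else n)" for n
  have "pnull r"
  proof (rule Cons.IH)
    show "coeff (r n) i = 0" if "i \<ge> length zs" for n i
      unfolding r_def using Cons.prems(1) that by (intro coeff_synthetic_div_eq_0[of "length zs"]) auto
    \<comment> \<open>Division by \<open>[:- z, 1:]\<close> leaves the same recurrence for the
      quotients with one zero less; the remainder \<beta> has become part of the
      inhomogeneity.\<close>
    show "pCons 0 (r (if fwd then n else Suc n)) + ([:\<beta> (ia n):] + w n) = r (if fwd then Suc n else n) + Polynomial.smult (l n) (root_poly zs)" for n
    proof -
      have x: "pCons 0 p = [:0, 1:] * p" for p :: "complex poly" by simp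
      have "[:- z, 1:] * (pCons 0 (r (ia n)) + ([:\<beta> (ia n):] + w n)) + [:z * \<beta> (ia n) + poly (v n) z:]
         = pCons 0 (a n) + v n"
      proof -
        have "a n = [:- z, 1:] * r (ia n) + [:\<beta> (ia n):]" using q[of "ia n"] by (simp add: a_def ia_def)
        then have "pCons 0 (a n) + v n = [:0, 1:] * ([:- z, 1:] * r (ia n) + [:\<beta> (ia n):]) + ([:- z, 1:] * w n + [:poly (v n) z:])"
          using v[of n] x by metis
        also have "\<dots> = [:- z, 1:] * ([:0, 1:] * r (ia n) + w n) + [:0, 1:] * [:\<beta> (ia n):] + [:poly (v n) z:]"
          by (simp only: distrib_left mult.left_commute add_ac)
        also have "[:0, 1:] * [:\<beta> (ia n):] = [:- z, 1:] * [:\<beta> (ia n):] + [:z * \<beta> (ia n):]" by simp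
        finally show ?thesis unfolding x[of "r (ia n)"] by (simp only: distrib_left add_ac) simp
      qed
      also have "\<dots> = [:- z, 1:] * (r (ib n) + Polynomial.smult (l n) R) + [:\<beta> (ib n):]"
      proof -
        have "b n = [:- z, 1:] * r (ib n) + [:\<beta> (ib n):]" using q[of "ib n"] by (simp add: b_def ib_def)
        then show ?thesis unfolding eq by (simp only: distrib_left mult_smult_right add_ac)
      qed
      finally have "[:- z, 1:] * (pCons 0 (r (ia n)) + ([:\<beta> (ia n):] + w n)) + [:z * \<beta> (ia n) + poly (v n) z:]
        = [:- z, 1:] * (r (ib n) + Polynomial.smult (l n) R) + [:\<beta> (ib n):]" .
      moreover have "z * \<beta> (ia n) + poly (v n) z = \<beta> (ib n)"
        using evz[of n] by (simp add: a_def b_def ia_def ib_def \<beta>_def)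
      ultimately have "[:- z, 1:] * (pCons 0 (r (ia n)) + ([:\<beta> (ia n):] + w n)) = [:- z, 1:] * (r (ib n) + Polynomial.smult (l n) R)"
        by simp
      then have "pCons 0 (r (ia n)) + ([:\<beta> (ia n):] + w n) = r (ib n) + Polynomial.smult (l n) R"
        by (subst (asm) mult_cancel_left) auto
      then show ?thesis unfolding ia_def ib_def R_def .
    qed
    show "if fwd then cmod z < 1 else 1 < cmod z" if "z \<in> set zs" for z using Cons.prems(3) that by auto
    have "(\<lambda>n. \<beta> (ia n)) \<longlonglongrightarrow> 0" unfolding ia_def using \<beta> LIMSEQ_Suc[OF \<beta>] by (cases fwd) auto
    then show "pnull (\<lambda>n. [:\<beta> (ia n):] + w n)"
      unfolding w_def by (intro pnull_add pnull_const_poly pnull_synthetic_div[OF Cons.prems(4) vd])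
  qed
  then have "pnull (\<lambda>n. [:- z, 1:] * r n + [:\<beta> n:])" by (intro pnull_add pnull_mult pnull_const_poly \<beta>)
  then show ?case unfolding q[symmetric] by (simp add: q[symmetric])
qed

lemma complex_poly_linear_factors:
  fixes p :: "complex poly"
  assumes "lead_coeff p = 1"
  shows "\<exists>zs. p = root_poly zs"
  using assms
proof (induction "Polynomial.degree p" arbitrary: p)
  case 0
  then have "p = 1" by (metis monic_degree_0)
  then show ?case by (intro exI[of _ "[]"]) simp
next
  case (Suc n)
  then obtain z where "poly p z = 0"
    using fundamental_theorem_of_algebra_alt[of p] by (metis Suc_neq_Zero degree_pCons_0)
  then obtain q where q: "p = [:- z, 1:] * q" by (metis poly_eq_0_iff_dvd dvdE)
  have "q \<noteq> 0" using Suc.prems q by auto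
  then have "Polynomial.degree p = Suc (Polynomial.degree q)" unfolding q by (subst degree_mult_eq) auto
  moreover have "lead_coeff q = 1" using Suc.prems unfolding q lead_coeff_mult by simp
  ultimately obtain zs where "q = root_poly zs" using Suc.hyps(1)[of q] Suc.hyps(2) by auto
  then show ?case using q by (intro exI[of _ "z # zs"]) simp
qed

section \<open>Orthogonal polynomials of a nondegenerate Toeplitz form\<close>

locale nondegenerate_sequence = hermitian_sequence +
  fixes k :: nat
  assumes nondeg: "p \<noteq> 0 \<Longrightarrow> Polynomial.degree p \<le> N \<Longrightarrow> \<exists>q. Polynomial.degree q \<le> N \<and> B p q \<noteq> 0"
    and neg: "neg_squares_le c k"
begin

lemma B_eq_0_degree_less:
  assumes "\<And>j. j < N \<Longrightarrow> B p (monom 1 j) = 0" "\<And>i. i \<ge> N \<Longrightarrow> coeff q i = 0"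
  shows "B p q = 0"
proof -
  have "q = (\<Sum>i<N. monom (coeff q i) i)"
    by (rule poly_eqI) (use assms(2) in \<open>auto simp: coeff_sum coeff_monom not_less\<close>)
  also have "\<dots> = (\<Sum>i<N. Polynomial.smult (coeff q i) (monom 1 i))" by (simp add: smult_monom)
  finally have "B p q = (\<Sum>i<N. cnj (coeff q i) * B p (monom 1 i))"
    by (metis (no_types, lifting) B_sum_right B_smult_right sum.cong)
  then show ?thesis using assms(1) by simp
qed

text \<open>\<open>N\<close> orthogonality conditions leave a nonzero polynomial of degree at most
  \<open>N\<close>. Nondegeneracy of the section of degree \<open>N - 1\<close> excludes a smaller
  degree: such a polynomial would be orthogonal to the whole space that contains it.\<close>

lemma orthogonal_polynomial_exists:
  "\<exists>\<phi>. Polynomial.degree \<phi> = N \<and> coeff \<phi> N = 1 \<and> (\<forall>q. (\<forall>i\<ge>N. coeff q i = 0) \<longrightarrow> B \<phi> q = 0)"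
proof -
  obtain x where x: "\<exists>i\<in>{..N}. x i \<noteq> 0" "\<forall>j\<in>{..<N}. (\<Sum>i\<in>{..N}. c (int i - int j) * x i) = 0"
    using underdetermined_system[of "{..<N}" "{..N}" "\<lambda>j i. c (int i - int j)"] by auto
  define p where "p = (\<Sum>i\<le>N. monom (x i) i)"
  have cp: "coeff p i = (if i \<le> N then x i else 0)" for i by (simp add: p_def coeff_sum coeff_monom)
  have dp: "Polynomial.degree p \<le> N" by (intro degree_le) (auto simp: cp)
  have p0: "p \<noteq> 0" using x(1) cp by (metis atMost_iff coeff_0)
  have "B p (monom 1 j) = 0" if "j < N" for j
  proof -
    have "B p (monom 1 j) = (\<Sum>i\<le>N. \<Sum>m\<le>j. c (int i - int m) * coeff p i * cnj (coeff (monom 1 j) m))"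
      by (rule tform_eq[OF dp]) (simp add: degree_monom_le)
    also have "\<dots> = (\<Sum>i\<le>N. c (int i - int j) * x i)"
      by (intro sum.cong refl, subst sum.remove[of _ j]) (auto simp: coeff_monom cp)
    finally show ?thesis using x(2) that by simp
  qed
  then have orth: "B p q = 0" if "\<forall>i\<ge>N. coeff q i = 0" for q
    using B_eq_0_degree_less that by blast
  have cN: "coeff p N \<noteq> 0"
  proof
    assume 0: "coeff p N = 0"
    then have N: "N \<noteq> 0" using dp p0 by (metis le_zero_eq leading_coeff_0_iff)
    have "Polynomial.degree p \<noteq> N" using 0 p0 leading_coeff_0_iff by metis
    then have "Polynomial.degree p \<le> N - 1" using dp by simp
    then obtain q where q: "Polynomial.degree q \<le> N - 1" "B p q \<noteq> 0" using nondeg[OF p0] by blast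
    have "\<forall>i\<ge>N. coeff q i = 0" using q(1) N by (auto intro: coeff_eq_0)
    with orth q(2) show False by blast
  qed
  have "Polynomial.degree p = N" using dp le_degree[OF cN] by simp
  then show ?thesis
    using orth cN by (intro exI[of _ "Polynomial.smult (1 / coeff p N) p"]) (auto simp: tform_smult_left)
qed

definition \<phi> :: "nat \<Rightarrow> complex poly" where
  "\<phi> N = (SOME \<phi>. Polynomial.degree \<phi> = N \<and> coeff \<phi> N = 1 \<and> (\<forall>q. (\<forall>i\<ge>N. coeff q i = 0) \<longrightarrow> B \<phi> q = 0))"

lemma \<phi>: "Polynomial.degree (\<phi> N) = N" "coeff (\<phi> N) N = 1" "(\<And>i. i \<ge> N \<Longrightarrow> coeff q i = 0) \<Longrightarrow> B (\<phi> N) q = 0"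
proof -
  have *: "Polynomial.degree (\<phi> N) = N \<and> coeff (\<phi> N) N = 1 \<and> (\<forall>q. (\<forall>i\<ge>N. coeff q i = 0) \<longrightarrow> B (\<phi> N) q = 0)"
    unfolding \<phi>_def by (rule someI_ex[OF orthogonal_polynomial_exists])
  then show "Polynomial.degree (\<phi> N) = N" "coeff (\<phi> N) N = 1" by auto
  show "B (\<phi> N) q = 0" if "\<And>i. i \<ge> N \<Longrightarrow> coeff q i = 0" using * that by blast
qed

lemma \<phi>_right: "(\<And>i. i \<ge> N \<Longrightarrow> coeff q i = 0) \<Longrightarrow> B q (\<phi> N) = 0"
  using \<phi>(3)[of N q] B_cnj[of "\<phi> N" q] by simp

definition h :: "nat \<Rightarrow> real" where "h N = Re (B (\<phi> N) (\<phi> N))"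

lemma B_\<phi>: "B (\<phi> i) (\<phi> j) = (if i = j then of_real (h i) else 0)"
proof -
  consider "i = j" | "i < j" | "j < i" by linarith
  then show ?thesis
  proof cases
    case 1 then show ?thesis using B_real by (simp add: h_def)
  next
    case 2 then show ?thesis using \<phi>(1)[of i] by (auto intro!: \<phi>_right coeff_eq_0)
  next
    case 3 then show ?thesis using \<phi>(1)[of j] by (auto intro!: \<phi>(3) coeff_eq_0)
  qed
qed

lemma \<phi>_expansion:
  "\<forall>i\<ge>N. coeff p i = 0 \<Longrightarrow> \<exists>b. p = (\<Sum>j<N. Polynomial.smult (b j) (\<phi> j))"
proof (induction N arbitrary: p)
  case 0
  then have "p = 0" by (simp add: poly_eq_iff)
  then show ?case by simp
next
  case (Suc N)
  define q where "q = p - Polynomial.smult (coeff p N) (\<phi> N)"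
  have "coeff q i = 0" if "i \<ge> N" for i
    using that Suc.prems \<phi>(1,2)[of N] by (cases "i = N") (auto simp: q_def coeff_eq_0)
  then obtain b where b: "q = (\<Sum>j<N. Polynomial.smult (b j) (\<phi> j))" using Suc.IH by blast
  have "p = (\<Sum>j<Suc N. Polynomial.smult ((b(N := coeff p N)) j) (\<phi> j))"
    using b by (simp add: q_def algebra_simps)
  then show ?case by blast
qed

lemma h_nonzero: "h N \<noteq> 0"
proof
  assume h0: "h N = 0"
  have "\<phi> N \<noteq> 0" using \<phi>(2)[of N] by auto
  then obtain q where q: "Polynomial.degree q \<le> N" "B (\<phi> N) q \<noteq> 0" using nondeg[of "\<phi> N" N] \<phi>(1) by auto
  define r where "r = q - Polynomial.smult (coeff q N) (\<phi> N)"
  have "coeff r i = 0" if "i \<ge> N" for i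
    using that q(1) \<phi>(1,2)[of N] by (cases "i = N") (auto simp: r_def coeff_eq_0)
  then have "B (\<phi> N) r = 0" by (rule \<phi>(3))
  then show False using q(2) h0 by (simp add: r_def B_diff_right B_smult_right B_\<phi>)
qed

text \<open>The form is diagonal in the basis \<open>\<phi> j\<close> with entries
  \<open>h j\<close>, so \<open>k + 1\<close> negative entries would span a negative definite
  subspace of dimension \<open>k + 1\<close>. Excluding sets of exactly \<open>k + 1\<close> indices
  yields both finiteness and the bound.\<close>

lemma neg_indices: "finite {j. h j < 0}" "card {j. h j < 0} \<le> k"
proof -
  have no: False if J: "finite J" "card J = Suc k" "J \<subseteq> {j. h j < 0}" for J
  proof -
    obtain f where f: "bij_betw f {0..<Suc k} J" using ex_bij_betw_nat_finite[OF J(1)] J(2) by auto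
    obtain \<alpha> where \<alpha>: "\<exists>i\<le>k. \<alpha> i \<noteq> 0"
      "0 \<le> Re (B (\<Sum>i\<le>k. Polynomial.smult (\<alpha> i) (\<phi> (f i))) (\<Sum>i\<le>k. Polynomial.smult (\<alpha> i) (\<phi> (f i))))"
      using neg unfolding neg_squares_le_def by (meson order_refl)
    have inj: "f i = f j \<longleftrightarrow> i = j" if "i \<le> k" "j \<le> k" for i j
      using f that unfolding bij_betw_def inj_on_def by auto
    have "B (\<Sum>i\<le>k. Polynomial.smult (\<alpha> i) (\<phi> (f i))) (\<Sum>i\<le>k. Polynomial.smult (\<alpha> i) (\<phi> (f i))) =
       (\<Sum>i\<le>k. \<Sum>j\<le>k. if i = j then of_real (h (f i)) * (\<alpha> i * cnj (\<alpha> i)) else 0)"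
      unfolding B_sum_left B_sum_right tform_smult_left B_smult_right sum_distrib_left
      by (intro sum.cong refl) (auto simp: B_\<phi> inj)
    also have "\<dots> = of_real (\<Sum>i\<le>k. h (f i) * (cmod (\<alpha> i))\<^sup>2)"
      by (simp add: complex_norm_square of_real_sum del: of_real_power)
    finally have "0 \<le> (\<Sum>i\<le>k. h (f i) * (cmod (\<alpha> i))\<^sup>2)" using \<alpha>(2) by simp
    moreover have "(\<Sum>i\<le>k. h (f i) * (cmod (\<alpha> i))\<^sup>2) < 0"
    proof -
      have hf: "h (f i) < 0" if "i \<le> k" for i
      proof -
        have "f i \<in> J" using f that unfolding bij_betw_def by auto
        then show ?thesis using J(3) by auto
      qed
      obtain i where i: "i \<le> k" "\<alpha> i \<noteq> 0" using \<alpha>(1) by auto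
      have "(\<Sum>i\<le>k. h (f i) * (cmod (\<alpha> i))\<^sup>2) < (\<Sum>i\<le>k. 0)"
      proof (rule sum_strict_mono_ex1)
        show "\<forall>i\<in>{..k}. h (f i) * (cmod (\<alpha> i))\<^sup>2 \<le> 0"
          using less_imp_le[OF hf] by (auto intro!: mult_nonpos_nonneg)
        show "\<exists>i\<in>{..k}. h (f i) * (cmod (\<alpha> i))\<^sup>2 < 0" using hf[OF i(1)] i by (intro bexI[of _ i]) (auto simp: mult_neg_pos)
      qed auto
      then show ?thesis by simp
    qed
    ultimately show False by simp
  qed
  show fin: "finite {j. h j < 0}"
  proof (rule ccontr)
    assume "infinite {j. h j < 0}"
    from infinite_arbitrarily_large[OF this, of "Suc k"] no show False by auto
  qed
  show "card {j. h j < 0} \<le> k"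
  proof (rule ccontr)
    assume "\<not> card {j. h j < 0} \<le> k"
    then have "Suc k \<le> card {j. h j < 0}" by simp
    from obtain_subset_with_card_n[OF this] no fin show False by metis
  qed
qed

text \<open>The expansion coefficient of \<open>p\<close> at \<open>\<phi> j\<close> is
  \<open>B p (\<phi> j) / h j\<close>, so only squares with positive weight remain.\<close>

lemma B_pos_off_negative:
  assumes p: "p \<noteq> 0" "\<And>j. h j < 0 \<Longrightarrow> B p (\<phi> j) = 0"
  shows "Re (B p p) > 0"
proof -
  obtain N where "\<forall>i\<ge>N. coeff p i = 0" using coeff_eq_0 by (metis Suc_le_lessD)
  then obtain b where b: "p = (\<Sum>j<N. Polynomial.smult (b j) (\<phi> j))" using \<phi>_expansion by blast
  have Bj: "B p (\<phi> j) = b j * of_real (h j)" if "j < N" for j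
  proof -
    have "B p (\<phi> j) = (\<Sum>i<N. if i = j then b i * of_real (h i) else 0)"
      by (subst b, unfold B_sum_left tform_smult_left) (intro sum.cong refl, auto simp: B_\<phi>)
    then show ?thesis using that by simp
  qed
  have b0: "b j = 0" if "j < N" "h j < 0" for j using p(2)[OF that(2)] Bj[OF that(1)] that(2) by simp
  have "B p p = B p (\<Sum>j<N. Polynomial.smult (b j) (\<phi> j))" using b by simp
  also have "\<dots> = (\<Sum>j<N. cnj (b j) * B p (\<phi> j))" unfolding B_sum_right B_smult_right ..
  also have "\<dots> = (\<Sum>j<N. of_real (h j) * (b j * cnj (b j)))"
    using Bj by (intro sum.cong refl) (simp add: mult_ac)
  also have "\<dots> = of_real (\<Sum>j<N. h j * (cmod (b j))\<^sup>2)"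
    by (simp add: complex_norm_square of_real_sum del: of_real_power)
  finally have eq: "Re (B p p) = (\<Sum>j<N. h j * (cmod (b j))\<^sup>2)" by simp
  obtain j where j: "j < N" "b j \<noteq> 0" using p(1) b by (metis (no_types, lifting) lessThan_iff smult_0_left sum.neutral)
  have "h j > 0" using b0[of j] j h_nonzero[of j] by (meson linorder_cases)
  have "0 < h j * (cmod (b j))\<^sup>2" using \<open>h j > 0\<close> j by simp
  also have "\<dots> \<le> (\<Sum>j<N. h j * (cmod (b j))\<^sup>2)"
  proof (rule member_le_sum)
    fix i assume "i \<in> {..<N} - {j}"
    then show "0 \<le> h i * (cmod (b i))\<^sup>2" using b0[of i] by (cases "h i < 0") auto
  qed (use j in auto)
  finally show ?thesis using eq by simp
qed

lemma B_null:
  assumes "pnull q" "\<And>n i. i \<ge> d \<Longrightarrow> coeff (q n) i = 0"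
  shows "(\<lambda>n. Re (B (q n) (q n))) \<longlonglongrightarrow> 0"
proof -
  have "Polynomial.degree (q n) \<le> d" for n using assms(2)[of _ n] by (intro degree_le) auto
  then have "B (q n) (q n) = (\<Sum>i\<le>d. \<Sum>j\<le>d. c (int i - int j) * coeff (q n) i * cnj (coeff (q n) j))" for n
    by (intro tform_eq)
  moreover have "(\<lambda>n. (\<Sum>i\<le>d. \<Sum>j\<le>d. c (int i - int j) * coeff (q n) i * cnj (coeff (q n) j))) \<longlonglongrightarrow> (\<Sum>i\<le>d. \<Sum>j\<le>d. c (int i - int j) * 0 * cnj 0)"
    using assms(1) unfolding pnull_def by (intro tendsto_intros) auto
  ultimately have "(\<lambda>n. B (q n) (q n)) \<longlonglongrightarrow> 0" by simp
  from tendsto_Re[OF this] show ?thesis by simp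
qed

text \<open>Pythagoras: the shift is isometric for the form, and \<open>\<phi> N\<close> is
  orthogonal to everything of lower degree. Iteration makes the form monotone along the recurrences
  in \<open>krein_factor\<close>.\<close>

lemma B_step:
  assumes "\<And>i. i \<ge> N \<Longrightarrow> coeff y i = 0" "pCons 0 x = y + Polynomial.smult l (\<phi> N)"
  shows "Re (B x x) = Re (B y y) + (cmod l)\<^sup>2 * h N"
proof -
  have "B x x = B (pCons 0 x) (pCons 0 x)" by (simp add: tform_shift)
  also have "\<dots> = B y y + l * cnj l * of_real (h N)"
    unfolding assms(2) tform_add_left B_add_right tform_smult_left B_smult_right
    using \<phi>(3)[OF assms(1)] \<phi>_right[OF assms(1)] by (simp add: B_\<phi>)
  also have "l * cnj l = of_real ((cmod l)\<^sup>2)" by (simp add: complex_norm_square del: of_real_power)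
  finally show ?thesis by simp
qed

text \<open>
  Modulo \<open>\<phi> N\<close>, multiplication with the variable decreases the form by a nonnegative multiple of \<open>h N\<close>.
  Let \<open>P\<close> and \<open>Q\<close> collect the zeros of \<open>\<phi> N\<close> outside and inside the unit circle. On multiples of \<open>P\<close> the
  iterates tend to \<open>0\<close>, so that the form is nonnegative. On multiples of \<open>Q\<close> the inverse iterates tend to
  \<open>0\<close>, so that the form is nonpositive, and \<open>P\<close> has degree at most \<open>k\<close>.
\<close>
lemma krein_factor:
  assumes hN: "h N > 0"
  shows "\<exists>zs. length zs \<le> k \<and> (\<forall>z\<in>set zs. cmod z > 1) \<and>
    (\<forall>q. Polynomial.degree q + length zs < N \<longrightarrow> 0 \<le> Re (B (root_poly zs * q) (root_poly zs * q)))"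
proof -
  obtain ws where ws: "\<phi> N = root_poly ws" using complex_poly_linear_factors[of "\<phi> N"] \<phi>(1,2)[of N] by auto
  \<comment> \<open>Removing a zero \<open>z\<close> of modulus 1 from \<open>\<phi> N\<close>
    leaves an \<open>x\<close> whose shift is \<open>z\<close> times \<open>x\<close> plus
    \<open>\<phi> N\<close>; by \<open>B_step\<close> the form at \<open>x\<close> would exceed
    itself by \<open>h N\<close>.\<close>
  have uni: "cmod z \<noteq> 1" if zin: "z \<in> set ws" for z
  proof
    assume z1: "cmod z = 1"
    obtain us vs where uv: "ws = us @ z # vs" using split_list[OF zin] by blast
    define x where "x = (\<Prod>z\<leftarrow>us @ vs. [:- z, 1:])"
    have "\<phi> N = [:- z, 1:] * x" unfolding ws uv x_def by (simp only: map_append list.map prod_list.append prod_list.Cons mult.left_commute)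
    then have e: "pCons 0 x = Polynomial.smult z x + Polynomial.smult 1 (\<phi> N)" by simp
    have "length ws = N" using degree_linear_factors[of ws] \<phi>(1)[of N] ws by simp
    then have "Polynomial.degree x < N" unfolding x_def degree_linear_factors uv by simp
    then have "Re (B x x) = Re (B (Polynomial.smult z x) (Polynomial.smult z x)) + (cmod 1)\<^sup>2 * h N"
      by (intro B_step e) (auto intro: coeff_eq_0)
    also have "B (Polynomial.smult z x) (Polynomial.smult z x) = z * cnj z * B x x" by (simp add: tform_smult_left B_smult_right)
    also have "z * cnj z = 1" using z1 complex_norm_square[of z] by simp
    finally show False using hN by simp
  qed
  define zs where "zs = filter (\<lambda>z. cmod z > 1) ws"
  define us where "us = filter (\<lambda>z. \<not> cmod z > 1) ws"
  define P where "P = root_poly zs"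
  define Q where "Q = root_poly us"
  have PQ: "\<phi> N = P * Q" unfolding ws P_def Q_def zs_def us_def
    by (induction ws) (simp_all only: filter.simps list.map prod_list.Cons mult_ac split: if_split, auto simp del: mult_pCons_left)
  have dP: "Polynomial.degree P = length zs" "lead_coeff P = 1" unfolding P_def by (rule degree_linear_factors lead_coeff_linear_factors)+
  have dQ: "degree Q = length us" "lead_coeff Q = 1" unfolding Q_def by (rule degree_linear_factors lead_coeff_linear_factors)+
  have P0: "P \<noteq> 0" "Q \<noteq> 0" using dP dQ by auto
  have N: "N = length zs + length us" using \<phi>(1)[of N] unfolding PQ using dP dQ P0 by (simp add: degree_mult_eq)
  have zs: "cmod z > 1" if "z \<in> set zs" for z using that by (auto simp: zs_def)
  have us: "cmod z < 1" if "z \<in> set us" for z using that uni[of z] by (auto simp: us_def)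
  have cmul: "coeff (R * q) i = 0" if "\<And>i. i \<ge> m \<Longrightarrow> coeff q i = 0" "degree R + m \<le> N" "i \<ge> N" for R q :: "complex poly" and m i
  proof (cases "q = 0")
    case False
    then have "Polynomial.degree q < m" using that(1) by (metis leading_coeff_0_iff not_less)
    then show ?thesis using that(2,3) by (intro coeff_eq_0 le_less_trans[OF degree_mult_le]) auto
  qed simp
  have pos: "0 \<le> Re (B (P * q) (P * q))" if "Polynomial.degree q + length zs < N" for q
  proof -
    define d where "d = length us"
    have d: "d > 0" "Polynomial.degree q < d" using that N by (auto simp: d_def)
    \<comment> \<open>The variable times \<open>q\<close>, reduced modulo the monic
      \<open>Q\<close>. Multiplied by \<open>P\<close> this is reduction modulo
      \<open>\<phi> N = P * Q\<close>.\<close>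
    define st where "st q = pCons 0 q - Polynomial.smult (coeff q (d - 1)) Q" for q
    define s where "s n = (st ^^ n) q" for n
    have sS: "s (Suc n) = st (s n)" for n by (simp add: s_def)
    have sd: "coeff (s n) i = 0" if "i \<ge> d" for n i
      using that
    proof (induction n arbitrary: i)
      case 0 then show ?case using d by (simp add: s_def coeff_eq_0)
    next
      case (Suc n)
      show ?case
      proof (cases "i = d")
        case True
        have "coeff Q d = 1" using dQ d_def by simp
        then show ?thesis using True d by (simp add: sS st_def coeff_pCons split: nat.splits)
      next
        case False
        then have "coeff Q i = 0" using Suc.prems dQ by (intro coeff_eq_0) (simp add: d_def)
        then show ?thesis using False Suc d by (auto simp: sS st_def coeff_pCons split: nat.splits)
      qed
    qed
    have "pnull s"
      by (rule polynomial_recurrence_null[where zs = us and fwd = True and v = "\<lambda>_. 0" and l = "\<lambda>n. coeff (s n) (d - 1)"])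
         (use sd us in \<open>auto simp: d_def[symmetric] sS st_def Q_def[symmetric] pnull_def\<close>)
    then have lim: "(\<lambda>n. Re (B (P * s n) (P * s n))) \<longlonglongrightarrow> 0"
      by (intro B_null[of _ N] pnull_mult cmul[of d]) (use sd N dP d_def in auto)
    have "Re (B (P * s (Suc n)) (P * s (Suc n))) \<le> Re (B (P * s n) (P * s n))" for n
    proof -
      have "pCons 0 (P * s n) = P * s (Suc n) + Polynomial.smult (coeff (s n) (d - 1)) (\<phi> N)"
        unfolding PQ sS st_def by (simp add: algebra_simps)
      then have "Re (B (P * s n) (P * s n)) = Re (B (P * s (Suc n)) (P * s (Suc n))) + (cmod (coeff (s n) (d - 1)))\<^sup>2 * h N"
        by (intro B_step cmul[of d]) (use sd N dP d_def in auto)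
      then show ?thesis using hN by simp
    qed
    then have "decseq (\<lambda>n. Re (B (P * s n) (P * s n)))" by (rule decseq_SucI)
    from decseq_ge[OF this lim, of 0] show ?thesis by (simp add: s_def)
  qed
  have nonpos: "Re (B (Q * p) (Q * p)) \<le> 0" if p: "Polynomial.degree p < length zs" for p
  proof -
    define d where "d = length zs"
    have P00: "poly P 0 \<noteq> 0"
    proof
      assume "poly P 0 = 0"
      then have "0 \<in> set zs" unfolding P_def poly_prod_list by (auto simp: prod_list_zero_iff)
      from zs[OF this] show False by simp
    qed
    \<comment> \<open>The inverse step modulo \<open>P\<close>: a multiple of \<open>P\<close> makes
      the constant term vanish, then the variable is divided out. This is possible because the zeros
      of \<open>P\<close> lie outside the unit circle, so that \<open>P\<close> does not vanish at
      0.\<close>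
    define st where "st p = synthetic_div (p - Polynomial.smult (poly p 0 / poly P 0) P) 0" for p
    have st: "pCons 0 (st p) = p + Polynomial.smult (- (poly p 0 / poly P 0)) P" for p
    proof -
      have "[:- 0, 1:] * st p + [:poly (p - Polynomial.smult (poly p 0 / poly P 0) P) 0:] = p - Polynomial.smult (poly p 0 / poly P 0) P"
        unfolding st_def by (rule synthetic_div_correct')
      then show ?thesis using P00 by simp
    qed
    define s where "s n = (st ^^ n) p" for n
    have sS: "s (Suc n) = st (s n)" for n by (simp add: s_def)
    have sd: "coeff (s n) i = 0" if "i \<ge> d" for n i
      using that
    proof (induction n arbitrary: i)
      case 0 then show ?case using p by (simp add: s_def coeff_eq_0 d_def)
    next
      case (Suc n)
      have "coeff (s (Suc n)) i = coeff (pCons 0 (st (s n))) (Suc i)" by (simp add: sS)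
      also have "\<dots> = coeff (s n) (Suc i) - poly (s n) 0 / poly P 0 * coeff P (Suc i)" unfolding st by simp
      also have "\<dots> = 0" using Suc dP by (simp add: d_def coeff_eq_0)
      finally show ?case .
    qed
    have "pnull s"
      by (rule polynomial_recurrence_null[where zs = zs and fwd = False and v = "\<lambda>_. 0" and l = "\<lambda>n. - (poly (s n) 0 / poly P 0)"])
         (use sd zs in \<open>auto simp: d_def[symmetric] sS st P_def[symmetric] pnull_def\<close>)
    then have lim: "(\<lambda>n. Re (B (Q * s n) (Q * s n))) \<longlonglongrightarrow> 0"
      by (intro B_null[of _ N] pnull_mult cmul[of d]) (use sd N dQ d_def in auto)
    have "Re (B (Q * s n) (Q * s n)) \<le> Re (B (Q * s (Suc n)) (Q * s (Suc n)))" for n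
    proof -
      have "pCons 0 (Q * s (Suc n)) = Q * pCons 0 (st (s n))" by (simp add: sS)
      also have "\<dots> = Q * s n + Polynomial.smult (- (poly (s n) 0 / poly P 0)) (\<phi> N)"
        unfolding st PQ by (simp add: algebra_simps)
      finally have "Re (B (Q * s (Suc n)) (Q * s (Suc n))) = Re (B (Q * s n) (Q * s n)) + (cmod (- (poly (s n) 0 / poly P 0)))\<^sup>2 * h N"
        by (intro B_step cmul[of d]) (use sd N dQ d_def in auto)
      then show ?thesis using hN by simp
    qed
    then have "incseq (\<lambda>n. Re (B (Q * s n) (Q * s n)))" by (rule incseq_SucI)
    from incseq_le[OF this lim, of 0] show ?thesis by (simp add: s_def)
  qed
  \<comment> \<open>Otherwise all polynomials of degree at most \<open>k\<close> are admissible in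
    \<open>nonpos\<close>, and a nonzero one makes \<open>Q * p\<close> orthogonal to the at most
    \<open>k\<close> polynomials \<open>\<phi> j\<close> with \<open>h j < 0\<close>; there the form
    is positive.\<close>
  have "length zs \<le> k"
  proof (rule ccontr)
    assume "\<not> length zs \<le> k"
    then have "card {j. h j < 0} < card {..k}" "k < length zs" using neg_indices(2) by auto
    then obtain \<alpha> where \<alpha>: "\<exists>i\<in>{..k}. \<alpha> i \<noteq> 0"
       "\<forall>j\<in>{j. h j < 0}. (\<Sum>i\<in>{..k}. B (Q * monom 1 i) (\<phi> j) * \<alpha> i) = 0"
      using underdetermined_system[of "{j. h j < 0}" "{..k}" "\<lambda>j i. B (Q * monom 1 i) (\<phi> j)"] neg_indices(1) by auto
    define p where "p = (\<Sum>i\<le>k. Polynomial.smult (\<alpha> i) (monom 1 i))"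
    have cp: "coeff p i = (if i \<le> k then \<alpha> i else 0)" for i
      by (simp add: p_def coeff_sum coeff_monom if_distrib cong: if_cong)
    have p0: "p \<noteq> 0" using \<alpha>(1) cp by (metis atMost_iff coeff_0)
    have "Polynomial.degree p \<le> k" by (intro degree_le) (simp add: cp)
    then have "Re (B (Q * p) (Q * p)) \<le> 0" using \<open>k < length zs\<close> by (intro nonpos) simp
    moreover have "Re (B (Q * p) (Q * p)) > 0"
    proof (rule B_pos_off_negative)
      show "Q * p \<noteq> 0" using P0 p0 by simp
      fix j assume "h j < 0"
      have "Q * p = (\<Sum>i\<le>k. Polynomial.smult (\<alpha> i) (Q * monom 1 i))" unfolding p_def sum_distrib_left mult_smult_right ..
      then have "B (Q * p) (\<phi> j) = (\<Sum>i\<le>k. B (Q * monom 1 i) (\<phi> j) * \<alpha> i)"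
        by (simp only: B_sum_left tform_smult_left mult.commute)
      then show "B (Q * p) (\<phi> j) = 0" using \<alpha>(2) \<open>h j < 0\<close> by simp
    qed
    ultimately show False by simp
  qed
  with zs pos show ?thesis unfolding P_def by blast
qed

text \<open>Only finitely many \<open>h j\<close> are negative and none vanishes, so
  \<open>h N > 0\<close> for all large \<open>N\<close>. The degree condition is stated with
  \<open>k\<close> in place of the unknown length of \<open>zs\<close>.\<close>

lemma krein_factor_large:
  "\<exists>N0. \<forall>N\<ge>N0. \<exists>zs. length zs \<le> k \<and> (\<forall>z\<in>set zs. cmod z > 1) \<and>
    (\<forall>q. Polynomial.degree q + k < N \<longrightarrow> 0 \<le> Re (B (root_poly zs * q) (root_poly zs * q)))"
proof -
  obtain N0 where N0: "\<forall>j\<in>{j. h j < 0}. j < N0" using neg_indices(1) finite_nat_set_iff_bounded by metis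
  have hN: "h N > 0" if "N \<ge> N0" for N using N0 that h_nonzero[of N] by (meson linorder_cases mem_Collect_eq not_less)
  show ?thesis
  proof (intro exI[of _ N0] allI impI)
    fix N assume "N \<ge> N0"
    then have "h N > 0" by (rule hN)
    from krein_factor[OF this] obtain zs where zs: "length zs \<le> k" "\<forall>z\<in>set zs. cmod z > 1"
      "\<And>q. Polynomial.degree q + length zs < N \<Longrightarrow> 0 \<le> Re (B (root_poly zs * q) (root_poly zs * q))"
      by blast
    show "\<exists>zs. length zs \<le> k \<and> (\<forall>z\<in>set zs. cmod z > 1) \<and>
      (\<forall>q. Polynomial.degree q + k < N \<longrightarrow> 0 \<le> Re (B (root_poly zs * q) (root_poly zs * q)))"
      using zs by (intro exI[of _ zs]) auto
  qed
qed

end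

text \<open>
  All but countably many \<open>\<epsilon>\<close> work: a section of the shifted Toeplitz matrix is singular only if \<open>- \<epsilon>\<close> is an
  eigenvalue of the original section.
\<close>
lemma toeplitz_generic_shift:
  fixes c :: "int \<Rightarrow> complex"
  assumes "\<And>n. c (- n) = cnj (c n)" "neg_squares_le c k"
  obtains \<epsilon> :: real where "0 < \<epsilon>" "\<epsilon> < 1" "nondegenerate_sequence (\<lambda>n. c n + (if n = 0 then of_real \<epsilon> else 0)) k"
proof -
  define c' where "c' \<epsilon> = (\<lambda>n. c n + (if n = 0 then complex_of_real \<epsilon> else 0))" for \<epsilon> :: real
  \<comment> \<open>Rows are indexed by the second argument of the form: \<open>A N\<close> applied
    to the coefficients of \<open>p\<close> lists the values of the form at \<open>p\<close> and the
    monomials.\<close>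
  define A where "A N = mat (Suc N) (Suc N) (\<lambda>(j, i). c (int i - int j))" for N
  define Bad where "Bad N = {\<epsilon>::real. eigenvalue (A N) (- of_real \<epsilon>)}" for N
  have tf: "tform (c' \<epsilon>) p q = tform c p q + of_real \<epsilon> * (\<Sum>i\<le>N. coeff p i * cnj (coeff q i))"
    if "Polynomial.degree p \<le> N" "Polynomial.degree q \<le> N" for p q N \<epsilon>
  proof -
    have "tform (c' \<epsilon>) p q = (\<Sum>i\<le>N. \<Sum>j\<le>N. c (int i - int j) * coeff p i * cnj (coeff q j)) +
        (\<Sum>i\<le>N. \<Sum>j\<le>N. if j = i then of_real \<epsilon> * (coeff p i * cnj (coeff q i)) else 0)"
      unfolding tform_eq[OF that] sum.distrib[symmetric] by (intro sum.cong refl) (auto simp: c'_def algebra_simps)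
    then show ?thesis unfolding tform_eq[OF that] by (simp add: sum_distrib_left)
  qed
  have "finite (Bad N)" for N
  proof -
    have A: "A N \<in> carrier_mat (Suc N) (Suc N)" by (simp add: A_def)
    have "char_poly (A N) \<noteq> 0" using degree_monic_char_poly[OF A] by auto
    then have "finite {x. poly (char_poly (A N)) x = 0}" by (rule poly_roots_finite)
    then have "finite ((\<lambda>\<epsilon>::real. - complex_of_real \<epsilon>) -` {x. poly (char_poly (A N)) x = 0})"
      by (rule finite_vimageI) (auto simp: inj_on_def)
    moreover have "(\<lambda>\<epsilon>::real. - complex_of_real \<epsilon>) -` {x. poly (char_poly (A N)) x = 0} = Bad N"
      by (auto simp: Bad_def eigenvalue_root_char_poly[OF A])
    ultimately show ?thesis by simp
  qed
  then have "countable (\<Union>N. Bad N)" by (simp add: countable_finite)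
  then have "\<not> {0<..<1} \<subseteq> (\<Union>N. Bad N)"
    using uncountable_open_interval[of 0 "1::real"] countable_subset by auto
  then obtain \<epsilon> where \<epsilon>: "\<epsilon> \<in> {0<..<1}" "\<epsilon> \<notin> (\<Union>N. Bad N)" by blast
  have "nondegenerate_sequence (c' \<epsilon>) k"
  proof unfold_locales
    show "c' \<epsilon> (- n) = cnj (c' \<epsilon> n)" for n using assms(1) by (simp add: c'_def)
    \<comment> \<open>The shift adds a positive multiple of the Euclidean norm of the coefficients,
      so nonnegative directions stay nonnegative.\<close>
    show "neg_squares_le (c' \<epsilon>) k"
      unfolding neg_squares_le_def
    proof
      fix x :: "nat \<Rightarrow> complex poly"
      obtain \<alpha> where \<alpha>: "\<exists>i\<le>k. \<alpha> i \<noteq> 0" "0 \<le> Re (tform c (\<Sum>i\<le>k. Polynomial.smult (\<alpha> i) (x i)) (\<Sum>i\<le>k. Polynomial.smult (\<alpha> i) (x i)))"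
        using assms(2) unfolding neg_squares_le_def by blast
      define y where "y = (\<Sum>i\<le>k. Polynomial.smult (\<alpha> i) (x i))"
      have "tform (c' \<epsilon>) y y = tform c y y + of_real \<epsilon> * (\<Sum>i\<le>Polynomial.degree y. of_real ((cmod (coeff y i))\<^sup>2))"
        unfolding complex_norm_square by (rule tf) auto
      then have "Re (tform (c' \<epsilon>) y y) = Re (tform c y y) + \<epsilon> * (\<Sum>i\<le>Polynomial.degree y. (cmod (coeff y i))\<^sup>2)"
        by (simp flip: of_real_sum of_real_mult of_real_power)
      also have "\<dots> \<ge> 0" using \<alpha>(2) \<epsilon>(1) unfolding y_def[symmetric] by (intro add_nonneg_nonneg mult_nonneg_nonneg sum_nonneg) auto
      finally show "\<exists>\<alpha>. (\<exists>i\<le>k. \<alpha> i \<noteq> 0) \<and> 0 \<le> Re (tform (c' \<epsilon>) (\<Sum>i\<le>k. Polynomial.smult (\<alpha> i) (x i)) (\<Sum>i\<le>k. Polynomial.smult (\<alpha> i) (x i)))"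
        using \<alpha>(1) unfolding y_def by blast
    qed
    fix p :: "complex poly" and N assume p: "p \<noteq> 0" "Polynomial.degree p \<le> N"
    show "\<exists>q. Polynomial.degree q \<le> N \<and> tform (c' \<epsilon>) p q \<noteq> 0"
    proof (rule ccontr)
      assume "\<not> ?thesis"
      then have z: "tform (c' \<epsilon>) p (monom 1 j) = 0" if "j \<le> N" for j using that by (metis degree_monom_le order_trans)
      define v where "v = vec (Suc N) (\<lambda>i. coeff p i)"
      have "A N *\<^sub>v v = (- of_real \<epsilon>) \<cdot>\<^sub>v v"
      proof (rule eq_vecI)
        fix j assume "j < dim_vec ((- complex_of_real \<epsilon>) \<cdot>\<^sub>v v)"
        then have j: "j \<le> N" by (simp add: v_def)
        have dj: "Polynomial.degree (monom 1 j :: complex poly) \<le> N" using j degree_monom_le order_trans by blast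
        have "tform c p (monom 1 j) = (\<Sum>i\<le>N. \<Sum>m\<le>N. c (int i - int m) * coeff p i * cnj (coeff (monom 1 j) m))"
          by (rule tform_eq[OF p(2) dj])
        also have "\<dots> = (\<Sum>i\<le>N. c (int i - int j) * coeff p i)"
          using j by (intro sum.cong refl, subst sum.remove[of _ j]) (auto simp: coeff_monom intro!: sum.neutral)
        also have "\<dots> = (A N *\<^sub>v v) $ j"
          using j by (simp add: A_def v_def scalar_prod_def atLeast0LessThan lessThan_Suc_atMost)
        finally have 1: "tform c p (monom 1 j) = (A N *\<^sub>v v) $ j" .
        have "(\<Sum>i\<le>N. coeff p i * cnj (coeff (monom 1 j) i)) = coeff p j"
          using j by (subst sum.remove[of _ j]) (auto simp: coeff_monom intro!: sum.neutral)
        then have "0 = (A N *\<^sub>v v) $ j + of_real \<epsilon> * coeff p j"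
          using z[OF j] tf[OF p(2) dj, of \<epsilon>] 1 by simp
        then show "(A N *\<^sub>v v) $ j = ((- complex_of_real \<epsilon>) \<cdot>\<^sub>v v) $ j"
          using j by (simp add: v_def eq_neg_iff_add_eq_0)
      qed (simp add: A_def v_def)
      moreover have "v \<noteq> 0\<^sub>v (Suc N)"
      proof
        assume "v = 0\<^sub>v (Suc N)"
        then have "v $ Polynomial.degree p = 0" using p(2) by simp
        then show False using p by (simp add: v_def)
      qed
      ultimately have "eigenvalue (A N) (- of_real \<epsilon>)"
        unfolding eigenvalue_def eigenvector_def by (intro exI[of _ v]) (auto simp: v_def A_def)
      then show False using \<epsilon>(2) by (auto simp: Bad_def)
    qed
  qed
  then show ?thesis using that[of \<epsilon>] \<epsilon>(1) by (simp add: c'_def)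
qed

section \<open>Growth of power series with few negative squares\<close>

text \<open>The Krein factor \<open>p\<close> with constant term 1, given by the inverses \<mu> of
  its zeros, which lie in the open unit disc; \<mu> = 0 stands for a zero at infinity and serves as
  padding.\<close>

abbreviation refl_poly :: "complex list \<Rightarrow> complex poly" where
  "refl_poly \<mu>s \<equiv> (\<Prod>\<mu>\<leftarrow>\<mu>s. [:1, - \<mu>:])"

text \<open>For \<open>p = refl_poly \<mu>s\<close> with \<open>k\<close> entries this is
  \<open>\<zeta> ^ k * poly p (1 / \<zeta>)\<close> if \<zeta> is not 0, and
  \<open>refl_prod\<close> is \<open>cnj (poly p (cnj \<zeta>))\<close>: the two factors that the
  twist by \<open>p\<close> produces.\<close>

abbreviation root_prod :: "complex list \<Rightarrow> complex \<Rightarrow> complex" where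
  "root_prod \<mu>s \<zeta> \<equiv> (\<Prod>\<mu>\<leftarrow>\<mu>s. \<zeta> - \<mu>)"

abbreviation refl_prod :: "complex list \<Rightarrow> complex \<Rightarrow> complex" where
  "refl_prod \<mu>s \<zeta> \<equiv> (\<Prod>\<mu>\<leftarrow>\<mu>s. 1 - cnj \<mu> * \<zeta>)"

lemma tform_monom_mult: "tform c (monom 1 n * p) (monom 1 n * q) = tform c p q"
proof (induction n)
  case (Suc n)
  have "monom 1 (Suc n) * r = pCons 0 (monom 1 n * r)" for r :: "complex poly"
    by (simp add: monom_Suc)
  then show ?case using Suc by (simp add: tform_shift)
qed simp

lemma linear_factors_normalize:
  fixes zs :: "complex list"
  assumes "\<forall>z\<in>set zs. z \<noteq> 0"
  shows "root_poly zs = Polynomial.smult (\<Prod>z\<leftarrow>zs. - z) (\<Prod>\<mu>\<leftarrow>map inverse zs. [:1, - \<mu>:])"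
  using assms
proof (induction zs)
  case (Cons z zs)
  have "[:- z, 1:] = Polynomial.smult (- z) [:1, - inverse z:]" using Cons.prems by simp
  moreover have "root_poly zs = Polynomial.smult (\<Prod>z\<leftarrow>zs. - z) (\<Prod>\<mu>\<leftarrow>map inverse zs. [:1, - \<mu>:])"
    using Cons by simp
  ultimately show ?case
    by (simp only: list.map prod_list.Cons mult_smult_left mult_smult_right smult_smult mult.commute)
qed simp

text \<open>Constant term 1 keeps the coefficients below \<open>2 ^ k\<close> whatever
  \<open>N\<close> is, whereas a monic factor could have zeros arbitrarily far out. Rescaling
  multiplies the form by a positive number only.\<close>

lemma (in nondegenerate_sequence) krein_factor_normalized:
  "\<exists>N0. \<forall>N\<ge>N0. \<exists>\<mu>s. length \<mu>s = k \<and> (\<forall>\<mu>\<in>set \<mu>s. cmod \<mu> < 1) \<and>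
    (\<forall>q. Polynomial.degree q + k < N \<longrightarrow> 0 \<le> Re (B (refl_poly \<mu>s * q) (refl_poly \<mu>s * q)))"
proof -
  obtain N0 where N0: "\<And>N. N \<ge> N0 \<Longrightarrow> \<exists>zs. length zs \<le> k \<and> (\<forall>z\<in>set zs. cmod z > 1) \<and>
    (\<forall>q. Polynomial.degree q + k < N \<longrightarrow> 0 \<le> Re (B (root_poly zs * q) (root_poly zs * q)))"
    using krein_factor_large by blast
  show ?thesis
  proof (intro exI[of _ N0] allI impI)
    fix N assume "N \<ge> N0"
    from N0[OF this] obtain zs where zs: "length zs \<le> k" "\<forall>z\<in>set zs. cmod z > 1"
      "\<And>q. Polynomial.degree q + k < N \<Longrightarrow> 0 \<le> Re (B (root_poly zs * q) (root_poly zs * q))" by blast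
    define \<mu>s where "\<mu>s = map inverse zs @ replicate (k - length zs) 0"
    define p where "p = (\<Prod>\<mu>\<leftarrow>map inverse zs. [:1, - \<mu>:])"
    define a where "a = (\<Prod>z\<leftarrow>zs. - z)"
    have z0: "\<forall>z\<in>set zs. z \<noteq> 0" using zs(2) by (metis norm_zero not_one_less_zero)
    then have a0: "a \<noteq> 0" by (auto simp: a_def prod_list_zero_iff)
    have P: "root_poly zs = Polynomial.smult a p" unfolding a_def p_def by (rule linear_factors_normalize[OF z0])
    have p: "refl_poly \<mu>s = p" by (simp add: \<mu>s_def p_def map_replicate_const flip: one_pCons)
    have "length \<mu>s = k" using zs(1) by (simp add: \<mu>s_def)
    moreover have "cmod \<mu> < 1" if "\<mu> \<in> set \<mu>s" for \<mu>
      using that zs(2) by (auto simp: \<mu>s_def norm_inverse inverse_less_1_iff split: if_splits)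
    moreover have "0 \<le> Re (B (p * q) (p * q))" if "Polynomial.degree q + k < N" for q
    proof -
      have "B (Polynomial.smult a p * q) (Polynomial.smult a p * q) = (a * cnj a) * B (p * q) (p * q)"
        by (simp add: tform_smult_left B_smult_right)
      also have "a * cnj a = of_real ((cmod a)\<^sup>2)" by (rule complex_norm_square[symmetric])
      finally have "Re (B (Polynomial.smult a p * q) (Polynomial.smult a p * q)) = (cmod a)\<^sup>2 * Re (B (p * q) (p * q))"
        by (simp del: of_real_power)
      then have "0 \<le> (cmod a)\<^sup>2 * Re (B (p * q) (p * q))" using zs(3)[OF that] unfolding P by simp
      then show ?thesis using a0 by (simp add: zero_le_mult_iff)
    qed
    ultimately show "\<exists>\<mu>s. length \<mu>s = k \<and> (\<forall>\<mu>\<in>set \<mu>s. cmod \<mu> < 1) \<and>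
      (\<forall>q. Polynomial.degree q + k < N \<longrightarrow> 0 \<le> Re (B (refl_poly \<mu>s * q) (refl_poly \<mu>s * q)))"
      unfolding p[symmetric] by blast
  qed
qed

lemma normalized_factor_coeffs:
  fixes \<mu>s :: "complex list"
  assumes "\<forall>\<mu>\<in>set \<mu>s. cmod \<mu> < 1"
  shows "cmod (coeff (refl_poly \<mu>s) i) \<le> 2 ^ length \<mu>s"
    and "Polynomial.degree (refl_poly \<mu>s) \<le> length \<mu>s"
    and "(\<Sum>i\<le>length \<mu>s. coeff (refl_poly \<mu>s) i * \<zeta> ^ (length \<mu>s - i)) = root_prod \<mu>s \<zeta>"
proof -
  have "(\<forall>i. cmod (coeff (refl_poly \<mu>s) i) \<le> 2 ^ length \<mu>s) \<and> Polynomial.degree (refl_poly \<mu>s) \<le> length \<mu>s \<and>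
    (\<Sum>i\<le>length \<mu>s. coeff (refl_poly \<mu>s) i * \<zeta> ^ (length \<mu>s - i)) = root_prod \<mu>s \<zeta>"
    using assms
  proof (induction \<mu>s)
    case Nil
    have "cmod (coeff 1 i) \<le> 1" for i by (cases i) (auto simp: one_pCons)
    then show ?case by simp
  next
    case (Cons \<mu> \<mu>s)
    define r where "r = refl_poly \<mu>s"
    define L where "L = length \<mu>s"
    have IH: "cmod (coeff r i) \<le> 2 ^ L" "Polynomial.degree r \<le> L" "(\<Sum>i\<le>L. coeff r i * \<zeta> ^ (L - i)) = root_prod \<mu>s \<zeta>" for i
      using Cons by (auto simp: r_def L_def)
    have \<mu>: "cmod \<mu> < 1" using Cons.prems by simp
    have eq: "(\<Prod>\<mu>\<leftarrow>\<mu> # \<mu>s. [:1, - \<mu>:]) = r - Polynomial.smult \<mu> (pCons 0 r)" by (simp add: r_def)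
    have c: "coeff (r - Polynomial.smult \<mu> (pCons 0 r)) i = coeff r i - \<mu> * (case i of 0 \<Rightarrow> 0 | Suc j \<Rightarrow> coeff r j)" for i
      by (cases i) simp_all
    have 1: "cmod (coeff (r - Polynomial.smult \<mu> (pCons 0 r)) i) \<le> 2 ^ Suc L" for i
    proof -
      have "cmod (\<mu> * (case i of 0 \<Rightarrow> 0 | Suc j \<Rightarrow> coeff r j)) \<le> 1 * 2 ^ L"
        unfolding norm_mult using \<mu> IH(1) by (intro mult_mono) (auto split: nat.splits)
      then have "cmod (coeff r i - \<mu> * (case i of 0 \<Rightarrow> 0 | Suc j \<Rightarrow> coeff r j)) \<le> 2 ^ L + 1 * 2 ^ L"
        by (intro order_trans[OF norm_triangle_ineq4] add_mono IH(1))
      then show ?thesis unfolding c by simp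
    qed
    have 2: "Polynomial.degree (r - Polynomial.smult \<mu> (pCons 0 r)) \<le> Suc L"
      using IH(2) by (intro degree_diff_le) (auto intro!: order_trans[OF degree_smult_le] order_trans[OF degree_pCons_le])
    have "(\<Sum>i\<le>Suc L. coeff (r - Polynomial.smult \<mu> (pCons 0 r)) i * \<zeta> ^ (Suc L - i)) =
        (\<Sum>i\<le>Suc L. coeff r i * \<zeta> ^ (Suc L - i)) - \<mu> * (\<Sum>i\<le>Suc L. (case i of 0 \<Rightarrow> 0 | Suc j \<Rightarrow> coeff r j) * \<zeta> ^ (Suc L - i))"
      unfolding c by (simp only: left_diff_distrib sum_subtractf sum_distrib_left mult.assoc)
    also have "(\<Sum>i\<le>Suc L. (case i of 0 \<Rightarrow> 0 | Suc j \<Rightarrow> coeff r j) * \<zeta> ^ (Suc L - i)) = (\<Sum>i\<le>L. coeff r i * \<zeta> ^ (L - i))"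
      by (subst sum.atMost_Suc_shift) simp
    also have "(\<Sum>i\<le>Suc L. coeff r i * \<zeta> ^ (Suc L - i)) = \<zeta> * (\<Sum>i\<le>L. coeff r i * \<zeta> ^ (L - i))"
    proof -
      have "coeff r (Suc L) = 0" using IH(2) by (intro coeff_eq_0) simp
      then have "(\<Sum>i\<le>Suc L. coeff r i * \<zeta> ^ (Suc L - i)) = (\<Sum>i\<le>L. coeff r i * \<zeta> ^ (Suc L - i))" by simp
      also have "\<dots> = \<zeta> * (\<Sum>i\<le>L. coeff r i * \<zeta> ^ (L - i))"
        unfolding sum_distrib_left by (intro sum.cong refl) (simp add: Suc_diff_le)
      finally show ?thesis .
    qed
    finally have 3: "(\<Sum>i\<le>Suc L. coeff (r - Polynomial.smult \<mu> (pCons 0 r)) i * \<zeta> ^ (Suc L - i)) = (\<Prod>\<mu>\<leftarrow>\<mu> # \<mu>s. \<zeta> - \<mu>)"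
      unfolding IH(3) by (simp add: left_diff_distrib)
    show ?case using 1 2 3 unfolding eq by (simp add: L_def)
  qed
  then show "cmod (coeff (refl_poly \<mu>s) i) \<le> 2 ^ length \<mu>s" "Polynomial.degree (refl_poly \<mu>s) \<le> length \<mu>s"
    "(\<Sum>i\<le>length \<mu>s. coeff (refl_poly \<mu>s) i * \<zeta> ^ (length \<mu>s - i)) = root_prod \<mu>s \<zeta>" by auto
qed

text \<open>
  With the Krein factor \<open>p\<close>, the numbers \<open>d n = B (x\<^sup>n p) p\<close> form a positive definite sequence up to the index
  \<open>N - k\<close>, hence are bounded by \<open>d 0\<close>. The left-hand side is the power series of \<open>d\<close> plus a bounded polynomial.
  The tail of the series forces \<open>N\<close>, and with it \<open>p\<close>, to depend on \<open>\<rho>\<close>.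
\<close>
lemma (in nondegenerate_sequence) twisted_product_bound:
  assumes summ: "\<And>\<rho>. 0 \<le> \<rho> \<Longrightarrow> \<rho> < 1 \<Longrightarrow> summable (\<lambda>n. cmod (c (int n)) * \<rho> ^ n)"
  shows "\<exists>C. \<forall>\<rho>. 0 \<le> \<rho> \<longrightarrow> \<rho> < 1 \<longrightarrow> (\<exists>\<mu>s. length \<mu>s = k \<and> (\<forall>\<mu>\<in>set \<mu>s. cmod \<mu> < 1) \<and>
     (\<forall>\<zeta>. cmod \<zeta> \<le> \<rho> \<longrightarrow> cmod (root_prod \<mu>s \<zeta>) * cmod (refl_prod \<mu>s \<zeta>) * cmod (\<Sum>n. c (int n) * \<zeta> ^ n) \<le> C / (1 - \<rho>)))"
proof -
  \<comment> \<open>\<open>D0\<close> bounds the form at every normalized factor, since a product of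
    two coefficients is at most \<open>4 ^ k\<close>; \<open>E0\<close> bounds the initial terms cut
    off by the shifts. Neither depends on \<open>N\<close> or \<rho>.\<close>
  define D0 where "D0 = 4 ^ k * (\<Sum>i\<le>k. \<Sum>j\<le>k. cmod (c (int i - int j)))"
  define E0 where "E0 = 4 ^ k * (\<Sum>i\<le>k. \<Sum>j\<le>k. \<Sum>u<k + i - j. cmod (c (int u)))"
  have D0: "D0 \<ge> 0" "E0 \<ge> 0" unfolding D0_def E0_def by (auto intro!: mult_nonneg_nonneg sum_nonneg)
  obtain N0 where N0: "\<And>N. N \<ge> N0 \<Longrightarrow> \<exists>\<mu>s. length \<mu>s = k \<and> (\<forall>\<mu>\<in>set \<mu>s. cmod \<mu> < 1) \<and>
    (\<forall>q. Polynomial.degree q + k < N \<longrightarrow> 0 \<le> Re (B (refl_poly \<mu>s * q) (refl_poly \<mu>s * q)))"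
    using krein_factor_normalized by blast
  show ?thesis
  proof (intro exI[of _ "D0 + 1 + E0"] allI impI)
    fix \<rho> :: real assume \<rho>: "0 \<le> \<rho>" "\<rho> < 1"
    \<comment> \<open>An auxiliary radius that is positive even if \<rho> = 0, as needed to divide
      by its powers.\<close>
    define \<rho>' where "\<rho>' = (1 + \<rho>) / 2"
    have \<rho>': "0 < \<rho>'" "\<rho>' < 1" "\<rho> \<le> \<rho>'" using \<rho> by (auto simp: \<rho>'_def)
    define b where "b s = 4 ^ k * (\<Sum>i\<le>k. \<Sum>j\<le>k. cmod (c (int (s + (k + i - j)))) * \<rho> ^ s)" for s
    have sb: "summable (\<lambda>s. cmod (c (int (s + t))) * \<rho> ^ s)" for t
    proof -
      have "summable (\<lambda>s. cmod (c (int (s + t))) * \<rho>' ^ (s + t))"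
        using summable_ignore_initial_segment[OF summ[of \<rho>'], of t] \<rho>' by simp
      then have "summable (\<lambda>s. cmod (c (int (s + t))) * \<rho>' ^ (s + t) / \<rho>' ^ t)" by (rule summable_divide)
      then have "summable (\<lambda>s. cmod (c (int (s + t))) * \<rho>' ^ s)" using \<rho>' by (simp add: power_add)
      then show ?thesis
        by (rule summable_comparison_test_ev[rotated]) (use \<rho> \<rho>' in \<open>auto intro!: always_eventually mult_left_mono power_mono\<close>)
    qed
    have bsum: "summable b" unfolding b_def by (intro summable_mult summable_sum sb)
    have "(\<lambda>S. \<Sum>s. b (s + S)) \<longlonglongrightarrow> 0" using suminf_exist_split2[OF bsum] .
    then have "\<forall>\<^sub>F S in sequentially. (\<Sum>s. b (s + S)) < 1" by (rule order_tendstoD) simp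
    then obtain S where S: "(\<Sum>s. b (s + S)) < 1" by (auto simp: eventually_sequentially)
    \<comment> \<open>The terms \<open>d (k + s)\<close> with \<open>s < S\<close> fall under
      \<open>dbound\<close>, which needs \<open>k + s + k < N\<close>; the remaining ones are
      majorized by \<open>b\<close>, whose tail is below 1 and does not depend on the
      factor.\<close>
    define N where "N = max N0 (S + 2 * k + 1)"
    have N: "N \<ge> N0" "S + 2 * k < N" by (auto simp: N_def)
    from N0[OF N(1)] obtain \<mu>s where \<mu>s: "length \<mu>s = k" "\<forall>\<mu>\<in>set \<mu>s. cmod \<mu> < 1"
      "\<And>q. Polynomial.degree q + k < N \<Longrightarrow> 0 \<le> Re (B (refl_poly \<mu>s * q) (refl_poly \<mu>s * q))" by blast
    define p where "p = refl_poly \<mu>s"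
    have pb: "cmod (coeff p i) \<le> 2 ^ k" for i using normalized_factor_coeffs(1)[OF \<mu>s(2)] by (simp add: p_def \<mu>s(1))
    have pd: "Polynomial.degree p \<le> k" using normalized_factor_coeffs(2)[OF \<mu>s(2)] by (simp add: p_def \<mu>s(1))
    have ppb: "cmod (coeff p i * cnj (coeff p j)) \<le> 4 ^ k" for i j
    proof -
      have "cmod (coeff p i * cnj (coeff p j)) \<le> 2 ^ k * 2 ^ k" unfolding norm_mult complex_mod_cnj by (intro mult_mono pb) auto
      also have "\<dots> = (4::real) ^ k" by (simp flip: power_mult_distrib)
      finally show ?thesis .
    qed
    define d where "d n = B (monom 1 n * p) p" for n
    have d_eq: "d n = (\<Sum>i\<le>k. \<Sum>j\<le>k. c (int n + int i - int j) * (coeff p i * cnj (coeff p j)))" for n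
    proof -
      have "Polynomial.degree (monom 1 n * p) \<le> n + k"
        using pd by (intro order_trans[OF degree_mult_le] add_mono degree_monom_le) auto
      then have "d n = (\<Sum>i\<le>n + k. \<Sum>j\<le>k. c (int i - int j) * coeff (monom 1 n * p) i * cnj (coeff p j))"
        unfolding d_def by (rule tform_eq[OF _ pd])
      also have "\<dots> = (\<Sum>i\<in>{n..n + k}. \<Sum>j\<le>k. c (int i - int j) * coeff (monom 1 n * p) i * cnj (coeff p j))"
        by (intro sum.mono_neutral_right) (auto simp: coeff_monom_mult)
      also have "\<dots> = (\<Sum>i\<le>k. \<Sum>j\<le>k. c (int (n + i) - int j) * coeff (monom 1 n * p) (n + i) * cnj (coeff p j))"
        by (rule sum.reindex_bij_witness[of _ "\<lambda>i. n + i" "\<lambda>i. i - n"]) auto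
      finally show ?thesis by (simp add: coeff_monom_mult mult.assoc)
    qed
    have d0: "Re (B p p) \<le> D0"
    proof -
      have "Re (B p p) \<le> cmod (B p p)" by (rule complex_Re_le_cmod)
      also have "cmod (B p p) = cmod (d 0)" by (simp add: d_def)
      also have "cmod (d 0) \<le> (\<Sum>i\<le>k. \<Sum>j\<le>k. cmod (c (int i - int j)) * 4 ^ k)"
        unfolding d_eq by (intro sum_norm_le) (use ppb in \<open>auto simp: norm_mult[of "c _"] intro!: mult_left_mono\<close>)
      finally show ?thesis by (simp add: D0_def sum_distrib_left mult.commute)
    qed
    have dbound: "cmod (d n) \<le> D0" if n: "n + k < N" for n
    proof -
      \<comment> \<open>The phase that turns \<open>d n\<close> into minus its modulus.
        Nonnegativity at \<open>p * (1 + monom \<omega> n)\<close> then bounds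
        \<open>2 * cmod (d n)\<close> by twice the form at \<open>p\<close>, as for every positive
        definite sequence.\<close>
      define \<omega> where "\<omega> = (if d n = 0 then 0 else - cnj (d n) / of_real (cmod (d n)))"
      have \<omega>d: "\<omega> * d n = - of_real (cmod (d n))"
        by (auto simp: \<omega>_def mult.commute[of "cnj _"] complex_norm_square[symmetric] power2_eq_square)
      have \<omega>: "cmod \<omega> \<le> 1" by (auto simp: \<omega>_def norm_divide)
      define q where "q = 1 + monom \<omega> n"
      have "Polynomial.degree q \<le> n" unfolding q_def by (intro degree_add_le) (auto simp: degree_monom_le)
      then have "0 \<le> Re (B (p * q) (p * q))" unfolding p_def using n by (intro \<mu>s(3)) simp
      moreover have "p * q = p + Polynomial.smult \<omega> (monom 1 n * p)"
      proof -
        have "monom \<omega> n = Polynomial.smult \<omega> (monom 1 n)" by (simp add: smult_monom)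
        then show ?thesis by (simp add: q_def distrib_left mult.commute)
      qed
      moreover have "B (p + Polynomial.smult \<omega> (monom 1 n * p)) (p + Polynomial.smult \<omega> (monom 1 n * p)) =
         B p p + \<omega> * cnj \<omega> * B p p + (\<omega> * d n + cnj (\<omega> * d n))"
        unfolding tform_add_left B_add_right tform_smult_left B_smult_right tform_monom_mult
        using B_cnj[of "monom 1 n * p" p] by (simp add: d_def algebra_simps)
      ultimately have "0 \<le> Re (B p p) + Re (\<omega> * cnj \<omega> * B p p) - 2 * cmod (d n)" unfolding \<omega>d by simp
      moreover have "\<omega> * cnj \<omega> * B p p = of_real ((cmod \<omega>)\<^sup>2 * Re (B p p))"
        unfolding of_real_mult complex_norm_square using B_real[of p] by simp
      moreover have "0 \<le> Re (B p p)" using \<mu>s(3)[of 1] N n by (simp add: p_def)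
      moreover have "(cmod \<omega>)\<^sup>2 * Re (B p p) \<le> 1 * Re (B p p)"
        using \<open>0 \<le> Re (B p p)\<close> \<omega> by (intro mult_right_mono) (auto simp: power_le_one)
      ultimately have "cmod (d n) \<le> Re (B p p)" by simp
      then show ?thesis using d0 by simp
    qed
    have dtail: "cmod (d (k + s)) * \<rho> ^ s \<le> b s" for s
    proof -
      have "cmod (d (k + s)) \<le> (\<Sum>i\<le>k. \<Sum>j\<le>k. cmod (c (int (s + (k + i - j)))) * 4 ^ k)"
        unfolding d_eq
      proof (intro sum_norm_le)
        fix i j assume "i \<in> {..k}" "j \<in> {..k}"
        then have e: "int (k + s) + int i - int j = int (s + (k + i - j))" by auto
        show "cmod (c (int (k + s) + int i - int j) * (coeff p i * cnj (coeff p j))) \<le> cmod (c (int (s + (k + i - j)))) * 4 ^ k"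
          unfolding e norm_mult[of "c _"] using ppb by (intro mult_mono) auto
      qed
      then have "cmod (d (k + s)) * \<rho> ^ s \<le> (\<Sum>i\<le>k. \<Sum>j\<le>k. cmod (c (int (s + (k + i - j)))) * 4 ^ k) * \<rho> ^ s"
        using \<rho> by (intro mult_right_mono) auto
      also have "\<dots> = b s" by (simp add: b_def sum_distrib_left sum_distrib_right mult_ac)
      finally show ?thesis .
    qed
    have sd: "summable (\<lambda>s. cmod (d (k + s)) * \<rho> ^ s)"
      by (rule summable_comparison_test_ev[OF _ bsum]) (use dtail \<rho> in auto)
    have dsum: "(\<Sum>s. cmod (d (k + s)) * \<rho> ^ s) \<le> D0 / (1 - \<rho>) + 1"
    proof -
      have "(\<Sum>s. cmod (d (k + s)) * \<rho> ^ s) = (\<Sum>s. cmod (d (k + (s + S))) * \<rho> ^ (s + S)) + (\<Sum>s<S. cmod (d (k + s)) * \<rho> ^ s)"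
        by (rule suminf_split_initial_segment[OF sd])
      also have "(\<Sum>s. cmod (d (k + (s + S))) * \<rho> ^ (s + S)) \<le> (\<Sum>s. b (s + S))"
        by (intro suminf_le dtail summable_ignore_initial_segment bsum summable_ignore_initial_segment[OF sd])
      also have "(\<Sum>s. b (s + S)) \<le> 1" using S by simp
      also have "(\<Sum>s<S. cmod (d (k + s)) * \<rho> ^ s) \<le> (\<Sum>s<S. D0 * \<rho> ^ s)"
        using N \<rho> by (intro sum_mono mult_right_mono dbound) auto
      also have "\<dots> \<le> (\<Sum>s. D0 * \<rho> ^ s)"
        using \<rho> D0 by (intro sum_le_suminf summable_mult summable_geometric) auto
      also have "\<dots> = D0 / (1 - \<rho>)" using \<rho> by (simp add: suminf_mult suminf_geometric summable_geometric)
      finally show ?thesis by simp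
    qed
    have main: "cmod (root_prod \<mu>s \<zeta>) * cmod (refl_prod \<mu>s \<zeta>) * cmod (\<Sum>n. c (int n) * \<zeta> ^ n) \<le> (D0 + 1 + E0) / (1 - \<rho>)"
      if \<zeta>: "cmod \<zeta> \<le> \<rho>" for \<zeta>
    proof -
      define G where "G = (\<Sum>n. c (int n) * \<zeta> ^ n)"
      have \<zeta>1: "cmod \<zeta> < 1" using \<zeta> \<rho> by simp
      have sG: "summable (\<lambda>n. c (int n) * \<zeta> ^ n)"
        by (rule summable_norm_cancel) (use summ[of "cmod \<zeta>"] \<zeta>1 in \<open>simp add: norm_mult norm_power\<close>)
      have A: "(\<Sum>i\<le>k. \<Sum>j\<le>k. coeff p i * cnj (coeff p j) * \<zeta> ^ (k + j - i)) = root_prod \<mu>s \<zeta> * refl_prod \<mu>s \<zeta>"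
      proof -
        have 1: "(\<Sum>i\<le>k. coeff p i * \<zeta> ^ (k - i)) = root_prod \<mu>s \<zeta>"
          using normalized_factor_coeffs(3)[OF \<mu>s(2)] by (simp add: p_def \<mu>s(1))
        have "(\<Sum>j\<le>k. cnj (coeff p j) * \<zeta> ^ j) = cnj (\<Sum>j\<le>k. coeff p j * cnj \<zeta> ^ j)" by simp
        also have "(\<Sum>j\<le>k. coeff p j * cnj \<zeta> ^ j) = poly p (cnj \<zeta>)"
          unfolding poly_altdef using pd by (intro sum.mono_neutral_right) (auto simp: coeff_eq_0)
        also have "cnj (poly p (cnj \<zeta>)) = refl_prod \<mu>s \<zeta>"
          unfolding p_def by (induction \<mu>s) (auto simp: algebra_simps)
        finally have 2: "(\<Sum>j\<le>k. cnj (coeff p j) * \<zeta> ^ j) = refl_prod \<mu>s \<zeta>" .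
        have "(\<Sum>i\<le>k. \<Sum>j\<le>k. coeff p i * cnj (coeff p j) * \<zeta> ^ (k + j - i)) = (\<Sum>i\<le>k. coeff p i * \<zeta> ^ (k - i)) * (\<Sum>j\<le>k. cnj (coeff p j) * \<zeta> ^ j)"
          unfolding sum_product
        proof (intro sum.cong refl)
          fix i j assume "i \<in> {..k}" "j \<in> {..k}"
          then have "k + j - i = (k - i) + j" by auto
          then show "coeff p i * cnj (coeff p j) * \<zeta> ^ (k + j - i) = coeff p i * \<zeta> ^ (k - i) * (cnj (coeff p j) * \<zeta> ^ j)"
            by (simp add: power_add mult_ac)
        qed
        then show ?thesis unfolding 1 2 .
      qed
      have shift: "(\<lambda>s. c (int (s + t)) * \<zeta> ^ (s + t)) sums (G - (\<Sum>u<t. c (int u) * \<zeta> ^ u))" for t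
        unfolding G_def by (rule sums_split_initial_segment) (rule summable_sums[OF sG])
      \<comment> \<open>The series of \<open>G\<close> is started at \<open>k + i - j\<close>, with
        a monomial in front, so that all summands have the exponent \<open>2 * k + s\<close> and the
        coefficients combine to \<open>d (k + s)\<close>. Starting at \<open>k\<close> avoids
        negative indices of \<open>c\<close>; the omitted initial terms are collected in
        \<open>E\<close>.\<close>
      have "(\<lambda>s. \<Sum>i\<le>k. \<Sum>j\<le>k. coeff p i * cnj (coeff p j) * \<zeta> ^ (k + j - i) * (c (int (s + (k + i - j))) * \<zeta> ^ (s + (k + i - j)))) sums
        (\<Sum>i\<le>k. \<Sum>j\<le>k. coeff p i * cnj (coeff p j) * \<zeta> ^ (k + j - i) * (G - (\<Sum>u<k + i - j. c (int u) * \<zeta> ^ u)))"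
        by (intro sums_sum sums_mult shift)
      also have "(\<lambda>s. \<Sum>i\<le>k. \<Sum>j\<le>k. coeff p i * cnj (coeff p j) * \<zeta> ^ (k + j - i) * (c (int (s + (k + i - j))) * \<zeta> ^ (s + (k + i - j)))) =
        (\<lambda>s. \<zeta> ^ (2 * k) * (d (k + s) * \<zeta> ^ s))"
      proof
        fix s
        show "(\<Sum>i\<le>k. \<Sum>j\<le>k. coeff p i * cnj (coeff p j) * \<zeta> ^ (k + j - i) * (c (int (s + (k + i - j))) * \<zeta> ^ (s + (k + i - j)))) = \<zeta> ^ (2 * k) * (d (k + s) * \<zeta> ^ s)"
          unfolding d_eq sum_distrib_left sum_distrib_right
        proof (intro sum.cong refl)
          fix i j assume ij: "i \<in> {..k}" "j \<in> {..k}"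
          then have e1: "int (k + s) + int i - int j = int (s + (k + i - j))" by auto
          have e2: "\<zeta> ^ (k + j - i) * \<zeta> ^ (s + (k + i - j)) = \<zeta> ^ (2 * k) * \<zeta> ^ s"
            unfolding power_add[symmetric] using ij by (intro arg_cong[where f = "\<lambda>n. \<zeta> ^ n"]) auto
          have "coeff p i * cnj (coeff p j) * \<zeta> ^ (k + j - i) * (c (int (s + (k + i - j))) * \<zeta> ^ (s + (k + i - j))) =
            coeff p i * cnj (coeff p j) * c (int (s + (k + i - j))) * (\<zeta> ^ (k + j - i) * \<zeta> ^ (s + (k + i - j)))"
            by (simp only: mult_ac)
          also have "\<dots> = \<zeta> ^ (2 * k) * (c (int (k + s) + int i - int j) * (coeff p i * cnj (coeff p j)) * \<zeta> ^ s)"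
            unfolding e1 e2 by (simp only: mult_ac)
          finally show "coeff p i * cnj (coeff p j) * \<zeta> ^ (k + j - i) * (c (int (s + (k + i - j))) * \<zeta> ^ (s + (k + i - j))) =
            \<zeta> ^ (2 * k) * (c (int (k + s) + int i - int j) * (coeff p i * cnj (coeff p j)) * \<zeta> ^ s)" .
        qed
      qed
      finally have sums: "(\<lambda>s. \<zeta> ^ (2 * k) * (d (k + s) * \<zeta> ^ s)) sums
        (\<Sum>i\<le>k. \<Sum>j\<le>k. coeff p i * cnj (coeff p j) * \<zeta> ^ (k + j - i) * (G - (\<Sum>u<k + i - j. c (int u) * \<zeta> ^ u)))" .
      define E where "E = (\<Sum>i\<le>k. \<Sum>j\<le>k. coeff p i * cnj (coeff p j) * \<zeta> ^ (k + j - i) * (\<Sum>u<k + i - j. c (int u) * \<zeta> ^ u))"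
      have "(\<Sum>i\<le>k. \<Sum>j\<le>k. coeff p i * cnj (coeff p j) * \<zeta> ^ (k + j - i) * (G - (\<Sum>u<k + i - j. c (int u) * \<zeta> ^ u))) =
         root_prod \<mu>s \<zeta> * refl_prod \<mu>s \<zeta> * G - E"
        unfolding A[symmetric] E_def by (simp only: right_diff_distrib sum_subtractf sum_distrib_right)
      with sums have AG: "root_prod \<mu>s \<zeta> * refl_prod \<mu>s \<zeta> * G = (\<Sum>s. \<zeta> ^ (2 * k) * (d (k + s) * \<zeta> ^ s)) + E"
        by (simp add: sums_iff)
      have zp: "cmod (\<zeta> ^ n) \<le> 1" for n using \<zeta>1 by (simp add: norm_power power_le_one)
      have E0': "E0 = (\<Sum>i\<le>k. \<Sum>j\<le>k. 4 ^ k * (\<Sum>u<k + i - j. cmod (c (int u))))"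
        unfolding E0_def sum_distrib_left ..
      have E: "cmod E \<le> E0"
        unfolding E_def E0'
      proof (intro sum_norm_le)
        fix i j
        have "cmod (\<Sum>u<k + i - j. c (int u) * \<zeta> ^ u) \<le> (\<Sum>u<k + i - j. cmod (c (int u)))"
        proof (intro sum_norm_le)
          fix u show "cmod (c (int u) * \<zeta> ^ u) \<le> cmod (c (int u))"
            unfolding norm_mult using mult_left_mono[OF zp[of u], of "cmod (c (int u))"] by simp
        qed
        then have "cmod (coeff p i * cnj (coeff p j)) * cmod (\<zeta> ^ (k + j - i)) * cmod (\<Sum>u<k + i - j. c (int u) * \<zeta> ^ u) \<le> 4 ^ k * 1 * (\<Sum>u<k + i - j. cmod (c (int u)))"
          by (intro mult_mono ppb zp) auto
        then show "cmod (coeff p i * cnj (coeff p j) * \<zeta> ^ (k + j - i) * (\<Sum>u<k + i - j. c (int u) * \<zeta> ^ u)) \<le> 4 ^ k * (\<Sum>u<k + i - j. cmod (c (int u)))"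
          by (simp add: norm_mult)
      qed
      have "cmod (\<Sum>s. \<zeta> ^ (2 * k) * (d (k + s) * \<zeta> ^ s)) \<le> (\<Sum>s. cmod (d (k + s)) * \<rho> ^ s)"
      proof (rule order_trans[OF summable_norm suminf_le])
        have le: "norm (\<zeta> ^ (2 * k) * (d (k + s) * \<zeta> ^ s)) \<le> cmod (d (k + s)) * \<rho> ^ s" for s
        proof -
          have "cmod (\<zeta> ^ (2 * k)) * (cmod (d (k + s)) * cmod \<zeta> ^ s) \<le> 1 * (cmod (d (k + s)) * \<rho> ^ s)"
            using \<zeta> \<rho> by (intro mult_mono zp power_mono) auto
          then show ?thesis by (simp add: norm_mult norm_power)
        qed
        show "norm (\<zeta> ^ (2 * k) * (d (k + s) * \<zeta> ^ s)) \<le> cmod (d (k + s)) * \<rho> ^ s" for s by (rule le)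
        show "summable (\<lambda>s. norm (\<zeta> ^ (2 * k) * (d (k + s) * \<zeta> ^ s)))"
          by (rule summable_comparison_test_ev[OF _ sd]) (use le in auto)
        then show "summable (\<lambda>s. norm (\<zeta> ^ (2 * k) * (d (k + s) * \<zeta> ^ s)))" .
      qed (rule sd)
      then have "cmod (root_prod \<mu>s \<zeta> * refl_prod \<mu>s \<zeta> * G) \<le> (D0 / (1 - \<rho>) + 1) + E0"
        unfolding AG using dsum E by (intro order_trans[OF norm_triangle_ineq] add_mono) auto
      also have "\<dots> \<le> D0 / (1 - \<rho>) + 1 / (1 - \<rho>) + E0 / (1 - \<rho>)"
        using \<rho> D0 by (intro add_mono) (auto simp: le_divide_eq mult_left_le)
      finally show ?thesis unfolding G_def[symmetric] by (simp add: norm_mult add_divide_distrib)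
    qed
    show "\<exists>\<mu>s. length \<mu>s = k \<and> (\<forall>\<mu>\<in>set \<mu>s. cmod \<mu> < 1) \<and>
     (\<forall>\<zeta>. cmod \<zeta> \<le> \<rho> \<longrightarrow> cmod (root_prod \<mu>s \<zeta>) * cmod (refl_prod \<mu>s \<zeta>) * cmod (\<Sum>n. c (int n) * \<zeta> ^ n) \<le> (D0 + 1 + E0) / (1 - \<rho>))"
      using \<mu>s(1,2) main by blast
  qed
qed

section \<open>From the twisted product back to the power series\<close>

lemma prod_list_ge_power:
  fixes f :: "'a \<Rightarrow> complex"
  assumes "\<And>x. x \<in> set xs \<Longrightarrow> cmod (f x) \<ge> \<eta>" "\<eta> \<ge> 0"
  shows "cmod (\<Prod>x\<leftarrow>xs. f x) \<ge> \<eta> ^ length xs"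
  using assms(1)
proof (induction xs)
  case (Cons x xs)
  then have "\<eta> * \<eta> ^ length xs \<le> cmod (f x) * cmod (\<Prod>x\<leftarrow>xs. f x)" using assms(2) by (intro mult_mono) auto
  then show ?case by (simp add: norm_mult)
qed simp

text \<open>Pigeonhole: each of the \<open>k\<close> points can spoil at most one of
  \<open>k + 1\<close> radii whose spacing \<open>\<delta> / (4 * Suc k)\<close> is twice the
  required distance.\<close>

lemma avoiding_radius:
  fixes \<mu>s :: "complex list"
  assumes "\<delta> > 0" "length \<mu>s = k"
  obtains s where "\<delta> / 4 \<le> s" "s \<le> \<delta> / 2"
    "\<And>\<mu>. \<mu> \<in> set \<mu>s \<Longrightarrow> \<bar>cmod (\<mu> - \<zeta>0) - s\<bar> \<ge> \<delta> / (8 * real (Suc k))"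
proof -
  define s where "s j = \<delta> / 4 + real j * (\<delta> / (4 * real (Suc k)))" for j
  have "\<exists>j\<le>k. \<forall>\<mu>\<in>set \<mu>s. \<bar>cmod (\<mu> - \<zeta>0) - s j\<bar> \<ge> \<delta> / (8 * real (Suc k))"
  proof (rule ccontr)
    assume "\<not> ?thesis"
    then have "\<forall>j\<in>{..k}. \<exists>\<mu>\<in>set \<mu>s. \<bar>cmod (\<mu> - \<zeta>0) - s j\<bar> < \<delta> / (8 * real (Suc k))"
      by (metis atMost_iff linorder_not_le)
    then obtain m where m: "\<And>j. j \<le> k \<Longrightarrow> m j \<in> set \<mu>s" "\<And>j. j \<le> k \<Longrightarrow> \<bar>cmod (m j - \<zeta>0) - s j\<bar> < \<delta> / (8 * real (Suc k))"
      by (metis atMost_iff)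
    have "inj_on m {..k}"
    proof (rule inj_onI)
      fix i j assume ij: "i \<in> {..k}" "j \<in> {..k}" "m i = m j"
      have h: "\<delta> / (4 * real (Suc k)) = 2 * (\<delta> / (8 * real (Suc k)))" by (simp add: field_simps)
      have "\<bar>s i - s j\<bar> < \<delta> / (4 * real (Suc k))"
      proof -
        define X where "X = \<delta> / (8 * real (Suc k))"
        have "\<bar>cmod (m i - \<zeta>0) - s i\<bar> < X" "\<bar>cmod (m i - \<zeta>0) - s j\<bar> < X"
          using m(2)[of i] m(2)[of j] ij unfolding X_def by auto
        then show ?thesis unfolding h X_def[symmetric] by linarith
      qed
      moreover have "s i - s j = (real i - real j) * (\<delta> / (4 * real (Suc k)))" by (simp add: s_def algebra_simps diff_divide_distrib)
      ultimately have "\<bar>real i - real j\<bar> * (\<delta> / (4 * real (Suc k))) < 1 * (\<delta> / (4 * real (Suc k)))"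
        using assms(1) by (simp add: abs_mult)
      then have "\<bar>real i - real j\<bar> < 1" using assms(1) by (subst (asm) mult_less_cancel_right_pos) auto
      then show "i = j" by linarith
    qed
    then have "card {..k} \<le> card (set \<mu>s)" using m(1) by (intro card_inj_on_le) auto
    then show False using card_length[of \<mu>s] assms(2) by simp
  qed
  then obtain j where j: "j \<le> k" "\<And>\<mu>. \<mu> \<in> set \<mu>s \<Longrightarrow> \<bar>cmod (\<mu> - \<zeta>0) - s j\<bar> \<ge> \<delta> / (8 * real (Suc k))" by blast
  have "real j * (\<delta> / (4 * real (Suc k))) \<le> real (Suc k) * (\<delta> / (4 * real (Suc k)))"
    using j(1) assms(1) by (intro mult_right_mono) auto
  also have "\<dots> = \<delta> / 4" by (simp add: field_simps)
  finally have "s j \<le> \<delta> / 2" unfolding s_def by linarith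
  moreover have "\<delta> / 4 \<le> s j" using assms(1) by (simp add: s_def)
  ultimately show ?thesis using that j(2) by blast
qed

text \<open>
  Maximum principle on a circle around \<open>\<zeta>\<close> of radius comparable to \<open>1 - \<bar>\<zeta>\<bar>\<close> that avoids the zeros of the
  twisting product.
\<close>
theorem caratheodory_growth:
  assumes herm: "\<And>n. c (- n) = cnj (c n)" and neg: "neg_squares_le c k"
    and summ: "\<And>\<rho>. 0 \<le> \<rho> \<Longrightarrow> \<rho> < 1 \<Longrightarrow> summable (\<lambda>n. cmod (c (int n)) * \<rho> ^ n)"
  shows "\<exists>C. \<forall>\<zeta>. cmod \<zeta> < 1 \<longrightarrow> cmod (\<Sum>n. c (int n) * \<zeta> ^ n) \<le> C / (1 - cmod \<zeta>) ^ (2 * k + 1)"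
proof -
  obtain \<epsilon> :: real where \<epsilon>: "0 < \<epsilon>" "\<epsilon> < 1" "nondegenerate_sequence (\<lambda>n. c n + (if n = 0 then of_real \<epsilon> else 0)) k"
    by (rule toeplitz_generic_shift[OF herm neg])
  define c' where "c' = (\<lambda>n. c n + (if n = 0 then complex_of_real \<epsilon> else 0))"
  interpret nondegenerate_sequence c' k using \<epsilon>(3) unfolding c'_def .
  have summ': "summable (\<lambda>n. cmod (c' (int n)) * \<rho> ^ n)" if "0 \<le> \<rho>" "\<rho> < 1" for \<rho>
    by (rule iffD1[OF summable_cong summ[OF that]]) (auto simp: c'_def eventually_sequentially intro!: exI[of _ 1])
  define G where "G \<zeta> = (\<Sum>n. c' (int n) * \<zeta> ^ n)" for \<zeta>
  have sG: "(\<lambda>n. c' (int n) * \<zeta> ^ n) sums G \<zeta>" if "cmod \<zeta> < 1" for \<zeta>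
    unfolding G_def by (rule summable_sums, rule summable_norm_cancel) (use summ'[of "cmod \<zeta>"] that in \<open>simp add: norm_mult norm_power\<close>)
  have holG: "G holomorphic_on ball 0 1"
    by (rule power_series_holomorphic[of 0 1 "\<lambda>n. c' (int n)"]) (use sG in auto)
  have ex: "\<exists>C. \<forall>\<rho>. 0 \<le> \<rho> \<longrightarrow> \<rho> < 1 \<longrightarrow> (\<exists>\<mu>s. length \<mu>s = k \<and> (\<forall>\<mu>\<in>set \<mu>s. cmod \<mu> < 1) \<and>
     (\<forall>\<zeta>. cmod \<zeta> \<le> \<rho> \<longrightarrow> cmod (root_prod \<mu>s \<zeta>) * cmod (refl_prod \<mu>s \<zeta>) * cmod (G \<zeta>) \<le> C / (1 - \<rho>)))"
    unfolding G_def by (rule twisted_product_bound) (rule summ')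
  obtain C where C: "\<forall>\<rho>. 0 \<le> \<rho> \<longrightarrow> \<rho> < 1 \<longrightarrow> (\<exists>\<mu>s. length \<mu>s = k \<and> (\<forall>\<mu>\<in>set \<mu>s. cmod \<mu> < 1) \<and>
     (\<forall>\<zeta>. cmod \<zeta> \<le> \<rho> \<longrightarrow> cmod (root_prod \<mu>s \<zeta>) * cmod (refl_prod \<mu>s \<zeta>) * cmod (G \<zeta>) \<le> C / (1 - \<rho>)))"
    by (rule exE[OF ex])
  define K where "K = 2 * C * (8 * real (Suc k)) ^ (2 * k)"
  have bound: "cmod (G \<zeta>0) \<le> K / (1 - cmod \<zeta>0) ^ (2 * k + 1)" if \<zeta>0: "cmod \<zeta>0 < 1" for \<zeta>0
  proof -
    define \<delta> where "\<delta> = 1 - cmod \<zeta>0"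
    have \<delta>: "0 < \<delta>" "\<delta> \<le> 1" using \<zeta>0 by (auto simp: \<delta>_def)
    \<comment> \<open>The disc of this radius contains all circles of radius at most
      \<open>\<delta> / 2\<close> around \<open>\<zeta>0\<close>, and its distance
      \<open>\<delta> / 2\<close> from the unit circle bounds the reflected factors from
      below.\<close>
    obtain \<mu>s where \<mu>s: "length \<mu>s = k" "\<forall>\<mu>\<in>set \<mu>s. cmod \<mu> < 1"
      "\<And>\<zeta>. cmod \<zeta> \<le> 1 - \<delta> / 2 \<Longrightarrow> cmod (root_prod \<mu>s \<zeta>) * cmod (refl_prod \<mu>s \<zeta>) * cmod (G \<zeta>) \<le> C / (1 - (1 - \<delta> / 2))"
      using C[THEN spec, of "1 - \<delta> / 2", THEN mp, THEN mp] \<delta> by auto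
    define \<eta> where "\<eta> = \<delta> / (8 * real (Suc k))"
    have \<eta>: "\<eta> > 0" using \<delta> by (simp add: \<eta>_def)
    have \<eta>2: "\<eta> \<le> \<delta> / 2" unfolding \<eta>_def using \<delta> by (intro divide_left_mono) auto
    obtain s where s: "\<delta> / 4 \<le> s" "s \<le> \<delta> / 2" "\<And>\<mu>. \<mu> \<in> set \<mu>s \<Longrightarrow> \<bar>cmod (\<mu> - \<zeta>0) - s\<bar> \<ge> \<eta>"
      using avoiding_radius[OF \<delta>(1) \<mu>s(1), of \<zeta>0] unfolding \<eta>_def by blast
    have circ: "cmod (G \<zeta>) \<le> C / (\<delta> / 2) / (\<eta> ^ k * \<eta> ^ k)" if z: "cmod (\<zeta> - \<zeta>0) = s" for \<zeta>
    proof -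
      have z1: "cmod \<zeta> \<le> 1 - \<delta> / 2"
        using norm_triangle_sub[of \<zeta> \<zeta>0] z s(2) by (simp add: \<delta>_def field_simps)
      have "\<eta> \<le> cmod (\<zeta> - \<mu>)" if "\<mu> \<in> set \<mu>s" for \<mu>
      proof -
        have "\<bar>cmod (\<mu> - \<zeta>0) - cmod (\<zeta> - \<zeta>0)\<bar> \<le> cmod ((\<mu> - \<zeta>0) - (\<zeta> - \<zeta>0))" by (rule norm_triangle_ineq3)
        then show ?thesis using s(3)[OF that] z by (simp add: norm_minus_commute)
      qed
      then have f1: "\<eta> ^ k \<le> cmod (root_prod \<mu>s \<zeta>)"
        using prod_list_ge_power[of \<mu>s \<eta> "\<lambda>\<mu>. \<zeta> - \<mu>"] \<eta> \<mu>s(1) by simp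
      have "\<eta> \<le> cmod (1 - cnj \<mu> * \<zeta>)" if "\<mu> \<in> set \<mu>s" for \<mu>
      proof -
        have "cmod (cnj \<mu> * \<zeta>) \<le> 1 * cmod \<zeta>" unfolding norm_mult using \<mu>s(2) that by (intro mult_right_mono) (auto intro: less_imp_le)
        moreover have "1 - cmod (cnj \<mu> * \<zeta>) \<le> cmod (1 - cnj \<mu> * \<zeta>)" using norm_triangle_ineq2[of 1 "cnj \<mu> * \<zeta>"] by simp
        ultimately show ?thesis using z1 \<eta>2 by simp
      qed
      then have f2: "\<eta> ^ k \<le> cmod (refl_prod \<mu>s \<zeta>)"
        using prod_list_ge_power[of \<mu>s \<eta> "\<lambda>\<mu>. 1 - cnj \<mu> * \<zeta>"] \<eta> \<mu>s(1) by simp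
      have "\<eta> ^ k * \<eta> ^ k * cmod (G \<zeta>) \<le> cmod (root_prod \<mu>s \<zeta>) * cmod (refl_prod \<mu>s \<zeta>) * cmod (G \<zeta>)"
        using \<eta> by (intro mult_right_mono mult_mono f1 f2) auto
      also have "\<dots> \<le> C / (\<delta> / 2)" using \<mu>s(3)[OF z1] by simp
      finally have "\<eta> ^ k * \<eta> ^ k * cmod (G \<zeta>) \<le> C / (\<delta> / 2)" .
      moreover have "\<eta> ^ k * \<eta> ^ k > 0" using \<eta> by simp
      ultimately show ?thesis by (simp only: pos_le_divide_eq mult.commute)
    qed
    have s0: "s > 0" using s(1) \<delta> by simp
    have sub: "cball \<zeta>0 s \<subseteq> ball 0 1"
    proof
      fix z assume "z \<in> cball \<zeta>0 s"
      then have "cmod (z - \<zeta>0) \<le> \<delta> / 2" using s(2) by (simp add: dist_norm norm_minus_commute)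
      then show "z \<in> ball 0 1" using norm_triangle_sub[of z \<zeta>0] \<delta> by (simp add: \<delta>_def)
    qed
    have "norm (G \<zeta>0) \<le> C / (\<delta> / 2) / (\<eta> ^ k * \<eta> ^ k)"
    proof (rule maximum_modulus_frontier[of G "cball \<zeta>0 s"])
      show "G holomorphic_on interior (cball \<zeta>0 s)"
        using holomorphic_on_subset[OF holG] sub interior_subset by blast
      show "continuous_on (closure (cball \<zeta>0 s)) G"
        using holomorphic_on_imp_continuous_on[OF holomorphic_on_subset[OF holG sub]] by simp
      show "norm (G z) \<le> C / (\<delta> / 2) / (\<eta> ^ k * \<eta> ^ k)" if "z \<in> frontier (cball \<zeta>0 s)" for z
        using that by (intro circ) (simp add: dist_norm norm_minus_commute)
    qed (use s0 in auto)
    also have "\<dots> = K / \<delta> ^ (2 * k + 1)"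
    proof -
      have "\<eta> ^ k * \<eta> ^ k = \<delta> ^ (2 * k) / (8 * real (Suc k)) ^ (2 * k)"
        by (simp add: \<eta>_def power_divide mult_2 power_add)
      then show ?thesis using \<delta> by (simp add: K_def)
    qed
    finally show ?thesis by (simp add: \<delta>_def)
  qed
  have "cmod (\<Sum>n. c (int n) * \<zeta> ^ n) \<le> (K + \<epsilon>) / (1 - cmod \<zeta>) ^ (2 * k + 1)" if \<zeta>: "cmod \<zeta> < 1" for \<zeta>
  proof -
    \<comment> \<open>The generic shift changes the constant coefficient only.\<close>
    have "(\<lambda>n. if n = 0 then complex_of_real \<epsilon> else 0) sums of_real \<epsilon>"
      using sums_single[of 0 "\<lambda>_. complex_of_real \<epsilon>"] by simp
    then have "(\<lambda>n. c' (int n) * \<zeta> ^ n - (if n = 0 then complex_of_real \<epsilon> else 0)) sums (G \<zeta> - of_real \<epsilon>)"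
      by (intro sums_diff sG \<zeta>)
    also have "(\<lambda>n. c' (int n) * \<zeta> ^ n - (if n = 0 then complex_of_real \<epsilon> else 0)) = (\<lambda>n. c (int n) * \<zeta> ^ n)"
      by (auto simp: c'_def fun_eq_iff)
    finally have "(\<Sum>n. c (int n) * \<zeta> ^ n) = G \<zeta> - of_real \<epsilon>" by (simp add: sums_iff)
    then have "cmod (\<Sum>n. c (int n) * \<zeta> ^ n) \<le> cmod (G \<zeta>) + \<epsilon>"
      using norm_triangle_ineq4[of "G \<zeta>" "of_real \<epsilon>"] \<epsilon>(1) by simp
    moreover have "\<epsilon> \<le> \<epsilon> / (1 - cmod \<zeta>) ^ (2 * k + 1)"
    proof -
      have "0 < (1 - cmod \<zeta>) ^ (2 * k + 1)" "(1 - cmod \<zeta>) ^ (2 * k + 1) \<le> 1"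
        using \<zeta> by (simp, intro power_le_one) auto
      then show ?thesis using \<epsilon>(1) by (simp only: le_divide_eq if_True) (simp add: mult_left_le)
    qed
    ultimately show ?thesis using bound[OF \<zeta>] by (simp add: add_divide_distrib)
  qed
  then show ?thesis by blast
qed

section \<open>Sampling the Caratheodory kernel near the origin\<close>

lemma sum_swap3:
  "(\<Sum>b\<in>A. \<Sum>n\<in>B. \<Sum>m\<in>C. h b n m) = (\<Sum>n\<in>B. \<Sum>m\<in>C. \<Sum>b\<in>A. h b n m)"
proof -
  have "(\<Sum>b\<in>A. \<Sum>n\<in>B. \<Sum>m\<in>C. h b n m) = (\<Sum>n\<in>B. \<Sum>b\<in>A. \<Sum>m\<in>C. h b n m)" by (rule sum.swap)
  also have "\<dots> = (\<Sum>n\<in>B. \<Sum>m\<in>C. \<Sum>b\<in>A. h b n m)" by (rule sum.cong[OF refl], rule sum.swap)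
  finally show ?thesis .
qed

text \<open>Multiplication with \<open>w\<close> moves every entry one step along its diagonal, so
  everything except the first and last row and column cancels.\<close>

lemma toeplitz_telescope:
  fixes f :: "nat \<Rightarrow> nat \<Rightarrow> complex"
  assumes f: "\<And>p q. f (Suc p) (Suc q) = w * f p q"
  shows "(1 - w) * (\<Sum>p<Suc M. \<Sum>q<Suc M. f p q) =
    (\<Sum>q<Suc M. f 0 q) + (\<Sum>p<M. f (Suc p) 0) - w * ((\<Sum>p<Suc M. f p M) + (\<Sum>q<M. f M q))"
proof -
  define S where "S = (\<Sum>p<Suc M. \<Sum>q<Suc M. f p q)"
  define T where "T = (\<Sum>p<M. \<Sum>q<M. f p q)"
  have "S = (\<Sum>q<Suc M. f 0 q) + (\<Sum>p<M. \<Sum>q<Suc M. f (Suc p) q)"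
    unfolding S_def by (rule sum.lessThan_Suc_shift)
  also have "(\<Sum>p<M. \<Sum>q<Suc M. f (Suc p) q) = (\<Sum>p<M. f (Suc p) 0) + w * T"
    unfolding sum.lessThan_Suc_shift[of _ M] by (simp add: f sum.distrib T_def sum_distrib_left)
  finally have 1: "S = (\<Sum>q<Suc M. f 0 q) + (\<Sum>p<M. f (Suc p) 0) + w * T" by simp
  have 2: "S = T + (\<Sum>p<Suc M. f p M) + (\<Sum>q<M. f M q)"
    by (simp add: S_def T_def sum.distrib)
  have "(1 - w) * S = S - w * S" by (simp add: algebra_simps)
  also have "w * S = w * T + w * ((\<Sum>p<Suc M. f p M) + (\<Sum>q<M. f M q))" by (subst 2) (simp only: distrib_left add.assoc)
  also have "S - \<dots> = (\<Sum>q<Suc M. f 0 q) + (\<Sum>p<M. f (Suc p) 0) - w * ((\<Sum>p<Suc M. f p M) + (\<Sum>q<M. f M q))"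
    by (subst 1) simp
  finally show ?thesis unfolding S_def[symmetric] .
qed

text \<open>
  The coefficients of \<open>(g \<zeta> + cnj (g \<omega>)) / (1 - \<zeta> * cnj \<omega>)\<close> at \<open>\<zeta>\<^sup>p (cnj \<omega>)\<^sup>q\<close>, which depend only on \<open>p - q\<close>,
  where \<open>a\<close> are the coefficients of \<open>g\<close>.
\<close>
definition toeplitz_seq :: "(nat \<Rightarrow> complex) \<Rightarrow> int \<Rightarrow> complex" where
  "toeplitz_seq a n = (if n > 0 then a (nat n) else if n = 0 then of_real (2 * Re (a 0)) else cnj (a (nat (- n))))"

lemma toeplitz_seq_herm: "toeplitz_seq a (- n) = cnj (toeplitz_seq a n)"
  by (auto simp: toeplitz_seq_def)

text \<open>The finite double sum is compared with the kernel after multiplication with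
  \<open>1 - \<zeta> * cnj \<omega>\<close>: by telescoping it becomes a Taylor section of the
  numerator up to boundary terms of order \<open>r ^ Suc M\<close>. No double series has to be
  summed.\<close>

lemma caratheodory_kernel_expansion:
  fixes g :: "complex \<Rightarrow> complex"
  assumes g: "\<And>\<zeta>. cmod \<zeta> < 1 \<Longrightarrow> (\<lambda>n. a n * \<zeta> ^ n) sums g \<zeta>"
  defines "c \<equiv> toeplitz_seq a"
  shows "\<exists>C. \<forall>r \<zeta> \<omega>. 0 < r \<longrightarrow> r \<le> 1 / 4 \<longrightarrow> cmod \<zeta> = r \<longrightarrow> cmod \<omega> = r \<longrightarrow>
     cmod ((g \<zeta> + cnj (g \<omega>)) / (1 - \<zeta> * cnj \<omega>) - (\<Sum>p<Suc M. \<Sum>q<Suc M. c (int p - int q) * \<zeta> ^ p * cnj \<omega> ^ q)) \<le> C * r ^ Suc M"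
proof -
  have sa: "summable (\<lambda>n. cmod (a n) * (1/2) ^ n)"
  proof -
    have "summable (\<lambda>n. a n * (of_real (3/4)) ^ n)" using g[of "of_real (3/4)"] sums_summable by (auto simp: norm_divide)
    then have "summable (\<lambda>n. cmod (a n * (of_real (1/2)) ^ n))"
      by (rule powser_insidea) (simp add: norm_divide)
    then show ?thesis by (simp add: norm_mult norm_power norm_divide)
  qed
  define A where "A = (\<Sum>n. cmod (a n) * (1/2) ^ n)"
  define D where "D = (\<Sum>p<Suc M. cmod (c (int p - int M))) + (\<Sum>q<M. cmod (c (int M - int q)))"
  define C where "C = 2 * (2 * (A * 2 ^ Suc M) + D)"
  have "cmod ((g \<zeta> + cnj (g \<omega>)) / (1 - \<zeta> * cnj \<omega>) - (\<Sum>p<Suc M. \<Sum>q<Suc M. c (int p - int q) * \<zeta> ^ p * cnj \<omega> ^ q)) \<le> C * r ^ Suc M"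
    if r: "0 < r" "r \<le> 1 / 4" and \<zeta>: "cmod \<zeta> = r" and \<omega>: "cmod \<omega> = r" for r \<zeta> \<omega>
  proof -
    define gL where "gL z = (\<Sum>p<Suc M. a p * z ^ p)" for z
    have rem: "cmod (g z - gL z) \<le> A * 2 ^ Suc M * r ^ Suc M" if z: "cmod z = r" for z
    proof -
      have "cmod z < 1" using z r by simp
      from g[OF this] have sz: "(\<lambda>n. a n * z ^ n) sums g z" .
      have ev: "(\<lambda>n. a (n + Suc M) * z ^ (n + Suc M)) sums (g z - gL z)"
        unfolding gL_def by (rule sums_split_initial_segment[OF sz])
      have le: "cmod (a (n + Suc M) * z ^ (n + Suc M)) \<le> cmod (a (n + Suc M)) * (1/2) ^ (n + Suc M) * (2 ^ Suc M * r ^ Suc M)" for n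
      proof -
        have "r ^ (n + Suc M) = (1/2) ^ (n + Suc M) * (2 * r) ^ n * (2 ^ Suc M * r ^ Suc M)"
          by (simp add: power_add power_mult_distrib power_one_over)
        also have "\<dots> \<le> (1/2) ^ (n + Suc M) * 1 * (2 ^ Suc M * r ^ Suc M)"
          using r by (intro mult_right_mono mult_left_mono power_le_one) auto
        finally have "r ^ (n + Suc M) \<le> (1/2) ^ (n + Suc M) * (2 ^ Suc M * r ^ Suc M)" by simp
        then show ?thesis using z mult_left_mono[of "r ^ (n + Suc M)" _ "cmod (a (n + Suc M))"] by (simp add: norm_mult norm_power mult.assoc)
      qed
      have s1: "summable (\<lambda>n. cmod (a (n + Suc M)) * (1/2) ^ (n + Suc M))" by (rule summable_ignore_initial_segment[OF sa])
      have "cmod (g z - gL z) \<le> (\<Sum>n. cmod (a (n + Suc M)) * (1/2) ^ (n + Suc M) * (2 ^ Suc M * r ^ Suc M))"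
        unfolding sums_unique[OF ev] by (rule norm_suminf_le[OF le]) (intro summable_mult2 s1)
      also have "\<dots> = (\<Sum>n. cmod (a (n + Suc M)) * (1/2) ^ (n + Suc M)) * (2 ^ Suc M * r ^ Suc M)"
        by (rule suminf_mult2[OF s1, symmetric])
      also have "\<dots> \<le> A * (2 ^ Suc M * r ^ Suc M)"
      proof (rule mult_right_mono)
        have "A = (\<Sum>n. cmod (a (n + Suc M)) * (1/2) ^ (n + Suc M)) + (\<Sum>n<Suc M. cmod (a n) * (1/2) ^ n)"
          unfolding A_def by (rule suminf_split_initial_segment[OF sa])
        moreover have "(\<Sum>n<Suc M. cmod (a n) * (1/2) ^ n) \<ge> 0" by (intro sum_nonneg) auto
        ultimately show "(\<Sum>n. cmod (a (n + Suc M)) * (1/2) ^ (n + Suc M)) \<le> A" by linarith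
      qed (use r in auto)
      finally show ?thesis by (simp only: mult.assoc)
    qed
    define w where "w = \<zeta> * cnj \<omega>"
    have w: "cmod w = r * r" by (simp add: w_def norm_mult \<zeta> \<omega>)
    have w2: "cmod w \<le> 1/16" unfolding w using r mult_mono[of r "1/4" r "1/4"] by simp
    then have w1: "cmod (1 - w) \<ge> 1/2" using norm_triangle_ineq2[of 1 w] by simp
    then have w0: "1 - w \<noteq> 0" by auto
    define f where "f p q = c (int p - int q) * \<zeta> ^ p * cnj \<omega> ^ q" for p q
    have f: "f (Suc p) (Suc q) = w * f p q" for p q by (simp add: f_def w_def)
    have row: "(\<Sum>q<Suc M. f 0 q) + (\<Sum>p<M. f (Suc p) 0) = gL \<zeta> + cnj (gL \<omega>)"
    proof -
      have "(\<Sum>q<Suc M. f 0 q) = of_real (2 * Re (a 0)) + (\<Sum>q<M. cnj (a (Suc q)) * cnj \<omega> ^ Suc q)"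
        by (subst sum.lessThan_Suc_shift) (simp add: f_def c_def toeplitz_seq_def nat_add_distrib)
      moreover have "(\<Sum>p<M. f (Suc p) 0) = (\<Sum>p<M. a (Suc p) * \<zeta> ^ Suc p)"
        by (simp add: f_def c_def toeplitz_seq_def nat_add_distrib)
      moreover have "gL \<zeta> = a 0 + (\<Sum>p<M. a (Suc p) * \<zeta> ^ Suc p)" unfolding gL_def by (subst sum.lessThan_Suc_shift) simp
      moreover have "cnj (gL \<omega>) = cnj (a 0) + (\<Sum>q<M. cnj (a (Suc q)) * cnj \<omega> ^ Suc q)" unfolding gL_def by (subst sum.lessThan_Suc_shift) simp
      moreover have "complex_of_real (2 * Re (a 0)) = a 0 + cnj (a 0)" by (simp add: complex_add_cnj)
      ultimately show ?thesis by simp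
    qed
    define X where "X = (\<Sum>p<Suc M. f p M) + (\<Sum>q<M. f M q)"
    have tel: "(1 - w) * (\<Sum>p<Suc M. \<Sum>q<Suc M. f p q) = gL \<zeta> + cnj (gL \<omega>) - w * X"
      using toeplitz_telescope[of f w M, OF f] unfolding row X_def .
    have "(g \<zeta> + cnj (g \<omega>)) / (1 - w) - (\<Sum>p<Suc M. \<Sum>q<Suc M. f p q) =
       ((g \<zeta> + cnj (g \<omega>)) - (1 - w) * (\<Sum>p<Suc M. \<Sum>q<Suc M. f p q)) / (1 - w)"
      using w0 by (simp add: diff_divide_distrib)
    also have "\<dots> = ((g \<zeta> - gL \<zeta>) + cnj (g \<omega> - gL \<omega>) + w * X) / (1 - w)" unfolding tel by simp
    also have "cmod \<dots> \<le> (A * 2 ^ Suc M * r ^ Suc M + A * 2 ^ Suc M * r ^ Suc M + D * r ^ Suc M) / (1/2)"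
      unfolding norm_divide
    proof (intro frac_le)
      have fb: "cmod (w * f p q) \<le> cmod (c (int p - int q)) * r ^ Suc M" if "p = M \<or> q = M" for p q
      proof -
        have "cmod (w * f p q) = cmod (c (int p - int q)) * r ^ (p + q + 2)"
          by (simp add: w f_def norm_mult norm_power \<zeta> \<omega> power_add power2_eq_square mult_ac)
        also have "\<dots> \<le> cmod (c (int p - int q)) * r ^ Suc M"
          using that r by (intro mult_left_mono power_decreasing) auto
        finally show ?thesis .
      qed
      have "cmod (w * X) \<le> (\<Sum>p<Suc M. cmod (c (int p - int M)) * r ^ Suc M) + (\<Sum>q<M. cmod (c (int M - int q)) * r ^ Suc M)"
        unfolding X_def distrib_left sum_distrib_left
        by (intro order_trans[OF norm_triangle_ineq] add_mono sum_norm_le fb) auto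
      then have "cmod (w * X) \<le> D * r ^ Suc M" by (simp only: D_def distrib_right sum_distrib_right)
      moreover have "cmod (cnj (g \<omega> - gL \<omega>)) \<le> A * 2 ^ Suc M * r ^ Suc M" unfolding complex_mod_cnj by (rule rem[OF \<omega>])
      ultimately show "cmod ((g \<zeta> - gL \<zeta>) + cnj (g \<omega> - gL \<omega>) + w * X) \<le> A * 2 ^ Suc M * r ^ Suc M + A * 2 ^ Suc M * r ^ Suc M + D * r ^ Suc M"
        by (intro order_trans[OF norm_triangle_ineq] add_mono rem[OF \<zeta>])
    next
      have "A \<ge> 0" unfolding A_def by (intro suminf_nonneg sa) auto
      moreover have "D \<ge> 0" unfolding D_def by (intro add_nonneg_nonneg sum_nonneg) auto
      ultimately show "0 \<le> A * 2 ^ Suc M * r ^ Suc M + A * 2 ^ Suc M * r ^ Suc M + D * r ^ Suc M" using r by simp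
    qed (use w1 in auto)
    also have "\<dots> = C * r ^ Suc M" unfolding C_def by (simp add: algebra_simps)
    finally show ?thesis unfolding w_def f_def .
  qed
  then show ?thesis by blast
qed

section \<open>Recovering Taylor coefficients from equidistributed samples\<close>

lemma sum_roots_of_unity_orthogonal:
  assumes "p < L" "n < L"
  shows "(\<Sum>a<L. cis (2 * pi * real a * (real p - real n) / real L)) = (if p = n then of_nat L else 0)"
proof (cases "p = n")
  case False
  have L: "L > 0" using assms by simp
  define z where "z = cis (2 * pi * (real p - real n) / real L)"
  have za: "cis (2 * pi * real a * (real p - real n) / real L) = z ^ a" for a
    unfolding z_def Complex.DeMoivre by (intro arg_cong[where f = cis]) simp
  have "z ^ L = cis (2 * pi * of_int (int p - int n))"
    unfolding z_def Complex.DeMoivre using L by (intro arg_cong[where f = cis]) simp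
  also have "\<dots> = 1" by (rule cis_multiple_2pi) simp
  finally have zL: "z ^ L = 1" .
  have "z \<noteq> 1"
  proof
    assume "z = 1"
    then have "cos (2 * pi * (real p - real n) / real L) = 1" by (simp add: z_def complex_eq_iff)
    then obtain m :: int where "2 * pi * (real p - real n) / real L = of_int m * (2 * pi)" using cos_one_2pi_int by (metis mult.assoc)
    then have "2 * pi * (real p - real n) = 2 * pi * (of_int m * real L)" using L by (simp add: field_simps)
    then have "real p - real n = of_int m * real L" by simp
    then have "real_of_int (int p - int n) = real_of_int (m * int L)" by simp
    then have eq: "int p - int n = m * int L" by linarith
    have "m \<noteq> 0" using eq False by auto
    then have "int L \<le> \<bar>m * int L\<bar>" unfolding abs_mult using mult_right_mono[of 1 "\<bar>m\<bar>" "int L"] by simp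
    then show False using eq assms by linarith
  qed
  then show ?thesis unfolding za using False geometric_sum[of z L] zL by simp
qed simp

definition root_point :: "nat \<Rightarrow> real \<Rightarrow> nat \<Rightarrow> complex" where
  "root_point L r a = of_real r * cis (2 * pi * real a / real L)"

text \<open>A discrete Cauchy formula: weighted sums over the \<open>L\<close> sample points give
  coefficient \<open>n\<close> exactly on polynomials of degree below \<open>L\<close>, at the price
  of \<open>r ^ n\<close> in the denominator.\<close>

definition dft_weight :: "nat \<Rightarrow> real \<Rightarrow> nat \<Rightarrow> nat \<Rightarrow> complex" where
  "dft_weight L r n a = cis (- (2 * pi * real a * real n / real L)) / of_real (real L * r ^ n)"

lemma dft_weight_orthogonal:
  assumes p: "p < L" "n < L" and r: "r > 0"
  shows "(\<Sum>a<L. root_point L r a ^ p * dft_weight L r n a) = (if p = n then 1 else 0)"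
proof -
  have "root_point L r a ^ p * dft_weight L r n a = of_real (r ^ p / (real L * r ^ n)) * cis (2 * pi * real a * (real p - real n) / real L)" for a
  proof -
    have "root_point L r a ^ p * dft_weight L r n a = of_real (r ^ p / (real L * r ^ n)) * (cis (real p * (2 * pi * real a / real L)) * cis (- (2 * pi * real a * real n / real L)))"
      unfolding root_point_def dft_weight_def power_mult_distrib Complex.DeMoivre by simp
    then show ?thesis unfolding cis_mult by (simp add: algebra_simps diff_divide_distrib)
  qed
  then have "(\<Sum>a<L. root_point L r a ^ p * dft_weight L r n a) = of_real (r ^ p / (real L * r ^ n)) * (if p = n then of_nat L else 0)"
    by (simp only: sum_distrib_left[symmetric] sum_roots_of_unity_orthogonal[OF p])
  then show ?thesis using p r by simp
qed

definition sample_entry :: "(complex \<Rightarrow> complex \<Rightarrow> complex) \<Rightarrow> nat \<Rightarrow> real \<Rightarrow> nat \<Rightarrow> nat \<Rightarrow> complex" where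
  "sample_entry S L r n m = (\<Sum>a<L. \<Sum>b<L. S (root_point L r a) (root_point L r b) * dft_weight L r n a * cnj (dft_weight L r m b))"

lemma sample_entry_diff: "sample_entry S L r n m - sample_entry S' L r n m = sample_entry (\<lambda>x y. S x y - S' x y) L r n m"
  by (simp add: sample_entry_def sum_subtractf[symmetric] left_diff_distrib)

lemma sample_entry_bound:
  assumes "\<And>x y. cmod x = r \<Longrightarrow> cmod y = r \<Longrightarrow> cmod (S x y) \<le> K" and r: "r > 0" and L: "L > 0"
  shows "cmod (sample_entry S L r n m) \<le> K / r ^ (n + m)"
proof -
  have w: "cmod (dft_weight L r n a) = 1 / (real L * r ^ n)" for n a
    unfolding dft_weight_def norm_divide norm_of_real using r by simp
  have S: "cmod (S (root_point L r a) (root_point L r b)) \<le> K" for a b using r by (intro assms(1)) (simp_all add: root_point_def norm_mult)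
  have "cmod (sample_entry S L r n m) \<le> (\<Sum>a<L. \<Sum>b<L. K * (1 / (real L * r ^ n)) * (1 / (real L * r ^ m)))"
    unfolding sample_entry_def by (intro sum_norm_le) (use r S in \<open>auto simp: norm_mult w intro!: divide_right_mono\<close>)
  also have "\<dots> = K / r ^ (n + m)" using L by (simp add: power_add)
  finally show ?thesis .
qed

lemma bilinear_sum_swap:
  fixes c :: "'p \<Rightarrow> 'q \<Rightarrow> 'c::comm_semiring_0"
  shows "(\<Sum>a\<in>A. \<Sum>b\<in>B. (\<Sum>p\<in>P. \<Sum>q\<in>Q. c p q * f a p * g b q) * u a * v b) =
    (\<Sum>p\<in>P. \<Sum>q\<in>Q. c p q * (\<Sum>a\<in>A. f a p * u a) * (\<Sum>b\<in>B. g b q * v b))"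
proof -
  define t where "t a b p q = c p q * f a p * g b q * u a * v b" for a b p q
  have "(\<Sum>a\<in>A. \<Sum>b\<in>B. (\<Sum>p\<in>P. \<Sum>q\<in>Q. c p q * f a p * g b q) * u a * v b) = (\<Sum>a\<in>A. \<Sum>b\<in>B. \<Sum>p\<in>P. \<Sum>q\<in>Q. t a b p q)"
    by (simp add: t_def sum_distrib_right)
  also have "\<dots> = (\<Sum>a\<in>A. \<Sum>p\<in>P. \<Sum>q\<in>Q. \<Sum>b\<in>B. t a b p q)" by (rule sum.cong[OF refl], rule sum_swap3)
  also have "\<dots> = (\<Sum>p\<in>P. \<Sum>q\<in>Q. \<Sum>a\<in>A. \<Sum>b\<in>B. t a b p q)" by (rule sum_swap3)
  also have "\<dots> = (\<Sum>p\<in>P. \<Sum>q\<in>Q. c p q * (\<Sum>a\<in>A. f a p * u a) * (\<Sum>b\<in>B. g b q * v b))"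
    by (intro sum.cong refl) (simp add: t_def sum_product sum_distrib_left mult_ac)
  finally show ?thesis .
qed

lemma sample_entry_polynomial:
  assumes n: "n < L" "m < L" and r: "r > 0"
  shows "sample_entry (\<lambda>x y. \<Sum>p<L. \<Sum>q<L. C p q * x ^ p * cnj y ^ q) L r n m = C n m"
proof -
  have *: "(\<Sum>b<L. cnj (root_point L r b) ^ q * cnj (dft_weight L r m b)) = (if q = m then 1 else 0)" if "q < L" for q
    using arg_cong[OF dft_weight_orthogonal[OF that n(2) r], of cnj] by (simp split: if_splits)
  have "sample_entry (\<lambda>x y. \<Sum>p<L. \<Sum>q<L. C p q * x ^ p * cnj y ^ q) L r n m = (\<Sum>p<L. \<Sum>q<L. C p q * (if p = n then 1 else 0) * (if q = m then 1 else 0))"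
    unfolding sample_entry_def bilinear_sum_swap using n r by (intro sum.cong refl) (simp add: dft_weight_orthogonal *)
  also have "\<dots> = (\<Sum>p<L. if p = n then C p m else 0)"
  proof (rule sum.cong[OF refl])
    fix p show "(\<Sum>q<L. C p q * (if p = n then 1 else 0) * (if q = m then 1 else 0)) = (if p = n then C p m else 0)"
      using n by (subst sum.remove[of _ m]) (auto intro!: sum.neutral)
  qed
  finally show ?thesis using n by simp
qed

text \<open>With \<open>2 * D + 1\<close> sample points the Taylor section is reproduced exactly.
  Its remainder is of order \<open>r ^ (2 * D + 1)\<close>, while the weights lose
  \<open>r ^ (n + m)\<close> with \<open>n + m \<le> 2 * D\<close>; one power of \<open>r\<close> is
  left. The radii start at \<open>1 / 4\<close>, where the expansion becomes valid.\<close>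

lemma caratheodory_sample_limit:
  fixes g :: "complex \<Rightarrow> complex"
  assumes g: "\<And>\<zeta>. cmod \<zeta> < 1 \<Longrightarrow> (\<lambda>n. a n * \<zeta> ^ n) sums g \<zeta>" and nm: "n \<le> D" "m \<le> D"
  shows "(\<lambda>j. sample_entry (\<lambda>x y. (g x + cnj (g y)) / (1 - x * cnj y)) (Suc (2 * D)) (1 / (real j + 4)) n m) \<longlonglongrightarrow> toeplitz_seq a (int n - int m)"
proof -
  define S where "S x y = (g x + cnj (g y)) / (1 - x * cnj y)" for x y
  define P where "P x y = (\<Sum>p<Suc (2 * D). \<Sum>q<Suc (2 * D). toeplitz_seq a (int p - int q) * x ^ p * cnj y ^ q)" for x y
  obtain C where C: "\<And>r \<zeta> \<omega>. 0 < r \<Longrightarrow> r \<le> 1 / 4 \<Longrightarrow> cmod \<zeta> = r \<Longrightarrow> cmod \<omega> = r \<Longrightarrow> cmod (S \<zeta> \<omega> - P \<zeta> \<omega>) \<le> C * r ^ Suc (2 * D)"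
    using caratheodory_kernel_expansion[OF g, where M="2 * D"] unfolding S_def P_def by blast
  define r where "r j = 1 / (real j + 4)" for j
  have r: "0 < r j" "r j \<le> 1/4" for j by (auto simp: r_def)
  have P: "sample_entry P (Suc (2 * D)) (r j) n m = toeplitz_seq a (int n - int m)" for j
    unfolding P_def using nm r by (intro sample_entry_polynomial) auto
  have le: "cmod (sample_entry S (Suc (2 * D)) (r j) n m - toeplitz_seq a (int n - int m)) \<le> \<bar>C\<bar> * r j" for j
  proof -
    have "cmod (sample_entry S (Suc (2 * D)) (r j) n m - sample_entry P (Suc (2 * D)) (r j) n m) \<le> C * r j ^ Suc (2 * D) / r j ^ (n + m)"
      unfolding sample_entry_diff by (intro sample_entry_bound C r) auto
    also have "\<dots> \<le> \<bar>C\<bar> * r j ^ Suc (2 * D) / r j ^ (n + m)"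
      using r[of j] by (intro divide_right_mono mult_right_mono) auto
    also have "\<dots> = \<bar>C\<bar> * r j ^ (Suc (2 * D) - (n + m))" using nm r[of j] by (simp add: power_diff)
    also have "\<dots> \<le> \<bar>C\<bar> * r j ^ 1" using nm r[of j] by (intro mult_left_mono power_decreasing) auto
    finally show ?thesis unfolding P by simp
  qed
  have "(\<lambda>j. \<bar>C\<bar> * r j) \<longlonglongrightarrow> 0"
  proof -
    have "(\<lambda>j. 1 / (real j + 4)) \<longlonglongrightarrow> 0" by real_asymp
    then show ?thesis unfolding r_def by (rule tendsto_mult_right_zero)
  qed
  then have "(\<lambda>j. sample_entry S (Suc (2 * D)) (r j) n m - toeplitz_seq a (int n - int m)) \<longlonglongrightarrow> 0"
    by (rule Lim_null_comparison[rotated]) (use le in auto)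
  then have "(\<lambda>j. sample_entry S (Suc (2 * D)) (r j) n m) \<longlonglongrightarrow> toeplitz_seq a (int n - int m)" by (simp add: LIM_zero_iff)
  then show ?thesis unfolding S_def r_def .
qed

section \<open>Growth of generalized Nevanlinna functions\<close>

definition cay :: "complex \<Rightarrow> complex" where "cay \<zeta> = \<i> * (1 + \<zeta>) / (1 - \<zeta>)"

lemma cay_upper: "cmod \<zeta> < 1 \<Longrightarrow> cay \<zeta> \<in> upper_halfplane"
proof -
  assume z: "cmod \<zeta> < 1"
  then have "\<zeta> \<noteq> 1" by auto
  then have "cay \<zeta> = \<i> * ((1 + \<zeta>) * cnj (1 - \<zeta>)) / of_real ((cmod (1 - \<zeta>))\<^sup>2)"
    unfolding cay_def complex_norm_square by simp
  moreover have "Re ((1 + \<zeta>) * cnj (1 - \<zeta>)) = 1 - (cmod \<zeta>)\<^sup>2"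
    unfolding cmod_power2 by (simp add: algebra_simps power2_eq_square)
  ultimately have "Im (cay \<zeta>) = (1 - (cmod \<zeta>)\<^sup>2) / (cmod (1 - \<zeta>))\<^sup>2"
    by (simp add: Im_divide_of_real del: of_real_power)
  moreover have "(cmod \<zeta>)\<^sup>2 < 1" using z by (simp add: power_less_one_iff abs_square_less_1)
  ultimately show ?thesis using \<open>\<zeta> \<noteq> 1\<close> by (simp add: upper_halfplane_def)
qed

text \<open>The kernels on the half-plane and on the disc differ by the factor
  \<open>(1 - \<zeta>) * (1 - cnj \<omega>) / 2\<close>, a diagonal congruence, which leaves the
  signature unchanged.\<close>

lemma cay_kernel:
  assumes "cmod \<zeta> < 1" "cmod \<omega> < 1"
  shows "\<i> * X / (cay \<zeta> - cnj (cay \<omega>)) = X / (1 - \<zeta> * cnj \<omega>) * ((1 - \<zeta>) * (1 - cnj \<omega>) / 2)"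
proof -
  have n: "1 - \<zeta> \<noteq> 0" "1 - cnj \<omega> \<noteq> 0"
    using assms by (metis complex_mod_cnj eq_iff_diff_eq_0 less_irrefl norm_one)+
  have "cmod (\<zeta> * cnj \<omega>) < 1" unfolding norm_mult complex_mod_cnj
    using mult_strict_mono'[OF assms] by simp
  then have n2: "1 - \<zeta> * cnj \<omega> \<noteq> 0" by auto
  have "cay \<zeta> - cnj (cay \<omega>) = 2 * \<i> * (1 - \<zeta> * cnj \<omega>) / ((1 - \<zeta>) * (1 - cnj \<omega>))"
    unfolding cay_def using n by (simp add: field_simps)
  then show ?thesis using n n2 by (simp add: field_simps)
qed

lemma sample_form:
  fixes D L :: nat and r :: real and p :: "complex poly"
  defines "u \<equiv> \<lambda>b. \<Sum>n\<le>D. cnj (coeff p n) * cnj (dft_weight L r n b)"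
  shows "(\<Sum>a<L. \<Sum>b<L. S (root_point L r a) (root_point L r b) * u b * cnj (u a)) =
    (\<Sum>n\<le>D. \<Sum>m\<le>D. sample_entry S L r n m * coeff p n * cnj (coeff p m))"
  unfolding sample_entry_def bilinear_sum_swap by (simp add: u_def mult_ac)

lemma bounded_coordinates_subsequence:
  fixes \<alpha> :: "nat \<Rightarrow> nat \<Rightarrow> complex"
  assumes "\<And>q i. i < N \<Longrightarrow> cmod (\<alpha> q i) \<le> K"
  shows "\<exists>r l. strict_mono r \<and> (\<forall>i<N. (\<lambda>q. \<alpha> (r q) i) \<longlonglongrightarrow> l i)"
  using assms
proof (induction N)
  case (Suc N)
  then obtain r l where r: "strict_mono r" "\<And>i. i < N \<Longrightarrow> (\<lambda>q. \<alpha> (r q) i) \<longlonglongrightarrow> l i" by (metis less_SucI)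
  have "bounded (range (\<lambda>q. \<alpha> (r q) N))" using Suc.prems unfolding bounded_iff by auto
  then obtain l' r' where r': "strict_mono r'" "((\<lambda>q. \<alpha> (r q) N) \<circ> r') \<longlonglongrightarrow> l'"
    using bounded_imp_convergent_subsequence by blast
  have "(\<lambda>q. \<alpha> ((r \<circ> r') q) i) \<longlonglongrightarrow> (l(N := l')) i" if "i < Suc N" for i
    using LIMSEQ_subseq_LIMSEQ[OF r(2) r'(1), of i] r'(2) that by (cases "i = N") (auto simp: o_def)
  then show ?case using strict_mono_o[OF r(1) r'(1)] by blast
qed (auto intro: exI[of _ id] simp: strict_mono_def)

text \<open>
  The Cayley transform turns the matrices of the Nevanlinna class at equidistributed points of a small circle
  into samples of the Caratheodory kernel. As the radius tends to \<open>0\<close>, normalized vectors with nonnegative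
  form converge along a subsequence.
\<close>
lemma nevanlinna_neg_squares:
  assumes F: "F \<in> nevanlinna_class k"
    and g: "\<And>\<zeta>. cmod \<zeta> < 1 \<Longrightarrow> (\<lambda>n. a n * \<zeta> ^ n) sums F (cay \<zeta>)"
  shows "neg_squares_le (toeplitz_seq a) k"
  unfolding neg_squares_le_def
proof
  fix x :: "nat \<Rightarrow> complex poly"
  let ?c = "toeplitz_seq a"
  define D where "D = (\<Sum>l\<le>k. Polynomial.degree (x l))"
  define L where "L = Suc (2 * D)"
  define S where "S = (\<lambda>x y. (F (cay x) + cnj (F (cay y))) / (1 - x * cnj y))"
  define P where "P \<alpha> = (\<Sum>i\<le>k. Polynomial.smult (\<alpha> i) (x i))" for \<alpha>
  have dP: "Polynomial.degree (P \<alpha>) \<le> D" for \<alpha>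
    unfolding P_def
  proof (rule degree_sum_le)
    fix i assume "i \<in> {..k}"
    then have "Polynomial.degree (x i) \<le> D" unfolding D_def by (intro member_le_sum) auto
    then show "Polynomial.degree (Polynomial.smult (\<alpha> i) (x i)) \<le> D" using degree_smult_le order_trans by blast
  qed simp
  define Q where "Q r \<alpha> = (\<Sum>n\<le>D. \<Sum>m\<le>D. sample_entry S L r n m * coeff (P \<alpha>) n * cnj (coeff (P \<alpha>) m))" for r \<alpha>
  define rj where "rj q = 1 / (real q + 4)" for q :: nat
  have "\<exists>\<alpha>. (\<Sum>i\<le>k. cmod (\<alpha> i)) = 1 \<and> 0 \<le> Re (Q (rj q) \<alpha>)" for q
  proof -
    define r where "r = rj q"
    have r: "0 < r" "r \<le> 1/4" by (auto simp: r_def rj_def)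
    define z where "z = root_point L r"
    have z1: "cmod (z a) < 1" for a using r by (simp add: z_def root_point_def norm_mult)
    have zi: "1 - z a \<noteq> 0" for a using z1[of a] by (metis eq_iff_diff_eq_0 less_irrefl norm_one)
    then have z0: "1 - cnj (z a) \<noteq> 0" for a by (metis complex_cnj_cnj complex_cnj_diff complex_cnj_one complex_cnj_zero)
    define u where "u p b = (\<Sum>n\<le>D. cnj (coeff p n) * cnj (dft_weight L r n b))" for p :: "complex poly" and b
    define A where "A = mat L L (\<lambda>(n, m). \<i> * (F (cay (z n)) + cnj (F (cay (z m)))) / (cay (z n) - cnj (cay (z m))))"
    have Ae: "A $$ (n, m) = S (z n) (z m) * ((1 - z n) * (1 - cnj (z m)) / 2)" if "n < L" "m < L" for n m
      using that unfolding A_def S_def by (simp add: cay_kernel[OF z1 z1])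
    have "num_neg_eigenvalues A \<le> k"
    proof -
      have "\<forall>n<L. cay (z n) \<in> upper_halfplane" using cay_upper z1 by auto
      then show ?thesis using F unfolding nevanlinna_class_def A_def
        by (auto elim!: allE[of _ L] allE[of _ "\<lambda>n. cay (z n)"])
    qed
    moreover have "A \<in> carrier_mat L L" by (simp add: A_def)
    moreover have "A $$ (j, i) = cnj (A $$ (i, j))" if "i < L" "j < L" for i j
      using that by (simp add: Ae S_def add.commute mult.commute)
    \<comment> \<open>The vectors are divided by \<open>1 - cnj (z m)\<close> to cancel the diagonal
      factors of \<open>A\<close>, so that the kernel of the disc is tested.\<close>
    ultimately obtain \<beta> where \<beta>: "\<exists>j\<le>k. \<beta> j \<noteq> 0"
      "0 \<le> Re (\<Sum>i<L. \<Sum>m<L. A $$ (i,m) * (\<Sum>j\<le>k. \<beta> j * (u (x j) m / (1 - cnj (z m)))) * cnj (\<Sum>j\<le>k. \<beta> j * (u (x j) i / (1 - cnj (z i)))))"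
      using num_neg_eigenvalues_nonneg_direction[of A L k "\<lambda>j m. u (x j) m / (1 - cnj (z m))"] by blast
    define s where "s = (\<Sum>i\<le>k. cmod (\<beta> i))"
    have s: "s > 0" unfolding s_def using \<beta>(1) by (auto intro!: sum_pos2)
    \<comment> \<open>Conjugated, because \<open>u\<close> is conjugate linear in the polynomial;
      normalized, so that the coefficients cannot all tend to 0.\<close>
    define \<alpha> where "\<alpha> i = cnj (\<beta> i) / of_real s" for i
    have "cmod (\<alpha> i) = cmod (\<beta> i) / s" for i using s by (simp add: \<alpha>_def norm_divide)
    then have \<alpha>1: "(\<Sum>i\<le>k. cmod (\<alpha> i)) = 1" using s by (simp add: s_def[symmetric] flip: sum_divide_distrib)
    have \<beta>\<alpha>: "\<beta> j = of_real s * cnj (\<alpha> j)" for j using s by (simp add: \<alpha>_def)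
    have lin: "(\<Sum>j\<le>k. \<beta> j * (u (x j) m / (1 - cnj (z m)))) = of_real s * u (P \<alpha>) m / (1 - cnj (z m))" for m
    proof -
      have "u (P \<alpha>) m = (\<Sum>n\<le>D. \<Sum>j\<le>k. cnj (\<alpha> j) * (cnj (coeff (x j) n) * cnj (dft_weight L r n m)))"
        unfolding u_def P_def by (simp add: coeff_sum sum_distrib_right mult.assoc)
      also have "\<dots> = (\<Sum>j\<le>k. cnj (\<alpha> j) * u (x j) m)"
        unfolding u_def by (subst sum.swap) (simp add: sum_distrib_left)
      finally show ?thesis unfolding \<beta>\<alpha> by (simp add: sum_distrib_left sum_divide_distrib mult.assoc)
    qed
    have gen: "f * (p * q / 2) * (of_real s * U / q) * cnj (of_real s * V / cnj p) = of_real (s\<^sup>2 / 2) * (f * U * cnj V)"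
      if "p \<noteq> 0" "q \<noteq> 0" for f p q U V :: complex using that by (simp add: field_simps power2_eq_square)
    have "(\<Sum>i<L. \<Sum>m<L. A $$ (i,m) * (\<Sum>j\<le>k. \<beta> j * (u (x j) m / (1 - cnj (z m)))) * cnj (\<Sum>j\<le>k. \<beta> j * (u (x j) i / (1 - cnj (z i))))) =
      of_real (s\<^sup>2 / 2) * (\<Sum>i<L. \<Sum>m<L. S (z i) (z m) * u (P \<alpha>) m * cnj (u (P \<alpha>) i))"
      unfolding lin sum_distrib_left
    proof (intro sum.cong refl)
      fix i m assume "i \<in> {..<L}" "m \<in> {..<L}"
      then show "A $$ (i,m) * (of_real s * u (P \<alpha>) m / (1 - cnj (z m))) * cnj (of_real s * u (P \<alpha>) i / (1 - cnj (z i))) =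
          of_real (s\<^sup>2 / 2) * (S (z i) (z m) * u (P \<alpha>) m * cnj (u (P \<alpha>) i))"
        using gen[OF zi z0, of "S (z i) (z m)" i m "u (P \<alpha>) m" "u (P \<alpha>) i"] by (simp add: Ae)
    qed
    also have "(\<Sum>i<L. \<Sum>m<L. S (z i) (z m) * u (P \<alpha>) m * cnj (u (P \<alpha>) i)) = Q r \<alpha>"
      unfolding Q_def z_def u_def by (rule sample_form)
    finally have "0 \<le> s\<^sup>2 / 2 * Re (Q r \<alpha>)" using \<beta>(2) by (simp only: Re_complex_of_real times_complex.sel Im_complex_of_real)
    then have "0 \<le> Re (Q r \<alpha>)" using s by (simp add: zero_le_mult_iff zero_le_divide_iff)
    with \<alpha>1 show ?thesis unfolding r_def by blast
  qed
  then obtain \<alpha> where \<alpha>: "\<And>q. (\<Sum>i\<le>k. cmod (\<alpha> q i)) = 1" "\<And>q. 0 \<le> Re (Q (rj q) (\<alpha> q))" by metis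
  have "cmod (\<alpha> q i) \<le> 1" if "i < Suc k" for q i
    using member_le_sum[of i "{..k}" "\<lambda>i. cmod (\<alpha> q i)"] \<alpha>(1)[of q] that by simp
  from bounded_coordinates_subsequence[of "Suc k" \<alpha> 1, OF this] obtain t l where t: "strict_mono t" and "\<forall>i<Suc k. (\<lambda>q. \<alpha> (t q) i) \<longlonglongrightarrow> l i" by blast
  then have l: "(\<lambda>q. \<alpha> (t q) i) \<longlonglongrightarrow> l i" if "i \<in> {..k}" for i using that by simp
  have "(\<lambda>q. \<Sum>i\<le>k. cmod (\<alpha> (t q) i)) \<longlonglongrightarrow> (\<Sum>i\<le>k. cmod (l i))" by (intro tendsto_intros l)
  then have "(\<Sum>i\<le>k. cmod (l i)) = 1" unfolding \<alpha>(1) by (simp add: LIMSEQ_const_iff)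
  then have l0: "\<exists>i\<le>k. l i \<noteq> 0" by (metis (no_types, lifting) atMost_iff norm_zero sum.neutral zero_neq_one)
  have se: "(\<lambda>q. sample_entry S L (rj (t q)) n m) \<longlonglongrightarrow> ?c (int n - int m)" if "n \<le> D" "m \<le> D" for n m
    using LIMSEQ_subseq_LIMSEQ[OF caratheodory_sample_limit[OF g that] t] unfolding S_def L_def rj_def o_def .
  have co: "(\<lambda>q. coeff (P (\<alpha> (t q))) n) \<longlonglongrightarrow> coeff (P l) n" for n
    unfolding P_def coeff_sum coeff_smult by (intro tendsto_intros l)
  have "(\<lambda>q. Q (rj (t q)) (\<alpha> (t q))) \<longlonglongrightarrow> tform ?c (P l) (P l)"
    unfolding Q_def tform_eq[OF dP dP] by (intro tendsto_intros se co) auto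
  then have "0 \<le> Re (tform ?c (P l) (P l))" by (rule LIMSEQ_le_const[OF tendsto_Re]) (use \<alpha>(2) in auto)
  with l0 show "\<exists>\<alpha>. (\<exists>i\<le>k. \<alpha> i \<noteq> 0) \<and> 0 \<le> Re (tform ?c (\<Sum>i\<le>k. Polynomial.smult (\<alpha> i) (x i)) (\<Sum>i\<le>k. Polynomial.smult (\<alpha> i) (x i)))"
    unfolding P_def by blast
qed

text \<open>The estimate in the disc is applied to the Taylor coefficients of \<open>F\<close>
  composed with the Cayley transform. If \<zeta> corresponds to \<open>z\<close>, then
  \<open>1 - (cmod \<zeta>)\<^sup>2\<close> is 4 divided by
  \<open>(cmod (z + \<i>))\<^sup>2 / Im z\<close>, so the latter measures the distance to the unit
  circle.\<close>

theorem nevanlinna_class_growth: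
  assumes F: "F \<in> nevanlinna_class k"
  shows "\<exists>C\<ge>0. \<forall>z. Im z > 0 \<longrightarrow> cmod (F z) \<le> C * ((cmod (z + \<i>))\<^sup>2 / Im z) ^ (2 * k + 1)"
proof -
  have holF: "F holomorphic_on upper_halfplane" using F by (simp add: nevanlinna_class_def)
  define g where "g \<zeta> = F (cay \<zeta>)" for \<zeta>
  have "cay holomorphic_on ball 0 1" unfolding cay_def[abs_def] by (intro holomorphic_intros) auto
  then have hol: "g holomorphic_on ball 0 1"
    unfolding g_def[abs_def] by (rule holomorphic_on_compose_gen[OF _ holF, unfolded o_def]) (auto simp: cay_upper)
  define a where "a n = (deriv ^^ n) g 0 / fact n" for n
  have g: "(\<lambda>n. a n * \<zeta> ^ n) sums g \<zeta>" if "cmod \<zeta> < 1" for \<zeta>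
    unfolding a_def using holomorphic_power_series[OF hol, of \<zeta>] that by simp
  let ?c = "toeplitz_seq a"
  have cn: "?c (int n) = (if n = 0 then of_real (2 * Re (a 0)) else a n)" for n by (simp add: toeplitz_seq_def)
  have "neg_squares_le ?c k" by (rule nevanlinna_neg_squares[OF F]) (use g in \<open>simp add: g_def\<close>)
  moreover have "summable (\<lambda>n. cmod (?c (int n)) * \<rho> ^ n)" if \<rho>: "0 \<le> \<rho>" "\<rho> < 1" for \<rho> :: real
  proof -
    define \<rho>' where "\<rho>' = (1 + \<rho>) / 2"
    have "cmod (complex_of_real \<rho>') < 1" using \<rho> unfolding norm_of_real \<rho>'_def by auto
    from sums_summable[OF g[OF this]] have "summable (\<lambda>n. a n * of_real \<rho>' ^ n)" .
    moreover have "cmod (complex_of_real \<rho>) < cmod (complex_of_real \<rho>')" using \<rho> unfolding norm_of_real \<rho>'_def by auto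
    ultimately have "summable (\<lambda>n. cmod (a n * of_real \<rho> ^ n))" by (rule powser_insidea)
    then have "summable (\<lambda>n. cmod (a n) * \<rho> ^ n)" using \<rho> by (simp add: norm_mult norm_power)
    then show ?thesis
      by (rule iffD1[OF summable_cong, rotated]) (auto simp: cn eventually_sequentially intro!: exI[of _ 1])
  qed
  ultimately obtain C where C: "\<And>\<zeta>. cmod \<zeta> < 1 \<Longrightarrow> cmod (\<Sum>n. ?c (int n) * \<zeta> ^ n) \<le> C / (1 - cmod \<zeta>) ^ (2 * k + 1)"
    using caratheodory_growth[of ?c k] toeplitz_seq_herm by blast
  \<comment> \<open>The Toeplitz sequence has \<open>a 0 + cnj (a 0)\<close> at 0 in place of
    \<open>a 0\<close>.\<close>
  have sumc: "(\<Sum>n. ?c (int n) * \<zeta> ^ n) = g \<zeta> + cnj (a 0)" if "cmod \<zeta> < 1" for \<zeta>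
  proof -
    have "(\<lambda>n. if n = 0 then cnj (a 0) else 0) sums cnj (a 0)" using sums_single[of 0 "\<lambda>_. cnj (a 0)"] by simp
    then have "(\<lambda>n. a n * \<zeta> ^ n + (if n = 0 then cnj (a 0) else 0)) sums (g \<zeta> + cnj (a 0))" by (intro sums_add g that)
    moreover have "(\<lambda>n. a n * \<zeta> ^ n + (if n = 0 then cnj (a 0) else 0)) = (\<lambda>n. ?c (int n) * \<zeta> ^ n)"
      using complex_add_cnj[of "a 0"] by (auto simp: cn fun_eq_iff)
    ultimately show ?thesis by (simp add: sums_iff)
  qed
  define K where "K = \<bar>C\<bar> + cmod (a 0)"
  have "cmod (F z) \<le> K * ((cmod (z + \<i>))\<^sup>2 / Im z) ^ (2 * k + 1)" if z: "Im z > 0" for z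
  proof -
    define \<zeta> where "\<zeta> = (z - \<i>) / (z + \<i>)"
    define Y where "Y = (cmod (z + \<i>))\<^sup>2 / Im z"
    have zi: "z + \<i> \<noteq> 0" using z by (auto simp: complex_eq_iff)
    have 1: "1 - (cmod \<zeta>)\<^sup>2 = 4 / Y"
    proof -
      have "(cmod \<zeta>)\<^sup>2 = (cmod (z - \<i>))\<^sup>2 / (cmod (z + \<i>))\<^sup>2" by (simp add: \<zeta>_def norm_divide power_divide)
      moreover have "(cmod (z + \<i>))\<^sup>2 - (cmod (z - \<i>))\<^sup>2 = 4 * Im z" unfolding cmod_power2 by (simp add: power2_eq_square algebra_simps)
      moreover have "1 - (cmod (z - \<i>))\<^sup>2 / (cmod (z + \<i>))\<^sup>2 = ((cmod (z + \<i>))\<^sup>2 - (cmod (z - \<i>))\<^sup>2) / (cmod (z + \<i>))\<^sup>2"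
        using zi by (simp add: diff_divide_distrib)
      ultimately show ?thesis by (simp add: Y_def)
    qed
    have Y4: "Y \<ge> 4"
    proof -
      have "(cmod (z + \<i>))\<^sup>2 - 4 * Im z = (cmod (z - \<i>))\<^sup>2" unfolding cmod_power2 by (simp add: power2_eq_square algebra_simps)
      then have "4 * Im z \<le> (cmod (z + \<i>))\<^sup>2" by (metis diff_ge_0_iff_ge zero_le_power2)
      then show ?thesis using z by (simp add: Y_def field_simps)
    qed
    then have "(cmod \<zeta>)\<^sup>2 < 1" using 1 by (metis add_0 diff_gt_0_iff_gt divide_pos_pos less_le_trans zero_less_numeral)
    then have \<zeta>1: "cmod \<zeta> < 1" by (simp add: abs_square_less_1)
    have cz: "cay \<zeta> = z"
    proof -
      have "1 + \<zeta> = 2 * z / (z + \<i>)" "1 - \<zeta> = 2 * \<i> / (z + \<i>)" unfolding \<zeta>_def using zi by (simp_all add: field_simps)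
      then show ?thesis unfolding cay_def using zi by simp
    qed
    have "1 - cmod \<zeta> \<ge> 2 / Y"
    proof -
      have "4 / Y = (1 - cmod \<zeta>) * (1 + cmod \<zeta>)" using 1 by (simp add: power2_eq_square algebra_simps)
      also have "\<dots> \<le> (1 - cmod \<zeta>) * 2" using \<zeta>1 by (intro mult_left_mono) auto
      finally show ?thesis by simp
    qed
    then have "1 - cmod \<zeta> \<ge> 1 / Y" using Y4 by (smt (verit) divide_right_mono)
    then have p: "(1 / Y) ^ (2 * k + 1) \<le> (1 - cmod \<zeta>) ^ (2 * k + 1)" using Y4 by (intro power_mono) auto
    have "cmod (g \<zeta>) \<le> cmod (g \<zeta> + cnj (a 0)) + cmod (a 0)"
      using norm_triangle_ineq4[of "g \<zeta> + cnj (a 0)" "cnj (a 0)"] by simp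
    also have "cmod (g \<zeta> + cnj (a 0)) \<le> C / (1 - cmod \<zeta>) ^ (2 * k + 1)" using C[OF \<zeta>1] sumc[OF \<zeta>1] by simp
    also have "\<dots> \<le> \<bar>C\<bar> / (1 / Y) ^ (2 * k + 1)"
      using p Y4 by (intro frac_le) auto
    also have "\<dots> = \<bar>C\<bar> * Y ^ (2 * k + 1)" by (simp only: power_one_over divide_divide_eq_right div_by_1)
    also have "cmod (a 0) \<le> cmod (a 0) * Y ^ (2 * k + 1)"
      using mult_left_mono[OF one_le_power[of Y "2 * k + 1"], of "cmod (a 0)"] Y4 by simp
    finally show ?thesis unfolding g_def cz Y_def[symmetric] by (simp add: K_def algebra_simps)
  qed
  moreover have "K \<ge> 0" by (simp add: K_def)
  ultimately show ?thesis by blast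
qed

section \<open>Almost periodic functions on the line and their means\<close>

text \<open>
  Bochner's characterization by totally bounded translates. Unlike the existence of translation numbers, it
  passes to sums and products directly.
\<close>
definition bohr_ap :: "(real \<Rightarrow> complex) \<Rightarrow> bool" where
  "bohr_ap f \<longleftrightarrow> continuous_on UNIV f \<and>
     (\<forall>e>0. \<exists>N. finite N \<and> (\<forall>t. \<exists>s\<in>N. \<forall>x. cmod (f (x + t) - f (x + s)) \<le> e))"

lemma bohr_ap_continuous: "bohr_ap f \<Longrightarrow> continuous_on S f"
  unfolding bohr_ap_def using continuous_on_subset by blast

lemma bohr_ap_net:
  assumes "bohr_ap f" "e > 0"
  obtains N where "finite N" "\<And>t. \<exists>s\<in>N. \<forall>x. cmod (f (x + t) - f (x + s)) \<le> e"
  using assms unfolding bohr_ap_def by blast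

lemma bohr_ap_bounded:
  assumes "bohr_ap f"
  obtains M where "M > 0" "\<And>x. cmod (f x) \<le> M"
proof -
  obtain N where N: "finite N" "\<And>t. \<exists>s\<in>N. \<forall>x. cmod (f (x + t) - f (x + s)) \<le> 1"
    using bohr_ap_net[OF assms, of 1] by auto
  define M where "M = 1 + (\<Sum>s\<in>N. cmod (f s))"
  have "cmod (f x) \<le> M" for x
  proof -
    obtain s where s: "s \<in> N" "\<forall>y. cmod (f (y + x) - f (y + s)) \<le> 1" using N(2) by blast
    have "cmod (f (0 + x) - f (0 + s)) \<le> 1" using s(2) by blast
    moreover have "cmod (f s) \<le> (\<Sum>s\<in>N. cmod (f s))"
      using s(1) N(1) by (intro member_le_sum) auto
    moreover have "cmod (f x) \<le> cmod (f x - f s) + cmod (f s)"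
      using norm_triangle_ineq[of "f x - f s" "f s"] by simp
    ultimately show ?thesis by (simp add: M_def)
  qed
  moreover have "M > 0" unfolding M_def by (intro add_pos_nonneg sum_nonneg) auto
  ultimately show ?thesis using that by blast
qed

text \<open>Every translate is close to one of finitely many, so continuity at the finitely many net
  points is already uniform.\<close>

lemma bohr_ap_uniformly_continuous:
  assumes "bohr_ap f" "e > 0"
  obtains d where "d > 0" "\<And>x y. \<bar>x - y\<bar> < d \<Longrightarrow> cmod (f x - f y) \<le> e"
proof -
  obtain N where N: "finite N" "\<And>t. \<exists>s\<in>N. \<forall>x. cmod (f (x + t) - f (x + s)) \<le> e / 3"
    using bohr_ap_net[OF assms(1), of "e / 3"] assms(2) by auto
  have "\<forall>s\<in>N. \<exists>d>0. \<forall>x. \<bar>x\<bar> < d \<longrightarrow> cmod (f (x + s) - f s) \<le> e / 3"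
  proof
    fix s assume "s \<in> N"
    have "isCont f s" using assms(1) by (simp add: bohr_ap_def continuous_on_eq_continuous_at)
    then obtain d where d: "d > 0" "\<And>x. dist x s < d \<Longrightarrow> dist (f x) (f s) < e / 3"
      using assms(2) unfolding continuous_at_eps_delta by (metis divide_pos_pos zero_less_numeral)
    then show "\<exists>d>0. \<forall>x. \<bar>x\<bar> < d \<longrightarrow> cmod (f (x + s) - f s) \<le> e / 3"
      by (intro exI[of _ d]) (auto simp: dist_norm intro: less_imp_le)
  qed
  then obtain d where d: "\<And>s. s \<in> N \<Longrightarrow> d s > 0"
    "\<And>s x. s \<in> N \<Longrightarrow> \<bar>x\<bar> < d s \<Longrightarrow> cmod (f (x + s) - f s) \<le> e / 3" by metis
  define D where "D = Min (insert 1 (d ` N))"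
  have D: "D > 0" "\<And>s. s \<in> N \<Longrightarrow> D \<le> d s" using N(1) d(1) by (auto simp: D_def)
  have "cmod (f x - f y) \<le> e" if "\<bar>x - y\<bar> < D" for x y
  proof -
    obtain s where s: "s \<in> N" "\<forall>x. cmod (f (x + y) - f (x + s)) \<le> e / 3" using N(2) by blast
    have "cmod (f (x - y + y) - f (x - y + s)) \<le> e / 3" "cmod (f (0 + y) - f (0 + s)) \<le> e / 3"
      using s(2) by blast+
    moreover have "cmod (f (x - y + s) - f s) \<le> e / 3" using d(2)[OF s(1)] D(2)[OF s(1)] that by auto
    moreover have "cmod (f x - f y) = cmod ((f (x - y + y) - f (x - y + s)) + (f (x - y + s) - f s) - (f (0 + y) - f (0 + s)))"
      by simp
    ultimately show ?thesis
      using norm_triangle_ineq4[of "(f (x - y + y) - f (x - y + s)) + (f (x - y + s) - f s)" "f (0 + y) - f (0 + s)"]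
        norm_triangle_ineq[of "f (x - y + y) - f (x - y + s)" "f (x - y + s) - f s"] by linarith
  qed
  with D that show ?thesis by blast
qed

text \<open>All net points lie in \<open>{-B..B}\<close>, so the difference between
  \<open>a + B\<close> and the net point of the translate by \<open>a + B\<close> is a translation
  number in a window of length \<open>2 * B\<close>.\<close>

lemma bohr_ap_translation:
  assumes "bohr_ap f" "e > 0"
  obtains l where "l > 0" "\<And>a. \<exists>\<tau>\<in>{a..a + l}. \<forall>x. cmod (f (x + \<tau>) - f x) \<le> e"
proof -
  obtain N where N: "finite N" "\<And>t. \<exists>s\<in>N. \<forall>x. cmod (f (x + t) - f (x + s)) \<le> e"
    using bohr_ap_net[OF assms] by auto
  define B where "B = 1 + (\<Sum>s\<in>N. \<bar>s\<bar>)"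
  have B: "\<bar>s\<bar> \<le> B" if "s \<in> N" for s
    using member_le_sum[of s N "\<lambda>s. \<bar>s\<bar>"] that N(1) by (auto simp: B_def)
  have "B > 0" unfolding B_def by (intro add_pos_nonneg sum_nonneg) auto
  moreover have "\<exists>\<tau>\<in>{a..a + 2 * B}. \<forall>x. cmod (f (x + \<tau>) - f x) \<le> e" for a
  proof -
    obtain s where s: "s \<in> N" "\<forall>x. cmod (f (x + (a + B)) - f (x + s)) \<le> e" using N(2) by blast
    have "cmod (f (x + (a + B - s)) - f x) \<le> e" for x
      using s(2)[rule_format, of "x - s"] by (simp add: algebra_simps)
    then show ?thesis using B[OF s(1)] by (intro bexI[of _ "a + B - s"]) auto
  qed
  ultimately show ?thesis using that[of "2 * B"] by auto
qed

lemma bohr_ap_common_net: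
  assumes "bohr_ap f" "bohr_ap g" "e > 0"
  obtains N where "finite N" "\<And>t. \<exists>s\<in>N. \<forall>x. cmod (f (x + t) - f (x + s)) \<le> e \<and> cmod (g (x + t) - g (x + s)) \<le> e"
proof -
  obtain N1 where N1: "finite N1" "\<And>t. \<exists>s\<in>N1. \<forall>x. cmod (f (x + t) - f (x + s)) \<le> e / 2"
    using bohr_ap_net[OF assms(1), of "e / 2"] assms(3) by auto
  obtain N2 where N2: "finite N2" "\<And>t. \<exists>s\<in>N2. \<forall>x. cmod (g (x + t) - g (x + s)) \<le> e / 2"
    using bohr_ap_net[OF assms(2), of "e / 2"] assms(3) by auto
  define P where "P t s \<longleftrightarrow> (\<forall>x. cmod (f (x + t) - f (x + fst s)) \<le> e / 2 \<and> cmod (g (x + t) - g (x + snd s)) \<le> e / 2)" for t s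
  \<comment> \<open>A pair of net points need not come from a single translate; each pair that is
    hit is represented by one translate near both. This doubles the error, hence
    \<open>e / 2\<close> above.\<close>
  define r where "r s = (SOME t. P t s)" for s
  show ?thesis
  proof (rule that)
    show "finite (r ` (N1 \<times> N2))" using N1 N2 by auto
    fix t
    obtain s1 s2 where s: "s1 \<in> N1" "s2 \<in> N2" "P t (s1, s2)" unfolding P_def using N1(2) N2(2) by (metis fst_conv snd_conv)
    then have "P (r (s1, s2)) (s1, s2)" unfolding r_def by (metis someI)
    with s(3) have "cmod (f (x + t) - f (x + r (s1, s2))) \<le> e \<and> cmod (g (x + t) - g (x + r (s1, s2))) \<le> e" for x
      unfolding P_def fst_conv snd_conv
      by (smt (verit, best) field_sum_of_halves norm_minus_commute norm_triangle_sub norm_diff_triangle_le)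
    with s show "\<exists>s\<in>r ` (N1 \<times> N2). \<forall>x. cmod (f (x + t) - f (x + s)) \<le> e \<and> cmod (g (x + t) - g (x + s)) \<le> e" by blast
  qed
qed

lemma bohr_ap_add:
  assumes "bohr_ap f" "bohr_ap g" shows "bohr_ap (\<lambda>x. f x + g x)"
  unfolding bohr_ap_def
proof (intro conjI allI impI)
  show "continuous_on UNIV (\<lambda>x. f x + g x)"
    by (intro continuous_intros bohr_ap_continuous assms)
  fix e :: real assume e: "e > 0"
  obtain N where N: "finite N" "\<And>t. \<exists>s\<in>N. \<forall>x. cmod (f (x + t) - f (x + s)) \<le> e/2 \<and> cmod (g (x + t) - g (x + s)) \<le> e/2"
    using bohr_ap_common_net[OF assms, of "e/2"] e by auto
  have "\<exists>s\<in>N. \<forall>x. cmod (f (x + t) + g (x + t) - (f (x + s) + g (x + s))) \<le> e" for t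
  proof -
    obtain s where s: "s \<in> N" "\<And>x. cmod (f (x + t) - f (x + s)) \<le> e/2" "\<And>x. cmod (g (x + t) - g (x + s)) \<le> e/2"
      using N(2) by metis
    have "cmod (f (x + t) + g (x + t) - (f (x + s) + g (x + s))) \<le> e" for x
      using norm_triangle_ineq[of "f (x + t) - f (x + s)" "g (x + t) - g (x + s)"] s(2,3)[of x]
      by (simp add: algebra_simps)
    with s(1) show ?thesis by blast
  qed
  with N(1) show "\<exists>N. finite N \<and> (\<forall>t. \<exists>s\<in>N. \<forall>x. cmod (f (x + t) + g (x + t) - (f (x + s) + g (x + s))) \<le> e)" by blast
qed

lemma bohr_ap_mult:
  assumes "bohr_ap f" "bohr_ap g" shows "bohr_ap (\<lambda>x. f x * g x)"
  unfolding bohr_ap_def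
proof (intro conjI allI impI)
  show "continuous_on UNIV (\<lambda>x. f x * g x)"
    by (intro continuous_intros bohr_ap_continuous assms)
  fix e :: real assume e: "e > 0"
  obtain A where A: "A > 0" "\<And>x. cmod (f x) \<le> A" using bohr_ap_bounded[OF assms(1)] by blast
  obtain B where B: "B > 0" "\<And>x. cmod (g x) \<le> B" using bohr_ap_bounded[OF assms(2)] by blast
  define d where "d = e / (A + B)"
  have d: "d > 0" using e A B by (simp add: d_def)
  obtain N where N: "finite N" "\<And>t. \<exists>s\<in>N. \<forall>x. cmod (f (x + t) - f (x + s)) \<le> d \<and> cmod (g (x + t) - g (x + s)) \<le> d"
    using bohr_ap_common_net[OF assms d] by auto
  have "\<exists>s\<in>N. \<forall>x. cmod (f (x + t) * g (x + t) - (f (x + s) * g (x + s))) \<le> e" for t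
  proof -
    obtain s where s: "s \<in> N" "\<And>x. cmod (f (x + t) - f (x + s)) \<le> d" "\<And>x. cmod (g (x + t) - g (x + s)) \<le> d"
      using N(2) by metis
    have "cmod (f (x + t) * g (x + t) - (f (x + s) * g (x + s))) \<le> e" for x
    proof -
      have "f (x + t) * g (x + t) - (f (x + s) * g (x + s)) =
         f (x + t) * (g (x + t) - g (x + s)) + (f (x + t) - f (x + s)) * g (x + s)"
        by (simp add: algebra_simps)
      also have "cmod \<dots> \<le> A * d + d * B"
        by (intro norm_triangle_mono) (auto simp: norm_mult intro!: mult_mono A B s less_imp_le[OF A(1)] less_imp_le[OF d])
      also have "A * d + d * B = d * (A + B)" by (simp add: algebra_simps)
      also have "\<dots> = e" using A B by (simp add: d_def)
      finally show ?thesis .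
    qed
    with s(1) show ?thesis by blast
  qed
  with N(1) show "\<exists>N. finite N \<and> (\<forall>t. \<exists>s\<in>N. \<forall>x. cmod (f (x + t) * g (x + t) - (f (x + s) * g (x + s))) \<le> e)" by blast
qed

lemma bohr_ap_const: "bohr_ap (\<lambda>_. c)"
  unfolding bohr_ap_def by (auto intro!: exI[of _ "{0}"])

lemma bohr_ap_cis: "bohr_ap (\<lambda>x. cis (\<nu> * x))"
  unfolding bohr_ap_def
proof (intro conjI allI impI)
  show "continuous_on UNIV (\<lambda>x. cis (\<nu> * x))" by (intro continuous_intros)
  fix e :: real assume e: "e > 0"
  have "compact (sphere (0::complex) 1)" by simp
  then obtain k where k: "finite k" "sphere (0::complex) 1 \<subseteq> (\<Union>x\<in>k. ball x (e/2))"
    using e unfolding compact_eq_totally_bounded by (metis half_gt_zero)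
  define r where "r c = (SOME t. cis (\<nu> * t) \<in> ball c (e/2))" for c
  have "\<exists>s\<in>r ` k. \<forall>x. cmod (cis (\<nu> * (x + t)) - cis (\<nu> * (x + s))) \<le> e" for t
  proof -
    have "cis (\<nu> * t) \<in> sphere 0 1" by simp
    then obtain c where c: "c \<in> k" "cis (\<nu> * t) \<in> ball c (e/2)" using k(2) by blast
    then have "cis (\<nu> * r c) \<in> ball c (e/2)" unfolding r_def by (metis someI)
    with c(2) have d: "cmod (cis (\<nu> * t) - cis (\<nu> * r c)) \<le> e"
      unfolding mem_ball dist_norm by norm
    have "cmod (cis (\<nu> * (x + t)) - cis (\<nu> * (x + r c))) \<le> e" for x
    proof -
      have "cis (\<nu> * (x + t)) - cis (\<nu> * (x + r c)) = cis (\<nu> * x) * (cis (\<nu> * t) - cis (\<nu> * r c))"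
        by (simp add: distrib_left cis_mult right_diff_distrib)
      then show ?thesis using d by (simp add: norm_mult)
    qed
    with c(1) show ?thesis by blast
  qed
  with k(1) show "\<exists>N. finite N \<and> (\<forall>t. \<exists>s\<in>N. \<forall>x. cmod (cis (\<nu> * (x + t)) - cis (\<nu> * (x + s))) \<le> e)"
    by (intro exI[of _ "r ` k"]) auto
qed

lemma bohr_ap_sum: "finite A \<Longrightarrow> (\<And>i. i \<in> A \<Longrightarrow> bohr_ap (f i)) \<Longrightarrow> bohr_ap (\<lambda>x. \<Sum>i\<in>A. f i x)"
  by (induction A rule: finite_induct) (auto intro: bohr_ap_const bohr_ap_add)

lemma bohr_ap_uniform_limit:
  assumes "\<And>e. e > 0 \<Longrightarrow> \<exists>g. bohr_ap g \<and> (\<forall>x. cmod (f x - g x) \<le> e)"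
  shows "bohr_ap f"
  unfolding bohr_ap_def
proof (intro conjI allI impI)
  have "\<forall>n::nat. \<exists>g. bohr_ap g \<and> (\<forall>x. cmod (f x - g x) \<le> 1 / Suc n)" using assms by auto
  then obtain g where g: "\<And>n. bohr_ap (g n)" "\<And>n x. cmod (f x - g n x) \<le> 1 / Suc n" by metis
  have "uniform_limit UNIV g f sequentially"
  proof (rule uniform_limitI)
    fix e :: real assume e: "e > 0"
    have "(\<lambda>n. 1 / real (Suc n)) \<longlonglongrightarrow> 0" by (rule LIMSEQ_Suc[OF lim_1_over_n, unfolded o_def])
    then have "\<forall>\<^sub>F n in sequentially. 1 / real (Suc n) < e" using e order_tendstoD(2) by blast
    then show "\<forall>\<^sub>F n in sequentially. \<forall>x\<in>UNIV. dist (g n x) (f x) < e"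
      by eventually_elim (use g(2) in \<open>auto simp: dist_norm norm_minus_commute intro: le_less_trans\<close>)
  qed
  then show "continuous_on UNIV f"
    by (rule uniform_limit_theorem[rotated]) (auto intro!: always_eventually bohr_ap_continuous g)
  fix e :: real assume e: "e > 0"
  obtain h where h: "bohr_ap h" "\<And>x. cmod (f x - h x) \<le> e/3" using assms[of "e/3"] e by auto
  obtain N where N: "finite N" "\<And>t. \<exists>s\<in>N. \<forall>x. cmod (h (x + t) - h (x + s)) \<le> e/3"
    using bohr_ap_net[OF h(1), of "e/3"] e by auto
  have "\<exists>s\<in>N. \<forall>x. cmod (f (x + t) - f (x + s)) \<le> e" for t
  proof -
    obtain s where s: "s \<in> N" "\<And>x. cmod (h (x + t) - h (x + s)) \<le> e/3" using N(2) by metis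
    have "cmod (f (x + t) - f (x + s)) \<le> e" for x
      using s(2)[of x] h(2)[of "x + t"] h(2)[of "x + s"] by norm
    with s(1) show ?thesis by blast
  qed
  with N(1) show "\<exists>N. finite N \<and> (\<forall>t. \<exists>s\<in>N. \<forall>x. cmod (f (x + t) - f (x + s)) \<le> e)" by blast
qed

text \<open>The mean is uniform in the position \<open>a\<close> of the window; the block
  decompositions and convolutions below depend on this.\<close>

definition ap_mean :: "(real \<Rightarrow> complex) \<Rightarrow> complex \<Rightarrow> bool" where
  "ap_mean f L \<longleftrightarrow> (\<forall>e>0. \<exists>T0>0. \<forall>T\<ge>T0. \<forall>a. cmod (integral {a..a+T} f - of_real T * L) \<le> e * T)"

lemma integral_window_shift_bound:
  fixes f :: "real \<Rightarrow> complex"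
  assumes f: "continuous_on UNIV f" and M: "\<And>x. cmod (f x) \<le> M" and T: "T \<ge> 0"
  shows "cmod (integral {a..a+T} f - integral {b..b+T} f) \<le> 2 * M * \<bar>a - b\<bar>"
proof -
  have int: "f integrable_on {x..y}" for x y
    by (intro integrable_continuous_real continuous_on_subset[OF f]) auto
  have main: "cmod (integral {a..a+T} f - integral {b..b+T} f) \<le> 2 * M * (b - a)" if "a \<le> b" for a b
  proof -
    have "integral {a..a+T} f + integral {a+T..b+T} f = integral {a..b+T} f"
      by (rule Henstock_Kurzweil_Integration.integral_combine) (use that T int in auto)
    then have 1: "integral {a..a+T} f = integral {a..b+T} f - integral {a+T..b+T} f" by (simp add: eq_diff_eq)
    have "integral {a..b} f + integral {b..b+T} f = integral {a..b+T} f"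
      by (rule Henstock_Kurzweil_Integration.integral_combine) (use that T int in auto)
    then have 2: "integral {b..b+T} f = integral {a..b+T} f - integral {a..b} f" by (simp add: eq_diff_eq add.commute)
    have "integral {a..a+T} f - integral {b..b+T} f = integral {a..b} f - integral {a+T..b+T} f"
      unfolding 1 2 by simp
    also have "cmod \<dots> \<le> cmod (integral {a..b} f) + cmod (integral {a+T..b+T} f)" by (rule norm_triangle_ineq4)
    also have "\<dots> \<le> M * (b - a) + M * (b + T - (a + T))"
      by (intro add_mono integral_bound continuous_on_subset[OF f]) (use that M in auto)
    finally show ?thesis by (simp add: algebra_simps)
  qed
  show ?thesis
  proof (cases "a \<le> b")
    case True then show ?thesis using main[of a b] by simp
  next
    case False then show ?thesis using main[of b a] by (simp add: norm_minus_commute)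
  qed
qed

lemma integral_shift_real:
  fixes f :: "real \<Rightarrow> complex"
  assumes "continuous_on UNIV f"
  shows "integral {a..b} (\<lambda>x. f (x + c)) = integral {a + c..b + c} f"
  using integral_shift[of a c b f] continuous_on_subset[OF assms] by (simp add: o_def)

text \<open>A translation number moves the second window to within \<open>l\<close> of the first.
  The displacement costs \<open>2 * M * l\<close>, at most \<open>e / 2 * T\<close> for
  \<open>T \<ge> T0\<close>, and the change of \<open>f\<close> another
  \<open>e / 2 * T\<close>.\<close>

lemma bohr_ap_window_difference:
  assumes f: "bohr_ap f" and e: "e > 0"
  obtains T0 where "T0 > 0" "\<And>T a b. T \<ge> T0 \<Longrightarrow> cmod (integral {a..a+T} f - integral {b..b+T} f) \<le> e * T"
proof -
  have cont: "continuous_on UNIV f" using f by (simp add: bohr_ap_def)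
  obtain M where M: "M > 0" "\<And>x. cmod (f x) \<le> M" using bohr_ap_bounded[OF f] by blast
  obtain l where l: "l > 0" "\<And>a. \<exists>\<tau>\<in>{a..a + l}. \<forall>x. cmod (f (x + \<tau>) - f x) \<le> e/2"
    using bohr_ap_translation[OF f, of "e/2"] e by auto
  define T0 where "T0 = 4 * M * l / e"
  have T0: "T0 > 0" using M l e by (simp add: T0_def)
  have "cmod (integral {a..a+T} f - integral {b..b+T} f) \<le> e * T" if T: "T \<ge> T0" for T a b
  proof -
    obtain \<tau> where \<tau>: "\<tau> \<in> {a-b..a-b+l}" "\<And>x. cmod (f (x + \<tau>) - f x) \<le> e/2" using l(2) by blast
    have T': "T \<ge> 0" using T T0 by simp
    have "cmod (integral {a..a+T} f - integral {b+\<tau>..b+\<tau>+T} f) \<le> 2 * M * \<bar>a - (b + \<tau>)\<bar>"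
      by (rule integral_window_shift_bound[OF cont M(2) T'])
    also have "\<dots> \<le> 2 * M * l" using \<tau>(1) M(1) by (intro mult_left_mono) auto
    also have "\<dots> \<le> e/2 * T" using T e unfolding T0_def by (simp add: field_simps)
    finally have 1: "cmod (integral {a..a+T} f - integral {b+\<tau>..b+\<tau>+T} f) \<le> e/2 * T" .
    have "integral {b+\<tau>..b+\<tau>+T} f - integral {b..b+T} f = integral {b..b+T} (\<lambda>x. f (x + \<tau>) - f x)"
    proof -
      have "integral {b+\<tau>..b+\<tau>+T} f = integral {b..b+T} (\<lambda>x. f (x + \<tau>))"
        using integral_shift_real[OF cont, of b "b+T" \<tau>] by (simp add: algebra_simps)
      then show ?thesis
        by (simp, intro integral_diff[symmetric] integrable_continuous_real continuous_intros
          continuous_on_compose2[OF cont] continuous_on_subset[OF cont]) auto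
    qed
    also have "cmod \<dots> \<le> e/2 * (b + T - b)"
      by (intro integral_bound continuous_intros continuous_on_compose2[OF cont] continuous_on_subset[OF cont])
         (use T' \<tau>(2) in auto)
    finally have "cmod (integral {b+\<tau>..b+\<tau>+T} f - integral {b..b+T} f) \<le> e/2 * T" by simp
    with 1 have "cmod (integral {a..a+T} f - integral {b..b+T} f) \<le> e/2 * T + e/2 * T"
      by (rule norm_diff_triangle_le)
    then show ?thesis by (simp add: mult_ac)
  qed
  with T0 that show ?thesis by blast
qed

text \<open>The double average \<open>m S T\<close>, over windows of length \<open>T\<close> that
  start in \<open>{0..S}\<close>, is symmetric by Fubini. Window differences show it to be close to
  every average of length \<open>T\<close>, hence also to every average of length \<open>S\<close>;
  so the averages are Cauchy, uniformly in the position.\<close>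

lemma bohr_ap_mean_exists:
  assumes f: "bohr_ap f"
  shows "\<exists>L. ap_mean f L"
proof -
  have cont: "continuous_on UNIV f" using f by (simp add: bohr_ap_def)
  obtain M where M: "M > 0" "\<And>x. cmod (f x) \<le> M" using bohr_ap_bounded[OF f] by blast
  define A where "A a T = integral {a..a+T} f" for a T
  have contA: "continuous_on S (\<lambda>a. A a T)" if "T \<ge> 0" for S T
  proof (rule continuous_onI)
    fix x e :: real assume e: "e > 0"
    show "\<exists>d>0. \<forall>x'\<in>S. dist x' x < d \<longrightarrow> dist (A x' T) (A x T) \<le> e"
    proof (intro exI[of _ "e / (2 * M)"] conjI ballI impI)
      fix x' assume "dist x' x < e / (2 * M)"
      then have "2 * M * \<bar>x' - x\<bar> \<le> e" using M(1) by (simp add: dist_norm field_simps)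
      then show "dist (A x' T) (A x T) \<le> e"
        using integral_window_shift_bound[OF cont M(2) that, of x' x] by (simp add: A_def dist_norm)
    qed (use e M in auto)
  qed
  have swap: "integral {0..S} (\<lambda>x. A x T) = integral {0..T} (\<lambda>x. A x S)" if "S \<ge> 0" "T \<ge> 0" for S T
  proof -
    have "A x T = integral {0..T} (\<lambda>u. f (u + x))" for x T
      using integral_shift_real[OF cont, of 0 T x] by (simp add: A_def add.commute)
    moreover have "integral (cbox 0 S) (\<lambda>x. integral (cbox 0 T) (\<lambda>u. f (u + x))) =
        integral (cbox 0 T) (\<lambda>u. integral (cbox 0 S) (\<lambda>x. f (u + x)))"
      by (rule integral_swap_continuous) (auto simp: split_def intro!: continuous_intros continuous_on_compose2[OF cont])
    ultimately show ?thesis by (simp add: add.commute)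
  qed
  have close: "\<exists>T0>0. \<forall>T\<ge>T0. \<forall>S\<ge>T0. \<forall>a b. cmod (A a T / of_real T - A b S / of_real S) \<le> e" if e: "e > 0" for e
  proof -
    obtain T0 where T0: "T0 > 0" "\<And>T a b. T \<ge> T0 \<Longrightarrow> cmod (A a T - A b T) \<le> e/2 * T"
      using bohr_ap_window_difference[OF f, of "e/2"] e unfolding A_def by auto
    define m where "m S T = integral {0..S} (\<lambda>x. A x T) / of_real (S * T)" for S T
    have main: "cmod (A a T / of_real T - m S T) \<le> e/2" if T: "T \<ge> T0" and S: "S \<ge> T0" for S T a
    proof -
      have pos: "T > 0" "S > 0" using T S T0(1) by auto
      have "integral {0..S} (\<lambda>x. A x T) - of_real S * A a T = integral {0..S} (\<lambda>x. A x T - A a T)"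
        using pos by (subst integral_diff) (auto intro!: integrable_continuous_real contA simp: scaleR_conv_of_real)
      also have "cmod \<dots> \<le> e/2 * T * (S - 0)"
        by (intro integral_bound continuous_intros contA) (use T pos T0 in auto)
      finally have "cmod (integral {0..S} (\<lambda>x. A x T) - of_real S * A a T) / (S * T) \<le> e/2" using pos by (simp add: pos_divide_le_eq mult_ac)
      moreover have "A a T / of_real T - m S T = - ((integral {0..S} (\<lambda>x. A x T) - of_real S * A a T) / of_real (S * T))"
        using pos by (simp add: m_def field_simps)
      ultimately show ?thesis using pos by (simp add: norm_divide norm_mult)
    qed
    have "cmod (A a T / of_real T - A b S / of_real S) \<le> e" if "T \<ge> T0" "S \<ge> T0" for S T a b
    proof -
      have "m T S = m S T" using swap[of S T] that T0(1) by (simp add: m_def mult.commute)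
      then have "cmod (A a T / of_real T - A b S / of_real S) \<le> e/2 + e/2"
        using main[OF that, of a] main[OF that(2,1), of b] by (metis norm_diff_triangle_le norm_minus_commute)
      then show ?thesis by simp
    qed
    with T0(1) show ?thesis by blast
  qed
  define q where "q n = A 0 (real n) / of_real (real n)" for n :: nat
  have "Cauchy q"
  proof (rule metric_CauchyI)
    fix e :: real assume "e > 0"
    then obtain T0 where T0: "\<And>T S a b. T \<ge> T0 \<Longrightarrow> S \<ge> T0 \<Longrightarrow> cmod (A a T / of_real T - A b S / of_real S) \<le> e/2"
      using close[OF half_gt_zero] by blast
    show "\<exists>N. \<forall>m\<ge>N. \<forall>n\<ge>N. dist (q m) (q n) < e"
    proof (intro exI[of _ "nat \<lceil>T0\<rceil>"] allI impI)
      fix m n assume "m \<ge> nat \<lceil>T0\<rceil>" "n \<ge> nat \<lceil>T0\<rceil>"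
      then have "real m \<ge> T0" "real n \<ge> T0" by linarith+
      from T0[OF this, of 0 0] \<open>e > 0\<close> show "dist (q m) (q n) < e" by (simp add: q_def dist_norm)
    qed
  qed
  then obtain L where L: "q \<longlonglongrightarrow> L" using Cauchy_convergent_iff convergent_def by blast
  have "ap_mean f L"
    unfolding ap_mean_def
  proof (intro allI impI)
    fix e :: real assume e: "e > 0"
    obtain T0 where T0: "T0 > 0" "\<And>T S a b. T \<ge> T0 \<Longrightarrow> S \<ge> T0 \<Longrightarrow> cmod (A a T / of_real T - A b S / of_real S) \<le> e"
      using close[OF e] by blast
    have "cmod (A a T - of_real T * L) \<le> e * T" if T: "T \<ge> T0" for T a
    proof -
      have Tp: "T > 0" using T T0 by auto
      have qe: "cmod (A a T / of_real T - q n) \<le> e" if "n \<ge> nat \<lceil>T0\<rceil>" for n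
        using T0(2)[OF T, of "real n" a 0] that by (simp add: q_def nat_le_iff ceiling_le_iff)
      have "(\<lambda>n. cmod (A a T / of_real T - q n)) \<longlonglongrightarrow> cmod (A a T / of_real T - L)" by (intro tendsto_intros L)
      then have "cmod (A a T / of_real T - L) \<le> e"
        by (rule Lim_bounded[of _ _ "nat \<lceil>T0\<rceil>"]) (use qe in blast)
      moreover have "A a T - of_real T * L = of_real T * (A a T / of_real T - L)" using Tp by (simp add: field_simps)
      ultimately show ?thesis using Tp by (simp add: norm_mult mult.commute)
    qed
    then show "\<exists>T0>0. \<forall>T\<ge>T0. \<forall>a. cmod (integral {a..a+T} f - of_real T * L) \<le> e * T"
      using T0(1) unfolding A_def by blast
  qed
  then show ?thesis ..
qed

section \<open>Gaussian weights and autocorrelations\<close>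

lemma measurable_cis [measurable (raw)]:
  "f \<in> borel_measurable M \<Longrightarrow> (\<lambda>x. cis (f x)) \<in> borel_measurable M"
  using measurable_compose[of f M borel cis borel]
  by (simp add: borel_measurable_continuous_onI continuous_on_cis)

lemma measurable_cnj [measurable (raw)]:
  "f \<in> borel_measurable M \<Longrightarrow> (\<lambda>x. cnj (f x)) \<in> borel_measurable M"
  using measurable_compose[of f M borel cnj borel]
  by (simp add: borel_measurable_continuous_onI continuous_on_cnj)

lemma gaussian_integral:
  "integrable lborel (\<lambda>h. exp (- (h\<^sup>2) / 2) :: real)"
  "(LBINT h. exp (- (h\<^sup>2) / 2)) = sqrt (2 * pi)"
proof -
  have eq: "(\<lambda>h. exp (- (h\<^sup>2) / 2)) = (\<lambda>h. sqrt (2 * pi) * std_normal_density h)"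
    by (auto simp: std_normal_density_def)
  show "integrable lborel (\<lambda>h. exp (- (h\<^sup>2) / 2) :: real)" unfolding eq by (intro integrable_mult_right) simp
  show "(LBINT h. exp (- (h\<^sup>2) / 2)) = sqrt (2 * pi)" unfolding eq by simp
qed

lemma gaussian_integral_scaled:
  assumes "b > 0"
  shows "integrable lborel (\<lambda>y. exp (- (((x - y) * b)\<^sup>2) / 2) :: real)"
    and "(LBINT y. exp (- (((x - y) * b)\<^sup>2) / 2)) = sqrt (2 * pi) / b"
proof -
  have eq: "(\<lambda>h. exp (- (((x - (x + 1 / b * h)) * b)\<^sup>2) / 2)) = (\<lambda>h. exp (- (h\<^sup>2) / 2) :: real)"
    using assms by (simp add: power2_eq_square)
  show "integrable lborel (\<lambda>y. exp (- (((x - y) * b)\<^sup>2) / 2) :: real)"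
    using lborel_integrable_real_affine_iff[of "1/b" "\<lambda>y. exp (- (((x - y) * b)\<^sup>2) / 2)" x] assms gaussian_integral(1)
    unfolding eq by simp
  show "(LBINT y. exp (- (((x - y) * b)\<^sup>2) / 2)) = sqrt (2 * pi) / b"
    using lborel_integral_real_affine[of "1/b" "\<lambda>y. exp (- (((x - y) * b)\<^sup>2) / 2)" x] assms gaussian_integral(2)
    unfolding eq by simp
qed

text \<open>Used with the normal distribution, with Lebesgue measure on a window and with weighted
  variations in the role of \<open>M\<close>.\<close>

lemma Fubini_bounded_kernel:
  fixes v :: "real \<Rightarrow> complex" and K :: "real \<Rightarrow> real \<Rightarrow> complex"
  assumes "finite_measure M" and [measurable_cong]: "sets M = sets borel" and v: "integrable lborel v"
    and K[measurable]: "(\<lambda>(l, x). K l x) \<in> borel_measurable (borel \<Otimes>\<^sub>M borel)"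
    and B: "\<And>l x. cmod (K l x) \<le> B"
  shows "(LINT l|M. LINT x|lborel. v x * K l x) = (LBINT x. v x * (LINT l|M. K l x))"
proof -
  interpret M: finite_measure M by fact
  interpret P: pair_sigma_finite M lborel ..
  have [measurable]: "v \<in> borel_measurable borel" using v by auto
  have B0: "B \<ge> 0" using B[of 0 0] norm_ge_zero order_trans by blast
  have int2: "integrable lborel (\<lambda>x. v x * K l x)" for l
    by (rule Bochner_Integration.integrable_bound[of _ "\<lambda>x. of_real B * v x"])
       (use v B B0 in \<open>auto intro!: integrable_mult_right simp: norm_mult mult_mono mult.commute[of B]\<close>)
  have "integrable (M \<Otimes>\<^sub>M lborel) (\<lambda>(l, x). v x * K l x)"
  proof (rule P.Fubini_integrable)
    show "(\<lambda>(l, x). v x * K l x) \<in> borel_measurable (M \<Otimes>\<^sub>M lborel)" by measurable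
    show "integrable M (\<lambda>l. LBINT x. norm (case (l, x) of (l, x) \<Rightarrow> v x * K l x))"
    proof (rule M.integrable_const_bound[of _ "B * (LBINT x. norm (v x))"])
      show "AE l in M. norm (LBINT x. norm (case (l, x) of (l, x) \<Rightarrow> v x * K l x)) \<le> B * (LBINT x. norm (v x))"
      proof (rule AE_I2)
        fix l
        have "(LBINT x. norm (v x * K l x)) \<le> (LBINT x. B * norm (v x))"
          by (intro integral_mono integrable_norm int2 integrable_mult_right v)
             (auto simp: norm_mult mult.commute[of _ "cmod (K _ _)"] intro!: mult_right_mono B)
        then show "norm (LBINT x. norm (case (l, x) of (l, x) \<Rightarrow> v x * K l x)) \<le> B * (LBINT x. norm (v x))"
          by simp
      qed
    qed measurable
    show "AE l in M. integrable lborel (\<lambda>x. case (l, x) of (l, x) \<Rightarrow> v x * K l x)"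
      using int2 by simp
  qed
  then have "(LINT l|M. LINT x|lborel. v x * K l x) = (LBINT x. LINT l|M. v x * K l x)"
    by (rule P.Fubini_integral[symmetric])
  then show ?thesis by simp
qed

text \<open>Two exchanges of integrals turn the Gaussian average of exponentials into the
  characteristic function of the normal distribution. Large \<open>b\<close> makes the weight on the
  left wide and the kernel on the right narrow.\<close>

lemma gaussian_quadratic_form:
  fixes v :: "real \<Rightarrow> complex"
  assumes v: "integrable lborel v"
  defines "V \<equiv> \<lambda>l. LBINT x. v x * cis (- (l * x))"
  shows "(LINT l|std_normal_distribution. V (l * b) * cnj (V (l * b))) =
    (LBINT x. v x * (LBINT y. cnj (v y) * of_real (exp (- (((x - y) * b)\<^sup>2) / 2))))"
proof -
  let ?N = std_normal_distribution
  interpret N: real_distribution ?N by (rule real_dist_normal_dist)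
  have vm[measurable]: "v \<in> borel_measurable borel" using v by auto
  define A where "A = (LBINT x. norm (v x))"
  have A: "cmod (V l) \<le> A" for l
  proof -
    have "cmod (V l) \<le> (LBINT x. norm (v x * cis (- (l * x))))"
      unfolding V_def by (rule integral_norm_bound)
    then show ?thesis by (simp add: A_def norm_mult)
  qed
  have Vm[measurable]: "V \<in> borel_measurable borel" unfolding V_def by measurable
  have "(LINT l|?N. V (l * b) * cnj (V (l * b))) =
      (LINT l|?N. LINT x|lborel. v x * (cis (- (l * b * x)) * cnj (V (l * b))))"
    by (subst (1) V_def) (simp add: mult.assoc integral_mult_left_zero[symmetric] del: integral_mult_left_zero)
  also have "\<dots> = (LBINT x. v x * (LINT l|?N. cis (- (l * b * x)) * cnj (V (l * b))))"
    by (rule Fubini_bounded_kernel[where B = A]) (use A N.finite_measure_axioms v in \<open>auto simp: norm_mult\<close>)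
  also have "\<dots> = (LBINT x. v x * (LBINT y. cnj (v y) * of_real (exp (- (((x - y) * b)\<^sup>2) / 2))))"
  proof (rule Bochner_Integration.integral_cong[OF refl], rule arg_cong2[where f = "(*)", OF refl])
    fix x
    have "(LINT l|?N. cis (- (l * b * x)) * cnj (V (l * b))) =
        (LINT l|?N. LINT y|lborel. cnj (v y) * (cis (l * (b * (y - x)))))"
    proof (intro Bochner_Integration.integral_cong refl)
      fix l
      have "cis (- (l * b * x)) * cnj (V (l * b)) = cis (- (l * b * x)) * (LBINT y. cnj (v y) * cis (l * b * y))"
        unfolding V_def by (subst Bochner_Integration.integral_cnj[symmetric]) (simp add: cis_cnj del: Bochner_Integration.integral_cnj)
      also have "\<dots> = (LBINT y. cis (- (l * b * x)) * (cnj (v y) * cis (l * b * y)))"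
        by (rule integral_mult_right_zero[symmetric])
      also have "\<dots> = (LBINT y. cnj (v y) * (cis (l * (b * (y - x)))))"
      proof (intro Bochner_Integration.integral_cong refl)
        fix y
        have "cis (l * (b * (y - x))) = cis (- (l * b * x)) * cis (l * b * y)"
          by (simp add: cis_mult algebra_simps)
        then show "cis (- (l * b * x)) * (cnj (v y) * cis (l * b * y)) = cnj (v y) * (cis (l * (b * (y - x))))"
          by (simp add: mult_ac)
      qed
      finally show "cis (- (l * b * x)) * cnj (V (l * b)) = (LBINT y. cnj (v y) * (cis (l * (b * (y - x)))))" .
    qed
    also have "\<dots> = (LBINT y. cnj (v y) * (LINT l|?N. cis (l * (b * (y - x)))))"
      by (rule Fubini_bounded_kernel[where B = 1]) (use N.finite_measure_axioms v in auto)
    also have "\<dots> = (LBINT y. cnj (v y) * of_real (exp (- (((x - y) * b)\<^sup>2) / 2)))"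
    proof (intro Bochner_Integration.integral_cong refl arg_cong2[where f = "(*)"])
      fix y
      have "(LINT l|?N. cis (l * (b * (y - x)))) = char ?N (b * (y - x))"
        unfolding char_def by (simp add: cis_conv_exp mult_ac)
      also have "\<dots> = of_real (exp (- ((b * (y - x))\<^sup>2) / 2))" by (simp add: char_std_normal_distribution)
      also have "(b * (y - x))\<^sup>2 = ((x - y) * b)\<^sup>2" by (simp add: power2_eq_square algebra_simps)
      finally show "(LINT l|?N. cis (l * (b * (y - x)))) = of_real (exp (- (((x - y) * b)\<^sup>2) / 2))" .
    qed
    finally show "(LINT l|?N. cis (- (l * b * x)) * cnj (V (l * b))) = (LBINT y. cnj (v y) * of_real (exp (- (((x - y) * b)\<^sup>2) / 2)))" .
  qed
  finally show ?thesis .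
qed

lemma integrable_bounded_support:
  fixes u :: "real \<Rightarrow> complex"
  assumes [measurable]: "u \<in> borel_measurable borel" and "\<And>x. cmod (u x) \<le> M" "\<And>x. x \<notin> {a..b} \<Longrightarrow> u x = 0" "a \<le> b"
  shows "integrable lborel u" "cmod (LBINT x. u x) \<le> M * (b - a)"
proof -
  have le: "cmod (u x) \<le> M * indicator {a..b} x" for x
    using assms(2,3)[of x] by (auto simp: indicator_def)
  have int: "integrable lborel (\<lambda>x. M * indicator {a..b} x)"
    by (intro integrable_mult_right integrable_real_indicator) (auto simp: emeasure_lborel_Icc_eq)
  show u: "integrable lborel u"
  proof (rule Bochner_Integration.integrable_bound[OF int])
    show "AE x in lborel. norm (u x) \<le> norm (M * indicator {a..b} x)"
      by (intro AE_I2 order_trans[OF le]) simp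
  qed auto
  have "(LBINT x. cmod (u x)) \<le> (LBINT x. M * indicator {a..b} x)"
    by (intro integral_mono integrable_norm u int le)
  also have "\<dots> = M * (b - a)" using assms(4) by simp
  finally show "cmod (LBINT x. u x) \<le> M * (b - a)" using integral_norm_bound[of lborel u] by linarith
qed

text \<open>The convolution theorem for \<open>u\<close> and its conjugate reflection; bounded
  support makes the joint integrand integrable.\<close>

lemma autocorrelation_transform:
  fixes u :: "real \<Rightarrow> complex"
  assumes [measurable]: "u \<in> borel_measurable borel" and M: "\<And>x. cmod (u x) \<le> M"
    and supp: "\<And>x. x \<notin> {0..T} \<Longrightarrow> u x = 0" and T: "T > 0"
  shows "(LBINT r. (LBINT y. u (y + r) * cnj (u y)) * cis (- (l * r))) =
    (LBINT x. u x * cis (- (l * x))) * cnj (LBINT x. u x * cis (- (l * x)))"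
proof -
  have M0: "M \<ge> 0" using M[of 0] norm_ge_zero order_trans by blast
  let ?f = "\<lambda>r y. u (y + r) * cnj (u y) * cis (- (l * r))"
  have int: "integrable (lborel \<Otimes>\<^sub>M lborel) (\<lambda>(r, y). ?f r y)"
  proof (rule Bochner_Integration.integrable_bound[of _ "\<lambda>z. M * M * indicator ({-T..T} \<times> {0..T}) z"])
    have "emeasure (lborel \<Otimes>\<^sub>M lborel) ({-T..T} \<times> {0..T}) < \<infinity>"
      using T by (subst lborel.emeasure_pair_measure_Times) (auto simp: ennreal_mult_less_top)
    then show "integrable (lborel \<Otimes>\<^sub>M lborel) (\<lambda>z. M * M * indicator ({-T..T} \<times> {0..T}) z)"
      by (intro integrable_mult_right integrable_real_indicator) auto
    show "AE z in lborel \<Otimes>\<^sub>M lborel. norm (case z of (r, y) \<Rightarrow> ?f r y) \<le> norm (M * M * indicator ({-T..T} \<times> {0..T}) z)"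
    proof (rule AE_I2, clarify)
      fix r y :: real
      have "cmod (u (y + r)) * cmod (u y) \<le> M * M" by (intro mult_mono M M0) auto
      moreover have "u (y + r) * cnj (u y) = 0" if "(r, y) \<notin> {-T..T} \<times> {0..T}"
        using supp[of y] supp[of "y + r"] that by force
      ultimately show "norm (?f r y) \<le> norm (M * M * indicator ({-T..T} \<times> {0..T}) (r, y))"
        using M0 by (cases "(r, y) \<in> {-T..T} \<times> {0..T}") (auto simp: norm_mult)
    qed
  qed measurable
  have shift: "(LBINT r. ?f r y) = cnj (u y) * cis (l * y) * (LBINT x. u x * cis (- (l * x)))" for y
  proof -
    have "(LBINT x. u x * cis (- (l * x))) = (LBINT r. u (y + r) * cis (- (l * (y + r))))"
      using lborel_integral_real_affine[of 1 "\<lambda>x. u x * cis (- (l * x))" y] by simp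
    then have "cnj (u y) * cis (l * y) * (LBINT x. u x * cis (- (l * x))) =
       (LBINT r. cnj (u y) * cis (l * y) * (u (y + r) * cis (- (l * (y + r)))))" by simp
    also have "\<dots> = (LBINT r. ?f r y)"
    proof (intro Bochner_Integration.integral_cong refl)
      fix r
      have "cis (- (l * r)) = cis (l * y) * cis (- (l * (y + r)))" by (simp add: cis_mult algebra_simps)
      then show "cnj (u y) * cis (l * y) * (u (y + r) * cis (- (l * (y + r)))) = ?f r y" by (simp add: mult_ac)
    qed
    finally show ?thesis ..
  qed
  have "(LBINT r. (LBINT y. u (y + r) * cnj (u y)) * cis (- (l * r))) = (LBINT r. LBINT y. ?f r y)"
    by simp
  also have "\<dots> = (LBINT y. LBINT r. ?f r y)"
    by (rule lborel_pair.Fubini_integral[symmetric, OF int])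
  also have "\<dots> = (LBINT y. cnj (u y) * cis (l * y)) * (LBINT x. u x * cis (- (l * x)))"
    unfolding shift by simp
  also have "(LBINT y. cnj (u y) * cis (l * y)) = cnj (LBINT x. u x * cis (- (l * x)))"
    by (subst Bochner_Integration.integral_cnj[symmetric]) (simp add: cis_cnj del: Bochner_Integration.integral_cnj)
  finally show ?thesis by (simp add: mult.commute)
qed

text \<open>
  Since the Fourier transform of \<open>c\<close> is the square of the modulus of that of \<open>u\<close>, this is Plancherel's theorem for \<open>c\<close>
  and for \<open>u\<close>, here obtained by integrating against wide Gaussian weights.
\<close>
lemma autocorrelation_L2_bound:
  fixes f :: "real \<Rightarrow> complex"
  assumes f: "continuous_on UNIV f" and M: "\<And>x. cmod (f x) \<le> M" and T: "T > 0"
  defines "u \<equiv> \<lambda>x. indicator {0..T} x * f x"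
  defines "c \<equiv> \<lambda>r. LBINT y. u (y + r) * cnj (u y)"
  assumes s: "\<And>l. cmod (LBINT x. u x * cis (- (l * x))) \<le> s"
  shows "continuous_on UNIV c" "\<And>r. r \<notin> {-T..T} \<Longrightarrow> c r = 0"
    "(LBINT r. (cmod (c r))\<^sup>2) \<le> s\<^sup>2 * M\<^sup>2 * T"
proof -
  have [measurable]: "f \<in> borel_measurable borel" by (rule borel_measurable_continuous_onI[OF f])
  have um[measurable]: "u \<in> borel_measurable borel" unfolding u_def by measurable
  have M0: "M \<ge> 0" using M[of 0] norm_ge_zero order_trans by blast
  have uM: "cmod (u x) \<le> M" for x using M M0 by (auto simp: u_def indicator_def)
  have us: "u x = 0" if "x \<notin> {0..T}" for x using that by (simp add: u_def)
  have uu: "cmod (u (y + r) * cnj (u y)) \<le> M * M * indicator {0..T} y" for y r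
    using mult_mono[OF uM[of "y + r"] uM[of y]] M0 us[of y] by (auto simp: norm_mult indicator_def)
  have uint: "integrable lborel (\<lambda>y. M * M * indicator {0..T} y)"
    by (intro integrable_mult_right integrable_real_indicator) (auto simp: emeasure_lborel_Icc_eq)
  \<comment> \<open>\<open>u\<close> may jump at 0 and \<open>T\<close>. For each shift these are
    two points, a null set, so dominated convergence still gives continuity of the
    autocorrelation.\<close>
  have cont_u: "isCont u z" if "z \<noteq> 0" "z \<noteq> T" for z
  proof -
    have "continuous_on {0<..<T} u" by (rule continuous_on_eq[OF continuous_on_subset[OF f subset_UNIV]]) (simp add: u_def)
    moreover have "continuous_on (- {0..T}) u" by (rule continuous_on_eq[OF continuous_on_const[of _ 0]]) (simp add: u_def)
    ultimately have "continuous_on ({0<..<T} \<union> - {0..T}) u" by (intro continuous_on_open_Un) auto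
    moreover have "open ({0<..<T} \<union> - {0..T})" by (intro open_Un open_greaterThanLessThan open_Compl closed_atLeastAtMost)
    moreover have "z \<in> {0<..<T} \<union> - {0..T}" using that by auto
    ultimately show ?thesis by (simp add: continuous_on_eq_continuous_at)
  qed
  show contc: "continuous_on UNIV c"
    unfolding continuous_on_sequentially
  proof (clarsimp simp: o_def)
    fix x r assume xr: "x \<longlonglongrightarrow> (r::real)"
    show "(\<lambda>n. c (x n)) \<longlonglongrightarrow> c r"
      unfolding c_def
    proof (rule integral_dominated_convergence[where w = "\<lambda>y. M * M * indicator {0..T} y"])
      show "AE y in lborel. (\<lambda>n. u (y + x n) * cnj (u y)) \<longlonglongrightarrow> u (y + r) * cnj (u y)"
      proof (rule AE_I')
        have "countable {- r, T - r}" by simp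
        then show "{- r, T - r} \<in> null_sets lborel" by (rule countable_imp_null_set_lborel)
        have "(\<lambda>n. u (y + x n) * cnj (u y)) \<longlonglongrightarrow> u (y + r) * cnj (u y)" if "y \<notin> {- r, T - r}" for y
        proof -
          have "isCont u (y + r)" using that by (intro cont_u) (simp_all add: eq_neg_iff_add_eq_0 eq_diff_eq)
          then show ?thesis by (intro tendsto_intros isCont_tendsto_compose[of "y + r" u] xr)
        qed
        then show "{y \<in> space lborel. \<not> (\<lambda>n. u (y + x n) * cnj (u y)) \<longlonglongrightarrow> u (y + r) * cnj (u y)} \<subseteq> {- r, T - r}" by blast
      qed
    qed (use uint uu in auto)
  qed
  have cm[measurable]: "c \<in> borel_measurable borel" by (rule borel_measurable_continuous_onI[OF contc])
  show cs: "c r = 0" if "r \<notin> {-T..T}" for r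
  proof -
    have "u (y + r) * cnj (u y) = 0" for y using us[of y] us[of "y + r"] that by force
    then show ?thesis unfolding c_def by (simp only: Bochner_Integration.integral_zero)
  qed
  have cM: "cmod (c r) \<le> M * M * T" for r
  proof -
    have "cmod (c r) \<le> M * M * (T - 0)"
      unfolding c_def by (rule integrable_bounded_support(2))
        (use T uu[of _ r] M0 us in \<open>auto simp: indicator_def intro: order_trans[OF uu] mult_nonneg_nonneg\<close>)
    then show ?thesis by simp
  qed
  have ui: "integrable lborel u" by (rule integrable_bounded_support(1)[OF um uM us]) (use T in auto)
  have ci: "integrable lborel c" by (rule integrable_bounded_support(1)[OF cm cM cs]) (use T in auto)
  define U where "U l = (LBINT x. u x * cis (- (l * x)))" for l
  define C where "C l = (LBINT r. c r * cis (- (l * r)))" for l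
  have [measurable]: "U \<in> borel_measurable borel" "C \<in> borel_measurable borel" unfolding U_def C_def by measurable
  have CU: "C l = U l * cnj (U l)" for l
    unfolding C_def U_def c_def by (rule autocorrelation_transform[OF um uM us T])
  have s0: "s \<ge> 0" using s[of 0] norm_ge_zero order_trans by blast
  have Us: "cmod (U l) \<le> s" for l using s by (simp add: U_def)
  interpret N: real_distribution std_normal_distribution by (rule real_dist_normal_dist)
  \<comment> \<open>The narrow Gaussian kernel around \<open>r\<close>, after a substitution that
    fixes its width: \<open>Q n\<close> is the quadratic form of \<open>c\<close> up to the factor
    \<open>1 / b\<close>.\<close>
  define k where "k n r h = cnj (c (r + 1 / real (Suc n) * h)) * of_real (exp (- (h\<^sup>2) / 2))" for n r h
  define Q where "Q n = (LBINT r. c r * (LBINT h. k n r h))" for n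
  have Qle: "Re (Q n) \<le> s\<^sup>2 * M\<^sup>2 * T * sqrt (2 * pi)" for n
  proof -
    define b where "b = real (Suc n)"
    have b: "b > 0" by (simp add: b_def)
    have "(LINT l|std_normal_distribution. C (l * b) * cnj (C (l * b))) =
      (LBINT x. c x * (LBINT y. cnj (c y) * of_real (exp (- (((x - y) * b)\<^sup>2) / 2))))"
      unfolding C_def by (rule gaussian_quadratic_form[OF ci])
    also have "\<dots> = (LBINT x. c x * (of_real (1 / b) * (LBINT h. cnj (c (x + 1 / b * h)) * of_real (exp (- (h\<^sup>2) / 2)))))"
    proof (intro Bochner_Integration.integral_cong refl arg_cong2[where f = "(*)"])
      fix x
      have "(LBINT y. cnj (c y) * complex_of_real (exp (- (((x - y) * b)\<^sup>2) / 2))) =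
        \<bar>1/b\<bar> *\<^sub>R (LBINT h. cnj (c (x + 1/b * h)) * of_real (exp (- (((x - (x + 1/b * h)) * b)\<^sup>2) / 2)))"
        by (rule lborel_integral_real_affine) (use b in simp)
      moreover have "((x - (x + 1/b * h)) * b)\<^sup>2 = h\<^sup>2" for h using b by (simp add: power2_eq_square)
      ultimately show "(LBINT y. cnj (c y) * complex_of_real (exp (- (((x - y) * b)\<^sup>2) / 2))) =
        of_real (1 / b) * (LBINT h. cnj (c (x + 1/b * h)) * of_real (exp (- (h\<^sup>2) / 2)))"
        using b by (simp add: scaleR_conv_of_real)
    qed
    also have "\<dots> = of_real (1 / b) * Q n"
      unfolding Q_def k_def b_def[symmetric] mult.left_commute[of "c _"] by (rule integral_mult_right_zero)
    finally have L: "(LINT l|std_normal_distribution. C (l * b) * cnj (C (l * b))) = of_real (1 / b) * Q n" .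
    have R: "(LINT l|std_normal_distribution. U (l * b) * cnj (U (l * b))) =
      (LBINT x. u x * (LBINT y. cnj (u y) * of_real (exp (- (((x - y) * b)\<^sup>2) / 2))))"
      unfolding U_def by (rule gaussian_quadratic_form[OF ui])
    have inner: "cmod (LBINT y. cnj (u y) * of_real (exp (- (((x - y) * b)\<^sup>2) / 2))) \<le> M * (sqrt (2 * pi) / b)" for x
    proof -
      have "cmod (LBINT y. cnj (u y) * of_real (exp (- (((x - y) * b)\<^sup>2) / 2))) \<le>
          (LBINT y. M * exp (- (((x - y) * b)\<^sup>2) / 2))"
      proof (rule Bochner_Integration.integral_norm_bound_integral)
        show "integrable lborel (\<lambda>y. M * exp (- (((x - y) * b)\<^sup>2) / 2))"
          by (intro integrable_mult_right gaussian_integral_scaled b)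
        then show "integrable lborel (\<lambda>y. cnj (u y) * of_real (exp (- (((x - y) * b)\<^sup>2) / 2)))"
          by (rule Bochner_Integration.integrable_bound) (use uM M0 in \<open>auto simp: norm_mult intro!: mult_right_mono\<close>)
      qed (use uM in \<open>auto simp: norm_mult intro!: mult_right_mono\<close>)
      then show ?thesis using gaussian_integral_scaled(2)[OF b, of x] by simp
    qed
    have "cmod (LBINT x. u x * (LBINT y. cnj (u y) * of_real (exp (- (((x - y) * b)\<^sup>2) / 2)))) \<le> M * (M * (sqrt (2 * pi) / b)) * (T - 0)"
    proof (rule integrable_bounded_support(2))
      show "cmod (u x * (LBINT y. cnj (u y) * of_real (exp (- (((x - y) * b)\<^sup>2) / 2)))) \<le> M * (M * (sqrt (2 * pi) / b))" for x
        unfolding norm_mult by (intro mult_mono uM inner M0) auto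
    qed (use us T in auto)
    then have Rle: "Re (LINT l|std_normal_distribution. U (l * b) * cnj (U (l * b))) \<le> M * M * (sqrt (2 * pi) / b) * T"
      unfolding R using complex_Re_le_cmod order_trans by fastforce
    have "Re (LINT l|std_normal_distribution. C (l * b) * cnj (C (l * b))) = (LINT l|std_normal_distribution. (cmod (C (l * b)))\<^sup>2)"
    proof -
      have "(LINT l|std_normal_distribution. C (l * b) * cnj (C (l * b))) = (LINT l|std_normal_distribution. of_real ((cmod (C (l * b)))\<^sup>2))"
        unfolding complex_norm_square ..
      then show ?thesis by (simp only: integral_complex_of_real Re_complex_of_real)
    qed
    \<comment> \<open>As \<open>C = U * cnj U\<close>, the square of \<open>cmod C\<close> has four
      factors \<open>cmod U\<close>, two of which are estimated by \<open>s\<close>. The Gaussian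
      averages on both sides carry the same factor \<open>1 / b\<close>, which drops out.\<close>
    also have "\<dots> \<le> (LINT l|std_normal_distribution. s\<^sup>2 * (cmod (U (l * b)))\<^sup>2)"
    proof (rule integral_mono)
      have Cb: "cmod (C l) \<le> s * s" for l
        unfolding CU norm_mult complex_mod_cnj by (intro mult_mono Us s0) auto
      show "integrable std_normal_distribution (\<lambda>l. (cmod (C (l * b)))\<^sup>2)"
        by (rule N.integrable_const_bound[of _ "(s * s)\<^sup>2"]) (auto intro!: power_mono Cb)
      show "integrable std_normal_distribution (\<lambda>l. s\<^sup>2 * (cmod (U (l * b)))\<^sup>2)"
      proof (rule N.integrable_const_bound[of _ "s\<^sup>2 * s\<^sup>2"], rule AE_I2)
        fix l
        have "s\<^sup>2 * (cmod (U (l * b)))\<^sup>2 \<le> s\<^sup>2 * s\<^sup>2" by (intro mult_left_mono power_mono Us) auto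
        then show "norm (s\<^sup>2 * (cmod (U (l * b)))\<^sup>2) \<le> s\<^sup>2 * s\<^sup>2" by simp
      qed measurable
      show "(cmod (C (l * b)))\<^sup>2 \<le> s\<^sup>2 * (cmod (U (l * b)))\<^sup>2" for l
      proof -
        have "cmod (C (l * b)) \<le> s * cmod (U (l * b))"
          unfolding CU norm_mult complex_mod_cnj by (intro mult_right_mono Us) auto
        then have "(cmod (C (l * b)))\<^sup>2 \<le> (s * cmod (U (l * b)))\<^sup>2" by (intro power_mono) auto
        then show ?thesis by (simp add: power_mult_distrib)
      qed
    qed
    also have "\<dots> = s\<^sup>2 * Re (LINT l|std_normal_distribution. U (l * b) * cnj (U (l * b)))"
    proof -
      have "(LINT l|std_normal_distribution. U (l * b) * cnj (U (l * b))) = (LINT l|std_normal_distribution. of_real ((cmod (U (l * b)))\<^sup>2))"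
        unfolding complex_norm_square ..
      then show ?thesis by (simp only: integral_complex_of_real Re_complex_of_real integral_mult_right_zero)
    qed
    also have "\<dots> \<le> s\<^sup>2 * (M * M * (sqrt (2 * pi) / b) * T)" by (intro mult_left_mono Rle) auto
    finally have "Re (Q n) / b \<le> s\<^sup>2 * (M * M * (sqrt (2 * pi) / b) * T)" unfolding L by (simp add: Re_divide_of_real)
    then show ?thesis using b by (simp add: field_simps power2_eq_square)
  qed
  have gi: "integrable lborel (\<lambda>h. M * M * T * exp (- (h\<^sup>2) / 2))" by (intro integrable_mult_right gaussian_integral)
  have kb: "cmod (k n r h) \<le> M * M * T * exp (- (h\<^sup>2) / 2)" for n r h
    unfolding k_def norm_mult complex_mod_cnj by (intro mult_mono cM) (use M0 T in auto)
  have km: "k n r \<in> borel_measurable lborel" for n r unfolding k_def by measurable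
  have ki: "integrable lborel (k n r)" for n r
    by (rule Bochner_Integration.integrable_bound[OF gi km], rule AE_I2, unfold real_norm_def, rule order_trans[OF kb abs_ge_self])
  have bound: "cmod (LBINT h. k n r h) \<le> M * M * T * sqrt (2 * pi)" for r n
    using Bochner_Integration.integral_norm_bound_integral[OF ki gi kb, of n r] gaussian_integral(2) by simp
  \<comment> \<open>As the kernels narrow, \<open>Q n\<close> tends to the square integral of
    \<open>c\<close> times the mass of the Gaussian.\<close>
  have "Q \<longlonglongrightarrow> (LBINT r. c r * (cnj (c r) * of_real (sqrt (2 * pi))))"
    unfolding Q_def
  proof (rule integral_dominated_convergence[where w = "\<lambda>r. M * M * T * sqrt (2 * pi) * cmod (c r)"])
    show "integrable lborel (\<lambda>r. M * M * T * sqrt (2 * pi) * cmod (c r))" using ci by auto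
    show "AE r in lborel. norm (c r * (LBINT h. k n r h)) \<le> M * M * T * sqrt (2 * pi) * cmod (c r)" for n
      using mult_left_mono[OF bound[of n] norm_ge_zero[of "c _"]] by (auto simp: norm_mult mult.commute)
    show "AE r in lborel. (\<lambda>n. c r * (LBINT h. k n r h)) \<longlonglongrightarrow> c r * (cnj (c r) * of_real (sqrt (2 * pi)))"
    proof (rule AE_I2, intro tendsto_intros)
      fix r
      have "(\<lambda>n. LBINT h. k n r h) \<longlonglongrightarrow> (LBINT h. cnj (c r) * of_real (exp (- (h\<^sup>2) / 2)))"
      proof (rule integral_dominated_convergence[OF _ km gi])
        show "AE h in lborel. (\<lambda>n. k n r h) \<longlonglongrightarrow> cnj (c r) * of_real (exp (- (h\<^sup>2) / 2))"
          unfolding k_def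
        proof (rule AE_I2, intro tendsto_intros)
          fix h
          have "(\<lambda>n. 1 / real (Suc n)) \<longlonglongrightarrow> 0" by (rule LIMSEQ_Suc[OF lim_1_over_n, unfolded o_def])
          then have "(\<lambda>n. r + 1 / real (Suc n) * h) \<longlonglongrightarrow> r + 0 * h" by (intro tendsto_intros)
          then have "(\<lambda>n. r + 1 / real (Suc n) * h) \<longlonglongrightarrow> r" by simp
          then show "(\<lambda>n. c (r + 1 / real (Suc n) * h)) \<longlonglongrightarrow> c r"
            using contc by (intro isCont_tendsto_compose[of r c]) (auto simp: continuous_on_eq_continuous_at)
        qed
        show "AE h in lborel. norm (k n r h) \<le> M * M * T * exp (- (h\<^sup>2) / 2)" for n by (rule AE_I2) (rule kb)
      qed measurable
      also have "(LBINT h. cnj (c r) * complex_of_real (exp (- (h\<^sup>2) / 2))) = cnj (c r) * of_real (sqrt (2 * pi))"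
        by (simp only: integral_mult_right_zero integral_complex_of_real gaussian_integral(2))
      finally show "(\<lambda>n. LBINT h. k n r h) \<longlonglongrightarrow> cnj (c r) * of_real (sqrt (2 * pi))" .
    qed
  qed (unfold k_def, measurable)
  also have "(LBINT r. c r * (cnj (c r) * complex_of_real (sqrt (2 * pi)))) = of_real ((LBINT r. (cmod (c r))\<^sup>2) * sqrt (2 * pi))"
  proof -
    have "(\<lambda>r. c r * (cnj (c r) * complex_of_real (sqrt (2 * pi)))) = (\<lambda>r. of_real ((cmod (c r))\<^sup>2 * sqrt (2 * pi)))"
      unfolding of_real_mult complex_norm_square by (simp add: mult.assoc)
    then show ?thesis by (simp only: integral_complex_of_real integral_mult_left_zero)
  qed
  finally have "(\<lambda>n. Re (Q n)) \<longlonglongrightarrow> (LBINT r. (cmod (c r))\<^sup>2) * sqrt (2 * pi)"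
    using tendsto_Re by fastforce
  then have "(LBINT r. (cmod (c r))\<^sup>2) * sqrt (2 * pi) \<le> s\<^sup>2 * M\<^sup>2 * T * sqrt (2 * pi)"
    by (rule Lim_bounded) (use Qle in auto)
  then show "(LBINT r. (cmod (c r))\<^sup>2) \<le> s\<^sup>2 * M\<^sup>2 * T" by simp
qed

section \<open>The uniqueness theorem for almost periodic functions\<close>

lemma ap_meanD:
  assumes "ap_mean f L" "e > 0"
  obtains T0 where "T0 > 0" "\<And>T a. T \<ge> T0 \<Longrightarrow> cmod (integral {a..a+T} f - of_real T * L) \<le> e * T"
  using assms unfolding ap_mean_def by blast

lemma ap_mean_add:
  assumes "continuous_on UNIV f" "continuous_on UNIV g" "ap_mean f A" "ap_mean g B"
  shows "ap_mean (\<lambda>x. f x + g x) (A + B)"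
  unfolding ap_mean_def
proof (intro allI impI)
  fix e :: real assume e: "e > 0"
  obtain S where S: "S > 0" "\<And>T a. T \<ge> S \<Longrightarrow> cmod (integral {a..a+T} f - of_real T * A) \<le> e/2 * T"
    using ap_meanD[OF assms(3), of "e/2"] e by auto
  obtain R where R: "R > 0" "\<And>T a. T \<ge> R \<Longrightarrow> cmod (integral {a..a+T} g - of_real T * B) \<le> e/2 * T"
    using ap_meanD[OF assms(4), of "e/2"] e by auto
  have "cmod (integral {a..a+T} (\<lambda>x. f x + g x) - of_real T * (A + B)) \<le> e * T" if "T \<ge> max S R" for T a
  proof -
    have "integral {a..a+T} (\<lambda>x. f x + g x) = integral {a..a+T} f + integral {a..a+T} g"
      by (intro Henstock_Kurzweil_Integration.integral_add integrable_continuous_real continuous_on_subset[OF assms(1)] continuous_on_subset[OF assms(2)]) auto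
    then have "integral {a..a+T} (\<lambda>x. f x + g x) - of_real T * (A + B) =
       (integral {a..a+T} f - of_real T * A) + (integral {a..a+T} g - of_real T * B)" by (simp add: algebra_simps)
    also have "cmod \<dots> \<le> e/2 * T + e/2 * T" using that by (intro norm_triangle_mono S R) auto
    finally show ?thesis by (simp add: mult_ac)
  qed
  then show "\<exists>T0>0. \<forall>T\<ge>T0. \<forall>a. cmod (integral {a..a+T} (\<lambda>x. f x + g x) - of_real T * (A + B)) \<le> e * T"
    using S(1) by (intro exI[of _ "max S R"]) auto
qed

lemma ap_mean_cmult:
  assumes "ap_mean f A" shows "ap_mean (\<lambda>x. k * f x) (k * A)"
  unfolding ap_mean_def
proof (intro allI impI)
  fix e :: real assume e: "e > 0"
  define d where "d = e / (cmod k + 1)"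
  have k0: "cmod k + 1 > 0" by (simp add: add_nonneg_pos)
  have d: "d > 0" using e k0 by (simp add: d_def)
  obtain S where S: "S > 0" "\<And>T a. T \<ge> S \<Longrightarrow> cmod (integral {a..a+T} f - of_real T * A) \<le> d * T"
    using ap_meanD[OF assms d] by auto
  have "cmod (integral {a..a+T} (\<lambda>x. k * f x) - of_real T * (k * A)) \<le> e * T" if "T \<ge> S" for T a
  proof -
    have "integral {a..a+T} (\<lambda>x. k * f x) - of_real T * (k * A) = k * (integral {a..a+T} f - of_real T * A)"
      by (simp add: algebra_simps)
    also have "cmod \<dots> \<le> (cmod k + 1) * (d * T)"
      unfolding norm_mult using S(2)[OF that, of a] by (intro mult_mono) auto
    also have "\<dots> = e * T" using k0 by (simp add: d_def)
    finally show ?thesis .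
  qed
  then show "\<exists>T0>0. \<forall>T\<ge>T0. \<forall>a. cmod (integral {a..a+T} (\<lambda>x. k * f x) - of_real T * (k * A)) \<le> e * T"
    using S(1) by blast
qed

lemma ap_mean_const: "ap_mean (\<lambda>_. k) k"
  unfolding ap_mean_def
proof (intro allI impI exI[of _ 1] conjI)
  fix e T a :: real assume "e > 0" "T \<ge> 1"
  then show "cmod (integral {a..a+T} (\<lambda>_. k) - of_real T * k) \<le> e * T"
    by (simp add: scaleR_conv_of_real)
qed simp

lemma ap_mean_cis:
  assumes "\<nu> \<noteq> 0" shows "ap_mean (\<lambda>x. cis (\<nu> * x)) 0"
  unfolding ap_mean_def
proof (intro allI impI)
  fix e :: real assume e: "e > 0"
  have bound: "cmod (integral {a..a+T} (\<lambda>x. cis (\<nu> * x))) \<le> 2 / \<bar>\<nu>\<bar>" if "T \<ge> 0" for a T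
  proof -
    have "((\<lambda>x. cis (\<nu> * x) / (\<i> * of_real \<nu>)) has_vector_derivative cis (\<nu> * x)) (at x within S)" for x S
    proof -
      have "((\<lambda>z. exp (\<i> * of_real \<nu> * z) / (\<i> * of_real \<nu>)) has_field_derivative exp (\<i> * of_real \<nu> * of_real x)) (at (of_real x))"
        using assms by (auto intro!: derivative_eq_intros)
      then show ?thesis
        using has_vector_derivative_real_field[of "\<lambda>z. exp (\<i> * of_real \<nu> * z) / (\<i> * of_real \<nu>)" _ x S]
        by (simp add: cis_conv_exp mult.assoc)
    qed
    then have "((\<lambda>x. cis (\<nu> * x)) has_integral (cis (\<nu> * (a + T)) / (\<i> * of_real \<nu>) - cis (\<nu> * a) / (\<i> * of_real \<nu>))) {a..a+T}"
      using that by (intro fundamental_theorem_of_calculus) auto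
    then have "integral {a..a+T} (\<lambda>x. cis (\<nu> * x)) = (cis (\<nu> * (a + T)) - cis (\<nu> * a)) / (\<i> * of_real \<nu>)"
      by (simp add: integral_unique diff_divide_distrib)
    then show ?thesis
      using norm_triangle_ineq4[of "cis (\<nu> * (a + T))" "cis (\<nu> * a)"]
      by (simp add: norm_divide norm_mult divide_right_mono)
  qed
  show "\<exists>T0>0. \<forall>T\<ge>T0. \<forall>a. cmod (integral {a..a+T} (\<lambda>x. cis (\<nu> * x)) - of_real T * 0) \<le> e * T"
  proof (intro exI[of _ "2 / (\<bar>\<nu>\<bar> * e)"] conjI allI impI)
    fix T a assume T: "T \<ge> 2 / (\<bar>\<nu>\<bar> * e)"
    have "2 / (\<bar>\<nu>\<bar> * e) > 0" using e assms by simp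
    then have "T \<ge> 0" using T by linarith
    moreover have "2 / \<bar>\<nu>\<bar> \<le> e * T" using T e assms by (simp add: field_simps)
    ultimately show "cmod (integral {a..a+T} (\<lambda>x. cis (\<nu> * x)) - of_real T * 0) \<le> e * T" using bound[of T a] by simp
  qed (use e assms in simp)
qed

lemma ap_mean_sum:
  assumes "finite A" "\<And>i. i \<in> A \<Longrightarrow> continuous_on UNIV (f i)" "\<And>i. i \<in> A \<Longrightarrow> ap_mean (f i) (m i)"
  shows "ap_mean (\<lambda>x. \<Sum>i\<in>A. f i x) (\<Sum>i\<in>A. m i)"
  using assms
proof (induction A rule: finite_induct)
  case (insert i A)
  then show ?case by (auto intro!: ap_mean_add continuous_on_sum)
qed (use ap_mean_const in auto)

lemma ap_mean_uniform_limit: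
  assumes f: "continuous_on UNIV f"
    and "\<And>e. e > 0 \<Longrightarrow> \<exists>g L'. continuous_on UNIV g \<and> (\<forall>x. cmod (f x - g x) \<le> e) \<and> ap_mean g L' \<and> cmod (L' - L) \<le> e"
  shows "ap_mean f L"
  unfolding ap_mean_def
proof (intro allI impI)
  fix e :: real assume e: "e > 0"
  obtain g L' where g: "continuous_on UNIV g" "\<And>x. cmod (f x - g x) \<le> e/3" "ap_mean g L'" "cmod (L' - L) \<le> e/3"
    using assms(2)[of "e/3"] e by auto
  obtain S where S: "S > 0" "\<And>T a. T \<ge> S \<Longrightarrow> cmod (integral {a..a+T} g - of_real T * L') \<le> e/3 * T"
    using ap_meanD[OF g(3), of "e/3"] e by auto
  have "cmod (integral {a..a+T} f - of_real T * L) \<le> e * T" if "T \<ge> S" for T a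
  proof -
    have T0: "T \<ge> 0" using that S by simp
    have "integral {a..a+T} f - integral {a..a+T} g = integral {a..a+T} (\<lambda>x. f x - g x)"
      by (intro Henstock_Kurzweil_Integration.integral_diff[symmetric] integrable_continuous_real continuous_on_subset[OF f] continuous_on_subset[OF g(1)]) auto
    also have "cmod \<dots> \<le> e/3 * (a + T - a)"
      by (intro integral_bound continuous_intros continuous_on_subset[OF f] continuous_on_subset[OF g(1)]) (use T0 g(2) in auto)
    finally have 1: "cmod (integral {a..a+T} f - integral {a..a+T} g) \<le> e/3 * T" by simp
    have "cmod (of_real T * L' - of_real T * L) = T * cmod (L' - L)"
      using T0 by (simp add: norm_mult right_diff_distrib[symmetric])
    also have "\<dots> \<le> T * (e/3)" by (intro mult_left_mono g T0)
    finally have 2: "cmod (of_real T * L' - of_real T * L) \<le> T * (e/3)" .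
    have "cmod (integral {a..a+T} f - of_real T * L) \<le> e/3 * T + (e/3 * T + T * (e/3))"
      by (rule norm_diff_triangle_le[OF 1 norm_diff_triangle_le[OF S(2)[OF that] 2]])
    then show ?thesis by (simp add: mult_ac)
  qed
  then show "\<exists>T0>0. \<forall>T\<ge>T0. \<forall>a. cmod (integral {a..a+T} f - of_real T * L) \<le> e * T"
    using S(1) by blast
qed

lemma ap_mean_unique:
  assumes "ap_mean f L" "ap_mean f L'" shows "L = L'"
proof (rule ccontr)
  assume "L \<noteq> L'"
  define e where "e = cmod (L - L') / 3"
  have e: "e > 0" using \<open>L \<noteq> L'\<close> by (simp add: e_def)
  obtain S where S: "S > 0" "\<And>T a. T \<ge> S \<Longrightarrow> cmod (integral {a..a+T} f - of_real T * L) \<le> e * T"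
    using ap_meanD[OF assms(1) e] by auto
  obtain R where R: "R > 0" "\<And>T a. T \<ge> R \<Longrightarrow> cmod (integral {a..a+T} f - of_real T * L') \<le> e * T"
    using ap_meanD[OF assms(2) e] by auto
  define T where "T = max S R"
  have T: "T > 0" "T \<ge> S" "T \<ge> R" using S by (auto simp: T_def)
  have "cmod (of_real T * L - of_real T * L') \<le> e * T + e * T"
    using S(2)[OF T(2), of 0] R(2)[OF T(3), of 0] by (metis norm_diff_triangle_le norm_minus_commute)
  moreover have "cmod (of_real T * L - of_real T * L') = T * (3 * e)"
    using T(1) unfolding right_diff_distrib[symmetric] norm_mult by (simp add: e_def)
  ultimately show False using T e by (simp add: mult.commute)
qed

lemma cmod_cis_diff_1_le: "cmod (cis a - 1) \<le> \<bar>a\<bar>"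
  using iexp_approx1[of a 0] by (simp add: cis_conv_exp)

lemma ap_blocks_bound:
  fixes g :: "real \<Rightarrow> complex"
  assumes g: "continuous_on UNIV g" and T0: "T0 > 0"
    and q: "\<And>a. cmod (integral {a..a+T0} g) \<le> q"
  shows "cmod (integral {0..real n * T0} g) \<le> real n * q"
proof (induction n)
  case (Suc n)
  have "integral {0..real n * T0} g + integral {real n * T0..real (Suc n) * T0} g = integral {0..real (Suc n) * T0} g"
    by (intro Henstock_Kurzweil_Integration.integral_combine integrable_continuous_real continuous_on_subset[OF g])
       (use T0 in \<open>auto intro!: mult_right_mono\<close>)
  then have "cmod (integral {0..real (Suc n) * T0} g) \<le> cmod (integral {0..real n * T0} g) + cmod (integral {real n * T0..real (Suc n) * T0} g)"
    by (metis norm_triangle_ineq)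
  moreover have "cmod (integral {real n * T0..real (Suc n) * T0} g) \<le> q"
    using q[of "real n * T0"] by (simp add: algebra_simps)
  ultimately show ?case using Suc.IH by (simp add: algebra_simps)
qed simp

text \<open>On a block of fixed length \<open>T0\<close> two exponentials with nearby frequencies
  differ, up to a constant phase, by at most \<open>d * T0\<close>. The mean being uniform in the
  position, this applies to all blocks and controls \<nu>' for arbitrarily long
  \<open>T\<close>.\<close>

lemma ap_small_near:
  assumes f: "bohr_ap f" and mean: "ap_mean (\<lambda>x. f x * cis (\<nu> * x)) 0" and e: "e > 0"
  shows "\<exists>d>0. \<exists>T1>0. \<forall>\<nu>'. \<bar>\<nu>' - \<nu>\<bar> < d \<longrightarrow> (\<forall>T\<ge>T1. cmod (integral {0..T} (\<lambda>x. f x * cis (\<nu>' * x))) \<le> e * T)"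
proof -
  have cont: "continuous_on UNIV f" using f by (simp add: bohr_ap_def)
  note [continuous_intros] = continuous_on_subset[OF cont subset_UNIV]
  obtain M where M: "M > 0" "\<And>x. cmod (f x) \<le> M" using bohr_ap_bounded[OF f] by blast
  obtain T0 where T0: "T0 > 0" "\<And>T a. T \<ge> T0 \<Longrightarrow> cmod (integral {a..a+T} (\<lambda>x. f x * cis (\<nu> * x)) - of_real T * 0) \<le> e/4 * T"
    using ap_meanD[OF mean, of "e/4"] e by auto
  \<comment> \<open>The error on a block is \<open>M * d * T0 * T0 = e / 4 * T0\<close>.
    \<open>T1\<close> makes the incomplete last block, which costs at most \<open>M * T0\<close>, no
    larger than \<open>e / 2 * T\<close>.\<close>
  define d where "d = e / (4 * M * T0)"
  define T1 where "T1 = 2 * M * T0 / e"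
  have d: "d > 0" "T1 > 0" using e M T0 by (auto simp: d_def T1_def)
  have "cmod (integral {0..T} (\<lambda>x. f x * cis (\<nu>' * x))) \<le> e * T" if \<nu>': "\<bar>\<nu>' - \<nu>\<bar> < d" and T: "T \<ge> T1" for \<nu>' T
  proof -
    define g where "g = (\<lambda>x. f x * cis (\<nu>' * x))"
    have contg: "continuous_on S g" for S unfolding g_def by (intro continuous_intros)
    have block: "cmod (integral {a..a+T0} g) \<le> e/2 * T0" for a
    proof -
      have "cis (- ((\<nu>' - \<nu>) * a)) * integral {a..a+T0} g - integral {a..a+T0} (\<lambda>x. f x * cis (\<nu> * x))
         = integral {a..a+T0} (\<lambda>x. cis (- ((\<nu>' - \<nu>) * a)) * g x - f x * cis (\<nu> * x))"
        by (subst Henstock_Kurzweil_Integration.integral_diff) (auto simp: g_def intro!: integrable_continuous_real continuous_intros)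
      also have "\<dots> = integral {a..a+T0} (\<lambda>x. f x * cis (\<nu> * x) * (cis ((\<nu>' - \<nu>) * (x - a)) - 1))"
      proof (intro Henstock_Kurzweil_Integration.integral_cong)
        fix x
        have "cis (- ((\<nu>' - \<nu>) * a)) * cis (\<nu>' * x) = cis (\<nu> * x) * cis ((\<nu>' - \<nu>) * (x - a))"
          by (simp add: cis_mult algebra_simps)
        then show "cis (- ((\<nu>' - \<nu>) * a)) * g x - f x * cis (\<nu> * x) = f x * cis (\<nu> * x) * (cis ((\<nu>' - \<nu>) * (x - a)) - 1)"
          by (simp add: g_def right_diff_distrib mult_ac)
      qed
      also have "cmod \<dots> \<le> M * (d * T0) * (a + T0 - a)"
      proof (rule integral_bound)
        fix x assume x: "x \<in> {a..a+T0}"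
        have "cmod (cis ((\<nu>' - \<nu>) * (x - a)) - 1) \<le> \<bar>(\<nu>' - \<nu>) * (x - a)\<bar>" by (rule cmod_cis_diff_1_le)
        also have "\<dots> \<le> d * T0" unfolding abs_mult using x \<nu>' d by (intro mult_mono) auto
        finally show "cmod (f x * cis (\<nu> * x) * (cis ((\<nu>' - \<nu>) * (x - a)) - 1)) \<le> M * (d * T0)"
          unfolding norm_mult norm_cis using M by (simp add: mult_mono)
      qed (use T0 in \<open>auto intro!: continuous_intros\<close>)
      also have "\<dots> = e/4 * T0" using M T0 by (simp add: d_def)
      finally have 1: "cmod (cis (- ((\<nu>' - \<nu>) * a)) * integral {a..a+T0} g - integral {a..a+T0} (\<lambda>x. f x * cis (\<nu> * x))) \<le> e/4 * T0" .
      have 2: "cmod (integral {a..a+T0} (\<lambda>x. f x * cis (\<nu> * x))) \<le> e/4 * T0" using T0(2)[of T0 a] by simp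
      have "cmod (integral {a..a+T0} g) = cmod (cis (- ((\<nu>' - \<nu>) * a)) * integral {a..a+T0} g)" by (simp add: norm_mult)
      also have "\<dots> \<le> e/4 * T0 + e/4 * T0" using 1 2 norm_triangle_sub by (smt (verit))
      finally show ?thesis by (simp add: mult_ac)
    qed
    have Tp: "T > 0" using T d by simp
    define n where "n = nat \<lfloor>T / T0\<rfloor>"
    have "real n \<le> T / T0" "T / T0 < real n + 1" using Tp T0 by (auto simp: n_def)
    then have n: "real n * T0 \<le> T" "T \<le> real n * T0 + T0" using T0 by (auto simp: field_simps)
    have "integral {0..real n * T0} g + integral {real n * T0..T} g = integral {0..T} g"
      by (intro Henstock_Kurzweil_Integration.integral_combine integrable_continuous_real contg) (use n T0 in auto)
    then have "cmod (integral {0..T} g) \<le> cmod (integral {0..real n * T0} g) + cmod (integral {real n * T0..T} g)"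
      by (metis norm_triangle_ineq)
    also have "\<dots> \<le> real n * (e/2 * T0) + M * (T - real n * T0)"
      by (intro add_mono ap_blocks_bound block integral_bound contg T0) (use n M in \<open>auto simp: g_def norm_mult\<close>)
    also have "\<dots> \<le> e/2 * T + M * T0"
    proof -
      have "e/2 * (real n * T0) \<le> e/2 * T" using n e by (intro mult_left_mono) auto
      moreover have "M * (T - real n * T0) \<le> M * T0" using n M by (intro mult_left_mono) auto
      ultimately show ?thesis by (simp add: mult_ac)
    qed
    also have "M * T0 \<le> e/2 * T" using T e unfolding T1_def by (simp add: field_simps)
    finally show ?thesis unfolding g_def by (simp add: mult_ac)
  qed
  with d show ?thesis by blast
qed

text \<open>
  A shift by \<open>pi / \<nu>\<close> changes the sign of the exponential and hardly changes \<open>f\<close>.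
\<close>
lemma ap_small_large_frequency:
  assumes f: "bohr_ap f" and e: "e > 0"
  shows "\<exists>\<Lambda>>0. \<exists>T1>0. \<forall>\<nu>. \<bar>\<nu>\<bar> \<ge> \<Lambda> \<longrightarrow> (\<forall>T\<ge>T1. cmod (integral {0..T} (\<lambda>x. f x * cis (\<nu> * x))) \<le> e * T)"
proof -
  have cont: "continuous_on UNIV f" using f by (simp add: bohr_ap_def)
  note [continuous_intros] = continuous_on_subset[OF cont subset_UNIV]
  obtain M where M: "M > 0" "\<And>x. cmod (f x) \<le> M" using bohr_ap_bounded[OF f] by blast
  obtain d where d: "d > 0" "\<And>x y. \<bar>x - y\<bar> < d \<Longrightarrow> cmod (f x - f y) \<le> e" using bohr_ap_uniformly_continuous[OF f e] by blast
  define \<Lambda> where "\<Lambda> = 2 * pi / d"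
  define T1 where "T1 = 2 * M * d / e"
  have pos: "\<Lambda> > 0" "T1 > 0" using d M e by (auto simp: \<Lambda>_def T1_def)
  have "cmod (integral {0..T} (\<lambda>x. f x * cis (\<nu> * x))) \<le> e * T" if \<nu>: "\<bar>\<nu>\<bar> \<ge> \<Lambda>" and T: "T \<ge> T1" for \<nu> T
  proof -
    have Tp: "T > 0" using T pos by simp
    have \<nu>0: "\<nu> \<noteq> 0" using \<nu> pos by auto
    define h where "h = pi / \<nu>"
    have h: "\<bar>h\<bar> < d"
    proof -
      have "\<bar>h\<bar> = pi / \<bar>\<nu>\<bar>" by (simp add: h_def)
      also have "\<dots> \<le> pi / \<Lambda>" using \<nu> pos by (intro divide_left_mono) auto
      also have "\<dots> < d" using d by (simp add: \<Lambda>_def)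
      finally show ?thesis .
    qed
    define g where "g = (\<lambda>x. f x * cis (\<nu> * x))"
    have contg: "continuous_on S g" for S unfolding g_def by (intro continuous_intros)
    have "integral {h..h+T} g = integral {0..T} (\<lambda>x. g (x + h))"
      using integral_shift_real[OF contg, of 0 T h] by (simp add: add.commute)
    also have "\<dots> = integral {0..T} (\<lambda>x. - (f (x + h) * cis (\<nu> * x)))"
    proof (intro Henstock_Kurzweil_Integration.integral_cong)
      fix x
      have "cis (\<nu> * (x + h)) = cis (\<nu> * x) * cis pi" using \<nu>0 by (subst cis_mult) (simp add: h_def distrib_left)
      then show "g (x + h) = - (f (x + h) * cis (\<nu> * x))" by (simp add: g_def)
    qed
    finally have "integral {0..T} g + integral {h..h+T} g = integral {0..T} (\<lambda>x. (f x - f (x + h)) * cis (\<nu> * x))"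
      by (simp add: g_def left_diff_distrib, subst Henstock_Kurzweil_Integration.integral_diff)
         (auto intro!: integrable_continuous_real continuous_intros continuous_on_compose2[OF cont])
    also have "cmod \<dots> \<le> e * (T - 0)"
    proof (rule integral_bound)
      show "continuous_on {0..T} (\<lambda>x. (f x - f (x + h)) * cis (\<nu> * x))"
        by (intro continuous_intros continuous_on_compose2[OF cont]) auto
      fix x show "cmod ((f x - f (x + h)) * cis (\<nu> * x)) \<le> e" using d(2)[of x "x + h"] h by (simp add: norm_mult)
    qed (use Tp in auto)
    finally have 1: "cmod (integral {0..T} g + integral {h..h+T} g) \<le> e * T" by simp
    have "cmod (integral {0..0+T} g - integral {h..h+T} g) \<le> 2 * M * \<bar>0 - h\<bar>"
      by (rule integral_window_shift_bound[OF contg]) (use M Tp in \<open>auto simp: g_def norm_mult\<close>)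
    also have "\<dots> \<le> 2 * M * d" using h M by (intro mult_left_mono) auto
    also have "\<dots> \<le> e * T" using T e unfolding T1_def by (simp add: field_simps)
    finally have 2: "cmod (integral {0..T} g - integral {h..h+T} g) \<le> e * T" by simp
    have "cmod (2 * integral {0..T} g) \<le> e * T + e * T"
      using norm_triangle_mono[OF 1 2] by simp
    then show ?thesis by (simp add: g_def norm_mult mult_ac)
  qed
  with pos show ?thesis by blast
qed

text \<open>Large frequencies are covered at once, the remaining compact set by finitely many of the
  neighbourhoods from \<open>ap_small_near\<close>.\<close>

lemma ap_small_uniformly:
  assumes f: "bohr_ap f" and mean: "\<And>\<nu>. ap_mean (\<lambda>x. f x * cis (\<nu> * x)) 0" and e: "e > 0"
  shows "\<exists>T1>0. \<forall>\<nu>. \<forall>T\<ge>T1. cmod (integral {0..T} (\<lambda>x. f x * cis (\<nu> * x))) \<le> e * T"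
proof -
  obtain \<Lambda> T2 where L: "\<Lambda> > 0" "T2 > 0" "\<And>\<nu> T. \<bar>\<nu>\<bar> \<ge> \<Lambda> \<Longrightarrow> T \<ge> T2 \<Longrightarrow> cmod (integral {0..T} (\<lambda>x. f x * cis (\<nu> * x))) \<le> e * T"
    using ap_small_large_frequency[OF f e] by blast
  have "\<forall>\<nu>. \<exists>d>0. \<exists>T1>0. \<forall>\<nu>'. \<bar>\<nu>' - \<nu>\<bar> < d \<longrightarrow> (\<forall>T\<ge>T1. cmod (integral {0..T} (\<lambda>x. f x * cis (\<nu>' * x))) \<le> e * T)"
    using ap_small_near[OF f mean e] by blast
  then obtain d T1 where dT: "\<And>\<nu>. d \<nu> > 0" "\<And>\<nu>. T1 \<nu> > 0"
     "\<And>\<nu> \<nu>' T. \<bar>\<nu>' - \<nu>\<bar> < d \<nu> \<Longrightarrow> T \<ge> T1 \<nu> \<Longrightarrow> cmod (integral {0..T} (\<lambda>x. f x * cis (\<nu>' * x))) \<le> e * T"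
    by metis
  have "{-\<Lambda>..\<Lambda>} \<subseteq> (\<Union>\<nu>\<in>{-\<Lambda>..\<Lambda>}. ball \<nu> (d \<nu>))" using dT(1) by force
  then obtain C where C: "finite C" "{-\<Lambda>..\<Lambda>} \<subseteq> (\<Union>\<nu>\<in>C. ball \<nu> (d \<nu>))"
    using compactE_image[of "{-\<Lambda>..\<Lambda>}" "{-\<Lambda>..\<Lambda>}" "\<lambda>\<nu>. ball \<nu> (d \<nu>)"] by (metis compact_Icc open_ball)
  define S where "S = Max (insert T2 (T1 ` C))"
  have S: "S \<ge> T2" "\<And>\<nu>. \<nu> \<in> C \<Longrightarrow> S \<ge> T1 \<nu>" using C(1) by (auto simp: S_def)
  have "cmod (integral {0..T} (\<lambda>x. f x * cis (\<nu> * x))) \<le> e * T" if "T \<ge> S" for \<nu> T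
  proof (cases "\<bar>\<nu>\<bar> \<ge> \<Lambda>")
    case True then show ?thesis using L(3) S(1) that by auto
  next
    case False
    then have "\<nu> \<in> {-\<Lambda>..\<Lambda>}" by auto
    then obtain c where "c \<in> C" "\<nu> \<in> ball c (d c)" using C(2) by blast
    then show ?thesis using dT(3)[of \<nu> c T] S(2)[of c] that by (auto simp: dist_real_def abs_minus_commute)
  qed
  then show ?thesis using L(2) S(1) by (intro exI[of _ S]) auto
qed

text \<open>Each window of length \<open>L\<close> contributes at least \<open>d * q\<close>. The 2
  in the denominator pays for rounding \<open>R / L\<close> down, given
  \<open>R \<ge> 2 * L\<close>.\<close>

lemma integral_blocks_lower:
  fixes g :: "real \<Rightarrow> real"
  assumes g: "continuous_on UNIV g" "\<And>x. g x \<ge> 0" and L: "L > 0" and d: "d \<ge> 0"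
    and sub: "\<And>a. a \<ge> 0 \<Longrightarrow> a + L \<le> R \<Longrightarrow> \<exists>b\<ge>a. b + d \<le> a + L \<and> (\<forall>x\<in>{b..b+d}. q \<le> g x)"
    and R: "R \<ge> 2 * L" and q: "q \<ge> 0"
  shows "R * d * q / (2 * L) \<le> integral {0..R} g"
proof -
  have int: "g integrable_on {a..b}" for a b
    by (intro integrable_continuous_real continuous_on_subset[OF g(1)]) auto
  have ind: "real n * d * q \<le> integral {0..real n * L} g" if "real n * L \<le> R" for n
    using that
  proof (induction n)
    case (Suc n)
    have le: "real n * L + L \<le> R" using Suc.prems by (simp add: algebra_simps)
    obtain b where b: "b \<ge> real n * L" "b + d \<le> real n * L + L" "\<forall>x\<in>{b..b+d}. q \<le> g x"
      using sub[of "real n * L"] le L by auto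
    have "d * q = integral {b..b+d} (\<lambda>_. q)" using d by simp
    also have "\<dots> \<le> integral {b..b+d} g" by (intro integral_le int) (use b in auto)
    also have "\<dots> \<le> integral {real n * L..real n * L + L} g" by (rule integral_subset_le) (use b int g in auto)
    finally have 1: "d * q \<le> integral {real n * L..real n * L + L} g" .
    have "integral {0..real n * L} g + integral {real n * L..real n * L + L} g = integral {0..real n * L + L} g"
      by (intro Henstock_Kurzweil_Integration.integral_combine int) (use L in auto)
    moreover have "real n * d * q \<le> integral {0..real n * L} g" using Suc.IH le L by simp
    ultimately show ?case using 1 by (simp add: algebra_simps)
  qed simp
  define n where "n = nat \<lfloor>R / L\<rfloor>"
  have RL: "R / L \<ge> 2" using R L by (simp add: field_simps)
  then have n: "real n \<le> R / L" "R / L < real n + 1" by (auto simp: n_def)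
  have nL: "real n * L \<le> R" using n L by (simp add: field_simps)
  define y where "y = R / L"
  have "R / (2 * L) = y / 2" by (simp add: y_def)
  also have "\<dots> \<le> real n" using n RL unfolding y_def[symmetric] by linarith
  finally have "R / (2 * L) * (d * q) \<le> real n * (d * q)" using d q by (intro mult_right_mono) auto
  also have "\<dots> \<le> integral {0..real n * L} g" using ind[OF nL] by (simp add: mult.assoc)
  also have "\<dots> \<le> integral {0..R} g" by (rule integral_subset_le) (use nL int g in auto)
  finally show ?thesis by simp
qed

text \<open>
  The Fourier integrals of \<open>f\<close> over \<open>{0..T}\<close> are \<open>o(T)\<close> uniformly in the frequency, so the square of the
  \<open>L\<^sup>2\<close> norm of the autocorrelation of \<open>f\<close> restricted to \<open>{0..T}\<close> is \<open>o(T\<^sup>3)\<close>. But if \<open>f \<noteq> 0\<close>, this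
  autocorrelation is at least of order \<open>T\<close> near all translation numbers.
\<close>
theorem bohr_ap_uniqueness:
  assumes f: "bohr_ap f" and mean: "\<And>\<nu>. ap_mean (\<lambda>x. f x * cis (\<nu> * x)) 0"
  shows "f x0 = 0"
proof (rule ccontr)
  assume "f x0 \<noteq> 0"
  define \<eta> where "\<eta> = cmod (f x0)"
  have \<eta>: "\<eta> > 0" using \<open>f x0 \<noteq> 0\<close> by (simp add: \<eta>_def)
  have cont: "continuous_on UNIV f" using f by (simp add: bohr_ap_def)
  note [continuous_intros] = continuous_on_subset[OF cont subset_UNIV]
  have contc: "continuous_on S (\<lambda>x. f (x + r))" for r S
    by (intro continuous_on_compose2[OF cont] continuous_intros) auto
  obtain M where M: "M > 0" "\<And>x. cmod (f x) \<le> M" using bohr_ap_bounded[OF f] by blast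
  obtain d0 where d0: "d0 > 0" "\<And>x y. \<bar>x - y\<bar> < d0 \<Longrightarrow> cmod (f x - f y) \<le> \<eta>/4"
    using bohr_ap_uniformly_continuous[OF f, of "\<eta>/4"] \<eta> by auto
  obtain l where l: "l > 0" "\<And>a. \<exists>\<tau>\<in>{a..a + l}. \<forall>x. cmod (f (x + \<tau>) - f x) \<le> \<eta>/4"
    using bohr_ap_translation[OF f, of "\<eta>/4"] \<eta> by auto
  define d where "d = d0 / 2"
  have d: "d > 0" "d < d0" using d0 by (auto simp: d_def)
  define L where "L = l + 2 * d"
  \<comment> \<open>A lower bound for the quadratic mean: every window of length \<open>L\<close>
    contains the shift of \<open>x0\<close> by a translation number, together with an interval of
    length \<open>2 * d\<close> around it on which \<open>cmod (f x)\<close> is at least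
    \<open>\<eta> / 2\<close>.\<close>
  define \<kappa> where "\<kappa> = 2 * d * (\<eta>/2)\<^sup>2 / (2 * L)"
  have L: "L > 0" using l d by (simp add: L_def)
  have \<kappa>: "\<kappa> > 0" using d \<eta> L by (simp add: \<kappa>_def)
  have lower1: "\<kappa> * R \<le> integral {0..R} (\<lambda>x. (cmod (f x))\<^sup>2)" if R: "R \<ge> 2 * L" for R
  proof -
    have "R * (2 * d) * (\<eta>/2)\<^sup>2 / (2 * L) \<le> integral {0..R} (\<lambda>x. (cmod (f x))\<^sup>2)"
    proof (rule integral_blocks_lower[OF _ _ L])
      fix a :: real
      obtain \<tau> where \<tau>: "\<tau> \<in> {a + d - x0..a + d - x0 + l}" "\<forall>x. cmod (f (x + \<tau>) - f x) \<le> \<eta>/4" using l(2) by blast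
      show "\<exists>b\<ge>a. b + 2 * d \<le> a + L \<and> (\<forall>x\<in>{b..b + 2 * d}. (\<eta>/2)\<^sup>2 \<le> (cmod (f x))\<^sup>2)"
      proof (intro exI[of _ "x0 + \<tau> - d"] conjI ballI)
        fix x assume x: "x \<in> {x0 + \<tau> - d..x0 + \<tau> - d + 2 * d}"
        have "cmod (f x - f (x0 + \<tau>)) \<le> \<eta>/4" using x d by (intro d0(2)) auto
        moreover have "cmod (f (x0 + \<tau>) - f x0) \<le> \<eta>/4" using \<tau>(2) by blast
        ultimately have "cmod (f x - f x0) \<le> \<eta>/4 + \<eta>/4" by (rule norm_diff_triangle_le)
        then have "cmod (f x) \<ge> \<eta> / 2" using norm_triangle_sub[of "f x0" "f x"] by (simp add: \<eta>_def norm_minus_commute)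
        then show "(\<eta>/2)\<^sup>2 \<le> (cmod (f x))\<^sup>2" using \<eta> by (intro power_mono) auto
      qed (use \<tau>(1) in \<open>auto simp: L_def\<close>)
    qed (use R d in \<open>auto intro!: continuous_intros\<close>)
    then show ?thesis by (simp add: \<kappa>_def mult_ac)
  qed
  \<comment> \<open>Replacing \<open>f (y + r)\<close> by \<open>f y\<close> in the autocorrelation
    changes it by at most \<open>2 * e2 * M * T = \<kappa> / 4 * T\<close>, half of the main
    term.\<close>
  define e2 where "e2 = \<kappa> / (8 * M)"
  have e2: "e2 > 0" using \<kappa> M by (simp add: e2_def)
  obtain d2 where d2: "d2 > 0" "\<And>x y. \<bar>x - y\<bar> < d2 \<Longrightarrow> cmod (f x - f y) \<le> e2"
    using bohr_ap_uniformly_continuous[OF f e2] by auto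
  obtain l2 where l2: "l2 > 0" "\<And>a. \<exists>\<tau>\<in>{a..a + l2}. \<forall>x. cmod (f (x + \<tau>) - f x) \<le> e2"
    using bohr_ap_translation[OF f e2] by auto
  define \<delta> where "\<delta> = d2 / 2"
  have \<delta>: "\<delta> > 0" "\<delta> < d2" using d2 by (auto simp: \<delta>_def)
  define L2 where "L2 = l2 + 2 * \<delta>"
  have L2: "L2 > 0" using l2 \<delta> by (simp add: L2_def)
  define \<kappa>3 where "\<kappa>3 = 2 * \<delta> * (\<kappa>/4)\<^sup>2 / (4 * L2)"
  have \<kappa>3: "\<kappa>3 > 0" using \<delta> \<kappa> L2 by (simp add: \<kappa>3_def)
  \<comment> \<open>Chosen such that \<open>e3\<^sup>2 * M\<^sup>2 = \<kappa>3 / 4\<close>: the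
    upper bound for the square integral is then a quarter of the lower bound
    \<open>\<kappa>3 * T ^ 3\<close>.\<close>
  define e3 where "e3 = sqrt \<kappa>3 / (2 * M)"
  have e3: "e3 > 0" using \<kappa>3 M by (simp add: e3_def)
  obtain T1 where T1: "T1 > 0" "\<And>\<nu> T. T \<ge> T1 \<Longrightarrow> cmod (integral {0..T} (\<lambda>x. f x * cis (\<nu> * x))) \<le> e3 * T"
    using ap_small_uniformly[OF f mean e3] by blast
  define T where "T = T1 + 4 * L + 4 * L2"
  have T: "T > 0" "T \<ge> T1" "T / 2 \<ge> 2 * L" "T / 2 \<ge> 2 * L2" using T1 L L2 by (auto simp: T_def)
  define u where "u = (\<lambda>x. indicator {0..T} x * f x)"
  define c where "c = (\<lambda>r. LBINT y. u (y + r) * cnj (u y))"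
  have lint: "(LBINT x. indicator {a..b} x * g x) = integral {a..b} g" if "continuous_on {a..b} g" for a b and g :: "real \<Rightarrow> complex"
  proof -
    have "set_integrable lborel {a..b} g"
      using borel_integrable_atLeastAtMost'[OF that] .
    then have "(LINT x:{a..b}|lborel. g x) = integral {a..b} g" by (rule set_borel_integral_eq_integral)
    moreover have "(\<lambda>x. indicator {a..b} x *\<^sub>R g x) = (\<lambda>x. indicator {a..b} x * g x)" by (auto simp: indicator_def)
    ultimately show ?thesis by (simp add: set_lebesgue_integral_def)
  qed
  have sbound: "cmod (LBINT x. u x * cis (- (l * x))) \<le> e3 * T" for l
  proof -
    have "(LBINT x. u x * cis (- (l * x))) = (LBINT x. indicator {0..T} x * (f x * cis ((-l) * x)))"
      by (simp add: u_def mult_ac)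
    also have "\<dots> = integral {0..T} (\<lambda>x. f x * cis ((-l) * x))" by (intro lint continuous_intros)
    finally show ?thesis using T1(2)[OF T(2), of "-l"] by simp
  qed
  have ac: "continuous_on UNIV c" "\<And>r. r \<notin> {-T..T} \<Longrightarrow> c r = 0"
    "(LBINT r. (cmod (c r))\<^sup>2) \<le> (e3 * T)\<^sup>2 * M\<^sup>2 * T"
    using autocorrelation_L2_bound[OF cont M(2) T(1), of "e3 * T"] sbound unfolding c_def u_def by blast+
  have contcc: "continuous_on S c" for S by (rule continuous_on_subset[OF ac(1) subset_UNIV])
  have clow: "cmod (c r) \<ge> \<kappa>/4 * T" if r: "r \<ge> 0" "r \<le> T / 2" "\<And>y. cmod (f (y + r) - f y) \<le> 2 * e2" for r
  proof -
    have "c r = (LBINT y. indicator {0..T-r} y * (f (y + r) * cnj (f y)))"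
      unfolding c_def by (intro Bochner_Integration.integral_cong) (use r(1) in \<open>auto simp: u_def indicator_def\<close>)
    also have "\<dots> = integral {0..T-r} (\<lambda>y. f (y + r) * cnj (f y))" by (intro lint continuous_intros contc)
    finally have cr: "c r = integral {0..T-r} (\<lambda>y. f (y + r) * cnj (f y))" .
    have "c r - integral {0..T-r} (\<lambda>y. f y * cnj (f y)) = integral {0..T-r} (\<lambda>y. (f (y + r) - f y) * cnj (f y))"
      unfolding cr left_diff_distrib
      by (subst Henstock_Kurzweil_Integration.integral_diff) (auto intro!: integrable_continuous_real continuous_intros contc)
    also have "cmod \<dots> \<le> (2 * e2 * M) * (T - r - 0)"
    proof (rule integral_bound)
      fix y show "cmod ((f (y + r) - f y) * cnj (f y)) \<le> 2 * e2 * M"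
        unfolding norm_mult complex_mod_cnj by (intro mult_mono r(3) M) (use e2 in auto)
    qed (use r T in \<open>auto intro!: continuous_intros contc\<close>)
    also have "\<dots> \<le> (2 * e2 * M) * T" using r e2 M by (intro mult_left_mono) auto
    also have "\<dots> = \<kappa>/4 * T" using M by (simp add: e2_def)
    finally have 1: "cmod (c r - integral {0..T-r} (\<lambda>y. f y * cnj (f y))) \<le> \<kappa>/4 * T" .
    have "integral {0..T-r} (\<lambda>y. f y * cnj (f y)) = of_real (integral {0..T-r} (\<lambda>y. (cmod (f y))\<^sup>2))"
    proof -
      have "((\<lambda>y. complex_of_real ((cmod (f y))\<^sup>2)) has_integral of_real (integral {0..T-r} (\<lambda>y. (cmod (f y))\<^sup>2))) {0..T-r}"
        by (intro has_integral_of_real integrable_integral integrable_continuous_real continuous_intros)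
      then show ?thesis unfolding complex_norm_square by (rule integral_unique)
    qed
    moreover have "\<kappa> * (T/2) \<le> integral {0..T-r} (\<lambda>y. (cmod (f y))\<^sup>2)"
    proof -
      have "\<kappa> * (T/2) \<le> integral {0..T/2} (\<lambda>y. (cmod (f y))\<^sup>2)" by (rule lower1) (use T in auto)
      also have "\<dots> \<le> integral {0..T-r} (\<lambda>y. (cmod (f y))\<^sup>2)"
        by (rule integral_subset_le) (use r in \<open>auto intro!: integrable_continuous_real continuous_intros\<close>)
      finally show ?thesis .
    qed
    ultimately have "cmod (integral {0..T-r} (\<lambda>y. f y * cnj (f y))) \<ge> \<kappa> * (T/2)" by simp
    then show ?thesis using 1 norm_triangle_sub[of "integral {0..T-r} (\<lambda>y. f y * cnj (f y))" "c r"]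
      by (simp add: norm_minus_commute)
  qed
  have "T/2 * (2 * \<delta>) * (\<kappa>/4 * T)\<^sup>2 / (2 * L2) \<le> integral {0..T/2} (\<lambda>r. (cmod (c r))\<^sup>2)"
  proof (rule integral_blocks_lower[OF _ _ L2])
    fix a :: real assume a: "a \<ge> 0" "a + L2 \<le> T / 2"
    obtain \<tau> where \<tau>: "\<tau> \<in> {a + \<delta>..a + \<delta> + l2}" "\<forall>x. cmod (f (x + \<tau>) - f x) \<le> e2" using l2(2) by blast
    show "\<exists>b\<ge>a. b + 2 * \<delta> \<le> a + L2 \<and> (\<forall>x\<in>{b..b + 2 * \<delta>}. (\<kappa>/4 * T)\<^sup>2 \<le> (cmod (c x))\<^sup>2)"
    proof (intro exI[of _ "\<tau> - \<delta>"] conjI ballI)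
      fix r assume r: "r \<in> {\<tau> - \<delta>..\<tau> - \<delta> + 2 * \<delta>}"
      have "cmod (f (y + r) - f y) \<le> 2 * e2" for y
      proof -
        have "cmod (f (y + r) - f (y + \<tau>)) \<le> e2" using r \<delta> by (intro d2(2)) auto
        moreover have "cmod (f (y + \<tau>) - f y) \<le> e2" using \<tau>(2) by blast
        ultimately have "cmod (f (y + r) - f y) \<le> e2 + e2" by (rule norm_diff_triangle_le)
        then show ?thesis by simp
      qed
      then have "\<kappa>/4 * T \<le> cmod (c r)" using r \<tau>(1) a by (intro clow) (auto simp: L2_def)
      then show "(\<kappa>/4 * T)\<^sup>2 \<le> (cmod (c r))\<^sup>2" using \<kappa> T by (intro power_mono) auto
    qed (use \<tau>(1) in \<open>auto simp: L2_def\<close>)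
  qed (use T \<delta> in \<open>auto intro!: continuous_intros contcc\<close>)
  also have "integral {0..T/2} (\<lambda>r. (cmod (c r))\<^sup>2) \<le> (LBINT r. (cmod (c r))\<^sup>2)"
  proof -
    have cc: "continuous_on S (\<lambda>r. (cmod (c r))\<^sup>2)" for S by (intro continuous_intros contcc)
    have eq: "(\<lambda>r. indicator {-T..T} r *\<^sub>R (cmod (c r))\<^sup>2) = (\<lambda>r. (cmod (c r))\<^sup>2)"
      using ac(2) by (auto simp: indicator_def fun_eq_iff)
    have int: "integrable lborel (\<lambda>r. (cmod (c r))\<^sup>2)"
      using borel_integrable_atLeastAtMost'[OF cc, of "-T" T] unfolding set_integrable_def eq .
    have "integral {0..T/2} (\<lambda>r. (cmod (c r))\<^sup>2) = (LINT r:{0..T/2}|lborel. (cmod (c r))\<^sup>2)"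
      by (rule set_borel_integral_eq_integral(2)[OF borel_integrable_atLeastAtMost'[OF cc], symmetric])
    also have "\<dots> \<le> (LBINT r. (cmod (c r))\<^sup>2)"
      unfolding set_lebesgue_integral_def
      by (intro integral_mono int) (use borel_integrable_atLeastAtMost'[OF cc, of 0 "T/2"] in \<open>auto simp: set_integrable_def indicator_def\<close>)
    finally show ?thesis .
  qed
  also have "\<dots> \<le> (e3 * T)\<^sup>2 * M\<^sup>2 * T" by (rule ac(3))
  also have "\<dots> = \<kappa>3 / 4 * T ^ 3"
  proof -
    have "e3\<^sup>2 = \<kappa>3 / (4 * M\<^sup>2)" using \<kappa>3 by (simp add: e3_def power_divide power_mult_distrib)
    moreover have "(e3 * T)\<^sup>2 * M\<^sup>2 * T = e3\<^sup>2 * (M\<^sup>2 * T ^ 3)"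
      by (simp add: power_mult_distrib power3_eq_cube power2_eq_square)
    ultimately show ?thesis using M by simp
  qed
  also have "T/2 * (2 * \<delta>) * (\<kappa>/4 * T)\<^sup>2 / (2 * L2) = \<kappa>3 * T ^ 3"
    unfolding \<kappa>3_def using L2 by (simp add: power_mult_distrib power3_eq_cube power2_eq_square)
  finally have "\<kappa>3 * T ^ 3 \<le> \<kappa>3 / 4 * T ^ 3" .
  then show False using \<kappa>3 T by simp
qed

section \<open>Fourier transforms of test functions\<close>

text \<open>All derivatives are carried along with one bound for their supports, so boundary terms
  in integrations by parts vanish at every order.\<close>

definition test_chain :: "(nat \<Rightarrow> real \<Rightarrow> complex) \<Rightarrow> real \<Rightarrow> bool" where
  "test_chain D R \<longleftrightarrow> R > 0 \<and> (\<forall>n x. (D n has_vector_derivative D (Suc n) x) (at x)) \<and> (\<forall>n x. \<bar>x\<bar> \<ge> R \<longrightarrow> D n x = 0)"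

lemma test_function_chain:
  assumes "test_function \<phi>"
  obtains D R where "test_chain D R" "D 0 = \<phi>"
proof -
  obtain D where D: "D 0 = \<phi>" "\<And>n x. (D n has_vector_derivative D (Suc n) x) (at x)"
    and c: "compact (closure {x. \<phi> x \<noteq> 0})" using assms unfolding test_function_def by blast
  have "bounded {x. \<phi> x \<noteq> 0}" using bounded_subset[OF compact_imp_bounded[OF c] closure_subset] .
  then obtain B where B: "\<And>x. \<phi> x \<noteq> 0 \<Longrightarrow> \<bar>x\<bar> \<le> B" unfolding bounded_iff by auto
  define S where "S = {x::real. \<bar>x\<bar> > \<bar>B\<bar>}"
  have S: "open S" unfolding S_def by (intro open_Collect_less continuous_intros)
  have z: "D n x = 0" if "x \<in> S" for n x
    using that
  proof (induction n arbitrary: x)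
    case 0 then show ?case using B[of x] D(1) by (force simp: S_def)
  next
    case (Suc n)
    have "(D n has_vector_derivative 0) (at x)"
      by (rule has_vector_derivative_transform_within_open[of "\<lambda>_. 0" 0 x S]) (use S Suc in auto)
    with D(2)[of n x] show ?case by (rule vector_derivative_unique_at)
  qed
  have "test_chain D (\<bar>B\<bar> + 1)" unfolding test_chain_def using D(2) z by (auto simp: S_def)
  with D(1) that show ?thesis by blast
qed

lemma test_chain_continuous: "test_chain D R \<Longrightarrow> continuous_on S (D n)"
  unfolding test_chain_def by (meson continuous_at_imp_continuous_on has_vector_derivative_continuous)

abbreviation echar :: "real \<Rightarrow> complex \<Rightarrow> complex" where
  "echar t z \<equiv> exp (- 2 * of_real pi * \<i> * of_real t * z)"

definition ft :: "(real \<Rightarrow> complex) \<Rightarrow> complex \<Rightarrow> complex" where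
  "ft f z = (LBINT t. f t * echar t z)"

lemma fourier_eq_ft: "fourier f \<xi> = ft f (of_real \<xi>)"
  by (simp add: fourier_def ft_def)

lemma integral_compact_support:
  fixes f :: "real \<Rightarrow> complex"
  assumes "continuous_on UNIV f" "\<And>x. \<bar>x\<bar> \<ge> R \<Longrightarrow> f x = 0" "R > 0"
  shows "integrable lborel f" "(LBINT x. f x) = integral {-R..R} f"
proof -
  have c: "continuous_on {-R..R} f" using assms(1) continuous_on_subset by blast
  have eq: "(\<lambda>x. indicator {-R..R} x *\<^sub>R f x) = f" using assms(2) by (force simp: indicator_def fun_eq_iff)
  show "integrable lborel f" using borel_integrable_atLeastAtMost'[OF c] unfolding set_integrable_def eq .
  show "(LBINT x. f x) = integral {-R..R} f"
    using set_borel_integral_eq_integral(2)[OF borel_integrable_atLeastAtMost'[OF c]] unfolding set_lebesgue_integral_def eq .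
qed

lemma ft_eq_integral:
  assumes "test_chain D R"
  shows "ft (D n) z = integral {-R..R} (\<lambda>t. D n t * echar t z)"
  unfolding ft_def
proof (rule integral_compact_support)
  show "continuous_on UNIV (\<lambda>t. D n t * echar t z)"
    by (intro continuous_intros test_chain_continuous[OF assms])
  show "D n t * echar t z = 0" if "\<bar>t\<bar> \<ge> R" for t
    using assms that by (simp add: test_chain_def)
  show "R > 0" using assms by (simp add: test_chain_def)
qed

lemma ft_holomorphic:
  assumes "test_chain D R"
  shows "ft (D n) holomorphic_on UNIV"
proof -
  have c: "continuous_on S (D n)" for S by (rule test_chain_continuous[OF assms])
  have "(\<lambda>z. integral (cbox (-R) R) (\<lambda>t. D n t * echar t z)) holomorphic_on UNIV"
  proof (rule leibniz_rule_holomorphic)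
    show "((\<lambda>z. D n t * echar t z) has_field_derivative
       D n t * (echar t z * (- 2 * of_real pi * \<i> * of_real t))) (at z within UNIV)" for z t
      by (auto intro!: derivative_eq_intros)
    show "(\<lambda>t. D n t * echar t z) integrable_on cbox (-R) R" for z
      unfolding cbox_interval by (intro integrable_continuous_real continuous_intros c)
    show "continuous_on (UNIV \<times> cbox (-R) R) (\<lambda>(z, t). D n t * (echar t z * (- 2 * of_real pi * \<i> * of_real t)))"
      unfolding split_def by (intro continuous_intros continuous_on_compose2[OF c[of UNIV]]) auto
  qed auto
  then show ?thesis unfolding cbox_interval ft_eq_integral[OF assms, abs_def] by (simp add: ft_eq_integral[OF assms])
qed

lemma ft_derivative:
  assumes T: "test_chain D R"
  shows "2 * of_real pi * \<i> * z * ft (D n) z = ft (D (Suc n)) z"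
proof -
  let ?w = "- 2 * of_real pi * \<i> * z"
  have R: "R > 0" and D: "\<And>n x. (D n has_vector_derivative D (Suc n) x) (at x)" and z: "D n (-R) = 0" "D n R = 0"
    using T by (auto simp: test_chain_def)
  have e: "echar t z = exp (?w * of_real t)" for t by (simp add: mult_ac)
  have c: "continuous_on S (D m)" for S m by (rule test_chain_continuous[OF T])
  have "((\<lambda>t. D n t * exp (?w * of_real t)) has_vector_derivative (D n t * (?w * exp (?w * of_real t)) + D (Suc n) t * exp (?w * of_real t))) (at t within S)" for t S
  proof -
    have "((\<lambda>t. exp (?w * of_real t)) has_vector_derivative ?w * exp (?w * of_real t)) (at t within S)"
    proof -
      have "((\<lambda>z. exp (?w * z)) has_field_derivative ?w * exp (?w * of_real t)) (at (of_real t))"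
        by (auto intro!: derivative_eq_intros)
      then show ?thesis by (rule has_vector_derivative_real_field)
    qed
    then show ?thesis using D[of n t] by (intro has_vector_derivative_mult) (auto intro: has_vector_derivative_at_within)
  qed
  then have "((\<lambda>t. D n t * (?w * exp (?w * of_real t)) + D (Suc n) t * exp (?w * of_real t)) has_integral
      (D n R * exp (?w * of_real R) - D n (-R) * exp (?w * of_real (-R)))) {-R..R}"
    using R by (intro fundamental_theorem_of_calculus) auto
  then have "integral {-R..R} (\<lambda>t. D n t * (?w * exp (?w * of_real t)) + D (Suc n) t * exp (?w * of_real t)) = 0"
    using z by (simp add: integral_unique)
  moreover have "integral {-R..R} (\<lambda>t. D n t * (?w * exp (?w * of_real t)) + D (Suc n) t * exp (?w * of_real t)) =
     integral {-R..R} (\<lambda>t. ?w * (D n t * exp (?w * of_real t))) + integral {-R..R} (\<lambda>t. D (Suc n) t * exp (?w * of_real t))"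
    by (subst Henstock_Kurzweil_Integration.integral_add[symmetric])
       (auto intro!: integrable_continuous_real continuous_intros c simp: mult_ac)
  ultimately have "?w * integral {-R..R} (\<lambda>t. D n t * exp (?w * of_real t)) + integral {-R..R} (\<lambda>t. D (Suc n) t * exp (?w * of_real t)) = 0"
    by simp
  then show ?thesis unfolding ft_eq_integral[OF T] e by (simp add: algebra_simps add_eq_0_iff)
qed

lemma ft_strip_bound:
  assumes T: "test_chain D R"
  shows "\<exists>C. \<forall>z. \<bar>Im z\<bar> \<le> Y \<longrightarrow> cmod (ft (D n) z) \<le> C"
proof -
  have R: "R > 0" using T by (auto simp: test_chain_def)
  have c: "continuous_on S (D m)" for S m by (rule test_chain_continuous[OF T])
  have "bounded (D n ` {-R..R})" by (intro compact_imp_bounded compact_continuous_image c) auto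
  then obtain B where B: "\<And>t. t \<in> {-R..R} \<Longrightarrow> cmod (D n t) \<le> B" unfolding bounded_iff by blast
  have B0: "B \<ge> 0" using order_trans[OF norm_ge_zero B[of 0]] R by simp
  have "cmod (ft (D n) z) \<le> B * exp (2 * pi * R * Y) * (R - (-R))" if z: "\<bar>Im z\<bar> \<le> Y" for z
    unfolding ft_eq_integral[OF T]
  proof (rule integral_bound)
    fix t assume t: "t \<in> {-R..R}"
    have "Re (- 2 * of_real pi * \<i> * of_real t * z) = 2 * pi * (t * Im z)" by simp
    also have "t * Im z \<le> R * Y"
    proof -
      have "t * Im z \<le> \<bar>t\<bar> * \<bar>Im z\<bar>" by (metis abs_ge_self abs_mult)
      also have "\<dots> \<le> R * Y" using t z by (intro mult_mono) auto
      finally show ?thesis .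
    qed
    finally have "exp (Re (- 2 * of_real pi * \<i> * of_real t * z)) \<le> exp (2 * pi * R * Y)" by (simp add: mult.assoc)
    then show "cmod (D n t * echar t z) \<le> B * exp (2 * pi * R * Y)"
      unfolding norm_mult norm_exp_eq_Re using B[OF t] B0 by (intro mult_mono) auto
  qed (use R in \<open>auto intro!: continuous_intros c\<close>)
  then show ?thesis by blast
qed

text \<open>Each integration by parts gains a factor \<open>z\<close>. The bounds for the transforms
  of order 0 and \<open>n\<close> on the strip cover small and large \<open>z\<close>
  respectively.\<close>

lemma ft_decay:
  assumes T: "test_chain D R"
  shows "\<exists>C\<ge>0. \<forall>z. \<bar>Im z\<bar> \<le> Y \<longrightarrow> cmod (ft (D 0) z) \<le> C / (1 + cmod z) ^ n"
proof -
  have pow: "(2 * of_real pi * \<i> * z) ^ m * ft (D 0) z = ft (D m) z" for m z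
  proof (induction m)
    case (Suc m)
    have "(2 * of_real pi * \<i> * z) ^ Suc m * ft (D 0) z = (2 * of_real pi * \<i> * z) * ((2 * of_real pi * \<i> * z) ^ m * ft (D 0) z)" by simp
    then show ?case unfolding Suc ft_derivative[OF T] .
  qed simp
  obtain A where A: "\<And>z. \<bar>Im z\<bar> \<le> Y \<Longrightarrow> cmod (ft (D 0) z) \<le> A" using ft_strip_bound[OF T] by blast
  obtain B where B: "\<And>z. \<bar>Im z\<bar> \<le> Y \<Longrightarrow> cmod (ft (D n) z) \<le> B" using ft_strip_bound[OF T] by blast
  define C where "C = 2 ^ n * (\<bar>A\<bar> + \<bar>B\<bar>)"
  have "cmod (ft (D 0) z) \<le> C / (1 + cmod z) ^ n" if z: "\<bar>Im z\<bar> \<le> Y" for z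
  proof -
    have p1: "cmod z ^ n * cmod (ft (D 0) z) \<le> \<bar>B\<bar>"
    proof -
      have "cmod z ^ n * cmod (ft (D 0) z) \<le> (2 * pi * cmod z) ^ n * cmod (ft (D 0) z)"
        using pi_gt3 mult_right_mono[of 1 "2 * pi" "cmod z"] by (intro mult_right_mono power_mono) auto
      also have "\<dots> = cmod ((2 * of_real pi * \<i> * z) ^ n * ft (D 0) z)" by (simp add: norm_mult norm_power)
      also have "\<dots> \<le> \<bar>B\<bar>" unfolding pow using B[OF z] by linarith
      finally show ?thesis .
    qed
    have "(1 + cmod z) ^ n \<le> 2 ^ n * (1 + cmod z ^ n)"
    proof (cases "cmod z \<le> 1")
      case True
      then have "(1 + cmod z) ^ n \<le> 2 ^ n * 1" by (simp, intro power_mono) auto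
      also have "\<dots> \<le> 2 ^ n * (1 + cmod z ^ n)" by (intro mult_left_mono) auto
      finally show ?thesis .
    next
      case False
      then have "(1 + cmod z) ^ n \<le> (2 * cmod z) ^ n" by (intro power_mono) auto
      also have "\<dots> \<le> 2 ^ n * (1 + cmod z ^ n)" by (simp add: power_mult_distrib)
      finally show ?thesis .
    qed
    then have "(1 + cmod z) ^ n * cmod (ft (D 0) z) \<le> 2 ^ n * (1 + cmod z ^ n) * cmod (ft (D 0) z)" by (intro mult_right_mono) auto
    also have "\<dots> = 2 ^ n * (cmod (ft (D 0) z) + cmod z ^ n * cmod (ft (D 0) z))" by (simp add: algebra_simps)
    also have "\<dots> \<le> C" unfolding C_def using A[OF z] p1 by (intro mult_left_mono) auto
    finally show ?thesis by (subst pos_le_divide_eq) (auto simp: mult.commute add_pos_nonneg)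
  qed
  moreover have "C \<ge> 0" by (simp add: C_def)
  ultimately show ?thesis by blast
qed

text \<open>Gaussian summation: with a Gaussian weight the integrals may be exchanged, and the inner
  one becomes a narrow Gaussian kernel at \<nu>. Integrability of \<open>h\<close> lets the weight
  tend to 1, continuity of \<open>f\<close> lets the kernel narrow.\<close>

theorem fourier_inversion:
  fixes f :: "real \<Rightarrow> complex"
  assumes f: "continuous_on UNIV f" and supp: "\<And>x. \<bar>x\<bar> \<ge> R \<Longrightarrow> f x = 0" and R: "R > 0"
  defines "h \<equiv> \<lambda>x. LBINT t. f t * cis (- (2 * pi * t * x))"
  assumes h: "integrable lborel h"
  shows "(LBINT x. h x * cis (2 * pi * \<nu> * x)) = f \<nu>"
proof -
  have fi: "integrable lborel f" by (rule integral_compact_support(1)[OF f supp R])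
  have [measurable]: "f \<in> borel_measurable borel" "h \<in> borel_measurable borel" using fi h by auto
  have "bounded (f ` {-R..R})" by (intro compact_imp_bounded compact_continuous_image continuous_on_subset[OF f]) auto
  then obtain B where B: "\<And>t. t \<in> {-R..R} \<Longrightarrow> cmod (f t) \<le> B" unfolding bounded_iff by blast
  have B0: "B \<ge> 0" using order_trans[OF norm_ge_zero B[of 0]] R by simp
  have fB: "cmod (f t) \<le> B" for t using B[of t] supp[of t] B0 by (cases "\<bar>t\<bar> \<le> R") (auto simp: abs_le_iff)
  interpret N: real_distribution std_normal_distribution by (rule real_dist_normal_dist)
  define I where "I n = (LBINT x. h x * cis (2 * pi * \<nu> * x) * of_real (exp (- ((x / real (Suc n))\<^sup>2) / 2)))" for n
  have lim1: "I \<longlonglongrightarrow> (LBINT x. h x * cis (2 * pi * \<nu> * x))"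
    unfolding I_def
  proof (rule integral_dominated_convergence[where w = "\<lambda>x. cmod (h x)"])
    show "AE x in lborel. (\<lambda>n. h x * cis (2 * pi * \<nu> * x) * complex_of_real (exp (- ((x / real (Suc n))\<^sup>2) / 2))) \<longlonglongrightarrow> h x * cis (2 * pi * \<nu> * x)"
    proof (rule AE_I2)
      fix x
      have "(\<lambda>n. 1 / real (Suc n)) \<longlonglongrightarrow> 0" by (rule LIMSEQ_Suc[OF lim_1_over_n, unfolded o_def])
      then have "(\<lambda>n. h x * cis (2 * pi * \<nu> * x) * complex_of_real (exp (- ((x * (1 / real (Suc n)))\<^sup>2) / 2))) \<longlonglongrightarrow> h x * cis (2 * pi * \<nu> * x) * of_real (exp (- ((x * 0)\<^sup>2) / 2))"
        by (intro tendsto_intros) auto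
      then show "(\<lambda>n. h x * cis (2 * pi * \<nu> * x) * complex_of_real (exp (- ((x / real (Suc n))\<^sup>2) / 2))) \<longlonglongrightarrow> h x * cis (2 * pi * \<nu> * x)" by simp
    qed
    show "AE x in lborel. norm (h x * cis (2 * pi * \<nu> * x) * complex_of_real (exp (- ((x / real (Suc n))\<^sup>2) / 2))) \<le> cmod (h x)" for n
      by (auto simp: norm_mult intro!: mult_left_le)
  qed (use h in auto)
  have Ieq: "I n = of_real (sqrt (2 * pi) / (2 * pi)) * (LBINT s. f (\<nu> + 1 / (2 * pi * real (Suc n)) * s) * of_real (exp (- (s\<^sup>2) / 2)))" for n
  proof -
    define b where "b = real (Suc n)"
    have b: "b > 0" by (simp add: b_def)
    have "I n = b *\<^sub>R (LBINT l. h (0 + b * l) * cis (2 * pi * \<nu> * (0 + b * l)) * of_real (exp (- (((0 + b * l) / b)\<^sup>2) / 2)))"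
      unfolding I_def b_def[symmetric] using lborel_integral_real_affine[of b "\<lambda>x. h x * cis (2 * pi * \<nu> * x) * of_real (exp (- ((x / b)\<^sup>2) / 2))" 0] b by simp
    also have "(LBINT l. h (0 + b * l) * cis (2 * pi * \<nu> * (0 + b * l)) * of_real (exp (- (((0 + b * l) / b)\<^sup>2) / 2))) =
       (LBINT l. of_real (sqrt (2 * pi)) * (std_normal_density l *\<^sub>R (h (b * l) * cis (2 * pi * \<nu> * (b * l)))))"
      using b by (intro Bochner_Integration.integral_cong refl) (simp add: std_normal_density_def scaleR_conv_of_real field_simps)
    also have "\<dots> = of_real (sqrt (2 * pi)) * (LINT l|std_normal_distribution. h (b * l) * cis (2 * pi * \<nu> * (b * l)))"
      by (simp only: integral_mult_right_zero, subst integral_density) auto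
    also have "(LINT l|std_normal_distribution. h (b * l) * cis (2 * pi * \<nu> * (b * l))) =
       (LINT l|std_normal_distribution. LINT t|lborel. f t * cis (l * (2 * pi * b * (\<nu> - t))))"
    proof (intro Bochner_Integration.integral_cong refl)
      fix l
      have "h (b * l) * cis (2 * pi * \<nu> * (b * l)) = (LBINT t. f t * cis (- (2 * pi * t * (b * l))) * cis (2 * pi * \<nu> * (b * l)))"
        unfolding h_def by simp
      also have "\<dots> = (LBINT t. f t * cis (l * (2 * pi * b * (\<nu> - t))))"
        unfolding mult.assoc[of "f _"] cis_mult by (intro Bochner_Integration.integral_cong refl) (simp add: algebra_simps)
      finally show "h (b * l) * cis (2 * pi * \<nu> * (b * l)) = (LBINT t. f t * cis (l * (2 * pi * b * (\<nu> - t))))" .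
    qed
    also have "\<dots> = (LBINT t. f t * (LINT l|std_normal_distribution. cis (l * (2 * pi * b * (\<nu> - t)))))"
      by (rule Fubini_bounded_kernel[where B = 1]) (use fi N.finite_measure_axioms in auto)
    also have "\<dots> = (LBINT t. f t * of_real (exp (- ((2 * pi * b * (\<nu> - t))\<^sup>2) / 2)))"
    proof (intro Bochner_Integration.integral_cong refl arg_cong2[where f = "(*)"])
      fix t
      have "(LINT l|std_normal_distribution. cis (l * (2 * pi * b * (\<nu> - t)))) = char std_normal_distribution (2 * pi * b * (\<nu> - t))"
        unfolding char_def by (simp add: cis_conv_exp mult_ac)
      then show "(LINT l|std_normal_distribution. cis (l * (2 * pi * b * (\<nu> - t)))) = of_real (exp (- ((2 * pi * b * (\<nu> - t))\<^sup>2) / 2))"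
        by (simp add: char_std_normal_distribution)
    qed
    also have "\<dots> = \<bar>1 / (2 * pi * b)\<bar> *\<^sub>R (LBINT s. f (\<nu> + 1 / (2 * pi * b) * s) * of_real (exp (- ((2 * pi * b * (\<nu> - (\<nu> + 1 / (2 * pi * b) * s)))\<^sup>2) / 2)))"
      by (rule lborel_integral_real_affine) (use b in simp)
    also have "(\<lambda>s. f (\<nu> + 1 / (2 * pi * b) * s) * complex_of_real (exp (- ((2 * pi * b * (\<nu> - (\<nu> + 1 / (2 * pi * b) * s)))\<^sup>2) / 2))) =
       (\<lambda>s. f (\<nu> + 1 / (2 * pi * b) * s) * of_real (exp (- (s\<^sup>2) / 2)))"
      using b by (simp add: power2_eq_square)
    finally show ?thesis unfolding b_def[symmetric] using b by (simp add: scaleR_conv_of_real)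
  qed
  have "(\<lambda>n. LBINT s. f (\<nu> + 1 / (2 * pi * real (Suc n)) * s) * of_real (exp (- (s\<^sup>2) / 2))) \<longlonglongrightarrow> (LBINT s. f \<nu> * of_real (exp (- (s\<^sup>2) / 2)))"
  proof (rule integral_dominated_convergence[where w = "\<lambda>s. B * exp (- (s\<^sup>2) / 2)"])
    show "integrable lborel (\<lambda>s. B * exp (- (s\<^sup>2) / 2))" by (intro integrable_mult_right gaussian_integral)
    show "AE s in lborel. (\<lambda>n. f (\<nu> + 1 / (2 * pi * real (Suc n)) * s) * complex_of_real (exp (- (s\<^sup>2) / 2))) \<longlonglongrightarrow> f \<nu> * of_real (exp (- (s\<^sup>2) / 2))"
    proof (rule AE_I2, intro tendsto_intros)
      fix s
      have "(\<lambda>n. 1 / real (Suc n)) \<longlonglongrightarrow> 0" by (rule LIMSEQ_Suc[OF lim_1_over_n, unfolded o_def])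
      then have "(\<lambda>n. \<nu> + 1 / (2 * pi) * (1 / real (Suc n)) * s) \<longlonglongrightarrow> \<nu> + 1 / (2 * pi) * 0 * s" by (intro tendsto_intros)
      then have "(\<lambda>n. \<nu> + 1 / (2 * pi * real (Suc n)) * s) \<longlonglongrightarrow> \<nu>" by simp
      then show "(\<lambda>n. f (\<nu> + 1 / (2 * pi * real (Suc n)) * s)) \<longlonglongrightarrow> f \<nu>"
        using f by (intro isCont_tendsto_compose[of \<nu> f]) (auto simp: continuous_on_eq_continuous_at)
    qed
    show "AE s in lborel. norm (f (\<nu> + 1 / (2 * pi * real (Suc n)) * s) * complex_of_real (exp (- (s\<^sup>2) / 2))) \<le> B * exp (- (s\<^sup>2) / 2)" for n
    proof (rule AE_I2)
      fix s
      show "norm (f (\<nu> + 1 / (2 * pi * real (Suc n)) * s) * complex_of_real (exp (- (s\<^sup>2) / 2))) \<le> B * exp (- (s\<^sup>2) / 2)"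
        unfolding norm_mult by (intro mult_mono fB) (use B0 in auto)
    qed
  qed measurable
  also have "(LBINT s. f \<nu> * complex_of_real (exp (- (s\<^sup>2) / 2))) = f \<nu> * of_real (sqrt (2 * pi))"
    by (simp only: integral_mult_right_zero integral_complex_of_real gaussian_integral(2))
  finally have "I \<longlonglongrightarrow> of_real (sqrt (2 * pi) / (2 * pi)) * (f \<nu> * of_real (sqrt (2 * pi)))"
    unfolding Ieq[abs_def] by (intro tendsto_mult_left)
  also have "of_real (sqrt (2 * pi) / (2 * pi)) * (f \<nu> * of_real (sqrt (2 * pi))) = f \<nu>"
  proof -
    have "of_real (sqrt (2 * pi) / (2 * pi)) * (f \<nu> * of_real (sqrt (2 * pi))) = of_real (sqrt (2 * pi) * sqrt (2 * pi) / (2 * pi)) * f \<nu>"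
      by (simp only: of_real_mult of_real_divide times_divide_eq_left times_divide_eq_right mult_ac)
    also have "sqrt (2 * pi) * sqrt (2 * pi) / (2 * pi) = 1" by (simp only: real_sqrt_mult_self) simp
    finally show ?thesis by (simp only: of_real_1 mult_1_left)
  qed
  finally show ?thesis using lim1 LIMSEQ_unique by blast
qed

lemma integrable_inverse_square: "integrable lborel (\<lambda>x::real. 1 / (1 + x\<^sup>2))"
  using integrable_inverse_1_plus_square by (simp add: set_integrable_def einterval_eq inverse_eq_divide)

section \<open>Cauchy theorem on rectangles\<close>

lemma contour_integral_horizontal:
  assumes ab: "a < b" and f: "continuous_on {a..b} (\<lambda>x. f (Complex x y))"
  shows "contour_integral (linepath (Complex a y) (Complex b y)) f = integral {a..b} (\<lambda>x. f (Complex x y))"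
proof -
  define g where "g x = f (Complex x y)" for x
  have "(g has_integral integral {a..b} g) (cbox a b)"
    using f unfolding g_def cbox_interval by (intro integrable_integral integrable_continuous_real)
  from has_integral_affinity[OF this, of "b - a" a] ab
  have "((\<lambda>s. g ((b - a) * s + a)) has_integral (1 / (b - a)) *\<^sub>R integral {a..b} g) ((\<lambda>x. 1 / (b - a) * x + - (1 / (b - a) * a)) ` {a..b})"
    by simp
  moreover have "(\<lambda>x. 1 / (b - a) * x + - (1 / (b - a) * a)) ` {a..b} = {0..1}"
    using ab by (subst image_affinity_atLeastAtMost) (auto simp: diff_divide_distrib[symmetric])
  ultimately have "((\<lambda>s. g ((b - a) * s + a)) has_integral (1 / (b - a)) *\<^sub>R integral {a..b} g) {0..1}" by simp
  from has_integral_mult_left[OF this, of "of_real (b - a)"]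
  have "((\<lambda>s. g ((b - a) * s + a) * of_real (b - a)) has_integral integral {a..b} g) {0..1}"
    using ab by (simp add: scaleR_conv_of_real)
  moreover have "g ((b - a) * s + a) * of_real (b - a) = f (linepath (Complex a y) (Complex b y) s) * (Complex b y - Complex a y)" for s
  proof -
    have "linepath (Complex a y) (Complex b y) s = Complex ((b - a) * s + a) y"
      by (simp add: linepath_def complex_eq_iff algebra_simps)
    moreover have "Complex b y - Complex a y = of_real (b - a)" by (simp add: complex_eq_iff)
    ultimately show ?thesis by (simp add: g_def)
  qed
  ultimately have "(f has_contour_integral integral {a..b} g) (linepath (Complex a y) (Complex b y))"
    unfolding has_contour_integral_linepath by simp
  then show ?thesis unfolding g_def by (rule contour_integral_unique)
qed

text \<open>In the counterclockwise orientation the lower side enters with a plus sign and the upper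
  one with a minus sign; the vertical sides, of length \<open>y2 - y1\<close> each, are the
  error.\<close>

lemma rectpath_horizontal_sides:
  assumes ab: "a < b" and y: "y1 < y2"
    and f: "continuous_on {z. Re z \<in> {a..b} \<and> Im z \<in> {y1..y2} \<and> (Im z = y1 \<or> Im z = y2 \<or> Re z = a \<or> Re z = b)} f"
    and I: "(f has_contour_integral I) (rectpath (Complex a y1) (Complex b y2))"
    and V: "\<And>z. Re z = a \<or> Re z = b \<Longrightarrow> Im z \<in> {y1..y2} \<Longrightarrow> cmod (f z) \<le> V"
  shows "cmod (I - (integral {a..b} (\<lambda>x. f (Complex x y1)) - integral {a..b} (\<lambda>x. f (Complex x y2)))) \<le> 2 * V * (y2 - y1)"
proof -
  let ?S = "{z. Re z \<in> {a..b} \<and> Im z \<in> {y1..y2} \<and> (Im z = y1 \<or> Im z = y2 \<or> Re z = a \<or> Re z = b)}"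
  have h: "continuous_on (closed_segment (Complex u w) (Complex v w)) f" if "u \<in> {a..b}" "v \<in> {a..b}" "w = y1 \<or> w = y2" for u v w
    using that y by (intro continuous_on_subset[OF f]) (auto simp: closed_segment_same_Im closed_segment_eq_real_ivl split: if_splits)
  have v: "continuous_on (closed_segment (Complex w u) (Complex w v)) f" if "u \<in> {y1..y2}" "v \<in> {y1..y2}" "w = a \<or> w = b" for u v w
    using that ab by (intro continuous_on_subset[OF f]) (auto simp: closed_segment_same_Re closed_segment_eq_real_ivl split: if_splits)
  note ci = contour_integrable_continuous_linepath
  have i1: "f contour_integrable_on linepath (Complex a y1) (Complex b y1)" using ab by (intro ci h) auto
  have i2: "f contour_integrable_on linepath (Complex b y1) (Complex b y2)" using y by (intro ci v) auto
  have i3: "f contour_integrable_on linepath (Complex b y2) (Complex a y2)" using ab by (intro ci h) auto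
  have i4: "f contour_integrable_on linepath (Complex a y2) (Complex a y1)" using y by (intro ci v) auto
  have "I = contour_integral (rectpath (Complex a y1) (Complex b y2)) f" using I by (simp add: contour_integral_unique)
  also have "\<dots> = contour_integral (linepath (Complex a y1) (Complex b y1)) f + (contour_integral (linepath (Complex b y1) (Complex b y2)) f +
     (contour_integral (linepath (Complex b y2) (Complex a y2)) f + contour_integral (linepath (Complex a y2) (Complex a y1)) f))"
    unfolding rectpath_def Let_def by (simp add: i1 i2 i3 i4 contour_integrable_join)
  also have "contour_integral (linepath (Complex b y2) (Complex a y2)) f = - contour_integral (linepath (Complex a y2) (Complex b y2)) f"
    using ab by (intro contour_integral_reverse_linepath h) auto
  also have "contour_integral (linepath (Complex a y2) (Complex b y2)) f = integral {a..b} (\<lambda>x. f (Complex x y2))"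
    by (rule contour_integral_horizontal[OF ab], rule continuous_on_compose2[OF f])
       (use y in \<open>auto intro!: continuous_intros simp: Complex_eq\<close>)
  also have "contour_integral (linepath (Complex a y1) (Complex b y1)) f = integral {a..b} (\<lambda>x. f (Complex x y1))"
    by (rule contour_integral_horizontal[OF ab], rule continuous_on_compose2[OF f])
       (use y in \<open>auto intro!: continuous_intros simp: Complex_eq\<close>)
  finally have "I - (integral {a..b} (\<lambda>x. f (Complex x y1)) - integral {a..b} (\<lambda>x. f (Complex x y2))) =
     contour_integral (linepath (Complex b y1) (Complex b y2)) f + contour_integral (linepath (Complex a y2) (Complex a y1)) f" by simp
  also have "cmod \<dots> \<le> V * cmod (Complex b y2 - Complex b y1) + V * cmod (Complex a y1 - Complex a y2)"
  proof (intro order_trans[OF norm_triangle_ineq] add_mono)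
    have V0: "V \<ge> 0" using order_trans[OF norm_ge_zero V[of "Complex a y1"]] y by simp
    show "cmod (contour_integral (linepath (Complex b y1) (Complex b y2)) f) \<le> V * cmod (Complex b y2 - Complex b y1)"
      by (rule contour_integral_bound_linepath[OF i2 V0])
        (use y in \<open>auto intro!: V simp: closed_segment_same_Re closed_segment_eq_real_ivl split: if_splits\<close>)
    show "cmod (contour_integral (linepath (Complex a y2) (Complex a y1)) f) \<le> V * cmod (Complex a y1 - Complex a y2)"
      by (rule contour_integral_bound_linepath[OF i4 V0])
        (use y in \<open>auto intro!: V simp: closed_segment_same_Re closed_segment_eq_real_ivl split: if_splits\<close>)
  qed
  also have "\<dots> = 2 * V * (y2 - y1)"
  proof -
    have "cmod (Complex b y2 - Complex b y1) = y2 - y1" "cmod (Complex a y1 - Complex a y2) = y2 - y1"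
      using y by (simp_all add: cmod_def)
    then show ?thesis by simp
  qed
  finally show ?thesis .
qed

lemma path_image_rectpath_sides:
  assumes "a < b" "y1 < y2"
  shows "path_image (rectpath (Complex a y1) (Complex b y2)) \<subseteq> {z. Re z \<in> {a..b} \<and> Im z \<in> {y1..y2} \<and> (Im z = y1 \<or> Im z = y2 \<or> Re z = a \<or> Re z = b)}"
  using assms unfolding rectpath_def Let_def
  by (auto simp: path_image_join closed_segment_same_Im closed_segment_same_Re closed_segment_eq_real_ivl split: if_splits)

lemma rectangle_holomorphic:
  assumes ab: "a < b" and y: "y1 < y2" and S: "convex S" "open S" and f: "f holomorphic_on S"
    and sub: "{z. Re z \<in> {a..b} \<and> Im z \<in> {y1..y2}} \<subseteq> S"
    and V: "\<And>z. Re z = a \<or> Re z = b \<Longrightarrow> Im z \<in> {y1..y2} \<Longrightarrow> cmod (f z) \<le> V"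
  shows "cmod (integral {a..b} (\<lambda>x. f (Complex x y1)) - integral {a..b} (\<lambda>x. f (Complex x y2))) \<le> 2 * V * (y2 - y1)"
proof -
  have "(f has_contour_integral 0) (rectpath (Complex a y1) (Complex b y2))"
    using path_image_rectpath_sides[OF ab y] sub
    by (intro Cauchy_theorem_convex_simple[OF f S(1)]) auto
  from rectpath_horizontal_sides[OF ab y continuous_on_subset[OF holomorphic_on_imp_continuous_on[OF f]] this V] sub
  show ?thesis by (simp add: norm_minus_commute) auto
qed

lemma rectangle_cauchy:
  assumes ab: "a < t" "t < b" and y: "y > 0" and f: "f holomorphic_on UNIV"
    and V: "\<And>z. Re z = a \<or> Re z = b \<Longrightarrow> Im z \<in> {-y..y} \<Longrightarrow> cmod (f z / (z - of_real t)) \<le> V"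
  shows "cmod (2 * of_real pi * \<i> * f (of_real t) - (integral {a..b} (\<lambda>x. f (Complex x (-y)) / (Complex x (-y) - of_real t)) - integral {a..b} (\<lambda>x. f (Complex x y) / (Complex x y - of_real t)))) \<le> 4 * V * y"
proof -
  have ab': "a < b" using ab by simp
  have y': "-y < y" using y by simp
  have sub: "path_image (rectpath (Complex a (-y)) (Complex b y)) \<subseteq> UNIV - {of_real t}"
    using path_image_rectpath_sides[OF ab' y'] ab y by force
  have "((\<lambda>z. f z / (z - of_real t)) has_contour_integral (2*pi * \<i> * winding_number (rectpath (Complex a (-y)) (Complex b y)) (of_real t) * f (of_real t))) (rectpath (Complex a (-y)) (Complex b y))"
    using sub by (intro Cauchy_integral_formula_convex_simple[OF _ f]) auto
  also have "winding_number (rectpath (Complex a (-y)) (Complex b y)) (of_real t) = 1"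
    using ab y by (intro winding_number_rectpath) (simp add: in_box_complex_iff)
  finally have I: "((\<lambda>z. f z / (z - of_real t)) has_contour_integral (2*pi * \<i> * f (of_real t))) (rectpath (Complex a (-y)) (Complex b y))" by simp
  have "continuous_on {z. Re z \<in> {a..b} \<and> Im z \<in> {-y..y} \<and> (Im z = -y \<or> Im z = y \<or> Re z = a \<or> Re z = b)} (\<lambda>z. f z / (z - of_real t))"
    using ab y by (intro continuous_intros continuous_on_subset[OF holomorphic_on_imp_continuous_on[OF f]]) auto
  from rectpath_horizontal_sides[OF ab' y' this I V] show ?thesis by simp
qed

section \<open>Almost periodic functions on horizontal lines\<close>

lemma AP_translation:
  assumes "G \<in> AP" "0 < \<alpha>" "\<alpha> < \<beta>" "e > 0"
  obtains l where "l > 0" "\<And>x. \<exists>\<tau>. x < \<tau> \<and> \<tau> < x + l \<and> (\<forall>z. \<alpha> < Im z \<longrightarrow> Im z < \<beta> \<longrightarrow> cmod (G (z + of_real \<tau>) - G z) \<le> e)"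
proof -
  obtain S where S: "relatively_dense S" "\<And>t z. t \<in> S \<Longrightarrow> \<alpha> < Im z \<Longrightarrow> Im z < \<beta> \<Longrightarrow> cmod (G (z + of_real t) - G z) \<le> e"
    using assms unfolding AP_def by blast
  from S(1) obtain l where l: "l > 0" "\<And>x. S \<inter> {x<..<x + l} \<noteq> {}" unfolding relatively_dense_def by blast
  show ?thesis
  proof (rule that[OF l(1)])
    fix x
    obtain \<tau> where "\<tau> \<in> S" "x < \<tau>" "\<tau> < x + l" using l(2)[of x] by auto
    then show "\<exists>\<tau>. x < \<tau> \<and> \<tau> < x + l \<and> (\<forall>z. \<alpha> < Im z \<longrightarrow> Im z < \<beta> \<longrightarrow> cmod (G (z + of_real \<tau>) - G z) \<le> e)"
      using S(2) by blast
  qed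
qed

lemma AP_continuous: "G \<in> AP \<Longrightarrow> continuous_on {z. Im z > 0} G"
  unfolding AP_def upper_halfplane_def by (auto intro: holomorphic_on_imp_continuous_on)

text \<open>A translation number brings any point into a compact box. The strip is enlarged to
  heights between \<open>\<alpha> / 2\<close> and \<open>2 * \<beta>\<close> because translation
  numbers refer to open strips.\<close>

lemma AP_strip_bounded:
  assumes G: "G \<in> AP" and \<alpha>: "0 < \<alpha>"
  shows "\<exists>M\<ge>0. \<forall>z. \<alpha> \<le> Im z \<and> Im z \<le> \<beta> \<longrightarrow> cmod (G z) \<le> M"
proof (cases "\<alpha> \<le> \<beta>")
  case True
  obtain l where l: "l > 0" "\<And>x. \<exists>\<tau>. x < \<tau> \<and> \<tau> < x + l \<and> (\<forall>z. \<alpha> / 2 < Im z \<longrightarrow> Im z < 2 * \<beta> \<longrightarrow> cmod (G (z + of_real \<tau>) - G z) \<le> 1)"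
  proof -
    have "0 < \<alpha> / 2" "\<alpha> / 2 < 2 * \<beta>" "(0::real) < 1" using \<alpha> True by auto
    from AP_translation[OF G this] show thesis using that by blast
  qed
  have "compact (cbox (Complex 0 \<alpha>) (Complex l \<beta>))" by (rule compact_cbox)
  moreover have "continuous_on (cbox (Complex 0 \<alpha>) (Complex l \<beta>)) G"
    by (rule continuous_on_subset[OF AP_continuous[OF G]]) (use \<alpha> in \<open>auto simp: in_cbox_complex_iff\<close>)
  ultimately have "bounded (G ` cbox (Complex 0 \<alpha>) (Complex l \<beta>))" by (intro compact_imp_bounded compact_continuous_image)
  then obtain B where B: "\<And>z. z \<in> cbox (Complex 0 \<alpha>) (Complex l \<beta>) \<Longrightarrow> cmod (G z) \<le> B" unfolding bounded_iff by blast
  have "cmod (G z) \<le> \<bar>B\<bar> + 1" if z: "\<alpha> \<le> Im z" "Im z \<le> \<beta>" for z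
  proof -
    obtain \<tau> where \<tau>: "- Re z < \<tau>" "\<tau> < - Re z + l" "\<And>z. \<alpha> / 2 < Im z \<Longrightarrow> Im z < 2 * \<beta> \<Longrightarrow> cmod (G (z + of_real \<tau>) - G z) \<le> 1"
      using l(2)[of "- Re z"] by blast
    have "cmod (G (z + of_real \<tau>)) \<le> B" using \<tau>(1,2) z by (intro B) (auto simp: in_cbox_complex_iff)
    moreover have "cmod (G (z + of_real \<tau>) - G z) \<le> 1" using z \<alpha> by (intro \<tau>(3)) auto
    ultimately show ?thesis using norm_triangle_sub[of "G z" "G (z + of_real \<tau>)"] by (simp add: norm_minus_commute)
  qed
  then show ?thesis by (intro exI[of _ "\<bar>B\<bar> + 1"]) auto
qed (auto intro!: exI[of _ 0])

text \<open>Translation numbers reduce every translate, up to a small error, to a shift in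
  \<open>{0..l}\<close>, and uniform continuity replaces this interval by a grid. Uniform continuity
  on the whole line is itself carried over from a compact interval by translation.\<close>

lemma AP_line_bohr_ap:
  assumes G: "G \<in> AP" and y: "y > 0"
  shows "bohr_ap (\<lambda>x. G (Complex x y))"
  unfolding bohr_ap_def
proof (intro conjI allI impI)
  define f where "f x = G (Complex x y)" for x
  show c0: "continuous_on UNIV (\<lambda>x. G (Complex x y))"
    by (rule continuous_on_compose2[OF AP_continuous[OF G]]) (use y in \<open>auto simp: Complex_eq intro!: continuous_intros\<close>)
  then have cont: "continuous_on S f" for S unfolding f_def using continuous_on_subset by blast
  have trans: "\<exists>l>0. \<forall>x. \<exists>\<tau>. x < \<tau> \<and> \<tau> < x + l \<and> (\<forall>x. cmod (f (x + \<tau>) - f x) \<le> e)" if e: "e > 0" for e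
  proof -
    obtain l where l: "l > 0" "\<And>x. \<exists>\<tau>. x < \<tau> \<and> \<tau> < x + l \<and> (\<forall>z. y / 2 < Im z \<longrightarrow> Im z < 2 * y \<longrightarrow> cmod (G (z + of_real \<tau>) - G z) \<le> e)"
      using AP_translation[OF G, of "y/2" "2*y" e] y e by auto
    have eq: "Complex x y + of_real \<tau> = Complex (x + \<tau>) y" for x \<tau> by (simp add: complex_eq_iff)
    have "\<exists>\<tau>. x < \<tau> \<and> \<tau> < x + l \<and> (\<forall>x. cmod (f (x + \<tau>) - f x) \<le> e)" for x
    proof -
      obtain \<tau> where \<tau>: "x < \<tau>" "\<tau> < x + l" "\<And>z. y / 2 < Im z \<Longrightarrow> Im z < 2 * y \<Longrightarrow> cmod (G (z + of_real \<tau>) - G z) \<le> e"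
        using l(2)[of x] by blast
      have "cmod (f (x + \<tau>) - f x) \<le> e" for x using \<tau>(3)[of "Complex x y"] y unfolding eq f_def by simp
      with \<tau> show ?thesis by blast
    qed
    with l(1) show ?thesis by blast
  qed
  fix e :: real assume e: "e > 0"
  obtain l where l: "l > 0" "\<And>x. \<exists>\<tau>. x < \<tau> \<and> \<tau> < x + l \<and> (\<forall>x. cmod (f (x + \<tau>) - f x) \<le> e/6)"
    using trans[of "e/6"] e by auto
  \<comment> \<open>The margin 1 leaves room for \<open>v + \<tau>\<close> when
    \<open>u + \<tau>\<close> lies in \<open>{0..l}\<close> and
    \<open>\<bar>u - v\<bar> < 1\<close>.\<close>
  have "uniformly_continuous_on {-1..l+1} f" by (intro compact_uniformly_continuous cont) auto
  then obtain d0 where d0: "d0 > 0" "\<And>u v. u \<in> {-1..l+1} \<Longrightarrow> v \<in> {-1..l+1} \<Longrightarrow> dist v u < d0 \<Longrightarrow> dist (f v) (f u) < e/6"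
    unfolding uniformly_continuous_on_def using e by (metis divide_pos_pos zero_less_numeral)
  define d where "d = min d0 1"
  have d: "d > 0" "d \<le> d0" "d \<le> 1" using d0 by (auto simp: d_def)
  have uc: "cmod (f u - f v) \<le> e/2" if uv: "\<bar>u - v\<bar> < d" for u v
  proof -
    obtain \<tau> where \<tau>: "- u < \<tau>" "\<tau> < - u + l" "\<And>x. cmod (f (x + \<tau>) - f x) \<le> e/6" using l(2)[of "- u"] by blast
    have "dist (f (v + \<tau>)) (f (u + \<tau>)) < e/6"
      by (rule d0(2)) (use \<tau>(1,2) uv d in \<open>auto simp: dist_real_def abs_if split: if_splits\<close>)
    then have 1: "cmod (f (u + \<tau>) - f (v + \<tau>)) \<le> e/6" by (simp add: dist_norm norm_minus_commute)
    have 2: "cmod (f u - f (u + \<tau>)) \<le> e/6" using \<tau>(3)[of u] by (simp add: norm_minus_commute)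
    have "cmod (f u - f v) \<le> e/6 + e/6 + e/6" by (rule norm_diff_triangle_le[OF norm_diff_triangle_le[OF 2 1] \<tau>(3)])
    then show ?thesis by simp
  qed
  define N where "N = (\<lambda>j. real j * (d/2)) ` {..nat \<lceil>l / (d/2)\<rceil>}"
  have "\<exists>s\<in>N. \<forall>x. cmod (f (x + t) - f (x + s)) \<le> e" for t
  proof -
    obtain \<tau> where \<tau>: "- t < \<tau>" "\<tau> < - t + l" "\<And>x. cmod (f (x + \<tau>) - f x) \<le> e/6" using l(2)[of "- t"] by blast
    define j where "j = nat \<lfloor>(t + \<tau>) / (d/2)\<rfloor>"
    have q: "(t + \<tau>) / (d/2) \<ge> 0" using \<tau>(1) d by simp
    then have j: "real j \<le> (t + \<tau>) / (d/2)" "(t + \<tau>) / (d/2) < real j + 1" by (auto simp: j_def)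
    have jd: "real j * (d/2) \<le> t + \<tau>" "t + \<tau> < real j * (d/2) + d/2" using j d by (auto simp: field_simps)
    have "(t + \<tau>) / (d/2) \<le> l / (d/2)" using \<tau>(2) d by (intro divide_right_mono) auto
    then have "j \<le> nat \<lceil>l / (d/2)\<rceil>" unfolding j_def by (intro nat_mono) linarith
    then have "real j * (d/2) \<in> N" by (auto simp: N_def)
    moreover have "cmod (f (x + t) - f (x + real j * (d/2))) \<le> e" for x
    proof -
      have "cmod (f (x + t) - f (x + t + \<tau>)) \<le> e/6" using \<tau>(3)[of "x + t"] by (simp add: norm_minus_commute)
      moreover have "cmod (f (x + t + \<tau>) - f (x + real j * (d/2))) \<le> e/2" using jd d by (intro uc) auto
      ultimately have "cmod (f (x + t) - f (x + real j * (d/2))) \<le> e/6 + e/2" by (rule norm_diff_triangle_le)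
      then show ?thesis using e by simp
    qed
    ultimately show ?thesis by blast
  qed
  moreover have "finite N" by (simp add: N_def)
  ultimately show "\<exists>N. finite N \<and> (\<forall>t. \<exists>s\<in>N. \<forall>x. cmod (G (Complex (x + t) y) - G (Complex (x + s) y)) \<le> e)"
    unfolding f_def by blast
qed

section \<open>Means along horizontal lines above the height \<open>c\<close>\<close>

locale shifted_AP =
  fixes F :: "complex \<Rightarrow> complex" and c :: real
  assumes c: "c > 0" and FAP: "(\<lambda>z. F (z + \<i> * of_real c)) \<in> AP"
    and holF: "F holomorphic_on upper_halfplane"
begin

lemma line_bohr_ap: "y > c \<Longrightarrow> bohr_ap (\<lambda>x. F (Complex x y))"
proof -
  assume "y > c"
  then have "bohr_ap (\<lambda>x. F (Complex x (y - c) + \<i> * of_real c))" by (intro AP_line_bohr_ap[OF FAP]) simp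
  moreover have "Complex x (y - c) + \<i> * of_real c = Complex x y" for x by (simp add: complex_eq_iff)
  ultimately show ?thesis by simp
qed

lemma strip_bounded:
  assumes "\<alpha> > c" shows "\<exists>M\<ge>0. \<forall>z. \<alpha> \<le> Im z \<and> Im z \<le> \<beta> \<longrightarrow> cmod (F z) \<le> M"
proof -
  obtain M where M: "M \<ge> 0" "\<And>z. \<alpha> - c \<le> Im z \<and> Im z \<le> \<beta> - c \<Longrightarrow> cmod (F (z + \<i> * of_real c)) \<le> M"
    using AP_strip_bounded[OF FAP, of "\<alpha> - c" "\<beta> - c"] assms by auto
  have "cmod (F z) \<le> M" if "\<alpha> \<le> Im z \<and> Im z \<le> \<beta>" for z
    using M(2)[of "z - \<i> * of_real c"] that by simp
  with M(1) show ?thesis by blast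
qed

definition line_mean :: "real \<Rightarrow> real \<Rightarrow> complex" where
  "line_mean \<nu> y = (THE L. ap_mean (\<lambda>x. F (Complex x y) * cis (- 2 * pi * \<nu> * x)) L)"

lemma line_mean:
  assumes "y > c"
  shows "ap_mean (\<lambda>x. F (Complex x y) * cis (- 2 * pi * \<nu> * x)) (line_mean \<nu> y)"
proof -
  have "bohr_ap (\<lambda>x. F (Complex x y) * cis (- 2 * pi * \<nu> * x))"
    by (intro bohr_ap_mult line_bohr_ap assms bohr_ap_cis)
  then obtain L where L: "ap_mean (\<lambda>x. F (Complex x y) * cis (- 2 * pi * \<nu> * x)) L" using bohr_ap_mean_exists by blast
  show ?thesis unfolding line_mean_def by (rule theI[of "ap_mean (\<lambda>x. F (Complex x y) * cis (- 2 * pi * \<nu> * x))", OF L]) (rule ap_mean_unique[OF _ L])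
qed

lemma exp_line: "echar \<nu> (Complex x y) = of_real (exp (2 * pi * \<nu> * y)) * cis (- 2 * pi * \<nu> * x)"
proof -
  have "- 2 * of_real pi * \<i> * of_real \<nu> * Complex x y = of_real (2 * pi * \<nu> * y) + \<i> * of_real (- 2 * pi * \<nu> * x)"
    by (simp add: complex_eq_iff)
  then show ?thesis by (simp only: exp_add exp_of_real cis_conv_exp)
qed

lemma line_continuous: "y > c \<Longrightarrow> continuous_on S (\<lambda>x. F (Complex x y))"
  by (intro bohr_ap_continuous line_bohr_ap)

lemma bohr_mean_eq:
  assumes y: "y > c" and T: "T > 0"
  shows "bohr_mean F \<nu> y T = of_real (exp (2 * pi * \<nu> * y)) * (integral {-T..-T + 2 * T} (\<lambda>x. F (Complex x y) * cis (- 2 * pi * \<nu> * x)) / of_real (2 * T))"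
proof -
  have "contour_integral (linepath (Complex (- T) y) (Complex T y)) (\<lambda>z. F z * echar \<nu> z) =
     integral {-T..T} (\<lambda>x. F (Complex x y) * echar \<nu> (Complex x y))"
    by (rule contour_integral_horizontal) (use T y in \<open>auto simp: Complex_eq intro!: continuous_intros line_continuous[unfolded Complex_eq]\<close>)
  also have "\<dots> = integral {-T..T} (\<lambda>x. of_real (exp (2 * pi * \<nu> * y)) * (F (Complex x y) * cis (- 2 * pi * \<nu> * x)))"
    unfolding exp_line by (simp add: mult_ac)
  also have "\<dots> = of_real (exp (2 * pi * \<nu> * y)) * integral {-T..T} (\<lambda>x. F (Complex x y) * cis (- 2 * pi * \<nu> * x))"
    by (rule integral_mult_right)
  finally show ?thesis unfolding bohr_mean_def by simp
qed

lemma bohr_mean_tendsto_line: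
  assumes y: "y > c"
  shows "(bohr_mean F \<nu> y \<longlongrightarrow> of_real (exp (2 * pi * \<nu> * y)) * line_mean \<nu> y) at_top"
proof -
  define I where "I T = integral {-T..-T + 2 * T} (\<lambda>x. F (Complex x y) * cis (- 2 * pi * \<nu> * x)) / of_real (2 * T)" for T :: real
  have "(I \<longlongrightarrow> line_mean \<nu> y) at_top"
  proof (rule tendstoI)
    fix e :: real assume e: "e > 0"
    obtain T0 where T0: "T0 > 0" "\<And>T a. T \<ge> T0 \<Longrightarrow> cmod (integral {a..a+T} (\<lambda>x. F (Complex x y) * cis (- 2 * pi * \<nu> * x)) - of_real T * line_mean \<nu> y) \<le> e/2 * T"
      using ap_meanD[OF line_mean[OF y], of "e/2" \<nu>] e by auto
    have "dist (I T) (line_mean \<nu> y) < e" if "T \<ge> T0" for T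
    proof -
      have T: "T > 0" using that T0 by simp
      have "I T - line_mean \<nu> y = (integral {-T..-T+2*T} (\<lambda>x. F (Complex x y) * cis (- 2 * pi * \<nu> * x)) - of_real (2 * T) * line_mean \<nu> y) / of_real (2 * T)"
        using T by (simp add: I_def diff_divide_distrib)
      also have "cmod \<dots> \<le> (e/2 * (2 * T)) / (2 * T)"
        unfolding norm_divide using T0(2)[of "2 * T" "-T"] that T by (simp add: pos_divide_le_eq)
      also have "\<dots> < e" using e T by simp
      finally show ?thesis by (simp add: dist_norm)
    qed
    then show "\<forall>\<^sub>F T in at_top. dist (I T) (line_mean \<nu> y) < e" by (auto simp: eventually_at_top_linorder)
  qed
  then have "((\<lambda>T. of_real (exp (2 * pi * \<nu> * y)) * I T) \<longlongrightarrow> of_real (exp (2 * pi * \<nu> * y)) * line_mean \<nu> y) at_top"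
    by (rule tendsto_mult_left)
  moreover have "\<forall>\<^sub>F T in at_top. of_real (exp (2 * pi * \<nu> * y)) * I T = bohr_mean F \<nu> y T"
    using eventually_gt_at_top[of 0] by eventually_elim (simp add: bohr_mean_eq[OF y] I_def)
  ultimately show ?thesis by (rule Lim_transform_eventually)
qed

text \<open>Cauchy's theorem on a rectangle of width \<open>2 * T\<close>: the integrand is bounded
  in the strip, so the vertical sides stay bounded while the means are divided by
  \<open>2 * T\<close>.\<close>

lemma bohr_mean_height_independent:
  assumes y: "c < y1" "y1 < y2"
  shows "((\<lambda>T. bohr_mean F \<nu> y1 T - bohr_mean F \<nu> y2 T) \<longlongrightarrow> 0) at_top"
proof -
  define f where "f z = F z * echar \<nu> z" for z
  obtain M where M: "M \<ge> 0" "\<And>z. y1 \<le> Im z \<and> Im z \<le> y2 \<Longrightarrow> cmod (F z) \<le> M" using strip_bounded[OF y(1), of y2] by blast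
  define V where "V = M * exp (2 * pi * \<bar>\<nu>\<bar> * y2)"
  have V: "cmod (f z) \<le> V" if "Im z \<in> {y1..y2}" for z
  proof -
    have "Re (- 2 * of_real pi * \<i> * of_real \<nu> * z) = 2 * pi * (\<nu> * Im z)" by simp
    also have "\<dots> \<le> 2 * pi * (\<bar>\<nu>\<bar> * y2)" using that y c by (intro mult_left_mono mult_mono) auto
    finally have "exp (Re (- 2 * of_real pi * \<i> * of_real \<nu> * z)) \<le> exp (2 * pi * \<bar>\<nu>\<bar> * y2)" by (simp add: mult.assoc)
    then show ?thesis unfolding f_def V_def norm_mult norm_exp_eq_Re using M that by (intro mult_mono) auto
  qed
  have hol: "f holomorphic_on {z. Im z > 0}"
    using holF unfolding f_def upper_halfplane_def by (intro holomorphic_intros) auto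
  have bm: "bohr_mean F \<nu> y T = integral {-T..T} (\<lambda>x. f (Complex x y)) / of_real (2 * T)" if "y > c" "T > 0" for y T
    unfolding bohr_mean_def f_def[symmetric]
    by (subst contour_integral_horizontal)
       (use that in \<open>auto simp: f_def Complex_eq intro!: continuous_intros line_continuous[unfolded Complex_eq]\<close>)
  have bound: "cmod (bohr_mean F \<nu> y1 T - bohr_mean F \<nu> y2 T) \<le> V * (y2 - y1) / T" if T: "T > 0" for T
  proof -
    have "cmod (integral {-T..T} (\<lambda>x. f (Complex x y1)) - integral {-T..T} (\<lambda>x. f (Complex x y2))) \<le> 2 * V * (y2 - y1)"
      by (rule rectangle_holomorphic[OF _ y(2) _ _ hol]) (use T y c V in \<open>auto intro: convex_halfspace_Im_gt open_halfspace_Im_gt\<close>)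
    moreover have "bohr_mean F \<nu> y1 T - bohr_mean F \<nu> y2 T = (integral {-T..T} (\<lambda>x. f (Complex x y1)) - integral {-T..T} (\<lambda>x. f (Complex x y2))) / of_real (2 * T)"
      using T y by (simp add: bm diff_divide_distrib)
    ultimately have "cmod (bohr_mean F \<nu> y1 T - bohr_mean F \<nu> y2 T) \<le> 2 * V * (y2 - y1) / (2 * T)"
      using T divide_right_mono[of "cmod (integral {-T..T} (\<lambda>x. f (Complex x y1)) - integral {-T..T} (\<lambda>x. f (Complex x y2)))" "2 * V * (y2 - y1)" "2 * T"]
      by (simp add: norm_divide norm_mult)
    then show ?thesis using T by simp
  qed
  have "((\<lambda>T. V * (y2 - y1) / T) \<longlongrightarrow> 0) at_top" by (intro tendsto_divide_0[OF tendsto_const] filterlim_at_top_imp_at_infinity filterlim_ident)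
  then show ?thesis
    by (rule Lim_null_comparison[rotated]) (use bound in \<open>auto simp: eventually_at_top_linorder intro!: exI[of _ 1]\<close>)
qed

lemma bohr_coeff_eq:
  assumes y: "y > c"
  shows "bohr_coeff F \<nu> = of_real (exp (2 * pi * \<nu> * y)) * line_mean \<nu> y"
    and "(bohr_mean F \<nu> y \<longlongrightarrow> bohr_coeff F \<nu>) at_top"
proof -
  define E where "E y = of_real (exp (2 * pi * \<nu> * y)) * line_mean \<nu> y" for y
  note lim = bohr_mean_tendsto_line[of _ \<nu>, folded E_def]
  have lt: "E y1 = E y2" if "c < y1" "y1 < y2" for y1 y2
  proof -
    have "((\<lambda>T. bohr_mean F \<nu> y1 T - bohr_mean F \<nu> y2 T) \<longlongrightarrow> E y1 - E y2) at_top"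
      using that by (intro tendsto_diff lim) auto
    from tendsto_unique[OF _ this bohr_mean_height_independent[OF that]] show ?thesis by simp
  qed
  have E: "E y' = E y" if "y' > c"  for y'
  proof (cases y' y rule: linorder_cases)
    case less show ?thesis by (rule lt[OF that less])
  next
    case greater show ?thesis by (rule lt[OF y greater, symmetric])
  qed simp
  have "bohr_coeff F \<nu> = E y"
    unfolding bohr_coeff_def
  proof (rule the_equality)
    have "(bohr_mean F \<nu> y' \<longlongrightarrow> E y) at_top" if "y' > c" for y' using lim[OF that] E[OF that] by simp
    then show "\<exists>c0. \<forall>y'>c0. (bohr_mean F \<nu> y' \<longlongrightarrow> E y) at_top" by blast
  next
    fix L assume "\<exists>c0. \<forall>y>c0. (bohr_mean F \<nu> y \<longlongrightarrow> L) at_top"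
    then obtain c0 where c0: "\<And>y. y > c0 \<Longrightarrow> (bohr_mean F \<nu> y \<longlongrightarrow> L) at_top" by blast
    \<comment> \<open>A height at which both limits are known.\<close>
    define y' where "y' = max c c0 + 1"
    have y': "y' > c0" "y' > c" by (auto simp: y'_def)
    have "L = E y'" by (rule tendsto_unique[OF trivial_limit_at_top_linorder c0[OF y'(1)] lim[OF y'(2)]])
    then show "L = E y" using E[of y'] by (simp add: y'_def)
  qed
  then show "bohr_coeff F \<nu> = of_real (exp (2 * pi * \<nu> * y)) * line_mean \<nu> y" by (simp add: E_def)
  with lim[OF y] show "(bohr_mean F \<nu> y \<longlongrightarrow> bohr_coeff F \<nu>) at_top" unfolding E_def by simp
qed

end

text \<open>
  Maximum principle for \<open>F z\<close> divided by a power of \<open>1 - \<i> \<epsilon> (z - \<i> y0)\<close>.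
\<close>
lemma phragmen_lindelof_half_plane:
  fixes F :: "complex \<Rightarrow> complex"
  assumes hol: "F holomorphic_on {z. Im z > a}" and y0: "y0 > a" "y0 > 0"
    and line: "\<And>x. cmod (F (Complex x y0)) \<le> M"
    and growth: "\<And>z. Im z \<ge> y0 \<Longrightarrow> cmod (F z) \<le> C * (cmod z + 1) ^ p"
    and z0: "Im z0 \<ge> y0"
  shows "cmod (F z0) \<le> M"
proof -
  have M0: "M \<ge> 0" using order_trans[OF norm_ge_zero line[of 0]] .
  define w where "w z = z - \<i> * of_real y0" for z
  have main: "cmod (F z0) \<le> M * cmod (1 - \<i> * of_real \<epsilon> * w z0) ^ Suc p" if \<epsilon>: "\<epsilon> > 0" for \<epsilon>
  proof -
    define g where "g z = 1 - \<i> * of_real \<epsilon> * w z" for z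
    have Reg: "Re (g z) = 1 + \<epsilon> * (Im z - y0)" "Im (g z) = - \<epsilon> * Re z" for z by (simp_all add: g_def w_def)
    have g1: "cmod (g z) \<ge> 1" if "Im z \<ge> y0" for z
      using complex_Re_le_cmod[of "g z"] Reg(1)[of z] that \<epsilon> by (smt (verit) mult_nonneg_nonneg)
    have g2: "cmod (g z) \<ge> \<epsilon> * cmod (w z)" if z: "Im z \<ge> y0" for z
    proof -
      have "(\<epsilon> * (Im z - y0))\<^sup>2 \<le> (1 + \<epsilon> * (Im z - y0))\<^sup>2" using z \<epsilon> by (intro power_mono) auto
      then have "(\<epsilon> * cmod (w z))\<^sup>2 \<le> (cmod (g z))\<^sup>2"
        unfolding cmod_power2 Reg power_mult_distrib by (simp add: w_def cmod_power2 power_mult_distrib algebra_simps)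
      then show ?thesis by (rule power2_le_imp_le) simp
    qed
    define H where "H z = F z / g z ^ Suc p" for z
    \<comment> \<open>The denominator has one power more than the growth of \<open>F\<close>, so
      \<open>H\<close> decays like the inverse of \<open>cmod (w z)\<close>; \<open>y0 + 2\<close>
      converts \<open>cmod z + 1\<close> into \<open>cmod (w z)\<close>.\<close>
    define K where "K = \<bar>C\<bar> * (y0 + 2) ^ p / \<epsilon> ^ Suc p"
    have K: "cmod (H z) \<le> K / cmod (w z)" if z: "Im z \<ge> y0" "cmod (w z) \<ge> 1" for z
    proof -
      have "cmod z \<le> cmod (w z) + y0" using norm_triangle_ineq[of "w z" "\<i> * of_real y0"] y0 by (simp add: w_def norm_mult)
      then have "cmod z + 1 \<le> (y0 + 2) * cmod (w z)"
        using z(2) y0 mult_left_mono[of 1 "cmod (w z)" "y0 + 1"] by (simp add: algebra_simps)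
      then have "C * (cmod z + 1) ^ p \<le> \<bar>C\<bar> * ((y0 + 2) * cmod (w z)) ^ p" by (intro mult_mono power_mono) auto
      then have F: "cmod (F z) \<le> \<bar>C\<bar> * ((y0 + 2) * cmod (w z)) ^ p" using growth[OF z(1)] by simp
      have G: "(\<epsilon> * cmod (w z)) ^ Suc p \<le> cmod (g z ^ Suc p)" unfolding norm_power using g2[OF z(1)] \<epsilon> by (intro power_mono) auto
      have "cmod (H z) \<le> \<bar>C\<bar> * ((y0 + 2) * cmod (w z)) ^ p / (\<epsilon> * cmod (w z)) ^ Suc p"
        unfolding H_def norm_divide using z(2) \<epsilon> y0 by (intro frac_le F G) (auto intro!: mult_nonneg_nonneg zero_le_power zero_less_power mult_pos_pos)
      also have "\<dots> = K / cmod (w z)" using z(2) \<epsilon> unfolding K_def power_mult_distrib power_Suc by (simp add: field_simps)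
      finally show ?thesis .
    qed
    have "cmod (H z0) \<le> M + \<delta>" if \<delta>: "\<delta> > 0" for \<delta>
    proof -
      \<comment> \<open>Large enough to reach \<open>z0\<close> and to make
        \<open>cmod (H z)\<close> at most \<delta> on the circular part of the frontier.\<close>
      define \<rho> where "\<rho> = cmod (w z0) + 1 + \<bar>K\<bar> / \<delta>"
      have "\<bar>K\<bar> / \<delta> \<ge> 0" using \<delta> by simp
      then have \<rho>: "\<rho> \<ge> 1" "cmod (w z0) \<le> \<rho>" "\<bar>K\<bar> / \<delta> \<le> \<rho>" by (auto simp: \<rho>_def intro: add_nonneg_nonneg)
      define S where "S = {z. cmod (w z) \<le> \<rho> \<and> Im z \<ge> y0}"
      have clS: "closed S" unfolding S_def w_def by (intro closed_Collect_conj closed_Collect_le continuous_intros)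
      have sub: "S \<subseteq> {z. Im z > a}" using y0 by (auto simp: S_def)
      have hH: "H holomorphic_on S"
        unfolding H_def g_def w_def
      proof (intro holomorphic_intros holomorphic_on_subset[OF hol sub])
        fix z assume "z \<in> S"
        then have "g z \<noteq> 0" using g1[of z] by (auto simp: S_def)
        then show "(1 - \<i> * of_real \<epsilon> * (z - \<i> * of_real y0)) ^ Suc p \<noteq> 0" by (simp add: g_def w_def)
      qed
      show ?thesis
      proof (rule maximum_modulus_frontier[of H S])
        show "H holomorphic_on interior S" using holomorphic_on_subset[OF hH interior_subset] .
        show "continuous_on (closure S) H" using holomorphic_on_imp_continuous_on[OF hH] clS by simp
        have "S \<subseteq> cball (\<i> * of_real y0) \<rho>" by (auto simp: S_def w_def dist_norm norm_minus_commute)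
        then show "bounded S" using bounded_cball bounded_subset by blast
        show "z0 \<in> S" using z0 \<rho> by (simp add: S_def)
        fix z assume z: "z \<in> frontier S"
        then have zS: "z \<in> S" using clS frontier_subset_closed by blast
        have "Im z = y0 \<or> cmod (w z) = \<rho>"
        proof (rule ccontr)
          assume "\<not> ?thesis"
          then have "z \<in> {z. cmod (w z) < \<rho>} \<inter> {z. Im z > y0}" using zS by (auto simp: S_def)
          note zin = this
          have op: "open ({z. cmod (w z) < \<rho>} \<inter> {z. Im z > y0})"
            unfolding w_def by (intro open_Int open_Collect_less continuous_intros)
          have "{z. cmod (w z) < \<rho>} \<inter> {z. Im z > y0} \<subseteq> S" by (auto simp: S_def)
          then have "z \<in> interior S" by (rule interiorI[OF op zin])
          then show False using z by (simp add: frontier_def)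
        qed
        then show "norm (H z) \<le> M + \<delta>"
        proof
          assume i: "Im z = y0"
          then have "z = Complex (Re z) y0" by (simp add: complex_eq_iff)
          then have Fz: "cmod (F z) \<le> M" using line[of "Re z"] by simp
          have "1 \<le> cmod (g z ^ Suc p)" unfolding norm_power using g1[of z] i by (intro one_le_power) auto
          then have "cmod (H z) \<le> M / 1" unfolding H_def norm_divide using M0 Fz by (intro frac_le) auto
          then show ?thesis using \<delta> by simp
        next
          assume r: "cmod (w z) = \<rho>"
          have "cmod (H z) \<le> K / \<rho>" using K[of z] zS r \<rho> by (simp add: S_def)
          also have "\<dots> \<le> \<bar>K\<bar> / \<rho>" using \<rho> by (intro divide_right_mono) auto
          also have "\<dots> \<le> \<delta>" using \<rho> \<delta> by (simp add: field_simps)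
          finally show ?thesis using M0 by simp
        qed
      qed
    qed
    then have "cmod (H z0) \<le> M" by (rule field_le_epsilon)
    then have "cmod (F z0) \<le> M * cmod (g z0 ^ Suc p)"
      unfolding H_def norm_divide using g1[OF z0] by (subst (asm) pos_divide_le_eq) (auto simp: norm_power)
    then show ?thesis unfolding g_def norm_power .
  qed
  have "((\<lambda>\<epsilon>. M * cmod (1 - \<i> * of_real \<epsilon> * w z0) ^ Suc p) \<longlongrightarrow> M * cmod (1 - \<i> * of_real 0 * w z0) ^ Suc p) (at_right 0)"
    by (intro tendsto_intros)
  then have "((\<lambda>\<epsilon>. M * cmod (1 - \<i> * of_real \<epsilon> * w z0) ^ Suc p) \<longlongrightarrow> M) (at_right 0)" by simp
  then show ?thesis
    by (rule tendsto_lowerbound) (use main in \<open>auto simp: eventually_at_right_field simp del: power_Suc intro!: exI[of _ 1]\<close>)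
qed

lemma (in shifted_AP) bohr_coeff_negative:
  assumes growth: "\<And>z. Im z \<ge> c + 1 \<Longrightarrow> cmod (F z) \<le> C * (cmod z + 1) ^ p" and \<nu>: "\<nu> < 0"
  shows "bohr_coeff F \<nu> = 0"
proof -
  obtain M where M: "M > 0" "\<And>x. cmod (F (Complex x (c + 1))) \<le> M"
    using bohr_ap_bounded[OF line_bohr_ap[of "c + 1"]] by auto
  have bd: "cmod (F z) \<le> M" if "Im z \<ge> c + 1" for z
    using phragmen_lindelof_half_plane[of F 0 "c + 1" M C p z] holF c M(2) growth that by (simp add: upper_halfplane_def)
  have le: "cmod (bohr_coeff F \<nu>) \<le> M * exp (2 * pi * \<nu> * y)" if y: "y \<ge> c + 1" for y
  proof -
    have yc: "y > c" using y by simp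
    have "cmod (bohr_mean F \<nu> y T) \<le> M * exp (2 * pi * \<nu> * y)" if T: "T > 0" for T
    proof -
      have "cmod (integral {-T..-T + 2 * T} (\<lambda>x. F (Complex x y) * cis (- 2 * pi * \<nu> * x))) \<le> M * (-T + 2 * T - -T)"
        by (rule integral_bound) (use T y bd in \<open>auto simp: norm_mult intro!: continuous_intros line_continuous\<close>)
      then have "cmod (integral {-T..-T + 2 * T} (\<lambda>x. F (Complex x y) * cis (- 2 * pi * \<nu> * x)) / of_real (2 * T)) \<le> M"
        using T by (simp add: norm_divide norm_mult divide_le_eq)
      then have "exp (2 * pi * \<nu> * y) * cmod (integral {-T..-T + 2 * T} (\<lambda>x. F (Complex x y) * cis (- 2 * pi * \<nu> * x)) / of_real (2 * T)) \<le> exp (2 * pi * \<nu> * y) * M"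
        by (intro mult_left_mono) auto
      then show ?thesis unfolding bohr_mean_eq[OF yc T] norm_mult norm_of_real by (simp add: mult.commute)
    qed
    then have "\<forall>\<^sub>F T in at_top. cmod (bohr_mean F \<nu> y T) \<le> M * exp (2 * pi * \<nu> * y)"
      by (rule eventually_mono[OF eventually_gt_at_top[of 0]])
    with tendsto_norm[OF bohr_coeff_eq(2)[OF yc]] show ?thesis by (intro tendsto_upperbound) auto
  qed
  define b where "b = - (2 * pi * \<nu>)"
  have b: "b > 0" using \<nu> by (simp add: b_def mult_pos_neg)
  have "((\<lambda>y. M * exp (- b * y)) \<longlongrightarrow> 0) at_top"
    using b M(1) by real_asymp
  then have "((\<lambda>y. M * exp (2 * pi * \<nu> * y)) \<longlongrightarrow> 0) at_top" by (simp add: b_def)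
  then have "cmod (bohr_coeff F \<nu>) \<le> 0"
    by (rule tendsto_lowerbound) (auto simp: eventually_at_top_linorder intro!: exI[of _ "c + 1"] le)
  then show ?thesis by simp
qed

section \<open>The summation formula on a horizontal line\<close>

lemma integrable_mult_bounded:
  fixes v h :: "real \<Rightarrow> complex"
  assumes v: "integrable M v" and h: "h \<in> borel_measurable M" and B: "\<And>x. cmod (h x) \<le> B"
  shows "integrable M (\<lambda>x. v x * h x)"
proof (rule Bochner_Integration.integrable_bound)
  show "integrable M (\<lambda>x. B * cmod (v x))" using v by simp
  show "(\<lambda>x. v x * h x) \<in> borel_measurable M" using v h by measurable
  show "AE x in M. cmod (v x * h x) \<le> norm (B * cmod (v x))"
  proof (rule AE_I2)
    fix x
    have "cmod (v x) * cmod (h x) \<le> cmod (v x) * B" by (intro mult_left_mono B) auto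
    also have "\<dots> \<le> \<bar>B * cmod (v x)\<bar>" by (simp add: mult.commute)
    finally show "cmod (v x * h x) \<le> norm (B * cmod (v x))" unfolding norm_mult[of "v x"] real_norm_def .
  qed
qed

text \<open>Convolution with \<psi> multiplies uniform distances by at most \<open>K\<close>, the
  integral of \<open>cmod (\<psi> u)\<close>, so moduli of continuity and nets are inherited from
  \<open>h\<close>. The divisor is \<open>K + 1\<close> since \<open>K\<close> may be 0.\<close>

lemma bohr_ap_convolution:
  fixes \<psi> h :: "real \<Rightarrow> complex"
  assumes h: "bohr_ap h" and \<psi>: "integrable lborel \<psi>"
  shows "bohr_ap (\<lambda>x. LBINT u. \<psi> u * h (x + u))"
proof -
  define K where "K = (LBINT u. cmod (\<psi> u))"
  have K: "K \<ge> 0" unfolding K_def by simp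
  obtain B where B: "\<And>x. cmod (h x) \<le> B" using bohr_ap_bounded[OF h] by blast
  have [measurable]: "h \<in> borel_measurable borel" using bohr_ap_continuous[OF h] by (rule borel_measurable_continuous_onI)
  have int: "integrable lborel (\<lambda>u. \<psi> u * h (x + u))" for x by (rule integrable_mult_bounded[OF \<psi> _ B]) measurable
  have close: "cmod ((LBINT u. \<psi> u * h (x + u)) - (LBINT u. \<psi> u * h (x' + u))) \<le> K * e"
    if "\<And>u. cmod (h (x + u) - h (x' + u)) \<le> e" for x x' e
  proof -
    have "(LBINT u. \<psi> u * h (x + u)) - (LBINT u. \<psi> u * h (x' + u)) = (LBINT u. \<psi> u * h (x + u) - \<psi> u * h (x' + u))"
      using int by simp
    also have "cmod \<dots> \<le> (LBINT u. cmod (\<psi> u * h (x + u) - \<psi> u * h (x' + u)))" by (rule integral_norm_bound)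
    also have "\<dots> \<le> (LBINT u. cmod (\<psi> u) * e)"
    proof (rule integral_mono)
      show "integrable lborel (\<lambda>u. cmod (\<psi> u * h (x + u) - \<psi> u * h (x' + u)))" using int by simp
      show "integrable lborel (\<lambda>u. cmod (\<psi> u) * e)" using \<psi> by simp
      fix u show "cmod (\<psi> u * h (x + u) - \<psi> u * h (x' + u)) \<le> cmod (\<psi> u) * e"
        unfolding right_diff_distrib[symmetric] norm_mult by (intro mult_left_mono that) auto
    qed
    also have "\<dots> = K * e" by (simp add: K_def)
    finally show ?thesis .
  qed
  have Ke: "K * (e / (K + 1)) \<le> e" if "e > 0" for e using K that by (simp add: field_simps)
  have Kp: "e / (K + 1) > 0" if "e > 0" for e :: real using K that by simp
  show ?thesis
    unfolding bohr_ap_def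
  proof (intro conjI allI impI)
    show "continuous_on UNIV (\<lambda>x. LBINT u. \<psi> u * h (x + u))"
      unfolding continuous_on_iff
    proof (intro ballI allI impI)
      fix x e :: real assume e: "e > 0"
      obtain d where d: "d > 0" "\<And>x y. \<bar>x - y\<bar> < d \<Longrightarrow> cmod (h x - h y) \<le> e/2 / (K + 1)"
        using bohr_ap_uniformly_continuous[OF h Kp[of "e/2"]] e by auto
      have "dist (LBINT u. \<psi> u * h (x' + u)) (LBINT u. \<psi> u * h (x + u)) < e" if x': "dist x' x < d" for x'
      proof -
        have "cmod ((LBINT u. \<psi> u * h (x' + u)) - (LBINT u. \<psi> u * h (x + u))) \<le> K * (e/2 / (K + 1))"
          using x' by (intro close d(2)) (simp add: dist_real_def)
        also have "\<dots> \<le> e/2" by (rule Ke) (use e in simp)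
        also have "\<dots> < e" using e by simp
        finally show ?thesis by (simp only: dist_norm)
      qed
      with d(1) show "\<exists>d>0. \<forall>x'\<in>UNIV. dist x' x < d \<longrightarrow> dist (LBINT u. \<psi> u * h (x' + u)) (LBINT u. \<psi> u * h (x + u)) < e" by blast
    qed
    fix e :: real assume e: "e > 0"
    obtain N where N: "finite N" "\<And>t. \<exists>s\<in>N. \<forall>x. cmod (h (x + t) - h (x + s)) \<le> e / (K + 1)"
      using bohr_ap_net[OF h Kp[OF e]] by blast
    have "\<exists>s\<in>N. \<forall>x. cmod ((LBINT u. \<psi> u * h (x + t + u)) - (LBINT u. \<psi> u * h (x + s + u))) \<le> e" for t
    proof -
      obtain s where s: "s \<in> N" "\<And>x. cmod (h (x + t) - h (x + s)) \<le> e / (K + 1)" using N(2) by blast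
      have "cmod ((LBINT u. \<psi> u * h (x + t + u)) - (LBINT u. \<psi> u * h (x + s + u))) \<le> K * (e / (K + 1))" for x
      proof (rule close)
        fix u show "cmod (h (x + t + u) - h (x + s + u)) \<le> e / (K + 1)" using s(2)[of "x + u"] by (simp add: add_ac)
      qed
      with s(1) Ke[OF e] show ?thesis by (meson order_trans)
    qed
    with N(1) show "\<exists>N. finite N \<and> (\<forall>t. \<exists>s\<in>N. \<forall>x. cmod ((LBINT u. \<psi> u * h (x + t + u)) - (LBINT u. \<psi> u * h (x + s + u))) \<le> e)" by blast
  qed
qed

text \<open>By Fubini the window integral of the convolution is the integral of \<psi> against
  integrals of \<open>h\<close> over shifted windows, and all of these are near \<open>T * m\<close>
  because the mean is uniform in the position.\<close>

lemma ap_mean_convolution: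
  fixes \<psi> h :: "real \<Rightarrow> complex"
  assumes h: "bohr_ap h" and \<psi>: "integrable lborel \<psi>" and m: "ap_mean h m"
  shows "ap_mean (\<lambda>x. LBINT u. \<psi> u * h (x + u)) (m * (LBINT u. \<psi> u))"
  unfolding ap_mean_def
proof (intro allI impI)
  define K where "K = (LBINT u. cmod (\<psi> u))"
  have K: "K \<ge> 0" unfolding K_def by simp
  obtain B where B: "\<And>x. cmod (h x) \<le> B" using bohr_ap_bounded[OF h] by blast
  have [measurable]: "h \<in> borel_measurable borel" using bohr_ap_continuous[OF h] by (rule borel_measurable_continuous_onI)
  fix e :: real assume e: "e > 0"
  then have "e / (K + 1) > 0" using K by simp
  then obtain T0 where T0: "T0 > 0" "\<And>T a. T \<ge> T0 \<Longrightarrow> cmod (integral {a..a+T} h - of_real T * m) \<le> e / (K + 1) * T"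
    using ap_meanD[OF m] by blast
  have "cmod (integral {a..a+T} (\<lambda>x. LBINT u. \<psi> u * h (x + u)) - of_real T * (m * (LBINT u. \<psi> u))) \<le> e * T" if T: "T \<ge> T0" for T a
  proof -
    define M where "M = density lborel (\<lambda>x. ennreal (indicator {a..a+T} x))"
    have sM [measurable_cong]: "sets M = sets borel" by (simp add: M_def)
    have fin: "finite_measure M"
      using T T0(1) by (intro finite_measureI) (simp add: M_def emeasure_density ennreal_indicator)
    interpret M: finite_measure M by (rule fin)
    have LM: "(LINT l|M. f l) = integral {a..a+T} f" if f: "continuous_on UNIV f" for f :: "real \<Rightarrow> complex"
    proof -
      have [measurable]: "f \<in> borel_measurable borel" using f by (rule borel_measurable_continuous_onI)
      have "(LINT l|M. f l) = (LBINT l. indicator {a..a+T} l *\<^sub>R f l)"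
        unfolding M_def by (rule integral_density) auto
      also have "\<dots> = (LINT l:{a..a+T}|lborel. f l)" by (simp add: set_lebesgue_integral_def)
      also have "\<dots> = integral {a..a+T} f"
      proof (rule set_borel_integral_eq_integral)
        show "set_integrable lborel {a..a+T} f"
          unfolding set_integrable_def
          by (rule borel_integrable_compact) (use continuous_on_subset[OF f] in auto)
      qed
      finally show ?thesis .
    qed
    define I where "I u = (LINT l|M. h (l + u))" for u
    have I: "I u = integral {a+u..a+u+T} h" for u
    proof -
      have "I u = integral {a..a+T} (\<lambda>l. h (l + u))"
        unfolding I_def by (rule LM) (rule continuous_on_compose2[OF bohr_ap_continuous[OF h, of UNIV]], auto intro!: continuous_intros)
      also have "\<dots> = integral {a+u..a+T+u} h" by (rule integral_shift_real[OF bohr_ap_continuous[OF h]])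
      finally show ?thesis by (simp add: add_ac)
    qed
    have [measurable]: "I \<in> borel_measurable borel" unfolding I_def by measurable
    have Ib: "cmod (I u - of_real T * m) \<le> e / (K + 1) * T" for u unfolding I using T0(2)[OF T] .
    have "integral {a..a+T} (\<lambda>x. LBINT u. \<psi> u * h (x + u)) = (LINT l|M. LINT u|lborel. \<psi> u * h (l + u))"
      by (rule LM[symmetric]) (rule bohr_ap_continuous[OF bohr_ap_convolution[OF h \<psi>]])
    also have "\<dots> = (LBINT u. \<psi> u * I u)"
      unfolding I_def by (rule Fubini_bounded_kernel[OF fin sM \<psi> _ B]) measurable
    finally have eq: "integral {a..a+T} (\<lambda>x. LBINT u. \<psi> u * h (x + u)) = (LBINT u. \<psi> u * I u)" .
    have i1: "integrable lborel (\<lambda>u. \<psi> u * (I u - of_real T * m))" by (rule integrable_mult_bounded[OF \<psi> _ Ib]) measurable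
    have i2: "integrable lborel (\<lambda>u. \<psi> u * (of_real T * m))" using \<psi> by simp
    have "(LBINT u. \<psi> u * I u) = (LBINT u. \<psi> u * (I u - of_real T * m) + \<psi> u * (of_real T * m))" by (simp add: algebra_simps)
    also have "\<dots> = (LBINT u. \<psi> u * (I u - of_real T * m)) + (LBINT u. \<psi> u) * (of_real T * m)"
      using i1 i2 by simp
    finally have "cmod ((LBINT u. \<psi> u * I u) - of_real T * (m * (LBINT u. \<psi> u))) = cmod (LBINT u. \<psi> u * (I u - of_real T * m))"
      by (simp add: mult_ac)
    also have "\<dots> \<le> (LBINT u. cmod (\<psi> u * (I u - of_real T * m)))" by (rule integral_norm_bound)
    also have "\<dots> \<le> (LBINT u. cmod (\<psi> u) * (e / (K + 1) * T))"
    proof (rule integral_mono)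
      show "integrable lborel (\<lambda>u. cmod (\<psi> u * (I u - of_real T * m)))" using i1 by simp
      show "integrable lborel (\<lambda>u. cmod (\<psi> u) * (e / (K + 1) * T))" using \<psi> by simp
      fix u show "cmod (\<psi> u * (I u - of_real T * m)) \<le> cmod (\<psi> u) * (e / (K + 1) * T)"
        unfolding norm_mult[of "\<psi> u"] by (intro mult_left_mono Ib) auto
    qed
    also have "\<dots> = K / (K + 1) * (e * T)" by (simp add: K_def)
    also have "\<dots> \<le> 1 * (e * T)" using K e T T0 by (intro mult_right_mono) auto
    finally show ?thesis unfolding eq by simp
  qed
  with T0(1) show "\<exists>T0>0. \<forall>T\<ge>T0. \<forall>a. cmod (integral {a..a+T} (\<lambda>x. LBINT u. \<psi> u * h (x + u)) - of_real T * (m * (LBINT u. \<psi> u))) \<le> e * T" by blast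
qed

lemma absolutely_summable_tail:
  fixes b :: "'a \<Rightarrow> complex" and q :: "'a \<Rightarrow> real \<Rightarrow> complex"
  assumes b: "(\<lambda>\<nu>. cmod (b \<nu>)) summable_on A" and q: "\<And>\<nu> x. cmod (q \<nu> x) = 1" and e: "e > 0"
  obtains X where "finite X" "X \<subseteq> A"
    "\<And>Y x. finite Y \<Longrightarrow> X \<subseteq> Y \<Longrightarrow> Y \<subseteq> A \<Longrightarrow> cmod ((\<Sum>\<^sub>\<infinity>\<nu>\<in>A. b \<nu> * q \<nu> x) - (\<Sum>\<nu>\<in>Y. b \<nu> * q \<nu> x)) \<le> e"
proof -
  obtain X where X: "finite X" "X \<subseteq> A" "dist (\<Sum>\<nu>\<in>X. cmod (b \<nu>)) (\<Sum>\<^sub>\<infinity>\<nu>\<in>A. cmod (b \<nu>)) \<le> e"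
    using infsum_finite_approximation[OF b e] by blast
  have nm: "cmod (b \<nu> * q \<nu> x) = cmod (b \<nu>)" for \<nu> x by (simp add: norm_mult q)
  have abs: "(\<lambda>\<nu>. cmod (b \<nu> * q \<nu> x)) summable_on A" for x using b by (simp add: nm)
  have "cmod ((\<Sum>\<^sub>\<infinity>\<nu>\<in>A. b \<nu> * q \<nu> x) - (\<Sum>\<nu>\<in>Y. b \<nu> * q \<nu> x)) \<le> e" if Y: "finite Y" "X \<subseteq> Y" "Y \<subseteq> A" for Y x
  proof -
    have sm: "(\<lambda>\<nu>. b \<nu> * q \<nu> x) summable_on A" by (rule abs_summable_summable[OF abs])
    have "(\<Sum>\<^sub>\<infinity>\<nu>\<in>A. b \<nu> * q \<nu> x) - (\<Sum>\<nu>\<in>Y. b \<nu> * q \<nu> x) = (\<Sum>\<^sub>\<infinity>\<nu>\<in>A - Y. b \<nu> * q \<nu> x)"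
      using infsum_Diff[OF sm summable_on_finite[OF Y(1)] Y(3)] Y(1) by simp
    also have "cmod \<dots> \<le> (\<Sum>\<^sub>\<infinity>\<nu>\<in>A - Y. cmod (b \<nu> * q \<nu> x))"
      by (rule norm_infsum_bound) (rule summable_on_subset_banach[OF abs], auto)
    also have "\<dots> = (\<Sum>\<^sub>\<infinity>\<nu>\<in>A. cmod (b \<nu>)) - (\<Sum>\<nu>\<in>Y. cmod (b \<nu>))"
      unfolding nm using infsum_Diff[OF b summable_on_finite[OF Y(1)] Y(3)] Y(1) by simp
    also have "\<dots> \<le> (\<Sum>\<^sub>\<infinity>\<nu>\<in>A. cmod (b \<nu>)) - (\<Sum>\<nu>\<in>X. cmod (b \<nu>))"
      using sum_mono2[OF Y(1,2), of "\<lambda>\<nu>. cmod (b \<nu>)"] by simp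
    also have "\<dots> \<le> e" using X(3) by (simp add: dist_real_def)
    finally show ?thesis .
  qed
  with X(1,2) that show ?thesis by blast
qed

lemma bohr_ap_trigonometric_series:
  fixes b :: "real \<Rightarrow> complex"
  assumes b: "(\<lambda>\<nu>. cmod (b \<nu>)) summable_on A"
  shows "bohr_ap (\<lambda>x. \<Sum>\<^sub>\<infinity>\<nu>\<in>A. b \<nu> * cis (2 * pi * \<nu> * x))"
    and "(\<And>\<nu>. \<nu> \<notin> A \<Longrightarrow> b \<nu> = 0) \<Longrightarrow> ap_mean (\<lambda>x. (\<Sum>\<^sub>\<infinity>\<nu>\<in>A. b \<nu> * cis (2 * pi * \<nu> * x)) * cis (- 2 * pi * \<nu>0 * x)) (b \<nu>0)"
proof -
  define q where "q \<nu> x = cis (2 * pi * \<nu> * x)" for \<nu> x :: real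
  have q: "cmod (q \<nu> x) = 1" for \<nu> x by (simp add: q_def)
  have ap: "bohr_ap (\<lambda>x. \<Sum>\<nu>\<in>Y. b \<nu> * q \<nu> x)" if "finite Y" for Y
    unfolding q_def using that by (intro bohr_ap_sum bohr_ap_mult bohr_ap_const bohr_ap_cis) auto
  have S: "bohr_ap (\<lambda>x. \<Sum>\<^sub>\<infinity>\<nu>\<in>A. b \<nu> * q \<nu> x)"
  proof (rule bohr_ap_uniform_limit)
    fix e :: real assume e: "e > 0"
    obtain X where X: "finite X" "X \<subseteq> A"
      "\<And>Y x. finite Y \<Longrightarrow> X \<subseteq> Y \<Longrightarrow> Y \<subseteq> A \<Longrightarrow> cmod ((\<Sum>\<^sub>\<infinity>\<nu>\<in>A. b \<nu> * q \<nu> x) - (\<Sum>\<nu>\<in>Y. b \<nu> * q \<nu> x)) \<le> e"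
      using absolutely_summable_tail[where b = b and q = q, OF b q e] by blast
    show "\<exists>g. bohr_ap g \<and> (\<forall>x. cmod ((\<Sum>\<^sub>\<infinity>\<nu>\<in>A. b \<nu> * q \<nu> x) - g x) \<le> e)"
      using ap[OF X(1)] X(3)[OF X(1) order_refl X(2)] by blast
  qed
  then show "bohr_ap (\<lambda>x. \<Sum>\<^sub>\<infinity>\<nu>\<in>A. b \<nu> * cis (2 * pi * \<nu> * x))" by (simp add: q_def)
  assume zero: "\<And>\<nu>. \<nu> \<notin> A \<Longrightarrow> b \<nu> = 0"
  have tw: "bohr_ap (\<lambda>x. f x * cis (- 2 * pi * \<nu>0 * x))" if "bohr_ap f" for f
    using that by (intro bohr_ap_mult bohr_ap_cis)
  have "ap_mean (\<lambda>x. (\<Sum>\<^sub>\<infinity>\<nu>\<in>A. b \<nu> * q \<nu> x) * cis (- 2 * pi * \<nu>0 * x)) (b \<nu>0)"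
  proof (rule ap_mean_uniform_limit)
    show "continuous_on UNIV (\<lambda>x. (\<Sum>\<^sub>\<infinity>\<nu>\<in>A. b \<nu> * q \<nu> x) * cis (- 2 * pi * \<nu>0 * x))"
      by (rule bohr_ap_continuous[OF tw[OF S]])
    fix e :: real assume e: "e > 0"
    obtain X where X: "finite X" "X \<subseteq> A"
      "\<And>Y x. finite Y \<Longrightarrow> X \<subseteq> Y \<Longrightarrow> Y \<subseteq> A \<Longrightarrow> cmod ((\<Sum>\<^sub>\<infinity>\<nu>\<in>A. b \<nu> * q \<nu> x) - (\<Sum>\<nu>\<in>Y. b \<nu> * q \<nu> x)) \<le> e"
      using absolutely_summable_tail[where b = b and q = q, OF b q e] by blast
    \<comment> \<open>Including \<open>\<nu>0\<close> makes the mean of the finite approximation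
      equal to \<open>b \<nu>0\<close> exactly.\<close>
    define Y where "Y = X \<union> ({\<nu>0} \<inter> A)"
    have Y: "finite Y" "X \<subseteq> Y" "Y \<subseteq> A" using X by (auto simp: Y_def)
    define g where "g x = (\<Sum>\<nu>\<in>Y. b \<nu> * q \<nu> x) * cis (- 2 * pi * \<nu>0 * x)" for x
    have g: "g x = (\<Sum>\<nu>\<in>Y. b \<nu> * cis (2 * pi * (\<nu> - \<nu>0) * x))" for x
      unfolding g_def q_def sum_distrib_right mult.assoc[of "b _"] cis_mult by (simp add: algebra_simps)
    have "ap_mean g (\<Sum>\<nu>\<in>Y. b \<nu> * (if \<nu> = \<nu>0 then 1 else 0))"
      unfolding g
    proof (rule ap_mean_sum[OF Y(1)])
      fix \<nu>
      show "continuous_on UNIV (\<lambda>x. b \<nu> * cis (2 * pi * (\<nu> - \<nu>0) * x))"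
        by (intro bohr_ap_continuous bohr_ap_mult bohr_ap_const bohr_ap_cis)
      show "ap_mean (\<lambda>x. b \<nu> * cis (2 * pi * (\<nu> - \<nu>0) * x)) (b \<nu> * (if \<nu> = \<nu>0 then 1 else 0))"
        by (rule ap_mean_cmult) (auto intro: ap_mean_cis ap_mean_const)
    qed
    also have "(\<Sum>\<nu>\<in>Y. b \<nu> * (if \<nu> = \<nu>0 then 1 else 0)) = (if \<nu>0 \<in> Y then b \<nu>0 else 0)"
      using Y(1) by (simp add: if_distrib[of "\<lambda>u. b _ * u"] sum.delta' cong: if_cong)
    also have "\<dots> = b \<nu>0" using zero by (auto simp: Y_def)
    finally have "ap_mean g (b \<nu>0)" .
    moreover have "continuous_on UNIV g" unfolding g_def by (rule bohr_ap_continuous[OF tw[OF ap[OF Y(1)]]])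
    moreover have "cmod ((\<Sum>\<^sub>\<infinity>\<nu>\<in>A. b \<nu> * q \<nu> x) * cis (- 2 * pi * \<nu>0 * x) - g x) \<le> e" for x
      unfolding g_def left_diff_distrib[symmetric] norm_mult using X(3)[OF Y] by simp
    ultimately show "\<exists>g L'. continuous_on UNIV g \<and> (\<forall>x. cmod ((\<Sum>\<^sub>\<infinity>\<nu>\<in>A. b \<nu> * q \<nu> x) * cis (- 2 * pi * \<nu>0 * x) - g x) \<le> e) \<and> ap_mean g L' \<and> cmod (L' - b \<nu>0) \<le> e"
      using e by (intro exI[of _ g] exI[of _ "b \<nu>0"]) auto
  qed
  then show "ap_mean (\<lambda>x. (\<Sum>\<^sub>\<infinity>\<nu>\<in>A. b \<nu> * cis (2 * pi * \<nu> * x)) * cis (- 2 * pi * \<nu>0 * x)) (b \<nu>0)" by (simp add: q_def)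
qed

section \<open>Fourier transforms of test functions on horizontal lines\<close>

lemma ft_line:
  "ft f (Complex u y) = (LBINT t. (f t * of_real (exp (2 * pi * t * y))) * cis (- (2 * pi * t * u)))"
  unfolding ft_def
proof (rule Bochner_Integration.integral_cong[OF refl])
  fix t
  have "- 2 * of_real pi * \<i> * of_real t * Complex u y = of_real (2 * pi * t * y) + \<i> * of_real (- (2 * pi * t * u))"
    by (simp add: complex_eq_iff)
  then show "f t * echar t (Complex u y) = f t * of_real (exp (2 * pi * t * y)) * cis (- (2 * pi * t * u))"
    by (simp only: exp_add exp_of_real cis_conv_exp mult.assoc)
qed

lemma ft_line_continuous:
  assumes "test_chain D R" shows "continuous_on S (\<lambda>u. ft (D n) (Complex u y))"
  by (rule continuous_on_compose2[OF holomorphic_on_imp_continuous_on[OF ft_holomorphic[OF assms]]])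
     (auto simp: Complex_eq intro!: continuous_intros)

lemma ft_line_integrable_power:
  assumes T: "test_chain D R"
  shows "integrable lborel (\<lambda>u. (1 + cmod (Complex u y)) ^ p * cmod (ft (D 0) (Complex u y)))"
proof -
  obtain C where C: "C \<ge> 0" "\<And>z. \<bar>Im z\<bar> \<le> \<bar>y\<bar> \<Longrightarrow> cmod (ft (D 0) z) \<le> C / (1 + cmod z) ^ (p + 2)"
    using ft_decay[OF T, of "\<bar>y\<bar>" "p + 2"] by blast
  have [measurable]: "(\<lambda>u. ft (D 0) (Complex u y)) \<in> borel_measurable borel"
    by (rule borel_measurable_continuous_onI[OF ft_line_continuous[OF T]])
  have [measurable]: "(\<lambda>u. Complex u y) \<in> borel_measurable borel"
    by (rule borel_measurable_continuous_onI) (simp add: Complex_eq, intro continuous_intros)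
  show ?thesis
  proof (rule Bochner_Integration.integrable_bound)
    show "integrable lborel (\<lambda>u. C * (1 / (1 + u\<^sup>2)))" by (intro Bochner_Integration.integrable_mult_right integrable_inverse_square)
    show "AE u in lborel. norm ((1 + cmod (Complex u y)) ^ p * cmod (ft (D 0) (Complex u y))) \<le> norm (C * (1 / (1 + u\<^sup>2)))"
    proof (rule AE_I2)
      fix u
      define s where "s = 1 + cmod (Complex u y)"
      have s: "s \<ge> 1" by (simp add: s_def)
      have "\<bar>u\<bar> \<le> cmod (Complex u y)" using abs_Re_le_cmod[of "Complex u y"] by simp
      then have "(1 + \<bar>u\<bar>)\<^sup>2 \<le> s\<^sup>2" unfolding s_def by (intro power_mono) auto
      then have u2: "1 + u\<^sup>2 \<le> s\<^sup>2" by (simp add: power2_sum)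
      have "s ^ p * cmod (ft (D 0) (Complex u y)) \<le> s ^ p * (C / s ^ (p + 2))"
        using C(2)[of "Complex u y"] s by (intro mult_left_mono) (auto simp: s_def)
      also have "\<dots> = C / s\<^sup>2" using s by (simp add: power_add power2_eq_square)
      also have "\<dots> \<le> C / (1 + u\<^sup>2)" using u2 C(1) s by (intro divide_left_mono mult_pos_pos) (auto intro: add_pos_nonneg)
      finally show "norm ((1 + cmod (Complex u y)) ^ p * cmod (ft (D 0) (Complex u y))) \<le> norm (C * (1 / (1 + u\<^sup>2)))"
        using C(1) by (simp add: s_def abs_mult)
    qed
  qed measurable
qed

lemma ft_line_integrable:
  assumes T: "test_chain D R"
  shows "integrable lborel (\<lambda>u. ft (D 0) (Complex u y))"
proof -
  have [measurable]: "(\<lambda>u. ft (D 0) (Complex u y)) \<in> borel_measurable borel"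
    by (rule borel_measurable_continuous_onI[OF ft_line_continuous[OF T]])
  show ?thesis using ft_line_integrable_power[OF T, of y 0] by (simp add: integrable_norm_iff)
qed

text \<open>At height \<open>y\<close> one has the Fourier transform of \<open>D 0\<close> times a
  real exponential, so inversion returns the same factor \<open>exp (2 * pi * \<nu> * y)\<close>
  that relates line means to \<open>bohr_coeff F\<close>.\<close>

lemma ft_line_inversion:
  assumes T: "test_chain D R"
  shows "(LBINT u. ft (D 0) (Complex u y) * cis (2 * pi * \<nu> * u)) = D 0 \<nu> * of_real (exp (2 * pi * \<nu> * y))"
proof -
  have R: "R > 0" using T by (simp add: test_chain_def)
  have "(LBINT u. (LBINT t. (D 0 t * of_real (exp (2 * pi * t * y))) * cis (- (2 * pi * t * u))) * cis (2 * pi * \<nu> * u)) = D 0 \<nu> * of_real (exp (2 * pi * \<nu> * y))"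
  proof (rule fourier_inversion[OF _ _ R])
    show "continuous_on UNIV (\<lambda>t. D 0 t * of_real (exp (2 * pi * t * y)))"
      by (intro continuous_intros test_chain_continuous[OF T])
    show "D 0 t * of_real (exp (2 * pi * t * y)) = 0" if "R \<le> \<bar>t\<bar>" for t using T that by (simp add: test_chain_def)
    show "integrable lborel (\<lambda>u. LBINT t. (D 0 t * of_real (exp (2 * pi * t * y))) * cis (- (2 * pi * t * u)))"
      using ft_line_integrable[OF T, of y] unfolding ft_line .
  qed
  then show ?thesis by (simp only: ft_line)
qed

lemma (in shifted_AP) fourier_coefficient_pairing:
  assumes T: "test_chain D R" and y: "y > c" and ls: "locally_summable (bohr_coeff F)"
  shows "integrable lborel (\<lambda>x. ft (D 0) (Complex x y) * F (Complex x y))"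
    and "((\<lambda>\<nu>. bohr_coeff F \<nu> * D 0 \<nu>) has_sum (LBINT x. ft (D 0) (Complex x y) * F (Complex x y))) (supp (bohr_coeff F))"
proof -
  define h where "h x = F (Complex x y)" for x
  define \<psi> where "\<psi> u = ft (D 0) (Complex u y)" for u
  have h: "bohr_ap h" unfolding h_def by (rule line_bohr_ap[OF y])
  have \<psi>: "integrable lborel \<psi>" unfolding \<psi>_def by (rule ft_line_integrable[OF T])
  obtain B where B: "\<And>x. cmod (h x) \<le> B" using bohr_ap_bounded[OF h] by blast
  have [measurable]: "h \<in> borel_measurable borel" using bohr_ap_continuous[OF h] by (rule borel_measurable_continuous_onI)
  show "integrable lborel (\<lambda>x. ft (D 0) (Complex x y) * F (Complex x y))"
    unfolding h_def[symmetric] \<psi>_def[symmetric] by (rule integrable_mult_bounded[OF \<psi> _ B]) measurable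
  \<comment> \<open>The pairing for all horizontal translates of \<open>F\<close>; its value at 0 is
    wanted.\<close>
  define W where "W x = (LBINT u. \<psi> u * h (x + u))" for x
  have W: "bohr_ap W" unfolding W_def by (rule bohr_ap_convolution[OF h \<psi>])
  define b where "b \<nu> = bohr_coeff F \<nu> * D 0 \<nu>" for \<nu>
  \<comment> \<open>The support of \<open>D 0\<close> cuts the frequencies down to a bounded set,
    where local summability makes the series absolutely convergent.\<close>
  define A where "A = supp (bohr_coeff F) \<inter> {-R..R}"
  have R: "R > 0" using T by (simp add: test_chain_def)
  have Wm: "ap_mean (\<lambda>x. W x * cis (- 2 * pi * \<nu> * x)) (b \<nu>)" for \<nu>
  proof -
    have h': "bohr_ap (\<lambda>x. h x * cis (- 2 * pi * \<nu> * x))" by (intro bohr_ap_mult h bohr_ap_cis)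
    have \<psi>': "integrable lborel (\<lambda>u. \<psi> u * cis (2 * pi * \<nu> * u))"
    proof (rule integrable_mult_bounded[OF \<psi>])
      show "(\<lambda>u. cis (2 * pi * \<nu> * u)) \<in> borel_measurable lborel" by measurable
      show "cmod (cis (2 * pi * \<nu> * u)) \<le> 1" for u by simp
    qed
    \<comment> \<open>The exponential is split between the two factors of the convolution, so that
      the mean of the twisted \<open>W\<close> is the mean of the twisted \<open>h\<close> times a
      Fourier integral of \<psi>.\<close>
    have "ap_mean (\<lambda>x. LBINT u. (\<psi> u * cis (2 * pi * \<nu> * u)) * (h (x + u) * cis (- 2 * pi * \<nu> * (x + u))))
       (line_mean \<nu> y * (LBINT u. \<psi> u * cis (2 * pi * \<nu> * u)))"
      by (rule ap_mean_convolution[OF h' \<psi>']) (unfold h_def, rule line_mean[OF y])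
    moreover have "(LBINT u. (\<psi> u * cis (2 * pi * \<nu> * u)) * (h (x + u) * cis (- 2 * pi * \<nu> * (x + u)))) = W x * cis (- 2 * pi * \<nu> * x)" for x
    proof -
      have "cis (2 * pi * \<nu> * u) * cis (- 2 * pi * \<nu> * (x + u)) = cis (- 2 * pi * \<nu> * x)" for u
        unfolding cis_mult by (simp add: algebra_simps)
      then have eq: "(\<psi> u * cis (2 * pi * \<nu> * u)) * (h (x + u) * cis (- 2 * pi * \<nu> * (x + u))) = (\<psi> u * h (x + u)) * cis (- 2 * pi * \<nu> * x)" for u
        by (metis (no_types, lifting) mult.assoc mult.left_commute)
      show ?thesis unfolding W_def eq by (rule integral_mult_left_zero)
    qed
    moreover have "line_mean \<nu> y * (LBINT u. \<psi> u * cis (2 * pi * \<nu> * u)) = b \<nu>"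
      unfolding \<psi>_def ft_line_inversion[OF T] b_def bohr_coeff_eq(1)[OF y] by (simp add: mult_ac)
    ultimately show ?thesis by simp
  qed
  have "compact (D 0 ` {-R..R})" by (intro compact_continuous_image test_chain_continuous[OF T] compact_Icc)
  then have "bounded (D 0 ` {-R..R})" by (rule compact_imp_bounded)
  then obtain B1 where B1: "\<And>t. t \<in> {-R..R} \<Longrightarrow> cmod (D 0 t) \<le> B1" unfolding bounded_iff by (meson imageI)
  have sm: "(\<lambda>\<nu>. cmod (b \<nu>)) summable_on A"
  proof (rule summable_on_comparison_test)
    show "(\<lambda>\<nu>. B1 * cmod (bohr_coeff F \<nu>)) summable_on A"
      using ls R unfolding locally_summable_def A_def by (intro summable_on_cmult_right) auto
    fix \<nu> assume "\<nu> \<in> A"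
    then show "cmod (b \<nu>) \<le> B1 * cmod (bohr_coeff F \<nu>)"
      using B1[of \<nu>] by (simp add: b_def norm_mult A_def mult.commute mult_right_mono)
  qed simp
  have zero: "b \<nu> = 0" if "\<nu> \<notin> A" for \<nu>
  proof -
    have "bohr_coeff F \<nu> = 0 \<or> R \<le> \<bar>\<nu>\<bar>" using that by (auto simp: A_def supp_def)
    then show ?thesis using T unfolding test_chain_def b_def by auto
  qed
  define S where "S x = (\<Sum>\<^sub>\<infinity>\<nu>\<in>A. b \<nu> * cis (2 * pi * \<nu> * x))" for x
  have S: "bohr_ap S" unfolding S_def by (rule bohr_ap_trigonometric_series(1)[OF sm])
  have Sm: "ap_mean (\<lambda>x. S x * cis (- 2 * pi * \<nu> * x)) (b \<nu>)" for \<nu>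
    unfolding S_def by (rule bohr_ap_trigonometric_series(2)[OF sm zero])
  have "W 0 + (-1) * S 0 = 0"
  proof (rule bohr_ap_uniqueness)
    show "bohr_ap (\<lambda>x. W x + (-1) * S x)" by (intro bohr_ap_add W bohr_ap_mult bohr_ap_const S)
    fix l :: real
    define \<nu> where "\<nu> = - l / (2 * pi)"
    have l: "l = - 2 * pi * \<nu>" by (simp add: \<nu>_def)
    have "ap_mean (\<lambda>x. W x * cis (- 2 * pi * \<nu> * x) + (-1) * (S x * cis (- 2 * pi * \<nu> * x))) (b \<nu> + (-1) * b \<nu>)"
      by (intro ap_mean_add ap_mean_cmult Wm Sm bohr_ap_continuous bohr_ap_mult bohr_ap_const bohr_ap_cis W S)
    then show "ap_mean (\<lambda>x. (W x + (-1) * S x) * cis (l * x)) 0" unfolding l by (simp add: algebra_simps)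
  qed
  then have "W 0 = (\<Sum>\<^sub>\<infinity>\<nu>\<in>A. b \<nu>)" by (simp add: S_def)
  moreover have "(b has_sum (\<Sum>\<^sub>\<infinity>\<nu>\<in>A. b \<nu>)) A" by (rule has_sum_infsum[OF abs_summable_summable[OF sm]])
  ultimately have "(b has_sum W 0) A" by simp
  then have "(b has_sum W 0) (supp (bohr_coeff F))"
    by (rule has_sum_cong_neutral[THEN iffD1, rotated -1]) (use zero in \<open>auto simp: A_def\<close>)
  then show "((\<lambda>\<nu>. bohr_coeff F \<nu> * D 0 \<nu>) has_sum (LBINT x. ft (D 0) (Complex x y) * F (Complex x y))) (supp (bohr_coeff F))"
    by (simp add: W_def h_def \<psi>_def b_def[abs_def])
qed

section \<open>Variations of locally finite measures\<close>

text \<open>The additivity of \<open>complex_measure\<close> for values in any normed space, so that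
  it applies to a measure as well as to its real and imaginary parts with either sign.\<close>

definition bb_additive :: "(real set \<Rightarrow> 'a::real_normed_vector) \<Rightarrow> bool" where
  "bb_additive \<rho> \<longleftrightarrow> (\<forall>A :: nat \<Rightarrow> real set. range A \<subseteq> bounded_borel \<longrightarrow> disjoint_family A \<longrightarrow> bounded (\<Union>n. A n) \<longrightarrow>
        (\<lambda>n. \<rho> (A n)) sums \<rho> (\<Union>n. A n))"

lemma complex_measure_bb_additive:
  assumes "complex_measure \<mu>"
  shows "bb_additive \<mu>" "bb_additive (\<lambda>A. Re (\<mu> A))" "bb_additive (\<lambda>A. - Re (\<mu> A))"
    "bb_additive (\<lambda>A. Im (\<mu> A))" "bb_additive (\<lambda>A. - Im (\<mu> A))"
  using assms unfolding complex_measure_def bb_additive_def by (auto intro!: sums_Re sums_Im sums_minus)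

lemma bounded_borel_Int: "A \<in> bounded_borel \<Longrightarrow> B \<in> sets borel \<Longrightarrow> A \<inter> B \<in> bounded_borel"
  unfolding bounded_borel_def by (auto intro: bounded_subset)

lemma bounded_borel_Un: "A \<in> bounded_borel \<Longrightarrow> B \<in> bounded_borel \<Longrightarrow> A \<union> B \<in> bounded_borel"
  unfolding bounded_borel_def by auto

lemma bounded_borel_empty [simp]: "{} \<in> bounded_borel" unfolding bounded_borel_def by auto

lemma bb_additive_empty:
  assumes "bb_additive \<rho>" shows "\<rho> {} = 0"
proof -
  have "(\<lambda>n::nat. \<rho> {}) sums \<rho> {}"
    using assms[unfolded bb_additive_def, rule_format, of "\<lambda>_. {}"] by (simp add: disjoint_family_on_def)
  then have "summable (\<lambda>n::nat. \<rho> {})" by (rule sums_summable)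
  then have "(\<lambda>n::nat. \<rho> {}) \<longlonglongrightarrow> 0" by (rule summable_LIMSEQ_zero)
  then show ?thesis by (simp add: LIMSEQ_const_iff)
qed

lemma bb_additive_Un:
  assumes \<rho>: "bb_additive \<rho>" and A: "A \<in> bounded_borel" "B \<in> bounded_borel" "A \<inter> B = {}"
  shows "\<rho> (A \<union> B) = \<rho> A + \<rho> B"
proof -
  have "(\<lambda>n. \<rho> (binaryset A B n)) sums \<rho> (\<Union>n. binaryset A B n)"
  proof (rule \<rho>[unfolded bb_additive_def, rule_format])
    show "range (binaryset A B) \<subseteq> bounded_borel" using A by (auto simp: range_binaryset_eq)
    show "disjoint_family (binaryset A B)" using A(3) by (auto simp: disjoint_family_on_def binaryset_def)
    show "bounded (\<Union>n. binaryset A B n)" using A by (auto simp: UN_binaryset_eq bounded_borel_def)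
  qed
  moreover have "(\<lambda>n. \<rho> (binaryset A B n)) sums (\<rho> A + \<rho> B)" by (rule binaryset_sums) (rule bb_additive_empty[OF \<rho>])
  ultimately show ?thesis using sums_unique2 by (simp add: UN_binaryset_eq)
qed

lemma bb_additive_Int_sums:
  assumes \<rho>: "bb_additive \<rho>" and A: "A \<in> bounded_borel" and B: "range B \<subseteq> sets borel" "disjoint_family B" "A \<subseteq> (\<Union>n. B n)"
  shows "(\<lambda>n. \<rho> (A \<inter> B n)) sums \<rho> A"
proof -
  have eq: "(\<Union>n. A \<inter> B n) = A" using B(3) by auto
  have "(\<lambda>n. \<rho> (A \<inter> B n)) sums \<rho> (\<Union>n. A \<inter> B n)"
  proof (rule \<rho>[unfolded bb_additive_def, rule_format])
    show "range (\<lambda>n. A \<inter> B n) \<subseteq> bounded_borel" using A B(1) by (auto intro!: bounded_borel_Int)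
    show "disjoint_family (\<lambda>n. A \<inter> B n)" using B(2) by (auto simp: disjoint_family_on_def)
    show "bounded (\<Union>n. A \<inter> B n)" unfolding eq using A by (simp add: bounded_borel_def)
  qed
  then show ?thesis by (simp only: eq)
qed

text \<open>Superadditivity and monotonicity bound the sum of the values through finite partial
  unions. Both variations are suprema and get their measure property from this criterion.\<close>

lemma countably_additive_of_super_sub:
  fixes f :: "real set \<Rightarrow> ennreal"
  assumes mono: "\<And>A B. A \<subseteq> B \<Longrightarrow> f A \<le> f B"
    and super: "\<And>A B. A \<in> sets borel \<Longrightarrow> B \<in> sets borel \<Longrightarrow> A \<inter> B = {} \<Longrightarrow> f A + f B \<le> f (A \<union> B)"
    and sub: "\<And>B::nat \<Rightarrow> real set. range B \<subseteq> sets borel \<Longrightarrow> disjoint_family B \<Longrightarrow> f (\<Union>n. B n) \<le> (\<Sum>n. f (B n))"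
  shows "countably_additive (sets borel) f"
  unfolding countably_additive_def
proof (intro allI impI antisym)
  fix B :: "nat \<Rightarrow> real set" assume B: "range B \<subseteq> sets borel" "disjoint_family B"
  show "f (\<Union>n. B n) \<le> (\<Sum>n. f (B n))" by (rule sub[OF B])
  have fin: "(\<Sum>n<N. f (B n)) \<le> f (\<Union>n<N. B n)" for N
  proof (induction N)
    case (Suc N)
    have m: "(\<Union>n<N. B n) \<in> sets borel" "B N \<in> sets borel" using B(1) by auto
    have "B n \<inter> B N = {}" if "n < N" for n using B(2) that unfolding disjoint_family_on_def by auto
    then have d: "(\<Union>n<N. B n) \<inter> B N = {}" by blast
    have "(\<Sum>n<Suc N. f (B n)) \<le> f (\<Union>n<N. B n) + f (B N)" using add_right_mono[OF Suc] by simp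
    also have "\<dots> \<le> f ((\<Union>n<N. B n) \<union> B N)" by (rule super[OF m d])
    finally show ?case by (simp add: lessThan_Suc Un_commute)
  qed simp
  show "(\<Sum>n. f (B n)) \<le> f (\<Union>n. B n)"
  proof (rule suminf_le_const)
    fix N
    have "f (\<Union>n<N. B n) \<le> f (\<Union>n. B n)" by (rule mono) auto
    with fin[of N] show "(\<Sum>n<N. f (B n)) \<le> f (\<Union>n. B n)" by (rule order_trans)
  qed simp
qed

lemma measure_of_borel:
  assumes "f {} = 0" "countably_additive (sets borel) f"
  shows "sets (measure_of UNIV (sets (borel :: real measure)) f) = sets borel"
    and "B \<in> sets borel \<Longrightarrow> emeasure (measure_of UNIV (sets (borel :: real measure)) f) B = f B"
proof -
  show s: "sets (measure_of UNIV (sets (borel :: real measure)) f) = sets borel"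
    using sets.sigma_sets_eq[of "borel :: real measure"] by simp
  show "emeasure (measure_of UNIV (sets (borel :: real measure)) f) B = f B" if "B \<in> sets borel"
    by (rule emeasure_measure_of[OF refl]) (use assms that s in \<open>auto simp: positive_def\<close>)
qed

lemma ennreal_plus_le: "ennreal (x + y) \<le> ennreal x + ennreal y"
  by (auto simp: ennreal_plus_if intro!: ennreal_leI)

lemma ennreal_sums_le:
  assumes "f sums s" shows "ennreal s \<le> (\<Sum>n. ennreal (f n))"
proof -
  have le: "ennreal (sum f {..<N}) \<le> (\<Sum>n<N. ennreal (f n))" for N
    by (induction N) (auto intro: order_trans[OF ennreal_plus_le] add_right_mono)
  have "(\<lambda>N. ennreal (sum f {..<N})) \<longlonglongrightarrow> ennreal s" using assms unfolding sums_def by (rule tendsto_ennrealI)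
  moreover have "(\<lambda>N. \<Sum>n<N. ennreal (f n)) \<longlonglongrightarrow> (\<Sum>n. ennreal (f n))" by (rule summable_LIMSEQ) simp
  ultimately show ?thesis by (rule LIMSEQ_le) (use le in auto)
qed

text \<open>The supremum is superadditive since competitors for disjoint sets can be joined, and
  countably subadditive since a competitor can be cut along the \<open>B n\<close>.\<close>

lemma pos_variation_measure:
  assumes \<rho>: "bb_additive \<rho>"
  shows "sets (pos_variation \<rho>) = sets borel"
    and "B \<in> sets borel \<Longrightarrow> emeasure (pos_variation \<rho>) B = (SUP A \<in> {A \<in> bounded_borel. A \<subseteq> B}. ennreal (\<rho> A))"
proof -
  define f where "f B = (SUP A \<in> {A \<in> bounded_borel. A \<subseteq> B}. ennreal (\<rho> A))" for B
  have up: "ennreal (\<rho> A) \<le> f B" if "A \<in> bounded_borel" "A \<subseteq> B" for A B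
    unfolding f_def using that by (intro SUP_upper) auto
  have "f {} = ennreal (\<rho> {})" by (intro antisym up) (auto simp: f_def intro!: SUP_least)
  then have f0: "f {} = 0" by (simp add: bb_additive_empty[OF \<rho>])
  have ca: "countably_additive (sets borel) f"
  proof (rule countably_additive_of_super_sub)
    show "f A \<le> f B" if "A \<subseteq> B" for A B unfolding f_def using that by (intro SUP_subset_mono) auto
    show "f A + f B \<le> f (A \<union> B)" if AB: "A \<in> sets borel" "B \<in> sets borel" "A \<inter> B = {}" for A B
    proof -
      have ne: "{C \<in> bounded_borel. C \<subseteq> A} \<noteq> {}" for A using bounded_borel_empty by blast
      have "ennreal (\<rho> C) + ennreal (\<rho> D) \<le> f (A \<union> B)" if "C \<in> bounded_borel" "C \<subseteq> A" "D \<in> bounded_borel" "D \<subseteq> B" for C D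
      proof -
        have 1: "\<rho> (C \<union> D) = \<rho> C + \<rho> D" using that AB(3) by (intro bb_additive_Un[OF \<rho>]) auto
        have 2: "ennreal (\<rho> (C \<union> D)) \<le> f (A \<union> B)" using that by (intro up bounded_borel_Un) auto
        have 3: "ennreal (\<rho> C) \<le> f (A \<union> B)" "ennreal (\<rho> D) \<le> f (A \<union> B)" using that by (auto intro!: up)
        show ?thesis
        proof (cases "\<rho> C \<ge> 0 \<and> \<rho> D \<ge> 0")
          case True
          then have "ennreal (\<rho> C) + ennreal (\<rho> D) = ennreal (\<rho> (C \<union> D))" unfolding 1 by (intro ennreal_plus[symmetric]) auto
          with 2 show ?thesis by simp
        next
          \<comment> \<open>\<open>ennreal\<close> truncates a negative value to 0, and the other
            set alone is a competitor.\<close>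
          case False
          then have "ennreal (\<rho> C) = 0 \<or> ennreal (\<rho> D) = 0" by (auto simp: ennreal_neg)
          with 3 show ?thesis by auto
        qed
      qed
      then show ?thesis
        unfolding f_def[of A] f_def[of B] ennreal_SUP_add_left[OF ne, symmetric] ennreal_SUP_add_right[OF ne]
        by (auto intro!: SUP_least)
    qed
    show "f (\<Union>n. B n) \<le> (\<Sum>n. f (B n))" if B: "range B \<subseteq> sets borel" "disjoint_family B" for B :: "nat \<Rightarrow> real set"
      unfolding f_def[of "\<Union>n. B n"]
    proof (rule SUP_least)
      fix A assume "A \<in> {A \<in> bounded_borel. A \<subseteq> (\<Union>n. B n)}"
      then have A: "A \<in> bounded_borel" "A \<subseteq> (\<Union>n. B n)" by auto
      have "ennreal (\<rho> A) \<le> (\<Sum>n. ennreal (\<rho> (A \<inter> B n)))" by (rule ennreal_sums_le[OF bb_additive_Int_sums[OF \<rho> A(1) B A(2)]])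
      also have "\<dots> \<le> (\<Sum>n. f (B n))" using A(1) B(1) by (intro suminf_le up bounded_borel_Int) auto
      finally show "ennreal (\<rho> A) \<le> (\<Sum>n. f (B n))" .
    qed
  qed
  show "sets (pos_variation \<rho>) = sets borel"
    unfolding pos_variation_def f_def[symmetric] by (rule measure_of_borel(1)[OF f0 ca])
  show "emeasure (pos_variation \<rho>) B = (SUP A \<in> {A \<in> bounded_borel. A \<subseteq> B}. ennreal (\<rho> A))" if "B \<in> sets borel"
    unfolding pos_variation_def f_def[symmetric] by (rule measure_of_borel(2)[OF f0 ca that])
qed

lemma total_variation_measure:
  assumes \<mu>: "bb_additive \<mu>"
  shows "sets (total_variation \<mu>) = sets borel"
    and "B \<in> sets borel \<Longrightarrow> emeasure (total_variation \<mu>) B = (SUP P \<in> {P. finite P \<and> disjoint P \<and> P \<subseteq> bounded_borel \<and> \<Union>P \<subseteq> B}.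
            \<Sum>A\<in>P. ennreal (cmod (\<mu> A)))"
proof -
  define D where "D B = {P. finite P \<and> disjoint P \<and> P \<subseteq> bounded_borel \<and> \<Union>P \<subseteq> B}" for B
  define f where "f B = (SUP P \<in> D B. \<Sum>A\<in>P. ennreal (cmod (\<mu> A)))" for B
  note \<mu>0 = bb_additive_empty[OF \<mu>]
  have up: "(\<Sum>A\<in>P. ennreal (cmod (\<mu> A))) \<le> f B" if "P \<in> D B" for P B
    unfolding f_def using that by (rule SUP_upper)
  have ne: "D B \<noteq> {}" for B unfolding D_def by (auto intro!: exI[of _ "{}"])
  have "f {} = 0"
    unfolding f_def
  proof (rule antisym[OF SUP_least])
    fix P assume "P \<in> D {}"
    then have "A = {}" if "A \<in> P" for A using that by (auto simp: D_def)
    then have "(\<Sum>A\<in>P. ennreal (cmod (\<mu> A))) = 0" using \<mu>0 by (intro sum.neutral) auto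
    then show "(\<Sum>A\<in>P. ennreal (cmod (\<mu> A))) \<le> 0" by simp
  qed simp
  note f0 = this
  have ca: "countably_additive (sets borel) f"
  proof (rule countably_additive_of_super_sub)
    show "f A \<le> f B" if "A \<subseteq> B" for A B unfolding f_def D_def using that by (intro SUP_subset_mono) auto
    show "f A + f B \<le> f (A \<union> B)" if AB: "A \<in> sets borel" "B \<in> sets borel" "A \<inter> B = {}" for A B
    proof -
      have "(\<Sum>C\<in>P. ennreal (cmod (\<mu> C))) + (\<Sum>C\<in>R. ennreal (cmod (\<mu> C))) \<le> f (A \<union> B)" if P: "P \<in> D A" and R: "R \<in> D B" for P R
      proof -
        have fin: "finite P" "finite R" using P R by (auto simp: D_def)
        \<comment> \<open>The two families may share the empty set, where the measure
          vanishes.\<close>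
        have "C = {}" if "C \<in> P \<inter> R" for C
        proof -
          have "C \<subseteq> A" "C \<subseteq> B" using that P R by (auto simp: D_def)
          then show ?thesis using AB(3) by blast
        qed
        then have "(\<Sum>C\<in>P \<inter> R. ennreal (cmod (\<mu> C))) = 0" using \<mu>0 by (intro sum.neutral) auto
        then have "(\<Sum>C\<in>P. ennreal (cmod (\<mu> C))) + (\<Sum>C\<in>R. ennreal (cmod (\<mu> C))) = (\<Sum>C\<in>P \<union> R. ennreal (cmod (\<mu> C)))"
          using sum.union_inter[OF fin, of "\<lambda>C. ennreal (cmod (\<mu> C))"] by simp
        moreover have "\<Union>P \<subseteq> A" "\<Union>R \<subseteq> B" using P R by (auto simp: D_def)
        then have "\<Union>P \<inter> \<Union>R = {}" using AB(3) by blast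
        then have "disjoint (P \<union> R)" using P R by (intro disjoint_union) (auto simp: D_def)
        then have "P \<union> R \<in> D (A \<union> B)" using P R by (auto simp: D_def)
        ultimately show ?thesis using up by simp
      qed
      then show ?thesis
        unfolding f_def[of A] f_def[of B] ennreal_SUP_add_left[OF ne, symmetric] ennreal_SUP_add_right[OF ne]
        by (intro SUP_least) auto
    qed
    show "f (\<Union>n. B n) \<le> (\<Sum>n. f (B n))" if B: "range B \<subseteq> sets borel" "disjoint_family B" for B :: "nat \<Rightarrow> real set"
      unfolding f_def[of "\<Union>n. B n"]
    proof (rule SUP_least)
      fix P assume P: "P \<in> D (\<Union>n. B n)"
      then have Pf: "finite P" "disjoint P" and PA: "\<And>A. A \<in> P \<Longrightarrow> A \<in> bounded_borel" "\<And>A. A \<in> P \<Longrightarrow> A \<subseteq> (\<Union>n. B n)" by (auto simp: D_def)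
      have "ennreal (cmod (\<mu> A)) \<le> (\<Sum>n. ennreal (cmod (\<mu> (A \<inter> B n))))" if A: "A \<in> P" for A
      proof -
        have s: "(\<lambda>n. \<mu> (A \<inter> B n)) sums \<mu> A" by (rule bb_additive_Int_sums[OF \<mu> PA(1)[OF A] B PA(2)[OF A]])
        have le: "ennreal (cmod (\<Sum>n<N. \<mu> (A \<inter> B n))) \<le> (\<Sum>n<N. ennreal (cmod (\<mu> (A \<inter> B n))))" for N
          by (subst sum_ennreal) (auto intro: ennreal_leI norm_sum)
        have "(\<lambda>N. ennreal (cmod (\<Sum>n<N. \<mu> (A \<inter> B n)))) \<longlonglongrightarrow> ennreal (cmod (\<mu> A))"
          using s unfolding sums_def by (intro tendsto_ennrealI tendsto_norm)
        moreover have "(\<lambda>N. \<Sum>n<N. ennreal (cmod (\<mu> (A \<inter> B n)))) \<longlonglongrightarrow> (\<Sum>n. ennreal (cmod (\<mu> (A \<inter> B n))))" by (rule summable_LIMSEQ) simp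
        ultimately show ?thesis by (rule LIMSEQ_le) (use le in auto)
      qed
      then have "(\<Sum>A\<in>P. ennreal (cmod (\<mu> A))) \<le> (\<Sum>A\<in>P. \<Sum>n. ennreal (cmod (\<mu> (A \<inter> B n))))" by (rule sum_mono)
      also have "\<dots> = (\<Sum>n. \<Sum>A\<in>P. ennreal (cmod (\<mu> (A \<inter> B n))))" by (rule suminf_sum[symmetric]) simp
      also have "\<dots> \<le> (\<Sum>n. f (B n))"
      proof (rule suminf_le)
        fix n
        \<comment> \<open>Different members of \<open>P\<close> have the same trace on
          \<open>B n\<close> only if it is empty, so passing to the set of traces loses
          nothing.\<close>
        have "(\<Sum>A\<in>P. ennreal (cmod (\<mu> (A \<inter> B n)))) = (\<Sum>C\<in>(\<lambda>A. A \<inter> B n) ` P. ennreal (cmod (\<mu> C)))"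
        proof (subst sum.reindex_nontrivial[OF Pf(1)])
          fix A A' assume AA: "A \<in> P" "A' \<in> P" "A \<noteq> A'" "A \<inter> B n = A' \<inter> B n"
          then have "A \<inter> A' = {}" using Pf(2) by (auto simp: disjoint_def)
          then have "A \<inter> B n = {}" using AA(4) by blast
          then show "ennreal (cmod (\<mu> (A \<inter> B n))) = 0" using \<mu>0 by simp
        qed simp
        also have "disjoint ((\<lambda>A. A \<inter> B n) ` P)" using Pf(2) unfolding disjoint_def by blast
        then have "(\<lambda>A. A \<inter> B n) ` P \<in> D (B n)" using Pf PA(1) B(1) unfolding D_def by (auto intro!: bounded_borel_Int)
        then have "(\<Sum>C\<in>(\<lambda>A. A \<inter> B n) ` P. ennreal (cmod (\<mu> C))) \<le> f (B n)" by (rule up)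
        finally show "(\<Sum>A\<in>P. ennreal (cmod (\<mu> (A \<inter> B n)))) \<le> f (B n)" .
      qed auto
      finally show "(\<Sum>A\<in>P. ennreal (cmod (\<mu> A))) \<le> (\<Sum>n. f (B n))" .
    qed
  qed
  show "sets (total_variation \<mu>) = sets borel"
    unfolding total_variation_def D_def[symmetric] f_def[symmetric] by (rule measure_of_borel(1)[OF f0 ca])
  show "emeasure (total_variation \<mu>) B = (SUP P \<in> {P. finite P \<and> disjoint P \<and> P \<subseteq> bounded_borel \<and> \<Union>P \<subseteq> B}.
            \<Sum>A\<in>P. ennreal (cmod (\<mu> A)))" if "B \<in> sets borel"
    unfolding total_variation_def D_def[symmetric] f_def[symmetric] by (rule measure_of_borel(2)[OF f0 ca that])
qed

lemma pos_variation_le_total_variation: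
  assumes \<mu>: "bb_additive \<mu>" and \<rho>: "bb_additive \<rho>" and le: "\<And>A. \<rho> A \<le> cmod (\<mu> A)"
  shows "pos_variation \<rho> \<le> total_variation \<mu>"
proof -
  note sp = pos_variation_measure(1)[OF \<rho>] and st = total_variation_measure(1)[OF \<mu>]
  have ep: "emeasure (pos_variation \<rho>) B \<le> emeasure (total_variation \<mu>) B" for B
  proof (cases "B \<in> sets borel")
    case True
    show ?thesis
      unfolding pos_variation_measure(2)[OF \<rho> True] total_variation_measure(2)[OF \<mu> True]
    proof (rule SUP_mono)
      fix A assume "A \<in> {A \<in> bounded_borel. A \<subseteq> B}"
      then have "{A} \<in> {P. finite P \<and> disjoint P \<and> P \<subseteq> bounded_borel \<and> \<Union>P \<subseteq> B}" by (auto simp: disjoint_def)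
      moreover have "ennreal (\<rho> A) \<le> (\<Sum>A\<in>{A}. ennreal (cmod (\<mu> A)))" using le[of A] by (simp add: ennreal_leI)
      ultimately show "\<exists>P\<in>{P. finite P \<and> disjoint P \<and> P \<subseteq> bounded_borel \<and> \<Union>P \<subseteq> B}. ennreal (\<rho> A) \<le> (\<Sum>A\<in>P. ennreal (cmod (\<mu> A)))" by blast
    qed
  next
    case False
    then show ?thesis using sp st by (simp add: emeasure_notin_sets)
  qed
  show ?thesis
    using sp st sets_eq_imp_space_eq[of "pos_variation \<rho>" "total_variation \<mu>"] ep
    by (subst le_measure) auto
qed

text \<open>The infimum runs over integers, so the bound \<open>2 * (m + 1)\<close> yields an
  admissible \<open>n\<close> not above it: otherwise all would be at least one larger. As the base
  \<open>1 + t\<^sup>2\<close> is at least 1, the weight for \<open>n\<close> dominates.\<close>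

lemma measure_deg_weight:
  assumes \<mu>: "bb_additive \<mu>" and deg: "measure_deg \<mu> \<le> ereal (2 * (real m + 1))"
  shows "(\<integral>\<^sup>+ t. ennreal (1 / (1 + t\<^sup>2) ^ (m + 1)) \<partial>total_variation \<mu>) < \<infinity>"
proof -
  define S where "S = {n :: int. (\<integral>\<^sup>+ t. ennreal ((1 + t\<^sup>2) powr (- real_of_int n / 2)) \<partial>total_variation \<mu>) < \<infinity>}"
  have "\<exists>n\<in>S. n \<le> 2 * (int m + 1)"
  proof (rule ccontr)
    assume "\<not> ?thesis"
    then have "2 * (int m + 1) + 1 \<le> n" if "n \<in> S" for n using that by force
    then have "ereal (real_of_int (2 * (int m + 1) + 1)) \<le> (INF n\<in>S. ereal (real_of_int n))"
      by (intro INF_greatest) (simp only: ereal_less_eq of_int_le_iff)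
    also have "\<dots> \<le> ereal (2 * (real m + 1))" using deg unfolding measure_deg_def S_def .
    finally show False by simp
  qed
  then obtain n where n: "n \<in> S" "n \<le> 2 * (int m + 1)" by blast
  have "(\<integral>\<^sup>+ t. ennreal (1 / (1 + t\<^sup>2) ^ (m + 1)) \<partial>total_variation \<mu>) \<le> (\<integral>\<^sup>+ t. ennreal ((1 + t\<^sup>2) powr (- real_of_int n / 2)) \<partial>total_variation \<mu>)"
  proof (intro nn_integral_mono ennreal_leI)
    fix t :: real
    have t: "1 + t\<^sup>2 > 0" by (simp add: add_pos_nonneg)
    have "1 / (1 + t\<^sup>2) ^ (m + 1) = (1 + t\<^sup>2) powr (- real (m + 1))" by (simp only: powr_minus powr_realpow[OF t] inverse_eq_divide)
    also have "\<dots> \<le> (1 + t\<^sup>2) powr (- real_of_int n / 2)"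
    proof (rule powr_mono)
      have "real_of_int n \<le> real_of_int (2 * (int m + 1))" using n(2) by (simp only: of_int_le_iff)
      then show "- real (m + 1) \<le> - real_of_int n / 2" by simp
    qed simp
    finally show "1 / (1 + t\<^sup>2) ^ (m + 1) \<le> (1 + t\<^sup>2) powr (- real_of_int n / 2)" .
  qed
  also have "\<dots> < \<infinity>" using n(1) by (simp add: S_def)
  finally show ?thesis .
qed

lemma pos_variation_weight_integrable:
  assumes \<mu>: "bb_additive \<mu>" and \<rho>: "bb_additive \<rho>" and le: "\<And>A. \<rho> A \<le> cmod (\<mu> A)" and deg: "measure_deg \<mu> \<le> ereal (2 * (real m + 1))"
  shows "integrable (pos_variation \<rho>) (\<lambda>t. 1 / (1 + t\<^sup>2) ^ (m + 1))"
proof (rule integrableI_nonneg)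
  note sp = pos_variation_measure(1)[OF \<rho>] and st = total_variation_measure(1)[OF \<mu>]
  show "(\<lambda>t. 1 / (1 + t\<^sup>2) ^ (m + 1)) \<in> borel_measurable (pos_variation \<rho>)"
    unfolding measurable_cong_sets[OF sp refl] by measurable
  show "AE t in pos_variation \<rho>. 0 \<le> 1 / (1 + t\<^sup>2) ^ (m + 1)" by simp
  have "(\<integral>\<^sup>+ t. ennreal (1 / (1 + t\<^sup>2) ^ (m + 1)) \<partial>pos_variation \<rho>) \<le> (\<integral>\<^sup>+ t. ennreal (1 / (1 + t\<^sup>2) ^ (m + 1)) \<partial>total_variation \<mu>)"
    by (rule nn_integral_mono_measure) (use sp st pos_variation_le_total_variation[OF \<mu> \<rho> le] in auto)
  also have "\<dots> < \<infinity>" by (rule measure_deg_weight[OF \<mu> deg])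
  finally show "(\<integral>\<^sup>+ t. ennreal (1 / (1 + t\<^sup>2) ^ (m + 1)) \<partial>pos_variation \<rho>) < \<infinity>" .
qed

lemma cm_integral_real_measure:
  assumes "real_measure \<mu>"
  shows "cm_integral \<mu> f = integral\<^sup>L (pos_variation (\<lambda>A. Re (\<mu> A))) f - integral\<^sup>L (pos_variation (\<lambda>A. - Re (\<mu> A))) f"
proof -
  have cm: "complex_measure \<mu>" and re: "\<And>A. A \<in> bounded_borel \<Longrightarrow> Im (\<mu> A) = 0"
    using assms by (auto simp: real_measure_def complex_is_Real_iff)
  have z: "integral\<^sup>L (pos_variation \<rho>) f = 0" if \<rho>: "bb_additive \<rho>" and 0: "\<And>A. A \<in> bounded_borel \<Longrightarrow> \<rho> A = 0" for \<rho>
  proof (rule integral_eq_zero_AE)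
    have "(SUP A \<in> {A \<in> bounded_borel. A \<subseteq> UNIV}. ennreal (\<rho> A)) = 0" using 0 by (intro antisym SUP_least) auto
    then have "emeasure (pos_variation \<rho>) UNIV = 0" using pos_variation_measure(2)[OF \<rho>, of UNIV] by simp
    then have "UNIV \<in> null_sets (pos_variation \<rho>)" by (auto simp: null_sets_def pos_variation_measure(1)[OF \<rho>])
    then show "AE x in pos_variation \<rho>. f x = 0" unfolding eventually_ae_filter by blast
  qed
  show ?thesis unfolding cm_integral_def using complex_measure_bb_additive(4,5)[OF cm] re by (simp add: z)
qed

section \<open>The Nevanlinna kernel tested against a Fourier transform\<close>

lemma symmetric_integral_limit:
  fixes g :: "real \<Rightarrow> complex"
  assumes g: "continuous_on UNIV g" and int: "integrable lborel g"
  shows "(\<lambda>n. integral {-real n..real n} g) \<longlonglongrightarrow> (LBINT x. g x)"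
proof -
  have [measurable]: "g \<in> borel_measurable borel" using g by (rule borel_measurable_continuous_onI)
  have eq: "(LBINT x. indicator {-real n..real n} x *\<^sub>R g x) = integral {-real n..real n} g" for n
  proof -
    have "set_integrable lborel {-real n..real n} g"
      unfolding set_integrable_def by (rule borel_integrable_compact) (use continuous_on_subset[OF g] in auto)
    from set_borel_integral_eq_integral(2)[OF this] show ?thesis by (simp add: set_lebesgue_integral_def)
  qed
  have "(\<lambda>n. LBINT x. indicator {-real n..real n} x *\<^sub>R g x) \<longlonglongrightarrow> (LBINT x. g x)"
  proof (rule integral_dominated_convergence[where w = "\<lambda>x. cmod (g x)"])
    show "AE x in lborel. (\<lambda>n. indicator {-real n..real n} x *\<^sub>R g x) \<longlonglongrightarrow> g x"
    proof (rule AE_I2)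
      fix x
      have "indicator {-real n..real n} x *\<^sub>R g x = g x" if "n \<ge> nat \<lceil>\<bar>x\<bar>\<rceil>" for n
      proof -
        have "\<bar>x\<bar> \<le> real n" using that by linarith
        then show ?thesis by (auto simp: indicator_def abs_le_iff)
      qed
      then have "\<forall>\<^sub>F n in sequentially. indicator {-real n..real n} x *\<^sub>R g x = g x" unfolding eventually_sequentially by blast
      then show "(\<lambda>n. indicator {-real n..real n} x *\<^sub>R g x) \<longlonglongrightarrow> g x" by (rule tendsto_eventually)
    qed
    show "AE x in lborel. norm (indicator {-real n..real n} x *\<^sub>R g x) \<le> cmod (g x)" for n
      by (auto simp: indicator_def)
  qed (use int in auto)
  then show ?thesis unfolding eq .
qed

lemma line_integral_limit:
  fixes g1 g2 :: "real \<Rightarrow> complex"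
  assumes g1: "continuous_on UNIV g1" "integrable lborel g1" and g2: "continuous_on UNIV g2" "integrable lborel g2"
    and V: "V \<longlonglongrightarrow> 0" and le: "\<And>n. n \<ge> n0 \<Longrightarrow> cmod (k - (integral {-real n..real n} g1 - integral {-real n..real n} g2)) \<le> V n"
  shows "k = (LBINT x. g1 x) - (LBINT x. g2 x)"
proof -
  have "(\<lambda>n. k - (integral {-real n..real n} g1 - integral {-real n..real n} g2)) \<longlonglongrightarrow> k - ((LBINT x. g1 x) - (LBINT x. g2 x))"
    by (intro tendsto_intros symmetric_integral_limit g1 g2)
  moreover have "(\<lambda>n. k - (integral {-real n..real n} g1 - integral {-real n..real n} g2)) \<longlonglongrightarrow> 0"
    by (rule Lim_null_comparison[OF _ V]) (use le in \<open>auto simp: eventually_sequentially\<close>)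
  ultimately show ?thesis using LIMSEQ_unique by fastforce
qed

lemma ft_line_mult_integrable:
  assumes T: "test_chain D R" and [measurable]: "g \<in> borel_measurable borel"
    and le: "\<And>x. cmod (g x) \<le> A * (1 + cmod (Complex x y)) ^ p"
  shows "integrable lborel (\<lambda>x. ft (D 0) (Complex x y) * g x)"
proof (rule Bochner_Integration.integrable_bound)
  show "integrable lborel (\<lambda>x. A * ((1 + cmod (Complex x y)) ^ p * cmod (ft (D 0) (Complex x y))))"
    by (intro Bochner_Integration.integrable_mult_right ft_line_integrable_power[OF T])
  have [measurable]: "(\<lambda>u. ft (D 0) (Complex u y)) \<in> borel_measurable borel"
    by (rule borel_measurable_continuous_onI[OF ft_line_continuous[OF T]])
  show "(\<lambda>x. ft (D 0) (Complex x y) * g x) \<in> borel_measurable lborel" by measurable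
  show "AE x in lborel. cmod (ft (D 0) (Complex x y) * g x) \<le> norm (A * ((1 + cmod (Complex x y)) ^ p * cmod (ft (D 0) (Complex x y))))"
  proof (rule AE_I2)
    fix x
    have "cmod (ft (D 0) (Complex x y)) * cmod (g x) \<le> cmod (ft (D 0) (Complex x y)) * (A * (1 + cmod (Complex x y)) ^ p)"
      by (intro mult_left_mono le) auto
    also have "\<dots> \<le> norm (A * ((1 + cmod (Complex x y)) ^ p * cmod (ft (D 0) (Complex x y))))" by (simp add: mult_ac)
    finally show "cmod (ft (D 0) (Complex x y) * g x) \<le> norm (A * ((1 + cmod (Complex x y)) ^ p * cmod (ft (D 0) (Complex x y))))"
      unfolding norm_mult[of "ft _ _"] .
  qed
qed

lemma entire_line_continuous:
  assumes "g holomorphic_on UNIV" shows "continuous_on S (\<lambda>x. g (Complex x y))"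
  by (rule continuous_on_compose2[OF holomorphic_on_imp_continuous_on[OF assms]])
     (auto simp: Complex_eq intro!: continuous_intros)

lemma ft_side_bound:
  assumes T: "test_chain D R" and g: "\<And>z. cmod (g z) \<le> A * (1 + cmod z) ^ p" and A: "A \<ge> 0"
  shows "\<exists>C\<ge>0. \<forall>z. \<bar>Im z\<bar> \<le> Y \<longrightarrow> cmod (ft (D 0) z * g z) \<le> C / (1 + \<bar>Re z\<bar>)"
proof -
  obtain C where C: "C \<ge> 0" "\<And>z. \<bar>Im z\<bar> \<le> Y \<Longrightarrow> cmod (ft (D 0) z) \<le> C / (1 + cmod z) ^ Suc p"
    using ft_decay[OF T, of Y "Suc p"] by blast
  have "cmod (ft (D 0) z * g z) \<le> C * A / (1 + \<bar>Re z\<bar>)" if z: "\<bar>Im z\<bar> \<le> Y" for z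
  proof -
    define s where "s = 1 + cmod z"
    have s: "s \<ge> 1 + \<bar>Re z\<bar>" "s > 0" using abs_Re_le_cmod[of z] by (auto simp: s_def intro: add_pos_nonneg)
    have "cmod (ft (D 0) z) * cmod (g z) \<le> C / s ^ Suc p * (A * s ^ p)"
      unfolding s_def by (intro mult_mono C(2) z g) (use C(1) in auto)
    also have "\<dots> = C * A / s" using s(2) by simp
    also have "\<dots> \<le> C * A / (1 + \<bar>Re z\<bar>)" using s C(1) A by (intro divide_left_mono mult_pos_pos mult_nonneg_nonneg) auto
    finally show ?thesis by (simp add: norm_mult)
  qed
  with C(1) A show ?thesis by (intro exI[of _ "C * A"]) auto
qed

text \<open>Cauchy's formula on rectangles over \<open>{-n..n}\<close>: the transform decays by one
  power more than \<open>g\<close> grows, so the vertical sides vanish in the limit.\<close>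

lemma ft_line_cauchy:
  assumes T: "test_chain D R" and hol: "g holomorphic_on UNIV" and g: "\<And>z. cmod (g z) \<le> A * (1 + cmod z) ^ p" and A: "A \<ge> 0"
    and y: "y > 0"
  shows "2 * of_real pi * \<i> * (ft (D 0) (of_real t) * g (of_real t)) =
    (LBINT x. ft (D 0) (Complex x (- y)) * (g (Complex x (- y)) / (Complex x (- y) - of_real t))) -
    (LBINT x. ft (D 0) (Complex x y) * (g (Complex x y) / (Complex x y - of_real t)))"
proof -
  define f where "f z = ft (D 0) z * g z" for z
  have f: "f holomorphic_on UNIV" unfolding f_def by (intro holomorphic_intros ft_holomorphic[OF T] hol)
  obtain C where C: "C \<ge> 0" "\<And>z. \<bar>Im z\<bar> \<le> y \<Longrightarrow> cmod (f z) \<le> C / (1 + \<bar>Re z\<bar>)"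
    using ft_side_bound[OF T g A, of y] unfolding f_def by blast
  have dist: "cmod (Complex x y - of_real t) \<ge> \<bar>y\<bar>" for x y using abs_Im_le_cmod[of "Complex x y - of_real t"] by simp
  have ne: "Complex x y - of_real t \<noteq> 0" if "y \<noteq> 0" for x y using that by (simp add: complex_eq_iff)
  have cont': "continuous_on UNIV (\<lambda>x. g (Complex x y) / (Complex x y - of_real t))" if "y \<noteq> 0" for y
    using ne[OF that] by (intro continuous_intros entire_line_continuous[OF hol]) (auto simp: Complex_eq intro!: continuous_intros)
  have cont: "continuous_on UNIV (\<lambda>x. f (Complex x y) / (Complex x y - of_real t))" if "y \<noteq> 0" for y
    using ne[OF that] by (intro continuous_intros entire_line_continuous[OF f]) (auto simp: Complex_eq intro!: continuous_intros)
  have int: "integrable lborel (\<lambda>x. f (Complex x y) / (Complex x y - of_real t))" if y: "y \<noteq> 0" for y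
  proof -
    have "integrable lborel (\<lambda>x. ft (D 0) (Complex x y) * (g (Complex x y) / (Complex x y - of_real t)))"
    proof (rule ft_line_mult_integrable[OF T borel_measurable_continuous_onI[OF cont'[OF y]]])
      fix x
      have "cmod (g (Complex x y) / (Complex x y - of_real t)) \<le> (A * (1 + cmod (Complex x y)) ^ p) / \<bar>y\<bar>"
        unfolding norm_divide by (intro frac_le g dist) (use A y in auto)
      then show "cmod (g (Complex x y) / (Complex x y - of_real t)) \<le> A / \<bar>y\<bar> * (1 + cmod (Complex x y)) ^ p" by simp
    qed
    then show ?thesis by (simp add: f_def)
  qed
  have "(\<lambda>n. 4 * (C / (1 + real n)) * y) \<longlonglongrightarrow> 0" by real_asymp
  then have "2 * of_real pi * \<i> * f (of_real t) =
    (LBINT x. f (Complex x (- y)) / (Complex x (- y) - of_real t)) - (LBINT x. f (Complex x y) / (Complex x y - of_real t))"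
  \<comment> \<open>From this \<open>n\<close> on the vertical sides have distance at least 1 from
    the pole at \<open>t\<close>.\<close>
  proof (rule line_integral_limit[rotated 4, of _ "nat \<lceil>\<bar>t\<bar> + 1\<rceil>"])
    fix n :: nat assume "n \<ge> nat \<lceil>\<bar>t\<bar> + 1\<rceil>"
    then have n: "real n \<ge> \<bar>t\<bar> + 1" by linarith
    show "cmod (2 * of_real pi * \<i> * f (of_real t) - (integral {- real n..real n} (\<lambda>x. f (Complex x (- y)) / (Complex x (- y) - of_real t)) -
       integral {- real n..real n} (\<lambda>x. f (Complex x y) / (Complex x y - of_real t)))) \<le> 4 * (C / (1 + real n)) * y"
    proof (rule rectangle_cauchy[OF _ _ y f])
      fix z assume "Re z = - real n \<or> Re z = real n" "Im z \<in> {- y..y}"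
      then have z: "\<bar>Re z\<bar> = real n" "\<bar>Im z\<bar> \<le> y" by auto
      have "1 \<le> \<bar>Re z - t\<bar>" using z(1) n by linarith
      also have "\<dots> \<le> cmod (z - of_real t)" using abs_Re_le_cmod[of "z - of_real t"] by simp
      finally have "cmod (f z / (z - of_real t)) \<le> cmod (f z) / 1" unfolding norm_divide by (intro frac_le) auto
      then show "cmod (f z / (z - of_real t)) \<le> C / (1 + real n)" using C(2)[of z] z by simp
    qed (use n in auto)
  qed (use y cont[of y] cont[of "-y"] int[of y] int[of "-y"] in auto)
  then show ?thesis by (simp add: f_def)
qed

text \<open>Cauchy's formula for \<open>g z * z\<close> at the point 0: the pole is cancelled and
  the value at 0 vanishes.\<close>

lemma ft_line_shift:
  assumes T: "test_chain D R" and hol: "g holomorphic_on UNIV" and g: "\<And>z. cmod (g z) \<le> A * (1 + cmod z) ^ p" and A: "A \<ge> 0"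
    and y: "y > 0"
  shows "(LBINT x. ft (D 0) (Complex x (- y)) * g (Complex x (- y))) = (LBINT x. ft (D 0) (Complex x y) * g (Complex x y))"
proof -
  have hol': "(\<lambda>z. g z * z) holomorphic_on UNIV" by (intro holomorphic_intros hol)
  have "cmod (g z * z) \<le> A * (1 + cmod z) ^ p * (1 + cmod z)" for z
    unfolding norm_mult using A by (intro mult_mono g) auto
  then have g': "cmod (g z * z) \<le> A * (1 + cmod z) ^ Suc p" for z by (simp add: mult_ac)
  have "Complex x y \<noteq> 0" "Complex x (- y) \<noteq> 0" for x using y by (auto simp: complex_eq_iff)
  then show ?thesis using ft_line_cauchy[OF T hol' g' A y, of 0] by simp
qed

section \<open>The kernel of the factorization and its residue\<close>

definition nev_kernel :: "complex \<Rightarrow> real \<Rightarrow> complex" where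
  "nev_kernel z t = (of_real t * z + 1) / (of_real t - z)"

lemma cmod_square_plus_one_le: "cmod (z\<^sup>2 + 1) \<le> (1 + cmod z)\<^sup>2"
proof -
  have "cmod (z\<^sup>2 + 1) \<le> (cmod z)\<^sup>2 + 1" using norm_triangle_ineq[of "z\<^sup>2" 1] by (simp add: norm_power)
  moreover have "(1 + cmod z)\<^sup>2 = 1 + (cmod z)\<^sup>2 + 2 * cmod z" by (simp add: power2_sum)
  ultimately show ?thesis using norm_ge_zero[of z] by linarith
qed

text \<open>Written as \<open>z + (z\<^sup>2 + 1) / (of_real t - z)\<close>, the kernel is bounded
  uniformly in \<open>t\<close>, since the denominator has modulus at least
  \<open>\<bar>Im z\<bar>\<close>.\<close>

lemma nev_kernel_bound:
  assumes "Im z \<noteq> 0"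
  shows "cmod (nev_kernel z t) \<le> (1 + 1 / \<bar>Im z\<bar>) * (1 + cmod z)\<^sup>2"
proof -
  have ne: "of_real t - z \<noteq> 0" using assms by (auto simp: complex_eq_iff)
  have "of_real t * z + 1 = z * (of_real t - z) + (z\<^sup>2 + 1)" by (simp add: algebra_simps power2_eq_square)
  then have "nev_kernel z t = z + (z\<^sup>2 + 1) / (of_real t - z)" unfolding nev_kernel_def using ne by (simp add: add_divide_distrib)
  also have "cmod \<dots> \<le> cmod z + cmod (z\<^sup>2 + 1) / cmod (of_real t - z)" by (metis norm_divide norm_triangle_ineq)
  also have "\<dots> \<le> (1 + cmod z)\<^sup>2 + (1 + cmod z)\<^sup>2 / \<bar>Im z\<bar>"
  proof (intro add_mono frac_le)
    show "cmod (z\<^sup>2 + 1) \<le> (1 + cmod z)\<^sup>2" by (rule cmod_square_plus_one_le)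
    show "cmod z \<le> (1 + cmod z)\<^sup>2" by (simp add: power2_sum)
    show "\<bar>Im z\<bar> \<le> cmod (of_real t - z)" using abs_Im_le_cmod[of "of_real t - z"] by simp
  qed (use assms in auto)
  also have "\<dots> = (1 + 1 / \<bar>Im z\<bar>) * (1 + cmod z)\<^sup>2" by (simp add: algebra_simps)
  finally show ?thesis .
qed

lemma cmod_square_plus_one_power_le: "cmod ((z\<^sup>2 + 1) ^ m) \<le> (1 + cmod z) ^ (2 * m)"
  unfolding norm_power power_mult by (intro power_mono cmod_square_plus_one_le) auto

lemma nev_kernel_Fubini:
  assumes T: "test_chain D R" and fin: "finite_measure M" and sM [measurable_cong]: "sets M = sets borel" and y: "y \<noteq> 0"
  shows "integrable M (\<lambda>t. LBINT x. ft (D 0) (Complex x y) * ((Complex x y)\<^sup>2 + 1) ^ m * nev_kernel (Complex x y) t)" (is ?A)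
    and "integrable lborel (\<lambda>x. ft (D 0) (Complex x y) * ((Complex x y)\<^sup>2 + 1) ^ m * (LINT t|M. nev_kernel (Complex x y) t))" (is ?B)
    and "(LINT t|M. LINT x|lborel. ft (D 0) (Complex x y) * ((Complex x y)\<^sup>2 + 1) ^ m * nev_kernel (Complex x y) t) =
      (LBINT x. ft (D 0) (Complex x y) * ((Complex x y)\<^sup>2 + 1) ^ m * (LINT t|M. nev_kernel (Complex x y) t))" (is ?C)
proof -
  interpret M: finite_measure M by (rule fin)
  define s where "s x = 1 + cmod (Complex x y)" for x
  have s: "s x > 0" for x by (simp add: s_def add_pos_nonneg)
  \<comment> \<open>The growth \<open>(s x)\<^sup>2\<close> of the kernel is moved to the rapidly
    decaying factor \<open>v\<close>, so that \<open>K\<close> is bounded in both variables.\<close>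
  define v where "v x = ft (D 0) (Complex x y) * (((Complex x y)\<^sup>2 + 1) ^ m * of_real ((s x)\<^sup>2))" for x
  define K where "K t x = nev_kernel (Complex x y) t / of_real ((s x)\<^sup>2)" for t x
  define B where "B = 1 + 1 / \<bar>y\<bar>"
  have [measurable]: "(\<lambda>x. Complex x y) \<in> borel_measurable borel"
    by (rule borel_measurable_continuous_onI) (simp add: Complex_eq, intro continuous_intros)
  have [measurable]: "s \<in> borel_measurable borel" unfolding s_def by measurable
  have Km: "(\<lambda>(t, x). K t x) \<in> borel_measurable (borel \<Otimes>\<^sub>M borel)" unfolding K_def nev_kernel_def by measurable
  note [measurable] = Km
  have Kb: "cmod (K t x) \<le> B" for t x
  proof -
    have "cmod (K t x) = cmod (nev_kernel (Complex x y) t) / (s x)\<^sup>2" unfolding K_def norm_divide norm_of_real by simp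
    also have "\<dots> \<le> B" using nev_kernel_bound[of "Complex x y" t] y s[of x] by (simp add: B_def s_def pos_divide_le_eq)
    finally show ?thesis .
  qed
  have v: "integrable lborel v"
    unfolding v_def
  proof (rule ft_line_mult_integrable[OF T])
    fix x
    have eq: "cmod (((Complex x y)\<^sup>2 + 1) ^ m * of_real ((s x)\<^sup>2)) = cmod (((Complex x y)\<^sup>2 + 1) ^ m) * (s x)\<^sup>2"
      unfolding norm_mult norm_of_real by simp
    have "cmod (((Complex x y)\<^sup>2 + 1) ^ m) * (s x)\<^sup>2 \<le> s x ^ (2 * m) * (s x)\<^sup>2"
      unfolding s_def by (intro mult_right_mono cmod_square_plus_one_power_le) auto
    then show "cmod (((Complex x y)\<^sup>2 + 1) ^ m * of_real ((s x)\<^sup>2)) \<le> 1 * (1 + cmod (Complex x y)) ^ (2 * m + 2)"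
      unfolding eq by (simp only: s_def power_add mult_1)
  qed measurable
  note [measurable] = borel_measurable_integrable[OF v]
  have vK: "ft (D 0) (Complex x y) * ((Complex x y)\<^sup>2 + 1) ^ m * nev_kernel (Complex x y) t = v x * K t x" for x t
    using s[of x] by (simp add: v_def K_def)
  have vJ: "ft (D 0) (Complex x y) * ((Complex x y)\<^sup>2 + 1) ^ m * (LINT t|M. nev_kernel (Complex x y) t) = v x * (LINT t|M. K t x)" for x
    using s[of x] by (simp add: v_def K_def)
  have vi: "integrable lborel (\<lambda>x. v x * K t x)" for t by (rule integrable_mult_bounded[OF v _ Kb]) measurable
  show ?A
    unfolding vK
  proof (rule M.integrable_const_bound)
    show "AE t in M. cmod (LBINT x. v x * K t x) \<le> (LBINT x. cmod (v x) * B)"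
    proof (rule AE_I2)
      fix t
      have "cmod (LBINT x. v x * K t x) \<le> (LBINT x. cmod (v x * K t x))" by (rule integral_norm_bound)
      also have "\<dots> \<le> (LBINT x. cmod (v x) * B)"
      proof (rule integral_mono)
        show "integrable lborel (\<lambda>x. cmod (v x * K t x))" by (rule integrable_norm[OF vi])
        show "integrable lborel (\<lambda>x. cmod (v x) * B)" using v by simp
        show "cmod (v x * K t x) \<le> cmod (v x) * B" for x unfolding norm_mult by (intro mult_left_mono Kb) simp
      qed
      finally show "cmod (LBINT x. v x * K t x) \<le> (LBINT x. cmod (v x) * B)" .
    qed
    show "(\<lambda>t. LBINT x. v x * K t x) \<in> borel_measurable M" by measurable
  qed
  show ?B
    unfolding vJ
  proof (rule integrable_mult_bounded[OF v])
    show "(\<lambda>x. LINT t|M. K t x) \<in> borel_measurable lborel" by measurable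
    fix x
    have i: "integrable M (\<lambda>t. K t x)" by (rule M.integrable_const_bound[of _ B]) (use Kb in auto)
    have "cmod (LINT t|M. K t x) \<le> (LINT t|M. cmod (K t x))" by (rule integral_norm_bound)
    also have "\<dots> \<le> (LINT t|M. B)" by (rule integral_mono) (use i Kb in auto)
    finally show "cmod (LINT t|M. K t x) \<le> (LINT t|M. B)" .
  qed
  show ?C
    unfolding vK vJ by (rule Fubini_bounded_kernel[OF fin sM v Km Kb])
qed

text \<open>As a function of \<open>z\<close>, the kernel times \<open>(z\<^sup>2 + 1) ^ m\<close>
  has its only pole at \<open>t\<close>, with numerator \<open>(1 + t\<^sup>2) ^ (m + 1)\<close>
  there. This is the inverse of the weight in the factorization, so the unweighted measure will come
  out.\<close>

lemma nev_kernel_identity: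
  assumes T: "test_chain D R" and fin: "finite_measure M" and s: "sets M = sets borel" and y: "y > 0"
  shows "(LBINT x. ft (D 0) (Complex x y) * ((Complex x y)\<^sup>2 + 1) ^ m * (LINT t|M. nev_kernel (Complex x y) t)) -
     (LBINT x. ft (D 0) (Complex x (- y)) * ((Complex x (- y))\<^sup>2 + 1) ^ m * (LINT t|M. nev_kernel (Complex x (- y)) t)) =
     (LINT t|M. 2 * of_real pi * \<i> * (ft (D 0) (of_real t) * of_real ((1 + t\<^sup>2) ^ (m + 1))))"
proof -
  define H where "H y t = (LBINT x. ft (D 0) (Complex x y) * ((Complex x y)\<^sup>2 + 1) ^ m * nev_kernel (Complex x y) t)" for y t
  have "H y t - H (- y) t = 2 * of_real pi * \<i> * (ft (D 0) (of_real t) * of_real ((1 + t\<^sup>2) ^ (m + 1)))" for t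
  proof -
    define g where "g z = (z\<^sup>2 + 1) ^ m * (of_real t * z + 1)" for z :: complex
    have g: "cmod (g z) \<le> (1 + \<bar>t\<bar>) * (1 + cmod z) ^ (2 * m + 1)" for z
    proof -
      have "cmod (of_real t * z + 1) \<le> \<bar>t\<bar> * cmod z + 1" using norm_triangle_ineq[of "of_real t * z" 1] by (simp add: norm_mult)
      also have "\<dots> \<le> (1 + \<bar>t\<bar>) * (1 + cmod z)" by (simp add: algebra_simps)
      finally have "cmod ((z\<^sup>2 + 1) ^ m) * cmod (of_real t * z + 1) \<le> (1 + cmod z) ^ (2 * m) * ((1 + \<bar>t\<bar>) * (1 + cmod z))"
        by (intro mult_mono cmod_square_plus_one_power_le) auto
      then show ?thesis by (simp add: g_def norm_mult mult_ac)
    qed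
    have hol: "g holomorphic_on UNIV" unfolding g_def by (intro holomorphic_intros)
    have H: "H y t = - (LBINT x. ft (D 0) (Complex x y) * (g (Complex x y) / (Complex x y - of_real t)))" for y
    proof -
      have "a / (of_real t - z) = - (a / (z - of_real t))" for a z :: complex
        by (metis minus_diff_eq minus_divide_right)
      then have "ft (D 0) z * (z\<^sup>2 + 1) ^ m * nev_kernel z t = - (ft (D 0) z * (g z / (z - of_real t)))" for z
        unfolding nev_kernel_def g_def by simp
      then show ?thesis unfolding H_def by simp
    qed
    have "g (of_real t) = of_real ((1 + t\<^sup>2) ^ (m + 1))"
      by (simp add: g_def power2_eq_square add.commute)
    with ft_line_cauchy[OF T hol g _ y, of t] show ?thesis unfolding H by simp
  qed
  then have "(LINT t|M. 2 * of_real pi * \<i> * (ft (D 0) (of_real t) * of_real ((1 + t\<^sup>2) ^ (m + 1)))) = (LINT t|M. H y t - H (- y) t)" by simp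
  also have "\<dots> = (LINT t|M. H y t) - (LINT t|M. H (- y) t)"
    unfolding H_def by (intro Bochner_Integration.integral_diff nev_kernel_Fubini(1)[OF T fin s]) (use y in auto)
  finally show ?thesis unfolding H_def using nev_kernel_Fubini(3)[OF T fin s] y by simp
qed

lemma poly_growth:
  fixes q :: "complex poly"
  shows "\<exists>A\<ge>0. \<exists>p. \<forall>z. cmod (poly q z) \<le> A * (1 + cmod z) ^ p"
proof (induction q)
  case (pCons a q)
  then obtain A p where A: "A \<ge> 0" "\<And>z. cmod (poly q z) \<le> A * (1 + cmod z) ^ p" by blast
  have "cmod (poly (pCons a q) z) \<le> (cmod a + A) * (1 + cmod z) ^ Suc p" for z
  proof -
    have "cmod (poly (pCons a q) z) \<le> cmod a + cmod z * cmod (poly q z)" using norm_triangle_ineq[of a "z * poly q z"] by (simp add: norm_mult)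
    also have "\<dots> \<le> cmod a * (1 + cmod z) ^ Suc p + (1 + cmod z) * (A * (1 + cmod z) ^ p)"
    proof (intro add_mono mult_mono A(2))
      show "cmod a \<le> cmod a * (1 + cmod z) ^ Suc p" using mult_left_mono[OF one_le_power[of "1 + cmod z" "Suc p"], of "cmod a"] by simp
    qed auto
    also have "\<dots> = (cmod a + A) * (1 + cmod z) ^ Suc p" by (simp add: algebra_simps)
    finally show ?thesis .
  qed
  with A(1) show ?case by (intro exI[of _ "cmod a + A"] conjI exI[of _ "Suc p"]) auto
qed (auto intro!: exI[of _ 0])

lemma poly_real_cnj: "poly (map_poly of_real Q) (cnj z) = cnj (poly (map_poly of_real Q) z)"
  by (induction Q) (simp_all add: map_poly_pCons)

section \<open>The Fourier summation pair\<close>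

text \<open>Absorbing the weight makes the variations finite measures, as the exchange of integrals
  with the kernel requires.\<close>

lemma weighted_measure:
  assumes s: "sets P = sets borel" and w: "integrable P (\<lambda>t::real. 1 / (1 + t\<^sup>2) ^ (m + 1) :: real)"
  defines "M \<equiv> density P (\<lambda>t. ennreal (1 / (1 + t\<^sup>2) ^ (m + 1)))"
  shows "finite_measure M" "sets M = sets borel"
    and "\<And>f :: real \<Rightarrow> complex. f \<in> borel_measurable borel \<Longrightarrow> (LINT t|M. f t) = (LINT t|P. f t * (1 / of_real ((1 + t\<^sup>2) ^ (m + 1))))"
proof -
  note [measurable_cong] = s
  show "sets M = sets borel" by (simp add: M_def s)
  have wm[measurable]: "(\<lambda>t::real. 1 / (1 + t\<^sup>2) ^ (m + 1) :: real) \<in> borel_measurable P" using w by (rule borel_measurable_integrable)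
  have sp: "space P = UNIV" using sets_eq_imp_space_eq[OF s] by simp
  show "finite_measure M"
  proof (rule finite_measureI)
    have "emeasure M (space M) = (\<integral>\<^sup>+ t. ennreal (1 / (1 + t\<^sup>2) ^ (m + 1)) \<partial>P)"
      unfolding M_def by (subst emeasure_density) (auto simp: sp intro!: nn_integral_cong)
    also have "\<dots> < \<infinity>" using w by (subst (asm) integrable_iff_bounded) (simp add: add_nonneg_nonneg)
    finally show "emeasure M (space M) \<noteq> \<infinity>" by simp
  qed
  fix f :: "real \<Rightarrow> complex" assume [measurable]: "f \<in> borel_measurable borel"
  have "(LINT t|M. f t) = (LINT t|P. (1 / (1 + t\<^sup>2) ^ (m + 1)) *\<^sub>R f t)"
    unfolding M_def by (rule integral_density) (auto simp: add_nonneg_nonneg)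
  then show "(LINT t|M. f t) = (LINT t|P. f t * (1 / of_real ((1 + t\<^sup>2) ^ (m + 1))))"
    by (simp add: scaleR_conv_of_real mult.commute)
qed

lemma nev_kernel_measurable: "nev_kernel z \<in> borel_measurable borel"
  unfolding nev_kernel_def by measurable

lemma nev_kernel_cnj: "cnj (nev_kernel z t) = nev_kernel (cnj z) t"
  by (simp add: nev_kernel_def)

text \<open>For a real measure, \<open>cnj (F z)\<close> is minus the expression of the
  factorization at \<open>cnj z\<close>, so this is a difference of integrals of one function along
  a line above and a line below the real axis.\<close>

definition line_pairing :: "(complex \<Rightarrow> complex) \<Rightarrow> (real \<Rightarrow> complex) \<Rightarrow> real \<Rightarrow> complex" where
  "line_pairing F \<phi> y = (LBINT x. ft \<phi> (Complex x y) * F (Complex x y)) + (LBINT x. ft \<phi> (Complex x (- y)) * cnj (F (Complex x y)))"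

text \<open>
  Both variations enter linearly, so it does not matter whether they form the Jordan decomposition of \<open>\<mu>\<close>.
\<close>
lemma nevanlinna_measure_pairing:
  fixes F :: "complex \<Rightarrow> complex"
  assumes T: "test_chain D R" and \<mu>: "real_measure \<mu>" and deg: "measure_deg \<mu> \<le> ereal (2 * (real m + 1))" and y: "y > 0"
    and F: "\<And>z. Im z > 0 \<Longrightarrow> F z = (z\<^sup>2 + 1) ^ m / (2 * of_real pi * \<i>) *
                   cm_integral \<mu> (\<lambda>t. (of_real t * z + 1) / (of_real t - z) * (1 / of_real ((1 + t\<^sup>2) ^ (m + 1))))
                 + \<i> * poly (map_poly of_real Q) z"
  shows "line_pairing F (D 0) y = cm_integral \<mu> (fourier (D 0))"
proof -
  have cm: "complex_measure \<mu>" using \<mu> by (simp add: real_measure_def)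
  note ad = complex_measure_bb_additive[OF cm]
  define P where "P = pos_variation (\<lambda>A. Re (\<mu> A))"
  define N where "N = pos_variation (\<lambda>A. - Re (\<mu> A))"
  have Pw: "sets P = sets borel" "integrable P (\<lambda>t. 1 / (1 + t\<^sup>2) ^ (m + 1))"
    unfolding P_def by (rule pos_variation_measure(1)[OF ad(2)], rule pos_variation_weight_integrable[OF ad(1,2) complex_Re_le_cmod deg])
  have Nw: "sets N = sets borel" "integrable N (\<lambda>t. 1 / (1 + t\<^sup>2) ^ (m + 1))"
    unfolding N_def using abs_Re_le_cmod by (intro pos_variation_measure(1)[OF ad(3)] pos_variation_weight_integrable[OF ad(1,3) _ deg]; force simp: abs_le_iff)+
  define MP where "MP = density P (\<lambda>t. ennreal (1 / (1 + t\<^sup>2) ^ (m + 1)))"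
  define MN where "MN = density N (\<lambda>t. ennreal (1 / (1 + t\<^sup>2) ^ (m + 1)))"
  note mp = weighted_measure[OF Pw, folded MP_def] and mn = weighted_measure[OF Nw, folded MN_def]
  define J where "J z = (LINT t|MP. nev_kernel z t) - (LINT t|MN. nev_kernel z t)" for z
  define q where "q = poly (map_poly of_real Q :: complex poly)"
  define w where "w = 1 / (2 * of_real pi * \<i>)"
  have w: "cnj w = - w" "w * (2 * of_real pi * \<i>) = 1" by (simp_all add: w_def)
  have J: "cm_integral \<mu> (\<lambda>t. (of_real t * z + 1) / (of_real t - z) * (1 / of_real ((1 + t\<^sup>2) ^ (m + 1)))) = J z" for z
    unfolding cm_integral_real_measure[OF \<mu>] P_def[symmetric] N_def[symmetric] J_def mp(3)[OF nev_kernel_measurable] mn(3)[OF nev_kernel_measurable]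
    by (simp add: nev_kernel_def)
  have Fz: "F z = w * ((z\<^sup>2 + 1) ^ m * J z) + \<i> * q z" if "Im z > 0" for z
    using F[OF that] unfolding J by (simp add: w_def q_def)
  have Jc: "cnj (J z) = J (cnj z)" for z
    unfolding J_def by (simp flip: Bochner_Integration.integral_cnj add: nev_kernel_cnj)
  \<comment> \<open>The weights, the measure and \<open>Q\<close> are real, while \<open>w\<close>
    and \<open>\<i>\<close> are imaginary: conjugation moves \<open>z\<close> to
    \<open>cnj z\<close> and changes the sign.\<close>
  have cFz: "cnj (F (Complex x y)) = - (w * (((Complex x (- y))\<^sup>2 + 1) ^ m * J (Complex x (- y))) + \<i> * q (Complex x (- y)))" for x
  proof -
    have c: "cnj (Complex x y) = Complex x (- y)" by (simp add: complex_eq_iff)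
    show ?thesis using Fz[of "Complex x y"] y by (simp add: w(1) Jc c q_def poly_real_cnj[symmetric])
  qed
  define A where "A M u = (LBINT x. ft (D 0) (Complex x u) * ((Complex x u)\<^sup>2 + 1) ^ m * (LINT t|M. nev_kernel (Complex x u) t))" for M u
  define B where "B u = (LBINT x. ft (D 0) (Complex x u) * q (Complex x u))" for u
  obtain K p where K: "K \<ge> 0" "\<And>z. cmod (q z) \<le> K * (1 + cmod z) ^ p" unfolding q_def using poly_growth by blast
  have qh: "q holomorphic_on UNIV" unfolding q_def by (intro holomorphic_intros)
  have iq: "integrable lborel (\<lambda>x. ft (D 0) (Complex x u) * q (Complex x u))" for u
    by (rule ft_line_mult_integrable[OF T borel_measurable_continuous_onI[OF entire_line_continuous[OF qh]] K(2)])
  have split: "(LBINT x. ft (D 0) (Complex x u) * (w * (((Complex x u)\<^sup>2 + 1) ^ m * J (Complex x u)) + \<i> * q (Complex x u)))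
      = w * (A MP u - A MN u) + \<i> * B u" if u: "u \<noteq> 0" for u
  proof -
    note ip = nev_kernel_Fubini(2)[OF T mp(1,2) u, of m] and im = nev_kernel_Fubini(2)[OF T mn(1,2) u, of m]
    have "(LBINT x. ft (D 0) (Complex x u) * (w * (((Complex x u)\<^sup>2 + 1) ^ m * J (Complex x u)) + \<i> * q (Complex x u))) =
      (LBINT x. w * (ft (D 0) (Complex x u) * ((Complex x u)\<^sup>2 + 1) ^ m * (LINT t|MP. nev_kernel (Complex x u) t)
         - ft (D 0) (Complex x u) * ((Complex x u)\<^sup>2 + 1) ^ m * (LINT t|MN. nev_kernel (Complex x u) t)) + \<i> * (ft (D 0) (Complex x u) * q (Complex x u)))"
      unfolding J_def by (simp add: algebra_simps)
    also have "\<dots> = w * (A MP u - A MN u) + \<i> * B u"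
      unfolding A_def B_def using ip im iq[of u] by (simp add: Bochner_Integration.integral_add Bochner_Integration.integral_diff)
    finally show ?thesis .
  qed
  have first: "(LBINT x. ft (D 0) (Complex x y) * F (Complex x y)) = w * (A MP y - A MN y) + \<i> * B y"
    using split[of y] y by (simp add: Fz)
  have second: "(LBINT x. ft (D 0) (Complex x (- y)) * cnj (F (Complex x y))) = - (w * (A MP (- y) - A MN (- y)) + \<i> * B (- y))"
    unfolding cFz mult_minus_right Bochner_Integration.integral_minus using split[of "- y"] y by simp
  \<comment> \<open>The polynomial term extends across the real axis, so its two integrals agree and
    cancel.\<close>
  have BB: "B (- y) = B y" unfolding B_def by (rule ft_line_shift[OF T qh K(2,1) y])
  have ftm: "(\<lambda>t. ft (D 0) (of_real t)) \<in> borel_measurable borel"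
    using borel_measurable_continuous_onI[OF ft_line_continuous[OF T, of UNIV 0 0]] by (simp add: complex_of_real_def)
  have id: "A M y - A M (- y) = 2 * of_real pi * \<i> * (LINT t|P'. ft (D 0) (of_real t))"
    if M: "finite_measure M" "sets M = sets borel" and MP: "\<And>f :: real \<Rightarrow> complex. f \<in> borel_measurable borel \<Longrightarrow> (LINT t|M. f t) = (LINT t|P'. f t * (1 / of_real ((1 + t\<^sup>2) ^ (m + 1))))"
    for M P' :: "real measure"
  proof -
    note [measurable] = ftm
    have ne: "(1 + t\<^sup>2) ^ (m + 1) \<noteq> 0" for t :: real by (smt (verit) power_not_zero zero_le_power2)
    have "A M y - A M (- y) = (LINT t|M. 2 * of_real pi * \<i> * (ft (D 0) (of_real t) * of_real ((1 + t\<^sup>2) ^ (m + 1))))"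
      unfolding A_def by (rule nev_kernel_identity[OF T M y])
    also have "\<dots> = (LINT t|P'. 2 * of_real pi * \<i> * (ft (D 0) (of_real t) * of_real ((1 + t\<^sup>2) ^ (m + 1))) * (1 / of_real ((1 + t\<^sup>2) ^ (m + 1))))"
      by (rule MP) measurable
    also have "\<dots> = (LINT t|P'. 2 * of_real pi * \<i> * ft (D 0) (of_real t))"
      using ne by (intro Bochner_Integration.integral_cong) (simp_all del: power_Suc of_real_power of_real_add)
    also have "\<dots> = 2 * of_real pi * \<i> * (LINT t|P'. ft (D 0) (of_real t))" by (rule integral_mult_right_zero)
    finally show ?thesis .
  qed
  have idP: "A MP y - A MP (- y) = 2 * of_real pi * \<i> * (LINT t|P. ft (D 0) (of_real t))"
    by (rule id[OF mp(1,2)]) (rule mp(3))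
  have idN: "A MN y - A MN (- y) = 2 * of_real pi * \<i> * (LINT t|N. ft (D 0) (of_real t))"
    by (rule id[OF mn(1,2)]) (rule mn(3))
  have "line_pairing F (D 0) y = w * ((A MP y - A MP (- y)) - (A MN y - A MN (- y)))"
    unfolding line_pairing_def first second BB by (simp add: algebra_simps)
  also have "\<dots> = (w * (2 * of_real pi * \<i>)) * ((LINT t|P. ft (D 0) (of_real t)) - (LINT t|N. ft (D 0) (of_real t)))"
    unfolding idP idN by (simp only: right_diff_distrib mult.assoc)
  also have "\<dots> = cm_integral \<mu> (fourier (D 0))"
    unfolding w(2) cm_integral_real_measure[OF \<mu>] P_def N_def by (simp add: fourier_eq_ft[abs_def])
  finally show ?thesis .
qed

section \<open>Antipodal coefficients and the pairing with test functions\<close>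

lemma test_chain_conjugate_reflection:
  assumes T: "test_chain D R"
  shows "test_chain (\<lambda>n t. (- 1) ^ n * cnj (D n (- t))) R"
    and "ft (\<lambda>t. cnj (D 0 (- t))) z = cnj (ft (D 0) (cnj z))"
proof -
  show "test_chain (\<lambda>n t. (- 1) ^ n * cnj (D n (- t))) R"
    unfolding test_chain_def
  proof (intro conjI allI impI)
    show "R > 0" using T by (simp add: test_chain_def)
    show "(- 1) ^ n * cnj (D n (- x)) = 0" if "R \<le> \<bar>x\<bar>" for n x using T that by (simp add: test_chain_def)
    fix n x
    have "(D n has_vector_derivative D (Suc n) (- x)) (at (- x))" using T by (simp add: test_chain_def)
    then have "((\<lambda>t. D n (- t)) has_vector_derivative (- 1) *\<^sub>R D (Suc n) (- x)) (at x)"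
      by (intro vector_diff_chain_at[of uminus "- 1" x "D n" "D (Suc n) (- x)", unfolded o_def]) (auto intro!: derivative_eq_intros)
    then have "((\<lambda>t. cnj (D n (- t))) has_vector_derivative cnj ((- 1) *\<^sub>R D (Suc n) (- x))) (at x)" by (rule has_vector_derivative_cnj)
    then have "((\<lambda>t. (- 1) ^ n * cnj (D n (- t))) has_vector_derivative (- 1) ^ n * cnj ((- 1) *\<^sub>R D (Suc n) (- x))) (at x)"
      by (rule has_vector_derivative_mult_right)
    then show "((\<lambda>t. (- 1) ^ n * cnj (D n (- t))) has_vector_derivative (- 1) ^ Suc n * cnj (D (Suc n) (- x))) (at x)" by simp
  qed
  have "ft (\<lambda>t. cnj (D 0 (- t))) z = (LBINT t. cnj (D 0 (- t) * echar (- t) (cnj z)))"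
    unfolding ft_def by (simp add: exp_cnj)
  also have "\<dots> = cnj (LBINT t. D 0 (- t) * echar (- t) (cnj z))"
    by (rule Bochner_Integration.integral_cnj)
  also have "(LBINT t. D 0 (- t) * echar (- t) (cnj z)) = ft (D 0) (cnj z)"
    unfolding ft_def using lborel_integral_real_affine[of "- 1" "\<lambda>t. D 0 t * echar t (cnj z)" 0] by simp
  finally show "ft (\<lambda>t. cnj (D 0 (- t))) z = cnj (ft (D 0) (cnj z))" .
qed

context shifted_AP
begin

text \<open>This is \<open>a\<close>, because \<open>bohr_coeff F\<close> vanishes on the negative axis.\<close>
definition antipodal_coeff :: "real \<Rightarrow> complex" where
  "antipodal_coeff \<nu> = bohr_coeff F \<nu> + cnj (bohr_coeff F (- \<nu>))"

lemma antipodal_coeff_locally_summable: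
  assumes ls: "locally_summable (bohr_coeff F)"
  shows "locally_summable antipodal_coeff"
  unfolding locally_summable_def
proof (intro conjI allI impI)
  have "supp antipodal_coeff \<subseteq> supp (bohr_coeff F) \<union> uminus ` supp (bohr_coeff F)"
  proof
    fix \<nu> assume "\<nu> \<in> supp antipodal_coeff"
    then have "bohr_coeff F \<nu> \<noteq> 0 \<or> bohr_coeff F (- \<nu>) \<noteq> 0" by (auto simp: supp_def antipodal_coeff_def)
    then show "\<nu> \<in> supp (bohr_coeff F) \<union> uminus ` supp (bohr_coeff F)" by (auto simp: supp_def image_iff intro!: exI[of _ "- \<nu>"])
  qed
  then show "countable (supp antipodal_coeff)"
    using ls unfolding locally_summable_def by (meson countable_Un countable_image countable_subset)
  fix T :: real assume T: "T > 0"
  have 1: "(\<lambda>\<nu>. cmod (bohr_coeff F \<nu>)) summable_on {-T..T}"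
  proof -
    have "(\<lambda>\<nu>. cmod (bohr_coeff F \<nu>)) summable_on (supp (bohr_coeff F) \<inter> {-T..T})" using ls T unfolding locally_summable_def by blast
    then show ?thesis by (rule summable_on_cong_neutral[THEN iffD1, rotated -1]) (auto simp: supp_def)
  qed
  have "(\<lambda>\<nu>. cmod (bohr_coeff F (- \<nu>))) summable_on {-T..T}"
    using 1 by (subst (asm) summable_on_reindex_bij_betw[symmetric, of uminus "{-T..T}"]) (auto intro!: bij_betwI[of _ _ _ uminus])
  from summable_on_add[OF 1 this]
  have "(\<lambda>\<nu>. cmod (antipodal_coeff \<nu>)) summable_on {-T..T}"
  proof (rule summable_on_comparison_test)
    fix \<nu> show "cmod (antipodal_coeff \<nu>) \<le> cmod (bohr_coeff F \<nu>) + cmod (bohr_coeff F (- \<nu>))"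
      unfolding antipodal_coeff_def using norm_triangle_ineq[of "bohr_coeff F \<nu>" "cnj (bohr_coeff F (- \<nu>))"] by simp
  qed simp
  then show "(\<lambda>\<nu>. cmod (antipodal_coeff \<nu>)) summable_on (supp antipodal_coeff \<inter> {-T..T})"
    by (rule summable_on_subset_banach) auto
qed

lemma antipodal_pairing:
  assumes T: "test_chain D R" and y: "y > c" and ls: "locally_summable (bohr_coeff F)"
  shows "((\<lambda>\<nu>. antipodal_coeff \<nu> * D 0 \<nu>) has_sum line_pairing F (D 0) y) (supp antipodal_coeff)"
proof -
  note T' = test_chain_conjugate_reflection[OF T]
  have "((\<lambda>\<nu>. bohr_coeff F \<nu> * D 0 \<nu>) has_sum (LBINT x. ft (D 0) (Complex x y) * F (Complex x y))) (supp (bohr_coeff F))"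
    by (rule fourier_coefficient_pairing(2)[OF T y ls])
  \<comment> \<open>All sums are extended to \<open>UNIV\<close>, because the two sums to be added
    may have different supports.\<close>
  then have 1: "((\<lambda>\<nu>. bohr_coeff F \<nu> * D 0 \<nu>) has_sum (LBINT x. ft (D 0) (Complex x y) * F (Complex x y))) UNIV"
    by (rule has_sum_cong_neutral[THEN iffD1, rotated -1]) (auto simp: supp_def)
  have c: "cnj (Complex x y) = Complex x (- y)" for x by (simp add: complex_eq_iff)
  \<comment> \<open>The same pairing for the conjugate reflection of the test function, whose
    transform is the conjugate of the original one at the conjugate point; conjugating the result
    gives the integral along the lower line.\<close>
  have "((\<lambda>\<nu>. bohr_coeff F \<nu> * cnj (D 0 (- \<nu>))) has_sum (LBINT x. cnj (ft (D 0) (Complex x (- y))) * F (Complex x y))) (supp (bohr_coeff F))"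
    using fourier_coefficient_pairing(2)[OF T'(1) y ls] by (simp add: T'(2) c)
  then have "((\<lambda>\<nu>. bohr_coeff F \<nu> * cnj (D 0 (- \<nu>))) has_sum (LBINT x. cnj (ft (D 0) (Complex x (- y))) * F (Complex x y))) UNIV"
    by (rule has_sum_cong_neutral[THEN iffD1, rotated -1]) (auto simp: supp_def)
  then have "((\<lambda>\<nu>. cnj (bohr_coeff F \<nu> * cnj (D 0 (- \<nu>)))) has_sum cnj (LBINT x. cnj (ft (D 0) (Complex x (- y))) * F (Complex x y))) UNIV"
    by (simp only: has_sum_cnj_iff)
  also have "cnj (LBINT x. cnj (ft (D 0) (Complex x (- y))) * F (Complex x y)) = (LBINT x. ft (D 0) (Complex x (- y)) * cnj (F (Complex x y)))"
    by (simp flip: Bochner_Integration.integral_cnj)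
  finally have "((\<lambda>\<nu>. cnj (bohr_coeff F \<nu>) * D 0 (- \<nu>)) has_sum (LBINT x. ft (D 0) (Complex x (- y)) * cnj (F (Complex x y)))) UNIV" by simp
  then have 2: "((\<lambda>\<nu>. cnj (bohr_coeff F (- \<nu>)) * D 0 \<nu>) has_sum (LBINT x. ft (D 0) (Complex x (- y)) * cnj (F (Complex x y)))) UNIV"
    by (subst has_sum_reindex_bij_betw[symmetric, of uminus UNIV UNIV]) (auto intro!: bij_betwI[of _ _ _ uminus])
  have "((\<lambda>\<nu>. antipodal_coeff \<nu> * D 0 \<nu>) has_sum line_pairing F (D 0) y) UNIV"
    using has_sum_add[OF 1 2] by (simp add: antipodal_coeff_def line_pairing_def distrib_right)
  then show ?thesis by (rule has_sum_cong_neutral[THEN iffD1, rotated -1]) (auto simp: supp_def)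
qed

end

lemma nevanlinna_diff_growth:
  assumes F: "F \<in> nevanlinna_diff k"
  shows "F holomorphic_on upper_halfplane"
    and "y0 > 0 \<Longrightarrow> \<exists>C p. \<forall>z. Im z \<ge> y0 \<longrightarrow> cmod (F z) \<le> C * (cmod z + 1) ^ p"
proof -
  obtain G H where G: "G \<in> nevanlinna_class k" and H: "H \<in> nevanlinna_class k" and FGH: "\<And>z. z \<in> upper_halfplane \<Longrightarrow> F z = G z - H z"
    using F unfolding nevanlinna_diff_def by blast
  have "(\<lambda>z. G z - H z) holomorphic_on upper_halfplane" using G H unfolding nevanlinna_class_def by (intro holomorphic_intros) auto
  then show "F holomorphic_on upper_halfplane" using FGH by (metis (no_types, lifting) holomorphic_transform)
  assume y0: "y0 > 0"
  obtain A where A: "A \<ge> 0" "\<And>z. Im z > 0 \<Longrightarrow> cmod (G z) \<le> A * ((cmod (z + \<i>))\<^sup>2 / Im z) ^ (2 * k + 1)"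
    using nevanlinna_class_growth[OF G] by blast
  obtain B where B: "B \<ge> 0" "\<And>z. Im z > 0 \<Longrightarrow> cmod (H z) \<le> B * ((cmod (z + \<i>))\<^sup>2 / Im z) ^ (2 * k + 1)"
    using nevanlinna_class_growth[OF H] by blast
  have "cmod (F z) \<le> (A + B) / y0 ^ (2 * k + 1) * (cmod z + 1) ^ (2 * (2 * k + 1))" if z: "Im z \<ge> y0" for z
  proof -
    have z0: "Im z > 0" using z y0 by simp
    \<comment> \<open>Above height \<open>y0\<close> the singular behaviour at the real axis is
      harmless and only polynomial growth is left.\<close>
    have "(cmod (z + \<i>))\<^sup>2 / Im z \<le> (cmod z + 1)\<^sup>2 / y0"
      using norm_triangle_ineq[of z \<i>] y0 z by (intro frac_le power_mono) auto
    then have q: "((cmod (z + \<i>))\<^sup>2 / Im z) ^ (2 * k + 1) \<le> ((cmod z + 1)\<^sup>2 / y0) ^ (2 * k + 1)"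
      using z0 by (intro power_mono) auto
    have "cmod (F z) \<le> cmod (G z) + cmod (H z)" using FGH[of z] z0 norm_triangle_ineq4[of "G z" "H z"] by (simp add: upper_halfplane_def)
    also have "\<dots> \<le> (A + B) * ((cmod (z + \<i>))\<^sup>2 / Im z) ^ (2 * k + 1)" unfolding distrib_right by (intro add_mono A(2) B(2) z0)
    also have "\<dots> \<le> (A + B) * ((cmod z + 1)\<^sup>2 / y0) ^ (2 * k + 1)" using q A(1) B(1) by (intro mult_left_mono) auto
    also have "\<dots> = (A + B) / y0 ^ (2 * k + 1) * (cmod z + 1) ^ (2 * (2 * k + 1))" by (simp only: power_divide power_mult times_divide_eq_right times_divide_eq_left)
    finally show ?thesis .
  qed
  then show "\<exists>C p. \<forall>z. Im z \<ge> y0 \<longrightarrow> cmod (F z) \<le> C * (cmod z + 1) ^ p" by blast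
qed

theorem theorem2:
  fixes k :: nat and F :: "complex \<Rightarrow> complex" and c :: real
  assumes "F \<in> nevanlinna_diff k"
    and "c > 0"
    and "(\<lambda>z. F (z + \<i> * of_real c)) \<in> AP"
    and "locally_summable (bohr_coeff F)"
  shows "(\<exists>c1>0. \<forall>\<nu>. \<forall>y>c1. (bohr_mean F \<nu> y \<longlongrightarrow> bohr_coeff F \<nu>) at_top) \<and>
         (\<forall>\<nu><0. bohr_coeff F \<nu> = 0) \<and>
         (\<forall>a \<mu>. a = (\<lambda>\<nu>. if \<nu> > 0 then bohr_coeff F \<nu>
                           else if \<nu> = 0 then of_real (2 * Re (bohr_coeff F 0))
                           else cnj (bohr_coeff F (- \<nu>))) \<longrightarrow>
                 nevanlinna_measure k F \<mu> \<longrightarrow>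
                 real_antipodal_FS_pair \<mu> a \<and> measure_deg \<mu> \<le> ereal (2 * (real k + 1)))"
proof -
  interpret shifted_AP F c
    by unfold_locales (use assms nevanlinna_diff_growth(1) in auto)
  obtain C p where growth: "\<And>z. Im z \<ge> c + 1 \<Longrightarrow> cmod (F z) \<le> C * (cmod z + 1) ^ p"
    using nevanlinna_diff_growth(2)[OF assms(1), of "c + 1"] c by auto
  have neg: "bohr_coeff F \<nu> = 0" if "\<nu> < 0" for \<nu> by (rule bohr_coeff_negative[OF growth that])
  have "real_antipodal_FS_pair \<mu> a \<and> measure_deg \<mu> \<le> ereal (2 * (real k + 1))"
    if a: "a = (\<lambda>\<nu>. if \<nu> > 0 then bohr_coeff F \<nu> else if \<nu> = 0 then of_real (2 * Re (bohr_coeff F 0)) else cnj (bohr_coeff F (- \<nu>)))"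
      and \<mu>: "nevanlinna_measure k F \<mu>" for a \<mu>
  proof -
    have a': "a = antipodal_coeff"
    proof
      \<comment> \<open>One of the two summands vanishes unless \<nu> = 0, where they add up to
        twice the real part.\<close>
      fix \<nu> show "a \<nu> = antipodal_coeff \<nu>"
        using neg[of \<nu>] neg[of "- \<nu>"] unfolding a antipodal_coeff_def by (cases \<nu> "0::real" rule: linorder_cases) (auto simp: complex_eq_iff)
    qed
    from \<mu> obtain m Q where rm: "real_measure \<mu>" and m: "m \<le> k" and deg: "measure_deg \<mu> \<le> ereal (2 * (real m + 1))"
      and rep: "\<And>z. z \<in> upper_halfplane \<Longrightarrow> F z = (z\<^sup>2 + 1) ^ m / (2 * of_real pi * \<i>) *
                   cm_integral \<mu> (\<lambda>t. (of_real t * z + 1) / (of_real t - z) * (1 / of_real ((1 + t\<^sup>2) ^ (m + 1))))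
                 + \<i> * poly (map_poly of_real Q) z"
      unfolding nevanlinna_measure_def by blast
    \<comment> \<open>The factorization may have an exponent \<open>m\<close> below
      \<open>k\<close>.\<close>
    have "measure_deg \<mu> \<le> ereal (2 * (real k + 1))" using deg m by (meson order_trans ereal_less_eq(3) add_right_mono mult_left_mono of_nat_mono zero_le_numeral)
    moreover have "strongly_tempered \<mu>" using rm deg unfolding strongly_tempered_def real_measure_def by (auto intro: le_less_trans)
    moreover have "((\<lambda>\<nu>. a \<nu> * \<phi> \<nu>) has_sum cm_integral \<mu> (fourier \<phi>)) (supp a)" if \<phi>: "test_function \<phi>" for \<phi>
    proof -
      obtain D R where T: "test_chain D R" and D: "D 0 = \<phi>" using test_function_chain[OF \<phi>] by blast
      \<comment> \<open>At any height above \<open>c\<close> both evaluations of the pairing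
        hold.\<close>
      have "line_pairing F (D 0) (c + 1) = cm_integral \<mu> (fourier (D 0))"
        by (rule nevanlinna_measure_pairing[OF T rm deg]) (use c rep in \<open>auto simp: upper_halfplane_def\<close>)
      with antipodal_pairing[OF T _ assms(4), of "c + 1"] show ?thesis unfolding a' D by simp
    qed
    ultimately show ?thesis
      using antipodal_coeff_locally_summable[OF assms(4)] rm unfolding real_antipodal_FS_pair_def FS_pair_def a' by blast
  qed
  with c neg bohr_coeff_eq(2) show ?thesis by blast
qed

end
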